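(* A category $\mathcal{E}$ is a totally distributive category having a small dense generator if and only if $\mathcal{E}$ is an essential subtopos of a presheaf topos $[\mathcal{C}^{\mathrm{op}},\mathbf{Set}]$ for some small category $\mathcal{C}$.
   Context: For a locally small category $\mathcal{E}$, $\widehat{\mathcal{E}} := [\mathcal{E}^{\mathrm{op}},\mathbf{Set}]$ and $\mathsf{y}:\mathcal{E}\to\widehat{\mathcal{E}}$, $v\mapsto \mathcal{E}(-,v)$, is the Yoneda embedding ($\mathcal{E}$ may be large). $\mathcal{E}$ is totally distributive if it is locally small and there are adjunctions $t\dashv c\dashv \mathsf{y}$ with $c:\widehat{\mathcal{E}}\to\mathcal{E}$ and $t:\mathcal{E}\to\widehat{\mathcal{E}}$. A small dense generator for $\mathcal{E}$ is a small full subcategory $\mathcal{G}\subseteq\mathcal{E}$ that is dense, i.e. the functor $\mathcal{E}\to[\mathcal{G}^{\mathrm{op}},\mathbf{Set}]$, $v\mapsto\mathcal{E}(-,v)|_{\mathcal{G}}$, is fully faithful. An essential subtopos of a topos $\mathcal{F}$ is a topos $\mathcal{E}$ for which there is a geometric inclusion $i:\mathcal{E}\to\mathcal{F}$ (a geometric morphism with $i_*$ fully faithful) whose inverse image functor $i^*:\mathcal{F}\to\mathcal{E}$ has a left adjoint. *)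

theory Defs
  imports Main "HOL-Library.FuncSet" "HOL-Library.Equipollence"
begin

section \<open>Size\<close>

text \<open>
  The type \<open>'u\<close> plays the role of the universe of small sets: its cardinality is assumed to be an
  uncountable strongly inaccessible cardinal, and a set (of elements of any type) is small when it is
  strictly smaller than \<open>'u\<close>. No size restriction is put on the types \<open>'o\<close> of objects and \<open>'m\<close> of
  morphisms of a category, so that large categories and presheaf categories over them are available.
\<close>

definition inaccessible :: "'u itself \<Rightarrow> bool" where
  "inaccessible (_ :: 'u itself) \<longleftrightarrow>
     (UNIV :: nat set) \<prec> (UNIV :: 'u set) \<and>
     (\<forall>A :: 'u set. A \<prec> (UNIV :: 'u set) \<longrightarrow> Pow A \<prec> (UNIV :: 'u set)) \<and>
     (\<forall>(I :: 'u set) (A :: 'u \<Rightarrow> 'u set).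
        I \<prec> (UNIV :: 'u set) \<and> (\<forall>i\<in>I. A i \<prec> (UNIV :: 'u set))
          \<longrightarrow> (\<Union>i\<in>I. A i) \<prec> (UNIV :: 'u set))"

definition small :: "'u itself \<Rightarrow> 'a set \<Rightarrow> bool" where
  "small (_ :: 'u itself) A \<longleftrightarrow> A \<prec> (UNIV :: 'u set)"


section \<open>Categories, functors, natural transformations\<close>

text \<open>
  Hom-sets are indexed by pairs of objects and need not be disjoint; \<open>Cmp C a b c g f\<close> is the composite of
  \<open>f \<in> Hom C a b\<close> followed by \<open>g \<in> Hom C b c\<close>. Only the values on \<open>Obj C\<close> and on the hom-sets matter.
\<close>

record ('o, 'm) cat =
  Obj :: "'o set"
  Hom :: "'o \<Rightarrow> 'o \<Rightarrow> 'm set"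
  Ide :: "'o \<Rightarrow> 'm"
  Cmp :: "'o \<Rightarrow> 'o \<Rightarrow> 'o \<Rightarrow> 'm \<Rightarrow> 'm \<Rightarrow> 'm"

definition category :: "('o, 'm) cat \<Rightarrow> bool" where
  "category C \<longleftrightarrow>
     (\<forall>a\<in>Obj C. Ide C a \<in> Hom C a a) \<and>
     (\<forall>a\<in>Obj C. \<forall>b\<in>Obj C. \<forall>c\<in>Obj C. \<forall>f\<in>Hom C a b. \<forall>g\<in>Hom C b c.
        Cmp C a b c g f \<in> Hom C a c) \<and>
     (\<forall>a\<in>Obj C. \<forall>b\<in>Obj C. \<forall>f\<in>Hom C a b.
        Cmp C a a b f (Ide C a) = f \<and> Cmp C a b b (Ide C b) f = f) \<and>
     (\<forall>a\<in>Obj C. \<forall>b\<in>Obj C. \<forall>c\<in>Obj C. \<forall>d\<in>Obj C.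
        \<forall>f\<in>Hom C a b. \<forall>g\<in>Hom C b c. \<forall>h\<in>Hom C c d.
        Cmp C a b d (Cmp C b c d h g) f = Cmp C a c d h (Cmp C a b c g f))"

definition locally_small :: "'u itself \<Rightarrow> ('o, 'm) cat \<Rightarrow> bool" where
  "locally_small U C \<longleftrightarrow> (\<forall>a\<in>Obj C. \<forall>b\<in>Obj C. small U (Hom C a b))"

definition small_category :: "'u itself \<Rightarrow> ('o, 'm) cat \<Rightarrow> bool" where
  "small_category U C \<longleftrightarrow> category C \<and> small U (Obj C) \<and> locally_small U C"

definition finite_category :: "('o, 'm) cat \<Rightarrow> bool" where
  "finite_category C \<longleftrightarrow>
     category C \<and> finite (Obj C) \<and> (\<forall>a\<in>Obj C. \<forall>b\<in>Obj C. finite (Hom C a b))"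

definition op_cat :: "('o, 'm) cat \<Rightarrow> ('o, 'm) cat" where
  "op_cat C = \<lparr>Obj = Obj C, Hom = (\<lambda>a b. Hom C b a), Ide = Ide C,
               Cmp = (\<lambda>a b c g f. Cmp C c b a f g)\<rparr>"

definition full_subcat :: "('o, 'm) cat \<Rightarrow> 'o set \<Rightarrow> ('o, 'm) cat" where
  "full_subcat C S = C\<lparr>Obj := S\<rparr>"

record ('o1, 'm1, 'o2, 'm2) funct =
  FOb :: "'o1 \<Rightarrow> 'o2"
  FHom :: "'o1 \<Rightarrow> 'o1 \<Rightarrow> 'm1 \<Rightarrow> 'm2"

definition is_functor ::
  "('o1, 'm1) cat \<Rightarrow> ('o2, 'm2) cat \<Rightarrow> ('o1, 'm1, 'o2, 'm2) funct \<Rightarrow> bool" where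
  "is_functor C D F \<longleftrightarrow>
     category C \<and> category D \<and>
     (\<forall>a\<in>Obj C. FOb F a \<in> Obj D) \<and>
     (\<forall>a\<in>Obj C. \<forall>b\<in>Obj C. \<forall>f\<in>Hom C a b. FHom F a b f \<in> Hom D (FOb F a) (FOb F b)) \<and>
     (\<forall>a\<in>Obj C. FHom F a a (Ide C a) = Ide D (FOb F a)) \<and>
     (\<forall>a\<in>Obj C. \<forall>b\<in>Obj C. \<forall>c\<in>Obj C. \<forall>f\<in>Hom C a b. \<forall>g\<in>Hom C b c.
        FHom F a c (Cmp C a b c g f) =
        Cmp D (FOb F a) (FOb F b) (FOb F c) (FHom F b c g) (FHom F a b f))"

definition comp_funct ::
  "('o2, 'm2, 'o3, 'm3) funct \<Rightarrow> ('o1, 'm1, 'o2, 'm2) funct \<Rightarrow> ('o1, 'm1, 'o3, 'm3) funct" where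
  "comp_funct G F = \<lparr>FOb = (\<lambda>a. FOb G (FOb F a)),
                     FHom = (\<lambda>a b f. FHom G (FOb F a) (FOb F b) (FHom F a b f))\<rparr>"

definition fully_faithful ::
  "('o1, 'm1) cat \<Rightarrow> ('o2, 'm2) cat \<Rightarrow> ('o1, 'm1, 'o2, 'm2) funct \<Rightarrow> bool" where
  "fully_faithful C D F \<longleftrightarrow>
     is_functor C D F \<and>
     (\<forall>a\<in>Obj C. \<forall>b\<in>Obj C. bij_betw (FHom F a b) (Hom C a b) (Hom D (FOb F a) (FOb F b)))"

definition nat_trans ::
  "('o1, 'm1) cat \<Rightarrow> ('o2, 'm2) cat \<Rightarrow> ('o1, 'm1, 'o2, 'm2) funct \<Rightarrow> ('o1, 'm1, 'o2, 'm2) funct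
     \<Rightarrow> ('o1 \<Rightarrow> 'm2) \<Rightarrow> bool" where
  "nat_trans C D F G \<alpha> \<longleftrightarrow>
     (\<forall>a\<in>Obj C. \<alpha> a \<in> Hom D (FOb F a) (FOb G a)) \<and>
     (\<forall>a\<in>Obj C. \<forall>b\<in>Obj C. \<forall>f\<in>Hom C a b.
        Cmp D (FOb F a) (FOb G a) (FOb G b) (FHom G a b f) (\<alpha> a) =
        Cmp D (FOb F a) (FOb F b) (FOb G b) (\<alpha> b) (FHom F a b f))"

text \<open>
  Functors and transformations are total HOL functions. As objects and morphisms of a functor
  category they are taken to be \<open>undefined\<close> outside their domain, so that HOL equality is
  equality of functors, respectively of natural transformations.
\<close>

definition extensional_funct :: "('o1, 'm1) cat \<Rightarrow> ('o1, 'm1, 'o2, 'm2) funct \<Rightarrow> bool" where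
  "extensional_funct C F \<longleftrightarrow>
     FOb F \<in> extensional (Obj C) \<and>
     (\<forall>a b f. \<not> (a \<in> Obj C \<and> b \<in> Obj C \<and> f \<in> Hom C a b) \<longrightarrow> FHom F a b f = undefined)"

definition restrict_funct ::
  "('o1, 'm1) cat \<Rightarrow> ('o1, 'm1, 'o2, 'm2) funct \<Rightarrow> ('o1, 'm1, 'o2, 'm2) funct" where
  "restrict_funct C F =
     \<lparr>FOb = restrict (FOb F) (Obj C),
      FHom = (\<lambda>a b f. if a \<in> Obj C \<and> b \<in> Obj C \<and> f \<in> Hom C a b then FHom F a b f else undefined)\<rparr>"

definition functor_cat ::
  "('o1, 'm1) cat \<Rightarrow> ('o2, 'm2) cat \<Rightarrow> (('o1, 'm1, 'o2, 'm2) funct, 'o1 \<Rightarrow> 'm2) cat" where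
  "functor_cat C D =
     \<lparr>Obj = {F. is_functor C D F \<and> extensional_funct C F},
      Hom = (\<lambda>F G. {\<alpha>. nat_trans C D F G \<alpha> \<and> \<alpha> \<in> extensional (Obj C)}),
      Ide = (\<lambda>F. \<lambda>a\<in>Obj C. Ide D (FOb F a)),
      Cmp = (\<lambda>F G H \<beta> \<alpha>. \<lambda>a\<in>Obj C. Cmp D (FOb F a) (FOb G a) (FOb H a) (\<beta> a) (\<alpha> a))\<rparr>"

definition adjunction ::
  "('o1, 'm1) cat \<Rightarrow> ('o2, 'm2) cat \<Rightarrow> ('o1, 'm1, 'o2, 'm2) funct \<Rightarrow> ('o2, 'm2, 'o1, 'm1) funct
     \<Rightarrow> bool" where
  \<comment> \<open>\<open>F : C \<rightarrow> D\<close> is left adjoint to \<open>G : D \<rightarrow> C\<close>\<close>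
  "adjunction C D F G \<longleftrightarrow>
     is_functor C D F \<and> is_functor D C G \<and>
     (\<exists>\<phi>. (\<forall>c\<in>Obj C. \<forall>d\<in>Obj D. bij_betw (\<phi> c d) (Hom D (FOb F c) d) (Hom C c (FOb G d))) \<and>
          (\<forall>c\<in>Obj C. \<forall>c'\<in>Obj C. \<forall>d\<in>Obj D. \<forall>d'\<in>Obj D.
             \<forall>f\<in>Hom C c' c. \<forall>g\<in>Hom D (FOb F c) d. \<forall>h\<in>Hom D d d'.
             \<phi> c' d' (Cmp D (FOb F c') d d' h (Cmp D (FOb F c') (FOb F c) d g (FHom F c' c f))) =
             Cmp C c' (FOb G d) (FOb G d') (FHom G d d' h) (Cmp C c' c (FOb G d) (\<phi> c d g) f)))"


section \<open>Presheaves and total distributivity\<close>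

text \<open>
  \<open>set_cat U\<close> has as objects the small sets of elements of a type \<open>'s\<close>. For any \<open>'s\<close> at least as large
  as \<open>'u\<close>, every small set is in bijection with one of these. A hom-set \<open>Hom C a v\<close> consists of elements
  of \<open>'m\<close>, a type which may be too poor for this; hence presheaves on a category with morphisms in \<open>'m\<close>
  take values in small sets of elements of \<open>'m + 'u\<close> wherever the Yoneda embedding is involved,
  and \<open>Hom C a v\<close> appears there as its copy \<open>Inl ` Hom C a v\<close>.
\<close>

definition set_cat :: "'u itself \<Rightarrow> ('s set, 's \<Rightarrow> 's) cat" where
  "set_cat U =
     \<lparr>Obj = {A. small U A},
      Hom = (\<lambda>A B. A \<rightarrow>\<^sub>E B),
      Ide = (\<lambda>A. \<lambda>x\<in>A. x),
      Cmp = (\<lambda>A B C g f. compose A g f)\<rparr>"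

type_synonym ('o, 'm, 's) presheaf = "('o, 'm, 's set, 's \<Rightarrow> 's) funct"

definition presheaf_cat ::
  "'u itself \<Rightarrow> ('o, 'm) cat \<Rightarrow> (('o, 'm, 's) presheaf, 'o \<Rightarrow> 's \<Rightarrow> 's) cat" where
  "presheaf_cat U C = functor_cat (op_cat C) (set_cat U)"

definition representable :: "('o, 'm) cat \<Rightarrow> 'o \<Rightarrow> ('o, 'm, 'm + 'u) presheaf" where
  "representable C v =
     restrict_funct (op_cat C)
       \<lparr>FOb = (\<lambda>a. Inl ` Hom C a v),
        FHom = (\<lambda>a b f. \<lambda>x\<in>Inl ` Hom C a v. map_sum (\<lambda>g. Cmp C b a v g f) id x)\<rparr>"

definition yoneda ::
  "'u itself \<Rightarrow> ('o, 'm) cat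
     \<Rightarrow> ('o, 'm, ('o, 'm, 'm + 'u) presheaf, 'o \<Rightarrow> 'm + 'u \<Rightarrow> 'm + 'u) funct" where
  "yoneda U C =
     \<lparr>FOb = representable C,
      FHom = (\<lambda>v w h. \<lambda>a\<in>Obj C. \<lambda>x\<in>Inl ` Hom C a v. map_sum (\<lambda>g. Cmp C a v w h g) id x)\<rparr>"

definition totally_distributive :: "'u itself \<Rightarrow> ('o, 'm) cat \<Rightarrow> bool" where
  "totally_distributive U E \<longleftrightarrow>
     category E \<and> locally_small U E \<and>
     (\<exists>c t. adjunction E (presheaf_cat U E) t c \<and> adjunction (presheaf_cat U E) E c (yoneda U E))"

definition restricted_yoneda ::
  "'u itself \<Rightarrow> ('o, 'm) cat \<Rightarrow> 'o set
     \<Rightarrow> ('o, 'm, ('o, 'm, 'm + 'u) presheaf, 'o \<Rightarrow> 'm + 'u \<Rightarrow> 'm + 'u) funct" where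
  "restricted_yoneda U C S =
     \<lparr>FOb = (\<lambda>v. restrict_funct (op_cat (full_subcat C S)) (FOb (yoneda U C) v)),
      FHom = (\<lambda>v w h. restrict (FHom (yoneda U C) v w h) S)\<rparr>"

definition small_dense_generator :: "'u itself \<Rightarrow> ('o, 'm) cat \<Rightarrow> 'o set \<Rightarrow> bool" where
  "small_dense_generator U C S \<longleftrightarrow>
     S \<subseteq> Obj C \<and> small_category U (full_subcat C S) \<and>
     fully_faithful C (presheaf_cat U (full_subcat C S)) (restricted_yoneda U C S)"


section \<open>Limits and elementary toposes\<close>

definition is_cone ::
  "('j, 'k) cat \<Rightarrow> ('o, 'm) cat \<Rightarrow> ('j, 'k, 'o, 'm) funct \<Rightarrow> 'o \<Rightarrow> ('j \<Rightarrow> 'm) \<Rightarrow> bool" where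
  "is_cone J C D x p \<longleftrightarrow>
     x \<in> Obj C \<and> (\<forall>j\<in>Obj J. p j \<in> Hom C x (FOb D j)) \<and>
     (\<forall>j\<in>Obj J. \<forall>k\<in>Obj J. \<forall>u\<in>Hom J j k.
        Cmp C x (FOb D j) (FOb D k) (FHom D j k u) (p j) = p k)"

definition is_limit ::
  "('j, 'k) cat \<Rightarrow> ('o, 'm) cat \<Rightarrow> ('j, 'k, 'o, 'm) funct \<Rightarrow> 'o \<Rightarrow> ('j \<Rightarrow> 'm) \<Rightarrow> bool" where
  "is_limit J C D x p \<longleftrightarrow>
     is_cone J C D x p \<and>
     (\<forall>y q. is_cone J C D y q \<longrightarrow>
        (\<exists>!h. h \<in> Hom C y x \<and> (\<forall>j\<in>Obj J. Cmp C y x (FOb D j) (p j) h = q j)))"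

text \<open>Every finite category is isomorphic to one whose objects and morphisms are natural numbers.\<close>

definition has_finite_limits :: "('o, 'm) cat \<Rightarrow> bool" where
  "has_finite_limits C \<longleftrightarrow>
     (\<forall>(J :: (nat, nat) cat) D. finite_category J \<and> is_functor J C D
        \<longrightarrow> (\<exists>x p. is_limit J C D x p))"

definition preserves_finite_limits ::
  "('o1, 'm1) cat \<Rightarrow> ('o2, 'm2) cat \<Rightarrow> ('o1, 'm1, 'o2, 'm2) funct \<Rightarrow> bool" where
  "preserves_finite_limits C C' F \<longleftrightarrow>
     (\<forall>(J :: (nat, nat) cat) D x p. finite_category J \<and> is_functor J C D \<and> is_limit J C D x p
        \<longrightarrow> is_limit J C' (comp_funct F D) (FOb F x) (\<lambda>j. FHom F x (FOb D j) (p j)))"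

definition is_terminal :: "('o, 'm) cat \<Rightarrow> 'o \<Rightarrow> bool" where
  "is_terminal C x \<longleftrightarrow> x \<in> Obj C \<and> (\<forall>y\<in>Obj C. \<exists>!h. h \<in> Hom C y x)"

definition is_product ::
  "('o, 'm) cat \<Rightarrow> 'o \<Rightarrow> 'o \<Rightarrow> 'o \<Rightarrow> 'm \<Rightarrow> 'm \<Rightarrow> bool" where
  "is_product C a b p p1 p2 \<longleftrightarrow>
     p \<in> Obj C \<and> p1 \<in> Hom C p a \<and> p2 \<in> Hom C p b \<and>
     (\<forall>y\<in>Obj C. \<forall>q1\<in>Hom C y a. \<forall>q2\<in>Hom C y b.
        \<exists>!h. h \<in> Hom C y p \<and> Cmp C y p a p1 h = q1 \<and> Cmp C y p b p2 h = q2)"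

definition is_pullback ::
  "('o, 'm) cat \<Rightarrow> 'o \<Rightarrow> 'o \<Rightarrow> 'o \<Rightarrow> 'm \<Rightarrow> 'm \<Rightarrow> 'o \<Rightarrow> 'm \<Rightarrow> 'm \<Rightarrow> bool" where
  \<comment> \<open>pullback \<open>p\<close>, with projections \<open>p1\<close>, \<open>p2\<close>, of \<open>f : a \<rightarrow> c\<close> and \<open>g : b \<rightarrow> c\<close>\<close>
  "is_pullback C a b c f g p p1 p2 \<longleftrightarrow>
     p \<in> Obj C \<and> p1 \<in> Hom C p a \<and> p2 \<in> Hom C p b \<and> Cmp C p a c f p1 = Cmp C p b c g p2 \<and>
     (\<forall>y\<in>Obj C. \<forall>q1\<in>Hom C y a. \<forall>q2\<in>Hom C y b.
        Cmp C y a c f q1 = Cmp C y b c g q2 \<longrightarrow>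
        (\<exists>!h. h \<in> Hom C y p \<and> Cmp C y p a p1 h = q1 \<and> Cmp C y p b p2 h = q2))"

definition is_mono :: "('o, 'm) cat \<Rightarrow> 'o \<Rightarrow> 'o \<Rightarrow> 'm \<Rightarrow> bool" where
  "is_mono C a b m \<longleftrightarrow>
     m \<in> Hom C a b \<and>
     (\<forall>y\<in>Obj C. \<forall>f\<in>Hom C y a. \<forall>g\<in>Hom C y a. Cmp C y a b m f = Cmp C y a b m g \<longrightarrow> f = g)"

text \<open>
  In the next definition \<open>k\<close> is the morphism \<open>h \<times> a : y \<times> a \<rightarrow> e \<times> a\<close> for the given
  product \<open>q\<close> of \<open>y\<close> and \<open>a\<close>.
\<close>

definition is_exponential ::
  "('o, 'm) cat \<Rightarrow> 'o \<Rightarrow> 'o \<Rightarrow> 'o \<Rightarrow> 'o \<Rightarrow> 'm \<Rightarrow> 'm \<Rightarrow> 'm \<Rightarrow> bool" where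
  \<comment> \<open>\<open>e\<close> is the exponential of base \<open>b\<close> and exponent \<open>a\<close>, with evaluation \<open>ev : p = e \<times> a \<rightarrow> b\<close>\<close>
  "is_exponential C a b e p p1 p2 ev \<longleftrightarrow>
     e \<in> Obj C \<and> is_product C e a p p1 p2 \<and> ev \<in> Hom C p b \<and>
     (\<forall>y\<in>Obj C. \<forall>q q1 q2. is_product C y a q q1 q2 \<longrightarrow>
        (\<forall>g\<in>Hom C q b. \<exists>!h. h \<in> Hom C y e \<and>
           (\<exists>k\<in>Hom C q p. Cmp C q p e p1 k = Cmp C q y e h q1 \<and> Cmp C q p a p2 k = q2 \<and>
              Cmp C q p b ev k = g)))"

definition cartesian_closed :: "('o, 'm) cat \<Rightarrow> bool" where
  "cartesian_closed C \<longleftrightarrow>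
     (\<exists>x. is_terminal C x) \<and>
     (\<forall>a\<in>Obj C. \<forall>b\<in>Obj C. \<exists>p p1 p2. is_product C a b p p1 p2) \<and>
     (\<forall>a\<in>Obj C. \<forall>b\<in>Obj C. \<exists>e p p1 p2 ev. is_exponential C a b e p p1 p2 ev)"

definition is_subobject_classifier :: "('o, 'm) cat \<Rightarrow> 'o \<Rightarrow> 'o \<Rightarrow> 'm \<Rightarrow> bool" where
  "is_subobject_classifier C one \<Omega> tr \<longleftrightarrow>
     is_terminal C one \<and> \<Omega> \<in> Obj C \<and> tr \<in> Hom C one \<Omega> \<and>
     (\<forall>u\<in>Obj C. \<forall>x\<in>Obj C. \<forall>m. is_mono C u x m \<longrightarrow>
        (\<exists>!\<chi>. \<chi> \<in> Hom C x \<Omega> \<and> (\<exists>t\<in>Hom C u one. is_pullback C x one \<Omega> \<chi> tr u m t)))"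

definition elementary_topos :: "('o, 'm) cat \<Rightarrow> bool" where
  "elementary_topos C \<longleftrightarrow>
     category C \<and> has_finite_limits C \<and> cartesian_closed C \<and>
     (\<exists>one \<Omega> tr. is_subobject_classifier C one \<Omega> tr)"

definition geometric_morphism ::
  "('o1, 'm1) cat \<Rightarrow> ('o2, 'm2) cat \<Rightarrow> ('o2, 'm2, 'o1, 'm1) funct \<Rightarrow> ('o1, 'm1, 'o2, 'm2) funct
     \<Rightarrow> bool" where
  \<comment> \<open>from \<open>E\<close> to \<open>F\<close>, with inverse image \<open>inv_im\<close> and direct image \<open>dir_im\<close>\<close>
  "geometric_morphism E F inv_im dir_im \<longleftrightarrow>
     elementary_topos E \<and> elementary_topos F \<and>
     adjunction F E inv_im dir_im \<and> preserves_finite_limits F E inv_im"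

definition essential_subtopos :: "('o1, 'm1) cat \<Rightarrow> ('o2, 'm2) cat \<Rightarrow> bool" where
  "essential_subtopos E F \<longleftrightarrow>
     (\<exists>inv_im dir_im ess. geometric_morphism E F inv_im dir_im \<and>
        fully_faithful E F dir_im \<and> adjunction E F ess inv_im)"

end

theory Submission
  imports Defs
begin

text \<open>
  Let \<open>k : C \<rightarrow> E\<close> be dense with \<open>C\<close> small, \<open>k\<^sup>*\<close> the restriction of presheaves from \<open>E\<close> to \<open>C\<close>, and
  \<open>N v = E(k -, v)\<close>. By density, maps \<open>P \<rightarrow> E(-, v)\<close> are the same as maps \<open>k\<^sup>* P \<rightarrow> N v\<close>, and \<open>k\<^sup>*\<close> has a
  right adjoint \<open>k\<^sub>*\<close> and a left adjoint \<open>k\<^sub>!\<close>, all pointwise small.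

  If \<open>t \<stileturn> c \<stileturn> y\<close> and \<open>k\<close> is the inclusion of a small dense generator, then \<open>c k\<^sub>*\<close> is left adjoint to \<open>N\<close>,
  which is fully faithful, and \<open>k\<^sup>* t\<close> is left adjoint to \<open>c k\<^sub>*\<close>. Conversely, if \<open>l \<stileturn> L \<stileturn> N\<close> exhibits \<open>E\<close>
  as an essential subtopos of presheaves on \<open>C\<close>, then \<open>k = L y\<^sub>C\<close> is dense, so its image is a small
  dense generator, and \<open>k\<^sub>! l \<stileturn> L k\<^sup>* \<stileturn> y\<close>.

  It remains to see that \<open>l \<stileturn> L \<stileturn> N\<close> with \<open>N\<close> fully faithful makes \<open>E\<close> a topos. Since \<open>L\<close> preserves
  limits, finite limits and exponentials are reflected from presheaves. The covering sieves on \<open>c\<close> are those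
  that contain the image of the counit \<open>l L y\<^sub>c \<rightarrow> y\<^sub>c\<close>, and the subobject classifier is the presheaf of
  closed sieves. The case \<open>l = L = N = id\<close> gives the presheaf topos itself.
\<close>


section \<open>Small sets\<close>

text \<open>That \<open>c\<close> after \<open>k_*\<close> is left adjoint to \<open>N\<close> comes
  from the chain E(c k_* Q, v) = Hom(k_* Q, y v) = Hom(k^* k_* Q, N v) = Hom(Q, N v). The second
  equality is density; the third holds because \<open>k\<close> is fully faithful, which makes the
  counit of \<open>k_*\<close> invertible. In the converse \<open>k = L y_C\<close> need be neither
  full nor faithful, but there E(L k^* P, v) = Hom(k^* P, N v) = Hom(P, y v) uses density alone, and
  density passes to the full image of \<open>k\<close>. Size shapes the rest. The value of
  \<open>k_* Q\<close> at \<open>v\<close> is Hom(N v, Q), small because \<open>C\<close> is; that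
  of \<open>k_! Q\<close> is a quotient of a small sum over the objects of \<open>C\<close>.
  Elements built in this way are families or functions whose type is not that of the universe, so
  each such presheaf is first given by raw sets and then transported into the universe. A smallest
  covering sieve exists because \<open>L\<close>, having the left adjoint \<open>l\<close>,
  preserves all intersections; closedness can therefore be tested on one family of
  morphisms.\<close>

lemma small_lepoll: "small U B \<Longrightarrow> A \<lesssim> B \<Longrightarrow> small U A"
  unfolding small_def using lesspoll_trans1 by blast

lemma small_subset: "small U B \<Longrightarrow> A \<subseteq> B \<Longrightarrow> small U A"
  by (metis small_lepoll subset_imp_lepoll)

lemma small_image: "small U A \<Longrightarrow> small U (f ` A)"
  by (metis small_lepoll image_lepoll)

lemma small_inj: "small U B \<Longrightarrow> inj_on f A \<Longrightarrow> f ` A \<subseteq> B \<Longrightarrow> small U A"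
  by (meson small_lepoll lepoll_def)

lemma small_bij: "bij_betw f A B \<Longrightarrow> small U A \<longleftrightarrow> small U B"
  by (metis bij_betw_def small_image small_inj order_refl)

text \<open>The injection depends on \<open>A\<close> alone, so that codings need no further
  parameter; it is arbitrary when \<open>A\<close> is not small.\<close>

definition enc :: "'a set \<Rightarrow> 'a \<Rightarrow> 'u" where
  "enc A = (SOME f. inj_on f A)"

lemma inj_enc:
  assumes "small (U :: 'u itself) A" shows "inj_on (enc A :: 'a \<Rightarrow> 'u) A"
proof -
  have "\<exists>f :: 'a \<Rightarrow> 'u. inj_on f A"
    using assms unfolding small_def by (meson lepoll_def lesspoll_imp_lepoll)
  then show ?thesis unfolding enc_def by (rule someI_ex)
qed

context
  fixes U :: "'u itself"
  assumes inaccessible: "inaccessible U"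
begin

lemma infinite_universe: "infinite (UNIV :: 'u set)"
  using inaccessible unfolding inaccessible_def
  by (metis infinite_le_lepoll lesspoll_imp_lepoll)

lemma small_finite: "finite A \<Longrightarrow> small U A"
  unfolding small_def by (simp add: finite_lesspoll_infinite infinite_universe)

lemma small_Pow:
  assumes "small U A" shows "small U (Pow A)"
proof -
  define e where "e = (enc A :: _ \<Rightarrow> 'u)"
  have e: "inj_on e A" unfolding e_def by (rule inj_enc[OF assms])
  have "small U (e ` A)" by (rule small_image[OF assms])
  then have "small U (Pow (e ` A))"
    using inaccessible unfolding inaccessible_def small_def by blast
  moreover have "inj_on (image e) (Pow A)" by (rule inj_on_image_Pow[OF e])
  moreover have "image e ` Pow A \<subseteq> Pow (e ` A)" by auto
  ultimately show ?thesis by (rule small_inj)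
qed

text \<open>Inaccessibility speaks of unions of subsets of \<open>'u\<close> indexed by subsets of
  \<open>'u\<close>. Index set and fibres are therefore encoded there first, and a bijection of
  \<open>'u \<times> 'u\<close> with \<open>'u\<close> keeps the encoded fibres disjoint, so that
  the union is a faithful copy of the sum.\<close>

lemma small_Sigma:
  assumes I: "small U I" and A: "\<And>i. i \<in> I \<Longrightarrow> small U (A i)"
  shows "small U (Sigma I A)"
proof -
  define e where "e = (enc I :: _ \<Rightarrow> 'u)"
  define d where "d = (\<lambda>i. (enc (A i) :: _ \<Rightarrow> 'u))"
  have e: "inj_on e I" unfolding e_def by (rule inj_enc[OF I])
  have d: "inj_on (d i) (A i)" if "i \<in> I" for i
    unfolding d_def by (rule inj_enc[OF A[OF that]])
  obtain p :: "'u \<times> 'u \<Rightarrow> 'u" where p: "bij p"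
    using card_of_Times_same_infinite[OF infinite_universe] card_of_ordIso[of "UNIV \<times> UNIV :: ('u \<times> 'u) set"]
    by auto
  define B where "B = (\<lambda>u. (\<lambda>x. p (u, d (inv_into I e u) x)) ` A (inv_into I e u))"
  have B: "small U (B u)" if "u \<in> e ` I" for u
    unfolding B_def using small_image[OF A] inv_into_into[OF that] by blast
  have "small U (\<Union>u\<in>e ` I. B u)"
    using inaccessible small_image[OF I, of e] B unfolding inaccessible_def small_def by metis
  moreover have "inj_on (\<lambda>(i, x). p (e i, d i x)) (Sigma I A)"
  proof (rule inj_onI, clarify)
    fix i x i' x' assume *: "i \<in> I" "x \<in> A i" "i' \<in> I" "x' \<in> A i'" "p (e i, d i x) = p (e i', d i' x')"
    then have "(e i, d i x) = (e i', d i' x')" by (blast dest: injD[OF bij_is_inj[OF p]])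
    then have "e i = e i'" "d i x = d i' x'" by simp_all
    then show "i = i' \<and> x = x'" using * e d by (metis inj_onD)
  qed
  moreover have "(\<lambda>(i, x). p (e i, d i x)) ` Sigma I A \<subseteq> (\<Union>u\<in>e ` I. B u)"
    using e unfolding B_def by (auto intro!: image_eqI)
  ultimately show ?thesis by (rule small_inj)
qed

lemma small_Times: "small U A \<Longrightarrow> small U B \<Longrightarrow> small U (A \<times> B)"
  by (rule small_Sigma)

text \<open>An extensional function is determined by its graph, a subset of the small set
  \<open>Sigma I A\<close>.\<close>

lemma small_PiE:
  assumes I: "small U I" and A: "\<And>i. i \<in> I \<Longrightarrow> small U (A i)"
  shows "small U (PiE I A)"
proof -
  have "small U (Pow (Sigma I A))" by (intro small_Pow small_Sigma assms)
  moreover have "inj_on (\<lambda>f. (\<lambda>i. (i, f i)) ` I) (PiE I A)"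
  proof (rule inj_onI)
    fix f g assume f: "f \<in> PiE I A" and g: "g \<in> PiE I A"
      and eq: "(\<lambda>i. (i, f i)) ` I = (\<lambda>i. (i, g i)) ` I"
    have "f i = g i" if "i \<in> I" for i using eq that by blast
    then show "f = g" using f g by (metis PiE_ext)
  qed
  moreover have "(\<lambda>f. (\<lambda>i. (i, f i)) ` I) ` PiE I A \<subseteq> Pow (Sigma I A)" by auto
  ultimately show ?thesis by (rule small_inj)
qed

end


section \<open>Categories and functors\<close>

definition iso_in :: "('o, 'm) cat \<Rightarrow> 'o \<Rightarrow> 'o \<Rightarrow> 'm \<Rightarrow> 'm \<Rightarrow> bool" where
  "iso_in C a b f g \<longleftrightarrow> f \<in> Hom C a b \<and> g \<in> Hom C b a \<and> Cmp C a b a g f = Ide C a \<and> Cmp C b a b f g = Ide C b"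

lemma cat_ide: "category C \<Longrightarrow> a \<in> Obj C \<Longrightarrow> Ide C a \<in> Hom C a a"
  by (simp add: category_def)

lemma cat_cmp:
  "category C \<Longrightarrow> a \<in> Obj C \<Longrightarrow> b \<in> Obj C \<Longrightarrow> c \<in> Obj C \<Longrightarrow> f \<in> Hom C a b \<Longrightarrow> g \<in> Hom C b c
    \<Longrightarrow> Cmp C a b c g f \<in> Hom C a c"
  by (simp add: category_def)

lemma cat_idr: "category C \<Longrightarrow> a \<in> Obj C \<Longrightarrow> b \<in> Obj C \<Longrightarrow> f \<in> Hom C a b \<Longrightarrow> Cmp C a a b f (Ide C a) = f"
  by (simp add: category_def)

lemma cat_idl: "category C \<Longrightarrow> a \<in> Obj C \<Longrightarrow> b \<in> Obj C \<Longrightarrow> f \<in> Hom C a b \<Longrightarrow> Cmp C a b b (Ide C b) f = f"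
  by (simp add: category_def)

lemma cat_assoc:
  "category C \<Longrightarrow> a \<in> Obj C \<Longrightarrow> b \<in> Obj C \<Longrightarrow> c \<in> Obj C \<Longrightarrow> d \<in> Obj C
    \<Longrightarrow> f \<in> Hom C a b \<Longrightarrow> g \<in> Hom C b c \<Longrightarrow> h \<in> Hom C c d
    \<Longrightarrow> Cmp C a b d (Cmp C b c d h g) f = Cmp C a c d h (Cmp C a b c g f)"
  by (simp add: category_def)

lemma fun_cat: "is_functor C D F \<Longrightarrow> category C" "is_functor C D F \<Longrightarrow> category D"
  by (simp_all add: is_functor_def)

lemma fun_ob: "is_functor C D F \<Longrightarrow> a \<in> Obj C \<Longrightarrow> FOb F a \<in> Obj D"
  by (simp add: is_functor_def)

lemma fun_hom:
  "is_functor C D F \<Longrightarrow> a \<in> Obj C \<Longrightarrow> b \<in> Obj C \<Longrightarrow> f \<in> Hom C a b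
    \<Longrightarrow> FHom F a b f \<in> Hom D (FOb F a) (FOb F b)"
  by (simp add: is_functor_def)

lemma fun_ide: "is_functor C D F \<Longrightarrow> a \<in> Obj C \<Longrightarrow> FHom F a a (Ide C a) = Ide D (FOb F a)"
  by (simp add: is_functor_def)

lemma fun_cmp:
  "is_functor C D F \<Longrightarrow> a \<in> Obj C \<Longrightarrow> b \<in> Obj C \<Longrightarrow> c \<in> Obj C \<Longrightarrow> f \<in> Hom C a b \<Longrightarrow> g \<in> Hom C b c
    \<Longrightarrow> FHom F a c (Cmp C a b c g f) = Cmp D (FOb F a) (FOb F b) (FOb F c) (FHom F b c g) (FHom F a b f)"
  by (simp add: is_functor_def)

lemma comp_funct_simps [simp]:
  "FOb (comp_funct G F) a = FOb G (FOb F a)"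
  "FHom (comp_funct G F) a b f = FHom G (FOb F a) (FOb F b) (FHom F a b f)"
  by (simp_all add: comp_funct_def)

lemma is_functor_comp: "is_functor C D F \<Longrightarrow> is_functor D E G \<Longrightarrow> is_functor C E (comp_funct G F)"
  by (auto simp: is_functor_def)

definition id_funct :: "('o, 'm, 'o, 'm) funct" where
  "id_funct = \<lparr>FOb = (\<lambda>a. a), FHom = (\<lambda>a b f. f)\<rparr>"

lemma id_funct_simps [simp]: "FOb id_funct a = a" "FHom id_funct a b f = f"
  by (simp_all add: id_funct_def)

lemma is_functor_id: "category C \<Longrightarrow> is_functor C C id_funct"
  by (simp add: is_functor_def)

lemma fully_faithful_id: "category C \<Longrightarrow> fully_faithful C C id_funct"
  by (auto simp: fully_faithful_def is_functor_id bij_betw_def inj_on_def)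

lemma adjunction_id: "category C \<Longrightarrow> adjunction C C id_funct id_funct"
  unfolding adjunction_def
  by (intro conjI is_functor_id exI[of _ "\<lambda>c d f. f"]) (auto simp: bij_betw_def cat_assoc)

lemma op_cat_simps [simp]:
  "Obj (op_cat C) = Obj C" "Hom (op_cat C) a b = Hom C b a" "Ide (op_cat C) = Ide C"
  "Cmp (op_cat C) a b c g f = Cmp C c b a f g"
  by (simp_all add: op_cat_def)

lemma full_subcat_simps [simp]:
  "Obj (full_subcat C S) = S" "Hom (full_subcat C S) = Hom C" "Ide (full_subcat C S) = Ide C"
  "Cmp (full_subcat C S) = Cmp C"
  by (simp_all add: full_subcat_def)

lemma category_op: "category C \<Longrightarrow> category (op_cat C)"
  unfolding category_def by simp

lemma category_full_subcat: "category C \<Longrightarrow> S \<subseteq> Obj C \<Longrightarrow> category (full_subcat C S)"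
  unfolding category_def full_subcat_simps by (meson subsetD)

lemma set_cat_simps [simp]:
  "Obj (set_cat U) = {A. small U A}" "Hom (set_cat U) A B = (A \<rightarrow>\<^sub>E B)"
  "Ide (set_cat U) A = (\<lambda>x\<in>A. x)" "Cmp (set_cat U) A B C g f = compose A g f"
  by (simp_all add: set_cat_def)

lemma category_set: "category (set_cat U)"
  unfolding category_def set_cat_simps
  by (auto simp: compose_def fun_eq_iff PiE_iff extensional_def restrict_def)


section \<open>Presheaves\<close>

text \<open>The presheaf laws for raw sets of elements of any type, without the smallness and
  extensionality demanded of an object of \<open>presheaf_cat\<close>. Constructions are checked at
  this level and only then coded.\<close>

definition psh_data :: "('o, 'm) cat \<Rightarrow> ('o \<Rightarrow> 's set) \<Rightarrow> ('o \<Rightarrow> 'o \<Rightarrow> 'm \<Rightarrow> 's \<Rightarrow> 's) \<Rightarrow> bool" where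
  "psh_data C A act \<longleftrightarrow>
     (\<forall>a\<in>Obj C. \<forall>b\<in>Obj C. \<forall>f\<in>Hom C b a. \<forall>x\<in>A a. act a b f x \<in> A b) \<and>
     (\<forall>a\<in>Obj C. \<forall>x\<in>A a. act a a (Ide C a) x = x) \<and>
     (\<forall>a\<in>Obj C. \<forall>b\<in>Obj C. \<forall>c\<in>Obj C. \<forall>f\<in>Hom C b a. \<forall>g\<in>Hom C c b. \<forall>x\<in>A a.
        act a c (Cmp C c b a f g) x = act b c g (act a b f x))"

lemma presheaf_cat_simps:
  "Ide (presheaf_cat U C) Q = (\<lambda>a\<in>Obj C. \<lambda>x\<in>FOb Q a. x)"
  "Cmp (presheaf_cat U C) P Q R \<beta> \<alpha> = (\<lambda>a\<in>Obj C. compose (FOb P a) (\<beta> a) (\<alpha> a))"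
  by (simp_all add: presheaf_cat_def functor_cat_def)

text \<open>Unfolds functors into sets to laws about elements, which is how presheaves are handled
  from here on.\<close>

lemma psh_obj_iff:
  "Q \<in> Obj (presheaf_cat U C) \<longleftrightarrow>
     category C \<and> extensional_funct (op_cat C) Q \<and> (\<forall>a\<in>Obj C. small U (FOb Q a)) \<and>
     (\<forall>a\<in>Obj C. \<forall>b\<in>Obj C. \<forall>f\<in>Hom C b a. FHom Q a b f \<in> extensional (FOb Q a)) \<and>
     psh_data C (FOb Q) (FHom Q)" (is "?l \<longleftrightarrow> ?r")
proof
  assume ?l
  then have F: "is_functor (op_cat C) (set_cat U) Q" and e: "extensional_funct (op_cat C) Q"
    by (auto simp: presheaf_cat_def functor_cat_def)
  have "op_cat (op_cat C) = C" by (simp add: op_cat_def)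
  then have C: "category C" using fun_cat(1)[OF F] category_op by metis
  have h: "FHom Q a b f \<in> FOb Q a \<rightarrow>\<^sub>E FOb Q b" if "a \<in> Obj C" "b \<in> Obj C" "f \<in> Hom C b a" for a b f
    using fun_hom[OF F, of a b f] that by simp
  have i: "FHom Q a a (Ide C a) = (\<lambda>x\<in>FOb Q a. x)" if "a \<in> Obj C" for a
    using fun_ide[OF F, of a] that by simp
  have c: "FHom Q a c (Cmp C c b a f g) = compose (FOb Q a) (FHom Q b c g) (FHom Q a b f)"
    if "a \<in> Obj C" "b \<in> Obj C" "c \<in> Obj C" "f \<in> Hom C b a" "g \<in> Hom C c b" for a b c f g
    using fun_cmp[OF F, of a b c f g] that by simp
  have "psh_data C (FOb Q) (FHom Q)"
    unfolding psh_data_def by (auto simp: i c compose_eq dest: h)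
  moreover have "small U (FOb Q a)" if "a \<in> Obj C" for a using fun_ob[OF F] that by simp
  moreover have "FHom Q a b f \<in> extensional (FOb Q a)" if "a \<in> Obj C" "b \<in> Obj C" "f \<in> Hom C b a" for a b f
    using h[OF that] by (simp add: PiE_iff)
  ultimately show ?r using C e by simp
next
  assume r: ?r
  then have C: "category C" and P: "psh_data C (FOb Q) (FHom Q)"
    and s: "\<And>a. a \<in> Obj C \<Longrightarrow> small U (FOb Q a)"
    and x: "\<And>a b f. a \<in> Obj C \<Longrightarrow> b \<in> Obj C \<Longrightarrow> f \<in> Hom C b a \<Longrightarrow> FHom Q a b f \<in> extensional (FOb Q a)"
    by auto
  have "is_functor (op_cat C) (set_cat U) Q"
    unfolding is_functor_def op_cat_simps set_cat_simps mem_Collect_eq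
  proof (intro conjI ballI category_op C category_set s)
    fix a b f assume "a \<in> Obj C" "b \<in> Obj C" "f \<in> Hom C b a"
    then show "FHom Q a b f \<in> FOb Q a \<rightarrow>\<^sub>E FOb Q b"
      using x P unfolding psh_data_def PiE_iff by blast
  next
    fix a assume a: "a \<in> Obj C"
    show "FHom Q a a (Ide C a) = (\<lambda>x\<in>FOb Q a. x)"
      by (rule extensionalityI[of _ "FOb Q a"]) (use a P x cat_ide[OF C] in \<open>auto simp: psh_data_def\<close>)
  next
    fix a b c f g assume *: "a \<in> Obj C" "b \<in> Obj C" "c \<in> Obj C" "f \<in> Hom C b a" "g \<in> Hom C c b"
    have "Cmp C c b a f g \<in> Hom C c a" using * C by (blast intro: cat_cmp)
    then show "FHom Q a c (Cmp C c b a f g) = compose (FOb Q a) (FHom Q b c g) (FHom Q a b f)"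
      by (intro extensionalityI[of _ "FOb Q a"]) (use * P x in \<open>auto simp: psh_data_def compose_eq\<close>)
  qed
  then show ?l using r by (simp add: presheaf_cat_def functor_cat_def)
qed

lemma psh_cat: "Q \<in> Obj (presheaf_cat U C) \<Longrightarrow> category C"
  by (simp add: psh_obj_iff)

lemma psh_small: "Q \<in> Obj (presheaf_cat U C) \<Longrightarrow> a \<in> Obj C \<Longrightarrow> small U (FOb Q a)"
  by (simp add: psh_obj_iff)

lemma psh_act:
  "Q \<in> Obj (presheaf_cat U C) \<Longrightarrow> a \<in> Obj C \<Longrightarrow> b \<in> Obj C \<Longrightarrow> f \<in> Hom C b a \<Longrightarrow> x \<in> FOb Q a
    \<Longrightarrow> FHom Q a b f x \<in> FOb Q b"
  by (simp add: psh_obj_iff psh_data_def)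

lemma psh_ide:
  "Q \<in> Obj (presheaf_cat U C) \<Longrightarrow> a \<in> Obj C \<Longrightarrow> x \<in> FOb Q a \<Longrightarrow> FHom Q a a (Ide C a) x = x"
  by (simp add: psh_obj_iff psh_data_def)

lemma psh_cmp:
  "Q \<in> Obj (presheaf_cat U C) \<Longrightarrow> a \<in> Obj C \<Longrightarrow> b \<in> Obj C \<Longrightarrow> c \<in> Obj C \<Longrightarrow> f \<in> Hom C b a
    \<Longrightarrow> g \<in> Hom C c b \<Longrightarrow> x \<in> FOb Q a \<Longrightarrow> FHom Q a c (Cmp C c b a f g) x = FHom Q b c g (FHom Q a b f x)"
  by (simp add: psh_obj_iff psh_data_def)

lemma psh_hom_iff:
  assumes "P \<in> Obj (presheaf_cat U C)" "Q \<in> Obj (presheaf_cat U C)"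
  shows "\<alpha> \<in> Hom (presheaf_cat U C) P Q \<longleftrightarrow>
     \<alpha> \<in> extensional (Obj C) \<and> (\<forall>a\<in>Obj C. \<alpha> a \<in> FOb P a \<rightarrow>\<^sub>E FOb Q a) \<and>
     (\<forall>a\<in>Obj C. \<forall>b\<in>Obj C. \<forall>f\<in>Hom C b a. \<forall>x\<in>FOb P a. FHom Q a b f (\<alpha> a x) = \<alpha> b (FHom P a b f x))"
    (is "_ \<longleftrightarrow> ?r")
proof -
  have "(\<forall>a\<in>Obj C. \<forall>b\<in>Obj C. \<forall>f\<in>Hom C b a.
           compose (FOb P a) (FHom Q a b f) (\<alpha> a) = compose (FOb P a) (\<alpha> b) (FHom P a b f)) \<longleftrightarrow>
        (\<forall>a\<in>Obj C. \<forall>b\<in>Obj C. \<forall>f\<in>Hom C b a. \<forall>x\<in>FOb P a. FHom Q a b f (\<alpha> a x) = \<alpha> b (FHom P a b f x))"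
    by (auto simp: fun_eq_iff compose_def restrict_def)
  then show ?thesis
    by (auto simp: presheaf_cat_def functor_cat_def nat_trans_def)
qed

lemma psh_homI:
  assumes "P \<in> Obj (presheaf_cat U C)" "Q \<in> Obj (presheaf_cat U C)"
    and "\<And>a x. a \<in> Obj C \<Longrightarrow> x \<in> FOb P a \<Longrightarrow> \<alpha> a x \<in> FOb Q a"
    and "\<And>a b f x. a \<in> Obj C \<Longrightarrow> b \<in> Obj C \<Longrightarrow> f \<in> Hom C b a \<Longrightarrow> x \<in> FOb P a
           \<Longrightarrow> FHom Q a b f (\<alpha> a x) = \<alpha> b (FHom P a b f x)"
  shows "(\<lambda>a\<in>Obj C. \<lambda>x\<in>FOb P a. \<alpha> a x) \<in> Hom (presheaf_cat U C) P Q"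
  unfolding psh_hom_iff[OF assms(1,2)] using assms(3,4) psh_act[OF assms(1)] by auto

lemma psh_hom_in:
  assumes "P \<in> Obj (presheaf_cat U C)" "Q \<in> Obj (presheaf_cat U C)"
    and "\<alpha> \<in> Hom (presheaf_cat U C) P Q" "a \<in> Obj C" "x \<in> FOb P a"
  shows "\<alpha> a x \<in> FOb Q a"
  using assms psh_hom_iff[OF assms(1,2)] by blast

lemma psh_hom_nat:
  assumes "P \<in> Obj (presheaf_cat U C)" "Q \<in> Obj (presheaf_cat U C)"
    and "\<alpha> \<in> Hom (presheaf_cat U C) P Q" "a \<in> Obj C" "b \<in> Obj C" "f \<in> Hom C b a" "x \<in> FOb P a"
  shows "FHom Q a b f (\<alpha> a x) = \<alpha> b (FHom P a b f x)"
  using assms psh_hom_iff[OF assms(1,2)] by blast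

lemma psh_hom_eqI:
  assumes "P \<in> Obj (presheaf_cat U C)" "Q \<in> Obj (presheaf_cat U C)"
    and "\<alpha> \<in> Hom (presheaf_cat U C) P Q" "\<beta> \<in> Hom (presheaf_cat U C) P Q"
    and "\<And>a x. a \<in> Obj C \<Longrightarrow> x \<in> FOb P a \<Longrightarrow> \<alpha> a x = \<beta> a x"
  shows "\<alpha> = \<beta>"
proof (rule extensionalityI[of _ "Obj C"])
  show "\<alpha> \<in> extensional (Obj C)" "\<beta> \<in> extensional (Obj C)"
    using assms psh_hom_iff[OF assms(1,2)] by blast+
  fix a assume "a \<in> Obj C"
  then show "\<alpha> a = \<beta> a"
    using assms psh_hom_iff[OF assms(1,2)] by (metis PiE_ext)
qed

lemma psh_cmp_app [simp]:
  "a \<in> Obj C \<Longrightarrow> x \<in> FOb P a \<Longrightarrow> Cmp (presheaf_cat U C) P Q R \<beta> \<alpha> a x = \<beta> a (\<alpha> a x)"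
  by (simp add: presheaf_cat_simps compose_eq)

lemma psh_ide_app [simp]:
  "a \<in> Obj C \<Longrightarrow> x \<in> FOb P a \<Longrightarrow> Ide (presheaf_cat U C) P a x = x"
  by (simp add: presheaf_cat_simps)

lemma category_psh:
  assumes C: "category C"
  shows "category (presheaf_cat U C)" (is "category ?P")
proof -
  have i: "Ide ?P a \<in> Hom ?P a a" if "a \<in> Obj ?P" for a
    unfolding presheaf_cat_simps by (rule psh_homI) (use that in auto)
  have c: "Cmp ?P P Q R \<beta> \<alpha> \<in> Hom ?P P R"
    if "P \<in> Obj ?P" "Q \<in> Obj ?P" "R \<in> Obj ?P" "\<alpha> \<in> Hom ?P P Q" "\<beta> \<in> Hom ?P Q R" for P Q R \<alpha> \<beta>
    unfolding presheaf_cat_simps compose_def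
    by (rule psh_homI) (use that in \<open>auto simp: psh_hom_in psh_hom_nat\<close>)
  show ?thesis
    unfolding category_def
  proof (intro conjI ballI i c)
    fix P Q \<alpha> assume *: "P \<in> Obj ?P" "Q \<in> Obj ?P" "\<alpha> \<in> Hom ?P P Q"
    show "Cmp ?P P P Q \<alpha> (Ide ?P P) = \<alpha>" "Cmp ?P P Q Q (Ide ?P Q) \<alpha> = \<alpha>"
      by (rule psh_hom_eqI[OF *(1,2)]; use * i c in \<open>simp add: psh_hom_in\<close>)+
  next
    fix P Q R S \<alpha> \<beta> \<gamma>
    assume *: "P \<in> Obj ?P" "Q \<in> Obj ?P" "R \<in> Obj ?P" "S \<in> Obj ?P"
      "\<alpha> \<in> Hom ?P P Q" "\<beta> \<in> Hom ?P Q R" "\<gamma> \<in> Hom ?P R S"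
    show "Cmp ?P P Q S (Cmp ?P Q R S \<gamma> \<beta>) \<alpha> = Cmp ?P P R S \<gamma> (Cmp ?P P Q R \<beta> \<alpha>)"
    proof (rule psh_hom_eqI[OF *(1,4)])
      show "Cmp ?P P Q S (Cmp ?P Q R S \<gamma> \<beta>) \<alpha> \<in> Hom ?P P S"
        by (rule c[OF *(1,2,4,5) c[OF *(2,3,4,6,7)]])
      show "Cmp ?P P R S \<gamma> (Cmp ?P P Q R \<beta> \<alpha>) \<in> Hom ?P P S"
        by (rule c[OF *(1,3,4) c[OF *(1,2,3,5,6)] *(7)])
    qed (use * in \<open>simp add: psh_hom_in\<close>)
  qed auto
qed

text \<open>The pointwise inverses are automatically natural: write \<open>y\<close> as
  \<open>\<alpha> a (\<beta> a y)\<close> and move the action through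
  \<open>\<alpha>\<close>.\<close>

lemma psh_iso_in:
  assumes P: "P \<in> Obj (presheaf_cat U C)" and Q: "Q \<in> Obj (presheaf_cat U C)"
    and \<alpha>: "\<alpha> \<in> Hom (presheaf_cat U C) P Q"
    and bij: "\<And>a. a \<in> Obj C \<Longrightarrow> bij_betw (\<alpha> a) (FOb P a) (FOb Q a)"
  shows "\<exists>\<beta>. iso_in (presheaf_cat U C) P Q \<alpha> \<beta>"
proof -
  define \<beta> where "\<beta> = (\<lambda>a\<in>Obj C. \<lambda>y\<in>FOb Q a. inv_into (FOb P a) (\<alpha> a) y)"
  have 1: "\<beta> a (\<alpha> a x) = x" if "a \<in> Obj C" "x \<in> FOb P a" for a x
    using that bij[of a] by (simp add: \<beta>_def psh_hom_in[OF P Q \<alpha>] bij_betw_inv_into_left)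
  have 2: "\<alpha> a (\<beta> a y) = y" if "a \<in> Obj C" "y \<in> FOb Q a" for a y
    using that bij[of a] by (simp add: \<beta>_def bij_betw_inv_into_right)
  have 3: "\<beta> a y \<in> FOb P a" if "a \<in> Obj C" "y \<in> FOb Q a" for a y
    using that bij[of a] by (metis 1 2 bij_betw_imp_surj_on imageE)
  have \<beta>: "\<beta> \<in> Hom (presheaf_cat U C) Q P"
    unfolding \<beta>_def
  proof (rule psh_homI[OF Q P])
    fix a b f y assume *: "a \<in> Obj C" "b \<in> Obj C" "f \<in> Hom C b a" "y \<in> FOb Q a"
    have "\<beta> b (FHom Q a b f y) = \<beta> b (FHom Q a b f (\<alpha> a (\<beta> a y)))" using * 2 by simp
    also have "\<dots> = FHom P a b f (\<beta> a y)"
      using * by (simp add: psh_hom_nat[OF P Q \<alpha>] 3 1 psh_act[OF P])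
    finally show "FHom P a b f (inv_into (FOb P a) (\<alpha> a) y) = inv_into (FOb P b) (\<alpha> b) (FHom Q a b f y)"
      using * by (simp add: \<beta>_def psh_act[OF Q])
  qed (use 3 in \<open>auto simp: \<beta>_def\<close>)
  note c = category_psh[OF psh_cat[OF P], of U]
  have "Cmp (presheaf_cat U C) P Q P \<beta> \<alpha> = Ide (presheaf_cat U C) P"
    by (rule psh_hom_eqI[OF P P cat_cmp[OF c P Q P \<alpha> \<beta>] cat_ide[OF c P]]) (simp add: 1)
  moreover have "Cmp (presheaf_cat U C) Q P Q \<alpha> \<beta> = Ide (presheaf_cat U C) Q"
    by (rule psh_hom_eqI[OF Q Q cat_cmp[OF c Q P Q \<beta> \<alpha>] cat_ide[OF c Q]]) (simp add: 2)
  ultimately show ?thesis using \<alpha> \<beta> by (auto simp: iso_in_def)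
qed

text \<open>The small sets \<open>A a\<close> of elements of any type are coded as sets of elements of \<open>'s\<close>, through an injection
  \<open>j\<close> of the universe \<open>'u\<close> into \<open>'s\<close>.\<close>

definition cod :: "('u \<Rightarrow> 's) \<Rightarrow> 't set \<Rightarrow> 't \<Rightarrow> 's" where
  "cod j A x = j (enc A x)"

definition dec :: "('u \<Rightarrow> 's) \<Rightarrow> 't set \<Rightarrow> 's \<Rightarrow> 't" where
  "dec j A = inv_into A (cod j A)"

definition psh_of ::
  "('u \<Rightarrow> 's) \<Rightarrow> ('o, 'm) cat \<Rightarrow> ('o \<Rightarrow> 't set) \<Rightarrow> ('o \<Rightarrow> 'o \<Rightarrow> 'm \<Rightarrow> 't \<Rightarrow> 't) \<Rightarrow> ('o, 'm, 's) presheaf" where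
  "psh_of j C A act = restrict_funct (op_cat C)
     \<lparr>FOb = (\<lambda>a. cod j (A a) ` A a),
      FHom = (\<lambda>a b f. \<lambda>y\<in>cod j (A a) ` A a. cod j (A b) (act a b f (dec j (A a) y)))\<rparr>"

lemma bij_cod:
  assumes "small (U :: 'u itself) A" "inj (j :: 'u \<Rightarrow> 's)"
  shows "bij_betw (cod j A) A (cod j A ` A)"
  using inj_enc[OF assms(1)] assms(2) by (simp add: bij_betw_def inj_on_def cod_def)

lemma dec_cod: "small (U :: 'u itself) A \<Longrightarrow> inj (j :: 'u \<Rightarrow> 's) \<Longrightarrow> x \<in> A \<Longrightarrow> dec j A (cod j A x) = x"
  unfolding dec_def by (rule bij_betw_inv_into_left[OF bij_cod])

lemma dec_in: "y \<in> cod j A ` A \<Longrightarrow> dec j A y \<in> A"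
  unfolding dec_def by (rule inv_into_into)

lemma cod_dec: "y \<in> cod j A ` A \<Longrightarrow> cod j A (dec j A y) = y"
  unfolding dec_def by (rule f_inv_into_f)

lemma psh_of_ob: "a \<in> Obj C \<Longrightarrow> FOb (psh_of j C A act) a = cod j (A a) ` A a"
  by (simp add: psh_of_def restrict_funct_def)

lemma psh_of_act:
  assumes "small (U :: 'u itself) (A a)" "inj (j :: 'u \<Rightarrow> 's)"
    and "a \<in> Obj C" "b \<in> Obj C" "f \<in> Hom C b a" "x \<in> A a"
  shows "FHom (psh_of j C A act) a b f (cod j (A a) x) = cod j (A b) (act a b f x)"
  using assms by (simp add: psh_of_def restrict_funct_def dec_cod[OF assms(1,2)])

lemma psh_of_obj:
  assumes C: "category C" and j: "inj (j :: 'u \<Rightarrow> 's)"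
    and s: "\<And>a. a \<in> Obj C \<Longrightarrow> small (U :: 'u itself) (A a)" and A: "psh_data C A act"
  shows "psh_of j C A act \<in> Obj (presheaf_cat U C)"
proof -
  let ?Q = "psh_of j C A act"
  have "FHom ?Q a b f \<in> extensional (FOb ?Q a)" if "a \<in> Obj C" "b \<in> Obj C" "f \<in> Hom C b a" for a b f
    using that by (auto simp: psh_of_def restrict_funct_def)
  moreover have "psh_data C (FOb ?Q) (FHom ?Q)"
    using A unfolding psh_data_def
    by (auto simp: psh_of_ob psh_of_act[where A=A, OF s j] cat_ide[OF C] cat_cmp[OF C])
  moreover have "extensional_funct (op_cat C) ?Q"
    by (auto simp: extensional_funct_def psh_of_def restrict_funct_def)
  ultimately show ?thesis
    unfolding psh_obj_iff by (auto simp: C psh_of_ob intro: small_image s)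
qed


section \<open>Adjunctions\<close>

text \<open>The form with unit, counit and triangle identities, to be extracted from the hom
  bijection in \<open>adjunction\<close>. In presheaf categories the unit acts on elements, and most
  later arguments compute with it.\<close>

locale adj =
  fixes C :: "('o1, 'm1) cat" and D :: "('o2, 'm2) cat" and F G \<eta> \<epsilon>
  assumes F: "is_functor C D F" and G: "is_functor D C G"
    and unit_hom: "c \<in> Obj C \<Longrightarrow> \<eta> c \<in> Hom C c (FOb G (FOb F c))"
    and counit_hom: "d \<in> Obj D \<Longrightarrow> \<epsilon> d \<in> Hom D (FOb F (FOb G d)) d"
    and unit_nat: "c \<in> Obj C \<Longrightarrow> c' \<in> Obj C \<Longrightarrow> f \<in> Hom C c c' \<Longrightarrow>
        Cmp C c (FOb G (FOb F c)) (FOb G (FOb F c')) (FHom G (FOb F c) (FOb F c') (FHom F c c' f)) (\<eta> c)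
          = Cmp C c c' (FOb G (FOb F c')) (\<eta> c') f"
    and counit_nat: "d \<in> Obj D \<Longrightarrow> d' \<in> Obj D \<Longrightarrow> h \<in> Hom D d d' \<Longrightarrow>
        Cmp D (FOb F (FOb G d)) (FOb F (FOb G d')) d' (\<epsilon> d') (FHom F (FOb G d) (FOb G d') (FHom G d d' h))
          = Cmp D (FOb F (FOb G d)) d d' h (\<epsilon> d)"
    and triangle_F: "c \<in> Obj C \<Longrightarrow>
        Cmp D (FOb F c) (FOb F (FOb G (FOb F c))) (FOb F c) (\<epsilon> (FOb F c)) (FHom F c (FOb G (FOb F c)) (\<eta> c))
          = Ide D (FOb F c)"
    and triangle_G: "d \<in> Obj D \<Longrightarrow>
        Cmp C (FOb G d) (FOb G (FOb F (FOb G d))) (FOb G d) (FHom G (FOb F (FOb G d)) d (\<epsilon> d)) (\<eta> (FOb G d))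
          = Ide C (FOb G d)"

text \<open>The unit is the image of an identity under \<open>\<phi>\<close>, the counit the
  preimage of one. Inserting identities into the joint naturality law gives naturality in each
  variable; equations between morphisms out of some \<open>F c\<close> are tested after applying the
  injective \<open>\<phi>\<close>.\<close>

lemma adjE:
  assumes "adjunction C D F G"
  obtains \<eta> \<epsilon> where "adj C D F G \<eta> \<epsilon>"
proof -
  obtain \<phi> where F: "is_functor C D F" and G: "is_functor D C G"
    and bij: "\<And>c d. c \<in> Obj C \<Longrightarrow> d \<in> Obj D \<Longrightarrow> bij_betw (\<phi> c d) (Hom D (FOb F c) d) (Hom C c (FOb G d))"
    and nat: "\<And>c c' d d' f g h. c \<in> Obj C \<Longrightarrow> c' \<in> Obj C \<Longrightarrow> d \<in> Obj D \<Longrightarrow> d' \<in> Obj D \<Longrightarrow> f \<in> Hom C c' c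
      \<Longrightarrow> g \<in> Hom D (FOb F c) d \<Longrightarrow> h \<in> Hom D d d' \<Longrightarrow>
      \<phi> c' d' (Cmp D (FOb F c') d d' h (Cmp D (FOb F c') (FOb F c) d g (FHom F c' c f))) =
      Cmp C c' (FOb G d) (FOb G d') (FHom G d d' h) (Cmp C c' c (FOb G d) (\<phi> c d g) f)"
    using assms unfolding adjunction_def by blast
  note [simp] = fun_cat[OF F] fun_ob[OF F] fun_ob[OF G] fun_ide[OF F] fun_ide[OF G]
    cat_idl cat_idr cat_ide fun_hom[OF F] fun_hom[OF G]
  have \<phi>: "\<phi> c d g \<in> Hom C c (FOb G d)" if "c \<in> Obj C" "d \<in> Obj D" "g \<in> Hom D (FOb F c) d" for c d g
    using bij that bij_betwE by blast
  have n1: "\<phi> c d' (Cmp D (FOb F c) d d' h g) = Cmp C c (FOb G d) (FOb G d') (FHom G d d' h) (\<phi> c d g)"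
    if "c \<in> Obj C" "d \<in> Obj D" "d' \<in> Obj D" "g \<in> Hom D (FOb F c) d" "h \<in> Hom D d d'" for c d d' g h
    using nat[of c c d d' "Ide C c" g h] that \<phi>[of c d g] by simp
  have n2: "\<phi> c' d (Cmp D (FOb F c') (FOb F c) d g (FHom F c' c f)) = Cmp C c' c (FOb G d) (\<phi> c d g) f"
    if "c \<in> Obj C" "c' \<in> Obj C" "d \<in> Obj D" "f \<in> Hom C c' c" "g \<in> Hom D (FOb F c) d" for c c' d f g
    using nat[of c c' d d f g "Ide D d"] that \<phi>[of c d g]
      cat_cmp[of D "FOb F c'" "FOb F c" d "FHom F c' c f" g] cat_cmp[of C c' c "FOb G d" f "\<phi> c d g"] by simp
  have inj: "g = g'" if "\<phi> c d g = \<phi> c d g'" "c \<in> Obj C" "d \<in> Obj D" "g \<in> Hom D (FOb F c) d"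
      "g' \<in> Hom D (FOb F c) d" for c d g g'
    using bij that by (meson bij_betw_def inj_onD)
  define \<eta> where "\<eta> = (\<lambda>c. \<phi> c (FOb F c) (Ide D (FOb F c)))"
  define \<epsilon> where "\<epsilon> = (\<lambda>d. inv_into (Hom D (FOb F (FOb G d)) d) (\<phi> (FOb G d) d) (Ide C (FOb G d)))"
  have \<eta>: "\<eta> c \<in> Hom C c (FOb G (FOb F c))" if "c \<in> Obj C" for c
    unfolding \<eta>_def using that by (simp add: \<phi>)
  have \<epsilon>: "\<epsilon> d \<in> Hom D (FOb F (FOb G d)) d" and \<phi>\<epsilon>: "\<phi> (FOb G d) d (\<epsilon> d) = Ide C (FOb G d)" if "d \<in> Obj D" for d
  proof -
    have "Ide C (FOb G d) \<in> \<phi> (FOb G d) d ` Hom D (FOb F (FOb G d)) d"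
      using bij[of "FOb G d" d] that by (simp add: bij_betw_def)
    then show "\<epsilon> d \<in> Hom D (FOb F (FOb G d)) d" "\<phi> (FOb G d) d (\<epsilon> d) = Ide C (FOb G d)"
      unfolding \<epsilon>_def by (rule inv_into_into, rule f_inv_into_f)
  qed
  have "adj C D F G \<eta> \<epsilon>"
  proof
    show "is_functor C D F" "is_functor D C G" by fact+
    show "\<eta> c \<in> Hom C c (FOb G (FOb F c))" if "c \<in> Obj C" for c by (rule \<eta>[OF that])
    show "\<epsilon> d \<in> Hom D (FOb F (FOb G d)) d" if "d \<in> Obj D" for d by (rule \<epsilon>[OF that])
  next
    fix c c' f assume *: "c \<in> Obj C" "c' \<in> Obj C" "f \<in> Hom C c c'"
    then show "Cmp C c (FOb G (FOb F c)) (FOb G (FOb F c')) (FHom G (FOb F c) (FOb F c') (FHom F c c' f)) (\<eta> c)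
          = Cmp C c c' (FOb G (FOb F c')) (\<eta> c') f"
      unfolding \<eta>_def
      using n1[of c "FOb F c" "FOb F c'" "Ide D (FOb F c)" "FHom F c c' f"]
        n2[of c' c "FOb F c'" f "Ide D (FOb F c')"] by simp
  next
    fix d d' h assume *: "d \<in> Obj D" "d' \<in> Obj D" "h \<in> Hom D d d'"
    show "Cmp D (FOb F (FOb G d)) (FOb F (FOb G d')) d' (\<epsilon> d') (FHom F (FOb G d) (FOb G d') (FHom G d d' h))
          = Cmp D (FOb F (FOb G d)) d d' h (\<epsilon> d)"
    proof (rule inj[of "FOb G d" d'])
      have "FHom G d d' h = Cmp C (FOb G d) (FOb G d') (FOb G d') (\<phi> (FOb G d') d' (\<epsilon> d')) (FHom G d d' h)"
        using * by (simp add: \<phi>\<epsilon>)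
      also have "\<dots> = \<phi> (FOb G d) d' (Cmp D (FOb F (FOb G d)) (FOb F (FOb G d')) d' (\<epsilon> d') (FHom F (FOb G d) (FOb G d') (FHom G d d' h)))"
        using * by (subst n2) (simp_all add: \<epsilon>)
      finally show "\<phi> (FOb G d) d' (Cmp D (FOb F (FOb G d)) (FOb F (FOb G d')) d' (\<epsilon> d') (FHom F (FOb G d) (FOb G d') (FHom G d d' h)))
          = \<phi> (FOb G d) d' (Cmp D (FOb F (FOb G d)) d d' h (\<epsilon> d))"
        using * by (simp add: n1 \<epsilon> \<phi>\<epsilon>)
    qed (use * in \<open>auto simp: \<epsilon> intro: cat_cmp[where b="FOb F (FOb G d')"] cat_cmp[where b=d]\<close>)
  next
    fix c assume *: "c \<in> Obj C"
    have "\<phi> c (FOb F c) (Cmp D (FOb F c) (FOb F (FOb G (FOb F c))) (FOb F c) (\<epsilon> (FOb F c)) (FHom F c (FOb G (FOb F c)) (\<eta> c)))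
      = \<eta> c" using * by (subst n2) (simp_all add: \<epsilon> \<phi>\<epsilon> \<eta>)
    then show "Cmp D (FOb F c) (FOb F (FOb G (FOb F c))) (FOb F c) (\<epsilon> (FOb F c)) (FHom F c (FOb G (FOb F c)) (\<eta> c))
          = Ide D (FOb F c)"
      unfolding \<eta>_def by (rule inj) (use * \<eta>[OF *, unfolded \<eta>_def] in \<open>simp_all add: \<epsilon> cat_cmp[where b="FOb F (FOb G (FOb F c))"]\<close>)
  next
    fix d assume *: "d \<in> Obj D"
    then show "Cmp C (FOb G d) (FOb G (FOb F (FOb G d))) (FOb G d) (FHom G (FOb F (FOb G d)) d (\<epsilon> d)) (\<eta> (FOb G d))
          = Ide C (FOb G d)"
      unfolding \<eta>_def by (subst n1[symmetric]) (simp_all add: \<epsilon> \<phi>\<epsilon>)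
  qed
  then show thesis by (rule that)
qed

context adj
begin

lemma C: "category C" and D: "category D"
  using fun_cat[OF F] by auto

lemmas adj_simps = C D fun_ob[OF F] fun_ob[OF G] fun_hom[OF F] fun_hom[OF G] fun_ide[OF F] fun_ide[OF G]
  fun_cmp[OF F] fun_cmp[OF G] unit_hom counit_hom

lemma transpose_left:
  assumes "c \<in> Obj C" "d \<in> Obj D" "f \<in> Hom C c (FOb G d)"
  shows "Cmp D (FOb F c) (FOb F (FOb G d)) d (\<epsilon> d) (FHom F c (FOb G d) f) \<in> Hom D (FOb F c) d" (is "?h \<in> _")
    and "Cmp C c (FOb G (FOb F c)) (FOb G d) (FHom G (FOb F c) d
           (Cmp D (FOb F c) (FOb F (FOb G d)) d (\<epsilon> d) (FHom F c (FOb G d) f))) (\<eta> c) = f"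
proof -
  let ?FG = "FOb F (FOb G d)"
  show h: "?h \<in> Hom D (FOb F c) d"
    using assms by (simp add: adj_simps cat_cmp[where b="?FG"])
  have "Cmp C c (FOb G (FOb F c)) (FOb G d) (FHom G (FOb F c) d ?h) (\<eta> c) =
        Cmp C c (FOb G ?FG) (FOb G d) (FHom G ?FG d (\<epsilon> d))
          (Cmp C c (FOb G (FOb F c)) (FOb G ?FG) (FHom G (FOb F c) ?FG (FHom F c (FOb G d) f)) (\<eta> c))"
    using assms by (simp add: adj_simps cat_assoc)
  also have "\<dots> = Cmp C c (FOb G d) (FOb G d) (Cmp C (FOb G d) (FOb G ?FG) (FOb G d) (FHom G ?FG d (\<epsilon> d)) (\<eta> (FOb G d))) f"
    using assms by (simp add: adj_simps cat_assoc unit_nat)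
  also have "\<dots> = f"
    using assms by (simp add: adj_simps triangle_G cat_idl)
  finally show "Cmp C c (FOb G (FOb F c)) (FOb G d) (FHom G (FOb F c) d ?h) (\<eta> c) = f" .
qed

lemma transpose_right:
  assumes "c \<in> Obj C" "d \<in> Obj D" "h \<in> Hom D (FOb F c) d"
  shows "Cmp C c (FOb G (FOb F c)) (FOb G d) (FHom G (FOb F c) d h) (\<eta> c) \<in> Hom C c (FOb G d)" (is "?f \<in> _")
    and "Cmp D (FOb F c) (FOb F (FOb G d)) d (\<epsilon> d) (FHom F c (FOb G d)
           (Cmp C c (FOb G (FOb F c)) (FOb G d) (FHom G (FOb F c) d h) (\<eta> c))) = h"
proof -
  let ?GF = "FOb G (FOb F c)"
  show f: "?f \<in> Hom C c (FOb G d)"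
    using assms by (simp add: adj_simps cat_cmp[where b="?GF"])
  have "Cmp D (FOb F c) (FOb F (FOb G d)) d (\<epsilon> d) (FHom F c (FOb G d) ?f) =
        Cmp D (FOb F c) (FOb F ?GF) d (Cmp D (FOb F ?GF) (FOb F (FOb G d)) d (\<epsilon> d) (FHom F ?GF (FOb G d) (FHom G (FOb F c) d h)))
          (FHom F c ?GF (\<eta> c))"
    using assms by (simp add: adj_simps cat_assoc)
  also have "\<dots> = Cmp D (FOb F c) (FOb F c) d h (Cmp D (FOb F c) (FOb F ?GF) (FOb F c) (\<epsilon> (FOb F c)) (FHom F c ?GF (\<eta> c)))"
    using assms by (simp add: adj_simps cat_assoc counit_nat)
  also have "\<dots> = h"
    using assms by (simp add: adj_simps triangle_F cat_idr)
  finally show "Cmp D (FOb F c) (FOb F (FOb G d)) d (\<epsilon> d) (FHom F c (FOb G d) ?f) = h" .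
qed

lemma left_eqI:
  assumes "c \<in> Obj C" "d \<in> Obj D" "h \<in> Hom D (FOb F c) d" "h' \<in> Hom D (FOb F c) d"
    and "Cmp C c (FOb G (FOb F c)) (FOb G d) (FHom G (FOb F c) d h) (\<eta> c) =
         Cmp C c (FOb G (FOb F c)) (FOb G d) (FHom G (FOb F c) d h') (\<eta> c)"
  shows "h = h'"
  using transpose_right(2)[OF assms(1,2,3)] transpose_right(2)[OF assms(1,2,4)] assms(5) by metis

lemma right_eqI:
  assumes "c \<in> Obj C" "d \<in> Obj D" "f \<in> Hom C c (FOb G d)" "f' \<in> Hom C c (FOb G d)"
    and "Cmp D (FOb F c) (FOb F (FOb G d)) d (\<epsilon> d) (FHom F c (FOb G d) f) =
         Cmp D (FOb F c) (FOb F (FOb G d)) d (\<epsilon> d) (FHom F c (FOb G d) f')"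
  shows "f = f'"
  using transpose_left(2)[OF assms(1,2,3)] transpose_left(2)[OF assms(1,2,4)] assms(5) by metis

text \<open>Fullness of \<open>G\<close> lifts the unit at \<open>G d\<close> to a morphism
  \<open>\<delta>\<close> from \<open>d\<close> to \<open>F (G d)\<close>. Faithfulness and a
  triangle identity give one composite; the other is checked on transposes.\<close>

lemma counit_iso:
  assumes ff: "fully_faithful D C G" and d: "d \<in> Obj D"
  shows "\<exists>\<delta>. iso_in D d (FOb F (FOb G d)) \<delta> (\<epsilon> d) \<and> FHom G d (FOb F (FOb G d)) \<delta> = \<eta> (FOb G d)"
proof -
  let ?FG = "FOb F (FOb G d)"
  have bij: "bij_betw (FHom G a b) (Hom D a b) (Hom C (FOb G a) (FOb G b))" if "a \<in> Obj D" "b \<in> Obj D" for a b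
    using ff that by (simp add: fully_faithful_def)
  have "\<eta> (FOb G d) \<in> FHom G d ?FG ` Hom D d ?FG"
    using bij[of d ?FG] d by (simp add: adj_simps bij_betw_def)
  then obtain \<delta> where \<delta>: "\<delta> \<in> Hom D d ?FG" and G\<delta>: "FHom G d ?FG \<delta> = \<eta> (FOb G d)" by auto
  note [simp] = d \<delta> adj_simps
  have 1: "Cmp D d ?FG d (\<epsilon> d) \<delta> = Ide D d"
  proof (rule inj_onD[of "FHom G d d" "Hom D d d"])
    show "inj_on (FHom G d d) (Hom D d d)" using bij[of d d] by (simp add: bij_betw_def)
    show "FHom G d d (Cmp D d ?FG d (\<epsilon> d) \<delta>) = FHom G d d (Ide D d)"
      by (simp add: G\<delta> triangle_G)
  qed (simp_all add: cat_cmp[where b="?FG"] cat_ide)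
  have 2: "Cmp D ?FG d ?FG \<delta> (\<epsilon> d) = Ide D ?FG"
  proof (rule left_eqI[of "FOb G d" ?FG])
    show "Cmp C (FOb G d) (FOb G ?FG) (FOb G ?FG) (FHom G ?FG ?FG (Cmp D ?FG d ?FG \<delta> (\<epsilon> d))) (\<eta> (FOb G d)) =
      Cmp C (FOb G d) (FOb G ?FG) (FOb G ?FG) (FHom G ?FG ?FG (Ide D ?FG)) (\<eta> (FOb G d))"
      by (simp add: cat_assoc triangle_G cat_idl cat_idr G\<delta>)
  qed (simp_all add: cat_cmp[where b=d] cat_ide)
  show ?thesis using 1 2 G\<delta> unfolding iso_in_def by (intro exI[of _ \<delta>]) simp
qed

end

text \<open>Naturality is split by variable, since this is how it gets verified; the joint law
  follows by applying the two in turn.\<close>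

locale hom_bijection =
  fixes C :: "('o1, 'm1) cat" and D :: "('o2, 'm2) cat" and F G \<phi>
  assumes F: "is_functor C D F" and G: "is_functor D C G"
    and bij: "c \<in> Obj C \<Longrightarrow> d \<in> Obj D \<Longrightarrow> bij_betw (\<phi> c d) (Hom D (FOb F c) d) (Hom C c (FOb G d))"
    and nat_left: "c \<in> Obj C \<Longrightarrow> c' \<in> Obj C \<Longrightarrow> d \<in> Obj D \<Longrightarrow> f \<in> Hom C c' c
      \<Longrightarrow> g \<in> Hom D (FOb F c) d \<Longrightarrow>
      \<phi> c' d (Cmp D (FOb F c') (FOb F c) d g (FHom F c' c f)) = Cmp C c' c (FOb G d) (\<phi> c d g) f"
    and nat_right: "c \<in> Obj C \<Longrightarrow> d \<in> Obj D \<Longrightarrow> d' \<in> Obj D \<Longrightarrow> g \<in> Hom D (FOb F c) d \<Longrightarrow> h \<in> Hom D d d' \<Longrightarrow>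
      \<phi> c d' (Cmp D (FOb F c) d d' h g) = Cmp C c (FOb G d) (FOb G d') (FHom G d d' h) (\<phi> c d g)"
begin

lemma hom: "c \<in> Obj C \<Longrightarrow> d \<in> Obj D \<Longrightarrow> g \<in> Hom D (FOb F c) d \<Longrightarrow> \<phi> c d g \<in> Hom C c (FOb G d)"
  using bij bij_betwE by blast

lemma adjunction: "adjunction C D F G"
  unfolding adjunction_def
proof (intro conjI F G exI[of _ \<phi>] ballI bij)
  fix c c' d d' f g h
  assume *: "c \<in> Obj C" "c' \<in> Obj C" "d \<in> Obj D" "d' \<in> Obj D" "f \<in> Hom C c' c" "g \<in> Hom D (FOb F c) d" "h \<in> Hom D d d'"
  have "Cmp D (FOb F c') (FOb F c) d g (FHom F c' c f) \<in> Hom D (FOb F c') d"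
    by (rule cat_cmp[OF fun_cat(2)[OF F]]) (use * F in \<open>auto intro: fun_ob fun_hom\<close>)
  then show "\<phi> c' d' (Cmp D (FOb F c') d d' h (Cmp D (FOb F c') (FOb F c) d g (FHom F c' c f))) =
      Cmp C c' (FOb G d) (FOb G d') (FHom G d d' h) (Cmp C c' c (FOb G d) (\<phi> c d g) f)"
    using * by (simp add: nat_left nat_right)
qed

end

lemmas adjunctionI = hom_bijection.adjunction[OF hom_bijection.intro]

lemma (in adj) hom_bijection:
  "hom_bijection C D F G (\<lambda>c d h. Cmp C c (FOb G (FOb F c)) (FOb G d) (FHom G (FOb F c) d h) (\<eta> c))"
proof (rule hom_bijection.intro[OF F G])
  fix c d assume *: "c \<in> Obj C" "d \<in> Obj D"
  show "bij_betw (\<lambda>h. Cmp C c (FOb G (FOb F c)) (FOb G d) (FHom G (FOb F c) d h) (\<eta> c)) (Hom D (FOb F c) d) (Hom C c (FOb G d))"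
    by (rule bij_betw_byWitness[where f' = "\<lambda>f. Cmp D (FOb F c) (FOb F (FOb G d)) d (\<epsilon> d) (FHom F c (FOb G d) f)"])
       (use * transpose_left transpose_right in auto)
qed (simp_all add: adj_simps cat_assoc unit_nat)

lemmas (in adj) adjunction = hom_bijection.adjunction[OF hom_bijection]

lemma adjunction_hom:
  assumes "adjunction C D F G"
  obtains \<phi> where "hom_bijection C D F G \<phi>"
proof -
  obtain \<eta> \<epsilon> where "adj C D F G \<eta> \<epsilon>" using adjE[OF assms] .
  then show thesis by (rule that[OF adj.hom_bijection])
qed

lemma adjunction_functors: "adjunction C D F G \<Longrightarrow> is_functor C D F" "adjunction C D F G \<Longrightarrow> is_functor D C G"
  by (simp_all add: adjunction_def)

lemma adjunction_comp:
  assumes 1: "adjunction C D F G" and 2: "adjunction D E F' G'"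
  shows "adjunction C E (comp_funct F' F) (comp_funct G G')"
proof -
  note fs = adjunction_functors[OF 1] adjunction_functors[OF 2]
  obtain \<phi> where "hom_bijection C D F G \<phi>"
    using adjunction_hom[OF 1] .
  then interpret \<phi>: hom_bijection C D F G \<phi> .
  obtain \<psi> where "hom_bijection D E F' G' \<psi>"
    using adjunction_hom[OF 2] .
  then interpret \<psi>: hom_bijection D E F' G' \<psi> .
  note obs = fun_ob[OF fs(1)] fun_ob[OF fs(2)] fun_ob[OF fs(3)] fun_ob[OF fs(4)]
    fun_hom[OF fs(1)] fun_hom[OF fs(2)] fun_hom[OF fs(3)] fun_hom[OF fs(4)]
  show ?thesis
  proof (rule adjunctionI[where \<phi> = "\<lambda>c d g. \<phi> c (FOb G' d) (\<psi> (FOb F c) d g)"])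
    show "is_functor C E (comp_funct F' F)" "is_functor E C (comp_funct G G')"
      using fs by (auto intro: is_functor_comp)
  next
    fix c d assume "c \<in> Obj C" "d \<in> Obj E"
    then show "bij_betw (\<lambda>g. \<phi> c (FOb G' d) (\<psi> (FOb F c) d g)) (Hom E (FOb (comp_funct F' F) c) d) (Hom C c (FOb (comp_funct G G') d))"
      using bij_betw_trans[OF \<psi>.bij[of "FOb F c" d] \<phi>.bij[of c "FOb G' d"]] by (simp add: obs comp_def)
  next
    fix c c' d f g assume "c \<in> Obj C" "c' \<in> Obj C" "d \<in> Obj E" "f \<in> Hom C c' c" "g \<in> Hom E (FOb (comp_funct F' F) c) d"
    then show "\<phi> c' (FOb G' d) (\<psi> (FOb F c') d (Cmp E (FOb (comp_funct F' F) c') (FOb (comp_funct F' F) c) d g (FHom (comp_funct F' F) c' c f))) =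
      Cmp C c' c (FOb (comp_funct G G') d) (\<phi> c (FOb G' d) (\<psi> (FOb F c) d g)) f"
      by (simp add: obs \<phi>.nat_left \<psi>.nat_left \<psi>.hom)
  qed (simp_all add: obs \<phi>.nat_right \<psi>.nat_right \<psi>.hom)
qed

text \<open>Compose the hom bijection with \<open>\<theta>\<close>. This serves to replace a given
  direct image by the isomorphic nerve of a functor.\<close>

lemma adjunction_transport_right:
  assumes 1: "adjunction C D F G" and G': "is_functor D C G'"
    and \<theta>: "\<And>d. d \<in> Obj D \<Longrightarrow> iso_in C (FOb G d) (FOb G' d) (\<theta> d) (\<theta>' d)"
    and nat: "\<And>d d' h. d \<in> Obj D \<Longrightarrow> d' \<in> Obj D \<Longrightarrow> h \<in> Hom D d d' \<Longrightarrow>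
      Cmp C (FOb G d) (FOb G d') (FOb G' d') (\<theta> d') (FHom G d d' h) =
      Cmp C (FOb G d) (FOb G' d) (FOb G' d') (FHom G' d d' h) (\<theta> d)"
  shows "adjunction C D F G'"
proof -
  note fs = adjunction_functors[OF 1]
  obtain \<phi> where "hom_bijection C D F G \<phi>"
    using adjunction_hom[OF 1] .
  then interpret \<phi>: hom_bijection C D F G \<phi> .
  have th: "\<theta> d \<in> Hom C (FOb G d) (FOb G' d)" "\<theta>' d \<in> Hom C (FOb G' d) (FOb G d)"
    "Cmp C (FOb G d) (FOb G' d) (FOb G d) (\<theta>' d) (\<theta> d) = Ide C (FOb G d)"
    "Cmp C (FOb G' d) (FOb G d) (FOb G' d) (\<theta> d) (\<theta>' d) = Ide C (FOb G' d)" if "d \<in> Obj D" for d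
    using \<theta>[OF that] by (simp_all add: iso_in_def)
  note obs = fun_cat[OF fs(1)] fun_ob[OF fs(1)] fun_ob[OF fs(2)] fun_ob[OF G']
    fun_hom[OF fs(1)] fun_hom[OF fs(2)] fun_hom[OF G'] th \<phi>.hom
  show ?thesis
  proof (rule adjunctionI[where \<phi> = "\<lambda>c d g. Cmp C c (FOb G d) (FOb G' d) (\<theta> d) (\<phi> c d g)"])
    fix c d assume *: "c \<in> Obj C" "d \<in> Obj D"
    have "bij_betw (Cmp C c (FOb G d) (FOb G' d) (\<theta> d)) (Hom C c (FOb G d)) (Hom C c (FOb G' d))"
    proof (rule bij_betw_byWitness[where f' = "Cmp C c (FOb G' d) (FOb G d) (\<theta>' d)"])
      show "\<forall>a\<in>Hom C c (FOb G d). Cmp C c (FOb G' d) (FOb G d) (\<theta>' d) (Cmp C c (FOb G d) (FOb G' d) (\<theta> d) a) = a"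
        using * by (auto simp: obs cat_idl cat_assoc[symmetric])
      show "\<forall>a\<in>Hom C c (FOb G' d). Cmp C c (FOb G d) (FOb G' d) (\<theta> d) (Cmp C c (FOb G' d) (FOb G d) (\<theta>' d) a) = a"
        using * by (auto simp: obs cat_idl cat_assoc[symmetric])
      show "Cmp C c (FOb G d) (FOb G' d) (\<theta> d) ` Hom C c (FOb G d) \<subseteq> Hom C c (FOb G' d)"
        "Cmp C c (FOb G' d) (FOb G d) (\<theta>' d) ` Hom C c (FOb G' d) \<subseteq> Hom C c (FOb G d)"
        using * by (auto intro!: cat_cmp simp: obs)
    qed
    then show "bij_betw (\<lambda>g. Cmp C c (FOb G d) (FOb G' d) (\<theta> d) (\<phi> c d g)) (Hom D (FOb F c) d) (Hom C c (FOb G' d))"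
      using bij_betw_trans[OF \<phi>.bij[OF *]] by (simp add: comp_def)
  next
    fix c c' d f g assume "c \<in> Obj C" "c' \<in> Obj C" "d \<in> Obj D" "f \<in> Hom C c' c" "g \<in> Hom D (FOb F c) d"
    then show "Cmp C c' (FOb G d) (FOb G' d) (\<theta> d) (\<phi> c' d (Cmp D (FOb F c') (FOb F c) d g (FHom F c' c f))) =
       Cmp C c' c (FOb G' d) (Cmp C c (FOb G d) (FOb G' d) (\<theta> d) (\<phi> c d g)) f"
      by (simp add: \<phi>.nat_left obs cat_assoc)
  next
    fix c d d' g h assume *: "c \<in> Obj C" "d \<in> Obj D" "d' \<in> Obj D" "g \<in> Hom D (FOb F c) d" "h \<in> Hom D d d'"
    then show "Cmp C c (FOb G d') (FOb G' d') (\<theta> d') (\<phi> c d' (Cmp D (FOb F c) d d' h g)) =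
       Cmp C c (FOb G' d) (FOb G' d') (FHom G' d d' h) (Cmp C c (FOb G d) (FOb G' d) (\<theta> d) (\<phi> c d g))"
      using nat[OF *(2,3,5)] by (simp add: \<phi>.nat_right obs cat_assoc[symmetric])
  qed (use fs G' in auto)
qed

text \<open>Objects are chosen from universal arrows, and the action on morphisms is then forced by
  uniqueness. Kan extensions can thus be described one object at a time, with no functoriality to
  check.\<close>

lemma left_adjoint_exists:
  fixes C :: "('o1, 'm1) cat" and D :: "('o2, 'm2) cat"
  assumes G: "is_functor D C G"
    and univ: "\<And>c. c \<in> Obj C \<Longrightarrow> \<exists>x\<in>Obj D. \<exists>u\<in>Hom C c (FOb G x). \<forall>d\<in>Obj D. \<forall>f\<in>Hom C c (FOb G d).
        \<exists>!h. h \<in> Hom D x d \<and> Cmp C c (FOb G x) (FOb G d) (FHom G x d h) u = f"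
  shows "\<exists>F. adjunction C D F G"
proof -
  obtain X where X: "\<And>c. c \<in> Obj C \<Longrightarrow> X c \<in> Obj D \<and> (\<exists>u\<in>Hom C c (FOb G (X c)). \<forall>d\<in>Obj D. \<forall>f\<in>Hom C c (FOb G d).
        \<exists>!h. h \<in> Hom D (X c) d \<and> Cmp C c (FOb G (X c)) (FOb G d) (FHom G (X c) d h) u = f)"
    using univ by metis
  then obtain u where Xo: "\<And>c. c \<in> Obj C \<Longrightarrow> X c \<in> Obj D"
    and u: "\<And>c. c \<in> Obj C \<Longrightarrow> u c \<in> Hom C c (FOb G (X c))"
    and un: "\<And>c d f. c \<in> Obj C \<Longrightarrow> d \<in> Obj D \<Longrightarrow> f \<in> Hom C c (FOb G d) \<Longrightarrow>
        \<exists>!h. h \<in> Hom D (X c) d \<and> Cmp C c (FOb G (X c)) (FOb G d) (FHom G (X c) d h) (u c) = f"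
    by metis
  have C: "category C" and D: "category D" using fun_cat[OF G] by auto
  define tr where "tr = (\<lambda>c d f. THE h. h \<in> Hom D (X c) d \<and> Cmp C c (FOb G (X c)) (FOb G d) (FHom G (X c) d h) (u c) = f)"
  have tr: "tr c d f \<in> Hom D (X c) d" "Cmp C c (FOb G (X c)) (FOb G d) (FHom G (X c) d (tr c d f)) (u c) = f"
    if "c \<in> Obj C" "d \<in> Obj D" "f \<in> Hom C c (FOb G d)" for c d f
    using theI'[OF un[OF that]] unfolding tr_def by auto
  have treq: "h = h'" if "c \<in> Obj C" "d \<in> Obj D" "h \<in> Hom D (X c) d" "h' \<in> Hom D (X c) d"
      "Cmp C c (FOb G (X c)) (FOb G d) (FHom G (X c) d h) (u c) = Cmp C c (FOb G (X c)) (FOb G d) (FHom G (X c) d h') (u c)"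
    for c d h h'
  proof -
    have "Cmp C c (FOb G (X c)) (FOb G d) (FHom G (X c) d h') (u c) \<in> Hom C c (FOb G d)"
      using that by (intro cat_cmp[OF C] fun_ob[OF G] fun_hom[OF G] Xo u)
    from un[OF that(1,2) this] show ?thesis using that by blast
  qed
  define F where "F = \<lparr>FOb = X, FHom = (\<lambda>a b f. tr a (X b) (Cmp C a b (FOb G (X b)) (u b) f))\<rparr>"
  note [simp] = C D Xo u fun_ob[OF G] fun_hom[OF G] fun_ide[OF G] fun_cmp[OF G]
  have uf: "Cmp C a b (FOb G (X b)) (u b) f \<in> Hom C a (FOb G (X b))" if "a \<in> Obj C" "b \<in> Obj C" "f \<in> Hom C a b" for a b f
    using that by (intro cat_cmp[OF C]) auto
  have Fh: "FHom F a b f \<in> Hom D (X a) (X b)"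
    "Cmp C a (FOb G (X a)) (FOb G (X b)) (FHom G (X a) (X b) (FHom F a b f)) (u a) = Cmp C a b (FOb G (X b)) (u b) f"
    if "a \<in> Obj C" "b \<in> Obj C" "f \<in> Hom C a b" for a b f
    using tr[OF that(1) Xo[OF that(2)] uf[OF that]] by (simp_all add: F_def)
  have F: "is_functor C D F"
    unfolding is_functor_def
  proof (intro conjI ballI C D)
    show "FOb F a \<in> Obj D" if "a \<in> Obj C" for a using that by (simp add: F_def)
    show "FHom F a b f \<in> Hom D (FOb F a) (FOb F b)" if "a \<in> Obj C" "b \<in> Obj C" "f \<in> Hom C a b" for a b f
      using Fh[OF that] by (simp add: F_def)
  next
    fix a assume a: "a \<in> Obj C"
    have "FHom F a a (Ide C a) = Ide D (X a)"
      by (rule treq[of a "X a"]) (use a in \<open>simp_all add: Fh cat_ide cat_idl cat_idr\<close>)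
    then show "FHom F a a (Ide C a) = Ide D (FOb F a)" by (simp add: F_def)
  next
    fix a b c f g assume *: "a \<in> Obj C" "b \<in> Obj C" "c \<in> Obj C" "f \<in> Hom C a b" "g \<in> Hom C b c"
    have "FHom F a c (Cmp C a b c g f) = Cmp D (X a) (X b) (X c) (FHom F b c g) (FHom F a b f)"
    proof (rule treq[of a "X c"])
      have "Cmp C a (FOb G (X a)) (FOb G (X c)) (FHom G (X a) (X c) (Cmp D (X a) (X b) (X c) (FHom F b c g) (FHom F a b f))) (u a)
        = Cmp C a (FOb G (X b)) (FOb G (X c)) (FHom G (X b) (X c) (FHom F b c g)) (Cmp C a b (FOb G (X b)) (u b) f)"
        using * by (simp add: Fh cat_assoc)
      also have "\<dots> = Cmp C a c (FOb G (X c)) (u c) (Cmp C a b c g f)"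
        using * by (simp add: Fh cat_assoc[symmetric])
      finally show "Cmp C a (FOb G (X a)) (FOb G (X c)) (FHom G (X a) (X c) (FHom F a c (Cmp C a b c g f))) (u a) =
        Cmp C a (FOb G (X a)) (FOb G (X c)) (FHom G (X a) (X c) (Cmp D (X a) (X b) (X c) (FHom F b c g) (FHom F a b f))) (u a)"
        using * by (simp add: Fh cat_cmp[where b=b])
    qed (use * in \<open>auto simp: cat_cmp[where b=b] Fh intro: cat_cmp\<close>)
    then show "FHom F a c (Cmp C a b c g f) = Cmp D (FOb F a) (FOb F b) (FOb F c) (FHom F b c g) (FHom F a b f)"
      by (simp add: F_def)
  qed
  have FO: "FOb F c = X c" for c by (simp add: F_def)
  have "adjunction C D F G"
  proof (rule adjunctionI[OF F G, where \<phi> = "\<lambda>c d h. Cmp C c (FOb G (X c)) (FOb G d) (FHom G (X c) d h) (u c)"])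
    fix c d assume *: "c \<in> Obj C" "d \<in> Obj D"
    show "bij_betw (\<lambda>h. Cmp C c (FOb G (X c)) (FOb G d) (FHom G (X c) d h) (u c)) (Hom D (FOb F c) d) (Hom C c (FOb G d))"
      unfolding FO
    proof (rule bij_betw_imageI)
      show "inj_on (\<lambda>h. Cmp C c (FOb G (X c)) (FOb G d) (FHom G (X c) d h) (u c)) (Hom D (X c) d)"
        by (rule inj_onI) (use * treq in blast)
      show "(\<lambda>h. Cmp C c (FOb G (X c)) (FOb G d) (FHom G (X c) d h) (u c)) ` Hom D (X c) d = Hom C c (FOb G d)"
      proof
        show "Hom C c (FOb G d) \<subseteq> (\<lambda>h. Cmp C c (FOb G (X c)) (FOb G d) (FHom G (X c) d h) (u c)) ` Hom D (X c) d"
          using tr[OF *] by (metis (no_types, lifting) image_eqI subsetI)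
      qed (use * in \<open>auto intro!: cat_cmp\<close>)
    qed
  qed (simp_all add: FO Fh cat_assoc)
  then show ?thesis by blast
qed

section \<open>Duality, and right adjoints from couniversal arrows\<close>

lemma op_op_cat [simp]: "op_cat (op_cat C) = C"
  by (simp add: op_cat_def)

lemma category_op_iff [simp]: "category (op_cat C) \<longleftrightarrow> category C"
  using category_op[of C] category_op[of "op_cat C"] by auto

definition op_funct :: "('o1, 'm1, 'o2, 'm2) funct \<Rightarrow> ('o1, 'm1, 'o2, 'm2) funct" where
  "op_funct F = \<lparr>FOb = FOb F, FHom = (\<lambda>a b. FHom F b a)\<rparr>"

lemma op_funct_simps [simp]: "FOb (op_funct F) a = FOb F a" "FHom (op_funct F) a b = FHom F b a"
  "op_funct (op_funct F) = F"
  by (simp_all add: op_funct_def)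

lemma is_functor_op: "is_functor (op_cat C) (op_cat D) (op_funct F) \<longleftrightarrow> is_functor C D F"
  unfolding is_functor_def by auto

text \<open>Reversing arrows exchanges the two hom-sets of the bijection, so \<open>\<phi>\<close>
  has to be inverted; naturality of the inverse is verified by applying \<open>\<phi>\<close> to the
  claimed value.\<close>

lemma adjunction_op:
  assumes "adjunction (op_cat D) (op_cat C) (op_funct G) (op_funct F)"
  shows "adjunction C D F G"
proof -
  note fs = adjunction_functors[OF assms, unfolded is_functor_op]
  obtain \<phi> where \<phi>: "\<forall>d\<in>Obj D. \<forall>c\<in>Obj C. bij_betw (\<phi> d c) (Hom C c (FOb G d)) (Hom D (FOb F c) d)"
    and nat: "\<forall>d\<in>Obj D. \<forall>d'\<in>Obj D. \<forall>c\<in>Obj C. \<forall>c'\<in>Obj C.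
        \<forall>h\<in>Hom D d d'. \<forall>f\<in>Hom C c (FOb G d). \<forall>k\<in>Hom C c' c.
        \<phi> d' c' (Cmp C c' c (FOb G d') (Cmp C c (FOb G d) (FOb G d') (FHom G d d' h) f) k) =
        Cmp D (FOb F c') (FOb F c) d' (Cmp D (FOb F c) d d' h (\<phi> d c f)) (FHom F c' c k)"
    using assms unfolding adjunction_def op_cat_simps op_funct_simps by blast
  define \<psi> where "\<psi> = (\<lambda>c d. inv_into (Hom C c (FOb G d)) (\<phi> d c))"
  have \<psi>: "bij_betw (\<psi> c d) (Hom D (FOb F c) d) (Hom C c (FOb G d))" if "c \<in> Obj C" "d \<in> Obj D" for c d
    using \<phi> that unfolding \<psi>_def by (simp add: bij_betw_inv_into)
  have \<psi>h: "\<psi> c d g \<in> Hom C c (FOb G d)" and \<phi>\<psi>: "\<phi> d c (\<psi> c d g) = g"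
    if "c \<in> Obj C" "d \<in> Obj D" "g \<in> Hom D (FOb F c) d" for c d g
    using \<psi>[OF that(1,2)] \<phi> that unfolding \<psi>_def by (auto dest: bij_betwE intro: bij_betw_inv_into_right)
  have \<psi>\<phi>: "\<psi> c d (\<phi> d c f) = f" if "c \<in> Obj C" "d \<in> Obj D" "f \<in> Hom C c (FOb G d)" for c d f
    using \<phi> that unfolding \<psi>_def by (metis bij_betw_inv_into_left)
  show ?thesis
    unfolding adjunction_def
  proof (intro conjI fs exI[of _ \<psi>] ballI \<psi>)
    fix c c' d d' f g h
    assume *: "c \<in> Obj C" "c' \<in> Obj C" "d \<in> Obj D" "d' \<in> Obj D" "f \<in> Hom C c' c" "g \<in> Hom D (FOb F c) d" "h \<in> Hom D d d'"
    note [simp] = fun_cat[OF fs(1)] fun_ob[OF fs(1)] fun_ob[OF fs(2)] fun_hom[OF fs(1)] fun_hom[OF fs(2)]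
    let ?k = "Cmp C c' (FOb G d) (FOb G d') (FHom G d d' h) (Cmp C c' c (FOb G d) (\<psi> c d g) f)"
    have "?k \<in> Hom C c' (FOb G d')"
      using * by (intro cat_cmp[where b="FOb G d"] cat_cmp[where b=c]) (simp_all add: \<psi>h)
    moreover have "\<phi> d' c' ?k = Cmp D (FOb F c') d d' h (Cmp D (FOb F c') (FOb F c) d g (FHom F c' c f))"
      using * nat[rule_format, of d d' c c' h "\<psi> c d g" f] by (simp add: \<psi>h \<phi>\<psi> cat_assoc)
    ultimately show "\<psi> c' d' (Cmp D (FOb F c') d d' h (Cmp D (FOb F c') (FOb F c) d g (FHom F c' c f))) = ?k"
      using \<psi>\<phi>[of c' d' ?k] * by simp
  qed
qed

lemma right_adjoint_exists:
  fixes C :: "('o1, 'm1) cat" and D :: "('o2, 'm2) cat"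
  assumes F: "is_functor C D F"
    and univ: "\<And>d. d \<in> Obj D \<Longrightarrow> \<exists>x\<in>Obj C. \<exists>u\<in>Hom D (FOb F x) d. \<forall>c\<in>Obj C. \<forall>g\<in>Hom D (FOb F c) d.
        \<exists>!f. f \<in> Hom C c x \<and> Cmp D (FOb F c) (FOb F x) d u (FHom F c x f) = g"
  shows "\<exists>G. adjunction C D F G"
proof -
  have "\<exists>G. adjunction (op_cat D) (op_cat C) G (op_funct F)"
    by (rule left_adjoint_exists) (use univ F in \<open>auto simp: is_functor_op\<close>)
  then obtain G where "adjunction (op_cat D) (op_cat C) (op_funct (op_funct G)) (op_funct F)" by auto
  then show ?thesis using adjunction_op by blast
qed


section \<open>Limits\<close>

text \<open>Cones over \<open>G K\<close> with vertex \<open>y\<close> transpose to cones over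
  \<open>K\<close> with vertex \<open>F y\<close>. For \<open>G = L\<close> this yields both the
  finite limits of \<open>E\<close> and the left exactness of the inverse image.\<close>

lemma right_adjoint_preserves_limit:
  assumes adj: "adjunction C D F G" and K: "is_functor J D K" and lim: "is_limit J D K x p"
  shows "is_limit J C (comp_funct G K) (FOb G x) (\<lambda>j. FHom G x (FOb K j) (p j))"
proof -
  obtain \<eta> \<epsilon> where "adj C D F G \<eta> \<epsilon>" using adjE[OF adj] .
  then interpret adj C D F G \<eta> \<epsilon> .
  have x: "x \<in> Obj D" and p: "\<And>j. j \<in> Obj J \<Longrightarrow> p j \<in> Hom D x (FOb K j)"
    and pc: "\<And>j k u. j \<in> Obj J \<Longrightarrow> k \<in> Obj J \<Longrightarrow> u \<in> Hom J j k \<Longrightarrow> Cmp D x (FOb K j) (FOb K k) (FHom K j k u) (p j) = p k"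
    using lim by (auto simp: is_limit_def is_cone_def)
  have lu: "\<exists>!h. h \<in> Hom D y x \<and> (\<forall>j\<in>Obj J. Cmp D y x (FOb K j) (p j) h = q j)" if "is_cone J D K y q" for y q
    using lim that by (auto simp: is_limit_def)
  note [simp] = adj_simps fun_ob[OF K] fun_hom[OF K] x p
  show ?thesis
    unfolding is_limit_def
  proof (intro conjI allI impI)
    show "is_cone J C (comp_funct G K) (FOb G x) (\<lambda>j. FHom G x (FOb K j) (p j))"
      unfolding is_cone_def
    proof (intro conjI ballI)
      fix j k u assume *: "j \<in> Obj J" "k \<in> Obj J" "u \<in> Hom J j k"
      then have "FHom G x (FOb K k) (p k) = FHom G x (FOb K k) (Cmp D x (FOb K j) (FOb K k) (FHom K j k u) (p j))"
        by (simp add: pc)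
      also have "\<dots> = Cmp C (FOb G x) (FOb G (FOb K j)) (FOb G (FOb K k)) (FHom G (FOb K j) (FOb K k) (FHom K j k u)) (FHom G x (FOb K j) (p j))"
        using * by simp
      finally show "Cmp C (FOb G x) (FOb (comp_funct G K) j) (FOb (comp_funct G K) k) (FHom (comp_funct G K) j k u) (FHom G x (FOb K j) (p j)) =
         FHom G x (FOb K k) (p k)" by simp
    qed auto
  next
    fix y q assume "is_cone J C (comp_funct G K) y q"
    then have y [simp]: "y \<in> Obj C" and q [simp]: "\<And>j. j \<in> Obj J \<Longrightarrow> q j \<in> Hom C y (FOb G (FOb K j))"
      and qc: "\<And>j k u. j \<in> Obj J \<Longrightarrow> k \<in> Obj J \<Longrightarrow> u \<in> Hom J j k \<Longrightarrow>
        Cmp C y (FOb G (FOb K j)) (FOb G (FOb K k)) (FHom G (FOb K j) (FOb K k) (FHom K j k u)) (q j) = q k"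
      by (auto simp: is_cone_def)
    define q' where "q' = (\<lambda>j. Cmp D (FOb F y) (FOb F (FOb G (FOb K j))) (FOb K j) (\<epsilon> (FOb K j)) (FHom F y (FOb G (FOb K j)) (q j)))"
    have q': "q' j \<in> Hom D (FOb F y) (FOb K j)" if "j \<in> Obj J" for j
      using transpose_left(1)[of y "FOb K j" "q j"] that by (simp add: q'_def)
    have q'G: "Cmp C y (FOb G (FOb F y)) (FOb G (FOb K j)) (FHom G (FOb F y) (FOb K j) (q' j)) (\<eta> y) = q j" if "j \<in> Obj J" for j
      using transpose_left(2)[of y "FOb K j" "q j"] that by (simp add: q'_def)
    have "is_cone J D K (FOb F y) q'"
      unfolding is_cone_def
    proof (intro conjI ballI)
      fix j k u assume *: "j \<in> Obj J" "k \<in> Obj J" "u \<in> Hom J j k"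
      show "Cmp D (FOb F y) (FOb K j) (FOb K k) (FHom K j k u) (q' j) = q' k"
      proof (rule left_eqI[of y])
        have "Cmp C y (FOb G (FOb F y)) (FOb G (FOb K k)) (FHom G (FOb F y) (FOb K k) (Cmp D (FOb F y) (FOb K j) (FOb K k) (FHom K j k u) (q' j))) (\<eta> y)
          = Cmp C y (FOb G (FOb K j)) (FOb G (FOb K k)) (FHom G (FOb K j) (FOb K k) (FHom K j k u))
             (Cmp C y (FOb G (FOb F y)) (FOb G (FOb K j)) (FHom G (FOb F y) (FOb K j) (q' j)) (\<eta> y))"
          using * by (simp add: q' cat_assoc)
        then show "Cmp C y (FOb G (FOb F y)) (FOb G (FOb K k)) (FHom G (FOb F y) (FOb K k) (Cmp D (FOb F y) (FOb K j) (FOb K k) (FHom K j k u) (q' j))) (\<eta> y)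
          = Cmp C y (FOb G (FOb F y)) (FOb G (FOb K k)) (FHom G (FOb F y) (FOb K k) (q' k)) (\<eta> y)"
          using * by (simp add: q'G qc)
      qed (use * q' in \<open>auto intro: cat_cmp\<close>)
    qed (use q' in auto)
    from lu[OF this] obtain h where h [simp]: "h \<in> Hom D (FOb F y) x"
      and hq: "\<And>j. j \<in> Obj J \<Longrightarrow> Cmp D (FOb F y) x (FOb K j) (p j) h = q' j"
      and hu: "\<And>h'. h' \<in> Hom D (FOb F y) x \<Longrightarrow> (\<And>j. j \<in> Obj J \<Longrightarrow> Cmp D (FOb F y) x (FOb K j) (p j) h' = q' j) \<Longrightarrow> h' = h"
      by metis
    let ?f = "Cmp C y (FOb G (FOb F y)) (FOb G x) (FHom G (FOb F y) x h) (\<eta> y)"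
    show "\<exists>!f. f \<in> Hom C y (FOb G x) \<and>
        (\<forall>j\<in>Obj J. Cmp C y (FOb G x) (FOb (comp_funct G K) j) (FHom G x (FOb K j) (p j)) f = q j)"
    proof (rule ex1I[of _ ?f])
      have "Cmp C y (FOb G x) (FOb G (FOb K j)) (FHom G x (FOb K j) (p j)) ?f = q j" if j: "j \<in> Obj J" for j
      proof -
        have "Cmp C y (FOb G x) (FOb G (FOb K j)) (FHom G x (FOb K j) (p j)) ?f =
          Cmp C y (FOb G (FOb F y)) (FOb G (FOb K j)) (FHom G (FOb F y) (FOb K j) (Cmp D (FOb F y) x (FOb K j) (p j) h)) (\<eta> y)"
          using j by (simp add: cat_assoc)
        then show ?thesis using j by (simp only: hq q'G)
      qed
      then show "?f \<in> Hom C y (FOb G x) \<and>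
        (\<forall>j\<in>Obj J. Cmp C y (FOb G x) (FOb (comp_funct G K) j) (FHom G x (FOb K j) (p j)) ?f = q j)"
        using transpose_right(1)[of y x h] by simp
    next
      fix f assume f: "f \<in> Hom C y (FOb G x) \<and>
        (\<forall>j\<in>Obj J. Cmp C y (FOb G x) (FOb (comp_funct G K) j) (FHom G x (FOb K j) (p j)) f = q j)"
      then have f1 [simp]: "f \<in> Hom C y (FOb G x)" and f2: "\<And>j. j \<in> Obj J \<Longrightarrow> Cmp C y (FOb G x) (FOb G (FOb K j)) (FHom G x (FOb K j) (p j)) f = q j"
        by auto
      let ?h = "Cmp D (FOb F y) (FOb F (FOb G x)) x (\<epsilon> x) (FHom F y (FOb G x) f)"
      have "?h = h"
      proof (rule hu)
        show "?h \<in> Hom D (FOb F y) x" using transpose_left(1)[of y x f] by simp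
        fix j assume j: "j \<in> Obj J"
        have "Cmp D (FOb F y) x (FOb K j) (p j) ?h =
          Cmp D (FOb F y) (FOb F (FOb G x)) (FOb K j) (Cmp D (FOb F (FOb G x)) x (FOb K j) (p j) (\<epsilon> x)) (FHom F y (FOb G x) f)"
          using j by (simp add: cat_assoc)
        also have "\<dots> = Cmp D (FOb F y) (FOb F (FOb G (FOb K j))) (FOb K j) (\<epsilon> (FOb K j))
            (FHom F y (FOb G (FOb K j)) (Cmp C y (FOb G x) (FOb G (FOb K j)) (FHom G x (FOb K j) (p j)) f))"
          using j by (simp add: counit_nat[symmetric] cat_assoc)
        finally show "Cmp D (FOb F y) x (FOb K j) (p j) ?h = q' j" using j by (simp add: f2 q'_def)
      qed
      then show "f = ?f" using transpose_left(2)[of y x f] by simp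
    qed
  qed
qed

text \<open>\<open>L N K\<close> agrees with \<open>K\<close> only up to the counit, so a limit
  obtained for the former still has to be moved to the latter.\<close>

lemma limit_transport:
  assumes K: "is_functor J C K" and K': "is_functor J C K'" and lim: "is_limit J C K x p"
    and \<theta>: "\<And>j. j \<in> Obj J \<Longrightarrow> iso_in C (FOb K j) (FOb K' j) (\<theta> j) (\<theta>' j)"
    and nat: "\<And>j k u. j \<in> Obj J \<Longrightarrow> k \<in> Obj J \<Longrightarrow> u \<in> Hom J j k \<Longrightarrow>
       Cmp C (FOb K j) (FOb K k) (FOb K' k) (\<theta> k) (FHom K j k u) = Cmp C (FOb K j) (FOb K' j) (FOb K' k) (FHom K' j k u) (\<theta> j)"
  shows "is_limit J C K' x (\<lambda>j. Cmp C x (FOb K j) (FOb K' j) (\<theta> j) (p j))"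
proof -
  have x: "x \<in> Obj C" and p: "\<And>j. j \<in> Obj J \<Longrightarrow> p j \<in> Hom C x (FOb K j)"
    and pc: "\<And>j k u. j \<in> Obj J \<Longrightarrow> k \<in> Obj J \<Longrightarrow> u \<in> Hom J j k \<Longrightarrow> Cmp C x (FOb K j) (FOb K k) (FHom K j k u) (p j) = p k"
    using lim by (auto simp: is_limit_def is_cone_def)
  have lu: "\<exists>!h. h \<in> Hom C y x \<and> (\<forall>j\<in>Obj J. Cmp C y x (FOb K j) (p j) h = q j)" if "is_cone J C K y q" for y q
    using lim that by (auto simp: is_limit_def)
  have th: "\<theta> j \<in> Hom C (FOb K j) (FOb K' j)" "\<theta>' j \<in> Hom C (FOb K' j) (FOb K j)"
    "Cmp C (FOb K j) (FOb K' j) (FOb K j) (\<theta>' j) (\<theta> j) = Ide C (FOb K j)"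
    "Cmp C (FOb K' j) (FOb K j) (FOb K' j) (\<theta> j) (\<theta>' j) = Ide C (FOb K' j)" if "j \<in> Obj J" for j
    using \<theta>[OF that] by (simp_all add: iso_in_def)
  note [simp] = fun_cat(2)[OF K] fun_ob[OF K] fun_hom[OF K] fun_ob[OF K'] fun_hom[OF K'] x p th cat_idl
  have c1: "Cmp C y (FOb K' j) (FOb K j) (\<theta>' j) (Cmp C y (FOb K j) (FOb K' j) (\<theta> j) r) = r"
    if "j \<in> Obj J" "y \<in> Obj C" "r \<in> Hom C y (FOb K j)" for j y r
    using that by (simp add: cat_assoc[symmetric])
  have c2: "Cmp C y (FOb K j) (FOb K' j) (\<theta> j) (Cmp C y (FOb K' j) (FOb K j) (\<theta>' j) r) = r"
    if "j \<in> Obj J" "y \<in> Obj C" "r \<in> Hom C y (FOb K' j)" for j y r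
    using that by (simp add: cat_assoc[symmetric])
  show ?thesis
    unfolding is_limit_def
  proof (intro conjI allI impI)
    show "is_cone J C K' x (\<lambda>j. Cmp C x (FOb K j) (FOb K' j) (\<theta> j) (p j))"
      unfolding is_cone_def
    proof (intro conjI ballI)
      fix j k u assume *: "j \<in> Obj J" "k \<in> Obj J" "u \<in> Hom J j k"
      have "Cmp C x (FOb K' j) (FOb K' k) (FHom K' j k u) (Cmp C x (FOb K j) (FOb K' j) (\<theta> j) (p j)) =
         Cmp C x (FOb K j) (FOb K' k) (Cmp C (FOb K j) (FOb K' j) (FOb K' k) (FHom K' j k u) (\<theta> j)) (p j)"
        using * by (simp add: cat_assoc)
      also have "\<dots> = Cmp C x (FOb K k) (FOb K' k) (\<theta> k) (p k)"
        using * pc[OF *] by (simp add: nat[symmetric] cat_assoc)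
      finally show "Cmp C x (FOb K' j) (FOb K' k) (FHom K' j k u) (Cmp C x (FOb K j) (FOb K' j) (\<theta> j) (p j)) =
         Cmp C x (FOb K k) (FOb K' k) (\<theta> k) (p k)" .
    qed (auto intro!: cat_cmp)
  next
    fix y q assume "is_cone J C K' y q"
    then have y [simp]: "y \<in> Obj C" and q [simp]: "\<And>j. j \<in> Obj J \<Longrightarrow> q j \<in> Hom C y (FOb K' j)"
      and qc: "\<And>j k u. j \<in> Obj J \<Longrightarrow> k \<in> Obj J \<Longrightarrow> u \<in> Hom J j k \<Longrightarrow> Cmp C y (FOb K' j) (FOb K' k) (FHom K' j k u) (q j) = q k"
      by (auto simp: is_cone_def)
    define q' where "q' = (\<lambda>j. Cmp C y (FOb K' j) (FOb K j) (\<theta>' j) (q j))"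
    have q' [simp]: "q' j \<in> Hom C y (FOb K j)" if "j \<in> Obj J" for j
      using that unfolding q'_def by (intro cat_cmp) simp_all
    have q'q: "Cmp C y (FOb K j) (FOb K' j) (\<theta> j) (q' j) = q j" if "j \<in> Obj J" for j
      using that by (simp add: q'_def c2)
    have "is_cone J C K y q'"
      unfolding is_cone_def
    proof (intro conjI ballI)
      fix j k u assume *: "j \<in> Obj J" "k \<in> Obj J" "u \<in> Hom J j k"
      have "Cmp C y (FOb K k) (FOb K' k) (\<theta> k) (Cmp C y (FOb K j) (FOb K k) (FHom K j k u) (q' j)) =
        Cmp C y (FOb K' j) (FOb K' k) (FHom K' j k u) (Cmp C y (FOb K j) (FOb K' j) (\<theta> j) (q' j))"
        using * nat[OF *] by (simp add: cat_assoc[symmetric])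
      also have "\<dots> = q k" using * by (simp add: q'q qc)
      finally have "Cmp C y (FOb K' k) (FOb K k) (\<theta>' k) (Cmp C y (FOb K k) (FOb K' k) (\<theta> k) (Cmp C y (FOb K j) (FOb K k) (FHom K j k u) (q' j))) = q' k"
        by (simp add: q'_def)
      moreover have "Cmp C y (FOb K j) (FOb K k) (FHom K j k u) (q' j) \<in> Hom C y (FOb K k)"
        using * by (intro cat_cmp) simp_all
      ultimately show "Cmp C y (FOb K j) (FOb K k) (FHom K j k u) (q' j) = q' k"
        using * by (simp add: c1)
    qed simp_all
    note u = lu[OF this]
    have eq: "(\<forall>j\<in>Obj J. Cmp C y x (FOb K' j) (Cmp C x (FOb K j) (FOb K' j) (\<theta> j) (p j)) h = q j) \<longleftrightarrow>
       (\<forall>j\<in>Obj J. Cmp C y x (FOb K j) (p j) h = q' j)" if h [simp]: "h \<in> Hom C y x" for h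
    proof (rule ball_cong[OF refl])
      fix j assume j: "j \<in> Obj J"
      have ph: "Cmp C y x (FOb K j) (p j) h \<in> Hom C y (FOb K j)" using j by (intro cat_cmp) simp_all
      have "Cmp C y x (FOb K' j) (Cmp C x (FOb K j) (FOb K' j) (\<theta> j) (p j)) h =
         Cmp C y (FOb K j) (FOb K' j) (\<theta> j) (Cmp C y x (FOb K j) (p j) h)"
        using j by (simp add: cat_assoc)
      then show "(Cmp C y x (FOb K' j) (Cmp C x (FOb K j) (FOb K' j) (\<theta> j) (p j)) h = q j) =
         (Cmp C y x (FOb K j) (p j) h = q' j)"
        using j c1[OF j y ph] c2[OF j y q[OF j]] by (auto simp: q'_def)
    qed
    show "\<exists>!h. h \<in> Hom C y x \<and> (\<forall>j\<in>Obj J. Cmp C y x (FOb K' j) (Cmp C x (FOb K j) (FOb K' j) (\<theta> j) (p j)) h = q j)"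
      using u eq by (metis (no_types, lifting))
  qed
qed

text \<open>The limit of \<open>K\<close> is \<open>L\<close> of the limit of \<open>N K\<close>:
  the left adjoint \<open>l\<close> makes \<open>L\<close> preserve it, and the counit, invertible
  since \<open>N\<close> is fully faithful, brings it back from \<open>L N K\<close> to
  \<open>K\<close>.\<close>

lemma has_finite_limits_reflective:
  assumes LN: "adjunction F E L N" and ff: "fully_faithful E F N" and lL: "adjunction E F l L"
    and lim: "has_finite_limits F"
  shows "has_finite_limits E"
  unfolding has_finite_limits_def
proof (intro allI impI)
  fix J :: "(nat, nat) cat" and K
  assume J: "finite_category J \<and> is_functor J E K"
  obtain \<eta> \<epsilon> where "adj F E L N \<eta> \<epsilon>" using adjE[OF LN] .
  then interpret adj F E L N \<eta> \<epsilon> .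
  have K: "is_functor J E K" and NK: "is_functor J F (comp_funct N K)"
    and LNK: "is_functor J E (comp_funct L (comp_funct N K))"
    using J F G by (auto intro: is_functor_comp)
  obtain x p where xp: "is_limit J F (comp_funct N K) x p"
    using lim J NK unfolding has_finite_limits_def by blast
  have x: "is_limit J E (comp_funct L (comp_funct N K)) (FOb L x) (\<lambda>j. FHom L x (FOb (comp_funct N K) j) (p j))"
    by (rule right_adjoint_preserves_limit[OF lL NK xp])
  have "\<forall>d\<in>Obj E. \<exists>\<delta>. iso_in E (FOb L (FOb N d)) d (\<epsilon> d) \<delta>"
    using counit_iso[OF ff] unfolding iso_in_def by blast
  then obtain \<delta> where \<delta>: "\<And>d. d \<in> Obj E \<Longrightarrow> iso_in E (FOb L (FOb N d)) d (\<epsilon> d) (\<delta> d)" by metis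
  have "is_limit J E K (FOb L x) (\<lambda>j. Cmp E (FOb L x) (FOb (comp_funct L (comp_funct N K)) j) (FOb K j) (\<epsilon> (FOb K j))
      (FHom L x (FOb (comp_funct N K) j) (p j)))"
    by (rule limit_transport[OF LNK K x, where \<theta>' = "\<lambda>j. \<delta> (FOb K j)"])
       (use fun_ob[OF K] fun_hom[OF K] in \<open>simp_all add: \<delta> counit_nat\<close>)
  then show "\<exists>x p. is_limit J E K x p" by blast
qed

section \<open>Terminal objects and binary products as finite limits\<close>

lemma has_terminal:
  assumes lim: "has_finite_limits C" and C: "category C"
  shows "\<exists>x. is_terminal C x"
proof -
  define J :: "(nat, nat) cat" where
    "J = \<lparr>Obj = {}, Hom = (\<lambda>a b. {}), Ide = (\<lambda>a. 0), Cmp = (\<lambda>a b c g f. 0)\<rparr>"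
  define K where "K = \<lparr>FOb = (\<lambda>j::nat. undefined :: 'a), FHom = (\<lambda>j k (u::nat). undefined :: 'b)\<rparr>"
  have J: "finite_category J" by (simp add: finite_category_def category_def J_def)
  then have "is_functor J C K"
    by (simp add: finite_category_def is_functor_def C) (simp add: J_def)
  with J obtain x p where x: "is_limit J C K x p" using lim unfolding has_finite_limits_def by blast
  have "is_terminal C x"
    using x unfolding is_terminal_def is_limit_def is_cone_def by (simp add: J_def)
  then show ?thesis ..
qed

lemma has_product:
  assumes lim: "has_finite_limits C" and C: "category C" and a: "a \<in> Obj C" and b: "b \<in> Obj C"
  shows "\<exists>p p1 p2. is_product C a b p p1 p2"
proof -
  define J :: "(nat, nat) cat" where
    "J = \<lparr>Obj = {0, 1}, Hom = (\<lambda>a b. if a = b then {0} else {}), Ide = (\<lambda>a. 0), Cmp = (\<lambda>a b c g f. 0)\<rparr>"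
  define K where "K = \<lparr>FOb = (\<lambda>j::nat. if j = 0 then a else b), FHom = (\<lambda>j k (u::nat). if j = 0 then Ide C a else Ide C b)\<rparr>"
  have J: "finite_category J"
    by (auto simp: finite_category_def category_def J_def split: if_splits)
  moreover from J have "is_functor J C K"
    using a b by (simp add: finite_category_def is_functor_def C)
      (auto simp: J_def K_def C cat_ide cat_idl split: if_splits)
  ultimately obtain x p where x: "is_limit J C K x p" using lim unfolding has_finite_limits_def by blast
  have cone: "is_cone J C K y q \<longleftrightarrow> y \<in> Obj C \<and> q 0 \<in> Hom C y a \<and> q 1 \<in> Hom C y b" for y q
    using a b by (auto simp: is_cone_def J_def K_def C cat_idl split: if_splits)
  have "is_product C a b x (p 0) (p 1)"
    unfolding is_product_def
  proof (intro conjI ballI)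
    show "x \<in> Obj C" "p 0 \<in> Hom C x a" "p 1 \<in> Hom C x b" using x cone by (auto simp: is_limit_def)
    fix y q1 q2 assume *: "y \<in> Obj C" "q1 \<in> Hom C y a" "q2 \<in> Hom C y b"
    have "is_cone J C K y (\<lambda>j. if j = 0 then q1 else q2)" using * by (simp add: cone)
    then have "\<exists>!h. h \<in> Hom C y x \<and> (\<forall>j\<in>Obj J. Cmp C y x (FOb K j) (p j) h = (if j = 0 then q1 else q2))"
      using x unfolding is_limit_def by blast
    then show "\<exists>!h. h \<in> Hom C y x \<and> Cmp C y x a (p 0) h = q1 \<and> Cmp C y x b (p 1) h = q2"
      by (simp add: J_def K_def)
  qed
  then show ?thesis by blast
qed

text \<open>\<open>is_product\<close> is not phrased as a limit over a diagram, so preservation is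
  argued directly with the transposition \<open>tr\<close>, a natural bijection from C(y, G d) to
  D(F y, d).\<close>

lemma right_adjoint_preserves_product:
  assumes adj: "adjunction C D F G" and prod: "is_product D a b p p1 p2"
    and a: "a \<in> Obj D" and b: "b \<in> Obj D"
  shows "is_product C (FOb G a) (FOb G b) (FOb G p) (FHom G p a p1) (FHom G p b p2)"
proof -
  obtain \<eta> \<epsilon> where "adj C D F G \<eta> \<epsilon>" using adjE[OF adj] .
  then interpret adj C D F G \<eta> \<epsilon> .
  have p: "p \<in> Obj D" "p1 \<in> Hom D p a" "p2 \<in> Hom D p b"
    and pu: "\<And>y q1 q2. y \<in> Obj D \<Longrightarrow> q1 \<in> Hom D y a \<Longrightarrow> q2 \<in> Hom D y b \<Longrightarrow>
       \<exists>!h. h \<in> Hom D y p \<and> Cmp D y p a p1 h = q1 \<and> Cmp D y p b p2 h = q2"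
    using prod by (auto simp: is_product_def)
  note [simp] = adj_simps a b p
  define tr where "tr = (\<lambda>y d f. Cmp D (FOb F y) (FOb F (FOb G d)) d (\<epsilon> d) (FHom F y (FOb G d) f))"
  have tr [simp]: "tr y d f \<in> Hom D (FOb F y) d" if "y \<in> Obj C" "d \<in> Obj D" "f \<in> Hom C y (FOb G d)" for y d f
    using transpose_left(1)[OF that] by (simp add: tr_def)
  have trn: "Cmp D (FOb F y) d d' h (tr y d f) = tr y d' (Cmp C y (FOb G d) (FOb G d') (FHom G d d' h) f)"
    if "y \<in> Obj C" "d \<in> Obj D" "d' \<in> Obj D" "f \<in> Hom C y (FOb G d)" "h \<in> Hom D d d'" for y d d' f h
  proof -
    have "Cmp D (FOb F y) d d' h (tr y d f) = Cmp D (FOb F y) (FOb F (FOb G d)) d'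
        (Cmp D (FOb F (FOb G d)) d d' h (\<epsilon> d)) (FHom F y (FOb G d) f)"
      using that by (simp add: tr_def cat_assoc)
    then show ?thesis using that by (simp add: tr_def counit_nat[symmetric] cat_assoc)
  qed
  have tri: "f = f'" if "tr y d f = tr y d f'" "y \<in> Obj C" "d \<in> Obj D" "f \<in> Hom C y (FOb G d)" "f' \<in> Hom C y (FOb G d)" for y d f f'
    using right_eqI[of y d f f'] that by (simp add: tr_def)
  have trs: "\<exists>f\<in>Hom C y (FOb G d). tr y d f = h" if "y \<in> Obj C" "d \<in> Obj D" "h \<in> Hom D (FOb F y) d" for y d h
    using transpose_right[OF that] by (auto simp: tr_def)
  show ?thesis
    unfolding is_product_def
  proof (intro conjI ballI)
    fix y q1 q2 assume *: "y \<in> Obj C" "q1 \<in> Hom C y (FOb G a)" "q2 \<in> Hom C y (FOb G b)"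
    note [simp] = *
    from pu[of "FOb F y" "tr y a q1" "tr y b q2"] obtain h where h: "h \<in> Hom D (FOb F y) p"
       "Cmp D (FOb F y) p a p1 h = tr y a q1" "Cmp D (FOb F y) p b p2 h = tr y b q2"
      and hu: "\<And>h'. h' \<in> Hom D (FOb F y) p \<Longrightarrow> Cmp D (FOb F y) p a p1 h' = tr y a q1 \<Longrightarrow>
        Cmp D (FOb F y) p b p2 h' = tr y b q2 \<Longrightarrow> h' = h"
      by (metis "*" a b fun_ob[OF F] tr)
    obtain f where f: "f \<in> Hom C y (FOb G p)" "tr y p f = h" using trs[of y p h] h by auto
    show "\<exists>!h. h \<in> Hom C y (FOb G p) \<and> Cmp C y (FOb G p) (FOb G a) (FHom G p a p1) h = q1 \<and>
      Cmp C y (FOb G p) (FOb G b) (FHom G p b p2) h = q2"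
    proof (rule ex1I[of _ f], intro conjI f(1))
      show "Cmp C y (FOb G p) (FOb G a) (FHom G p a p1) f = q1"
        by (rule tri[of y a]) (use f h(2) trn[of y p a f p1] in \<open>auto intro: cat_cmp\<close>)
      show "Cmp C y (FOb G p) (FOb G b) (FHom G p b p2) f = q2"
        by (rule tri[of y b]) (use f h(3) trn[of y p b f p2] in \<open>auto intro: cat_cmp\<close>)
    next
      fix g assume g: "g \<in> Hom C y (FOb G p) \<and> Cmp C y (FOb G p) (FOb G a) (FHom G p a p1) g = q1 \<and>
        Cmp C y (FOb G p) (FOb G b) (FHom G p b p2) g = q2"
      then have "tr y p g = h" by (intro hu) (simp_all add: trn)
      then show "g = f" using tri[of y p g f] f g by auto
    qed
  qed simp_all
qed

text \<open>\<open>Q\<close> is a copy of the raw data \<open>A\<close>, \<open>act\<close> along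
  mutually inverse equivariant maps \<open>e\<close> and \<open>d\<close>. Arguments about a coded
  presheaf then rest on these laws alone and not on how \<open>Q\<close> was encoded.\<close>

locale coding =
  fixes C :: "('o, 'm) cat" and A :: "'o \<Rightarrow> 't set" and act :: "'o \<Rightarrow> 'o \<Rightarrow> 'm \<Rightarrow> 't \<Rightarrow> 't"
    and Q :: "('o, 'm, 's) presheaf" and e :: "'o \<Rightarrow> 't \<Rightarrow> 's" and d :: "'o \<Rightarrow> 's \<Rightarrow> 't"
  assumes e_in: "a \<in> Obj C \<Longrightarrow> x \<in> A a \<Longrightarrow> e a x \<in> FOb Q a"
    and d_e: "a \<in> Obj C \<Longrightarrow> x \<in> A a \<Longrightarrow> d a (e a x) = x"
    and d_in: "a \<in> Obj C \<Longrightarrow> y \<in> FOb Q a \<Longrightarrow> d a y \<in> A a"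
    and e_d: "a \<in> Obj C \<Longrightarrow> y \<in> FOb Q a \<Longrightarrow> e a (d a y) = y"
    and act_e: "a \<in> Obj C \<Longrightarrow> b \<in> Obj C \<Longrightarrow> f \<in> Hom C b a \<Longrightarrow> x \<in> A a \<Longrightarrow>
      FHom Q a b f (e a x) = e b (act a b f x)"
    and act_d: "a \<in> Obj C \<Longrightarrow> b \<in> Obj C \<Longrightarrow> f \<in> Hom C b a \<Longrightarrow> y \<in> FOb Q a \<Longrightarrow>
      d b (FHom Q a b f y) = act a b f (d a y)"

lemma coding_psh_of:
  fixes U :: "'u itself" and C :: "('o, 'm) cat" and j :: "'u \<Rightarrow> 's"
  assumes j: "inj j" and s: "\<And>a. a \<in> Obj C \<Longrightarrow> small U (A a)" and A: "psh_data C A act"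
  shows "coding C A act (psh_of j C A act) (\<lambda>a. cod j (A a)) (\<lambda>a. dec j (A a))"
proof
  fix a assume a: "a \<in> Obj C"
  show "cod j (A a) x \<in> FOb (psh_of j C A act) a" "dec j (A a) (cod j (A a) x) = x" if "x \<in> A a" for x
    using a that dec_cod[OF s j] by (auto simp: psh_of_ob)
  have y: "dec j (A a) y \<in> A a" "cod j (A a) (dec j (A a) y) = y" if "y \<in> FOb (psh_of j C A act) a" for y
    using that by (auto simp: psh_of_ob[OF a] intro: dec_in cod_dec)
  then show "dec j (A a) y \<in> A a" "cod j (A a) (dec j (A a) y) = y" if "y \<in> FOb (psh_of j C A act) a" for y
    using that by auto
  fix b f assume b: "b \<in> Obj C" "f \<in> Hom C b a"
  show act: "FHom (psh_of j C A act) a b f (cod j (A a) x) = cod j (A b) (act a b f x)" if "x \<in> A a" for x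
    by (rule psh_of_act[where A=A, OF s[OF a] j a b that])
  show "dec j (A b) (FHom (psh_of j C A act) a b f y) = act a b f (dec j (A a) y)" if "y \<in> FOb (psh_of j C A act) a" for y
  proof -
    have "act a b f (dec j (A a) y) \<in> A b" using A a b y(1)[OF that] by (simp add: psh_data_def)
    then show ?thesis using act[OF y(1)[OF that]] y(2)[OF that] dec_cod[OF s[OF b(1)] j] by metis
  qed
qed

lemma coded_presheaf:
  fixes U :: "'u itself" and C :: "('o, 'm) cat" and j :: "'u \<Rightarrow> 's"
  assumes "category C" and "inj j"
    and "\<And>a. a \<in> Obj C \<Longrightarrow> small U (A a)" and "psh_data C A act"
  obtains Q :: "('o, 'm, 's) presheaf" and e d where "Q \<in> Obj (presheaf_cat U C)" "coding C A act Q e d"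
  using that[OF psh_of_obj coding_psh_of] assms by blast

text \<open>Limits are computed pointwise: \<open>A c\<close> is the set of matching families of the
  diagram at \<open>c\<close>, the usual limit of sets. Its elements are functions on
  \<open>Obj J\<close>, hence the coding.\<close>

lemma presheaf_has_finite_limits:
  fixes U :: "'u itself" and C :: "('o, 'm) cat"
  assumes inacc: "inaccessible U" and C: "category C"
  shows "has_finite_limits (presheaf_cat U C :: (('o, 'm, 'u) presheaf, 'o \<Rightarrow> 'u \<Rightarrow> 'u) cat)"
  unfolding has_finite_limits_def
proof (intro allI impI, elim conjE)
  let ?P = "presheaf_cat U C :: (('o, 'm, 'u) presheaf, 'o \<Rightarrow> 'u \<Rightarrow> 'u) cat"
  fix J :: "(nat, nat) cat" and K
  assume J: "finite_category J" and K: "is_functor J ?P K"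
  note Kob = fun_ob[OF K] and Khom = fun_hom[OF K]
  define A where "A = (\<lambda>c. {q \<in> PiE (Obj J) (\<lambda>j. FOb (FOb K j) c).
     \<forall>j\<in>Obj J. \<forall>k\<in>Obj J. \<forall>u\<in>Hom J j k. FHom K j k u c (q j) = q k})"
  define act where "act = (\<lambda>a b f q. \<lambda>j\<in>Obj J. FHom (FOb K j) a b f (q j))"
  have J': "small U (Obj J)" using J by (intro small_finite[OF inacc]) (simp add: finite_category_def)
  have s: "small U (A c)" if "c \<in> Obj C" for c
    by (rule small_subset[OF small_PiE[OF inacc J' psh_small[OF Kob]]]) (auto simp: A_def that)
  have data: "psh_data C A act"
    unfolding psh_data_def
  proof (intro conjI ballI)
    fix a b f q assume *: "a \<in> Obj C" "b \<in> Obj C" "f \<in> Hom C b a" "q \<in> A a"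
    have "act a b f q j \<in> FOb (FOb K j) b" if "j \<in> Obj J" for j
      using * that psh_act[OF Kob[OF that] *(1,2,3), of "q j"] by (auto simp: act_def A_def)
    moreover have "FHom K j k u b (act a b f q j) = act a b f q k" if "j \<in> Obj J" "k \<in> Obj J" "u \<in> Hom J j k" for j k u
    proof -
      have "q j \<in> FOb (FOb K j) a" "FHom K j k u a (q j) = q k" using * that by (auto simp: A_def)
      then show ?thesis
        using that psh_hom_nat[OF Kob[OF that(1)] Kob[OF that(2)] Khom[OF that] *(1,2,3), of "q j"] by (simp add: act_def)
    qed
    ultimately show "act a b f q \<in> A b" by (auto simp: A_def act_def)
  next
    fix a q assume *: "a \<in> Obj C" "q \<in> A a"
    show "act a a (Ide C a) q = q"
      by (rule extensionalityI[of _ "Obj J"]) (use * psh_ide[OF Kob] in \<open>auto simp: act_def A_def PiE_iff\<close>)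
  next
    fix a b c f g q assume *: "a \<in> Obj C" "b \<in> Obj C" "c \<in> Obj C" "f \<in> Hom C b a" "g \<in> Hom C c b" "q \<in> A a"
    show "act a c (Cmp C c b a f g) q = act b c g (act a b f q)"
      by (rule extensionalityI[of _ "Obj J"]) (use * psh_cmp[OF Kob] in \<open>auto simp: act_def A_def PiE_iff\<close>)
  qed
  obtain Q e d where Q: "Q \<in> Obj ?P" and "coding C A act Q e d"
    using coded_presheaf[OF C inj_on_id s data] .
  then interpret Q: coding C A act Q e d by simp
  define p where "p = (\<lambda>j. \<lambda>c\<in>Obj C. \<lambda>y\<in>FOb Q c. d c y j)"
  have p: "p j \<in> Hom ?P Q (FOb K j)" if j: "j \<in> Obj J" for j
    unfolding p_def
  proof (rule psh_homI[OF Q Kob[OF j]])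
    fix c y assume "c \<in> Obj C" "y \<in> FOb Q c"
    then show "d c y j \<in> FOb (FOb K j) c" using j Q.d_in[of c y] by (auto simp: A_def)
  next
    fix a b f y assume "a \<in> Obj C" "b \<in> Obj C" "f \<in> Hom C b a" "y \<in> FOb Q a"
    then show "FHom (FOb K j) a b f (d a y j) = d b (FHom Q a b f y) j"
      using j by (simp add: Q.act_d) (simp add: act_def)
  qed
  have pv: "p j c y = d c y j" if "c \<in> Obj C" "y \<in> FOb Q c" for j c y
    using that by (simp add: p_def)
  have "is_limit J ?P K Q p"
    unfolding is_limit_def
  proof (intro conjI allI impI)
    show "is_cone J ?P K Q p"
      unfolding is_cone_def
    proof (intro conjI ballI Q p)
      fix j k u assume *: "j \<in> Obj J" "k \<in> Obj J" "u \<in> Hom J j k"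
      show "Cmp ?P Q (FOb K j) (FOb K k) (FHom K j k u) (p j) = p k"
      proof (rule psh_hom_eqI[OF Q Kob[OF *(2)]])
        show "Cmp ?P Q (FOb K j) (FOb K k) (FHom K j k u) (p j) \<in> Hom ?P Q (FOb K k)"
          using * by (intro cat_cmp category_psh C Q Kob Khom p)
        fix c y assume "c \<in> Obj C" "y \<in> FOb Q c"
        then show "Cmp ?P Q (FOb K j) (FOb K k) (FHom K j k u) (p j) c y = p k c y"
          using Q.d_in[of c y] * by (simp add: pv) (simp add: A_def)
      qed (use p * in auto)
    qed
  next
    fix Y q assume cone: "is_cone J ?P K Y q"
    then have Y: "Y \<in> Obj ?P" and q: "\<And>j. j \<in> Obj J \<Longrightarrow> q j \<in> Hom ?P Y (FOb K j)"
      by (auto simp: is_cone_def)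
    have qA: "(\<lambda>j\<in>Obj J. q j c y) \<in> A c" if c: "c \<in> Obj C" and y: "y \<in> FOb Y c" for c y
    proof -
      have "FHom K j k u c (q j c y) = q k c y" if "j \<in> Obj J" "k \<in> Obj J" "u \<in> Hom J j k" for j k u
      proof -
        have "Cmp ?P Y (FOb K j) (FOb K k) (FHom K j k u) (q j) = q k"
          using cone that by (auto simp: is_cone_def)
        then show ?thesis using c y by (metis psh_cmp_app)
      qed
      then show ?thesis using psh_hom_in[OF Y Kob q c y] by (auto simp: A_def)
    qed
    define h where "h = (\<lambda>c\<in>Obj C. \<lambda>y\<in>FOb Y c. e c (\<lambda>j\<in>Obj J. q j c y))"
    have h: "h \<in> Hom ?P Y Q"
      unfolding h_def
    proof (rule psh_homI[OF Y Q])
      fix c y assume "c \<in> Obj C" "y \<in> FOb Y c"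
      then show "e c (\<lambda>j\<in>Obj J. q j c y) \<in> FOb Q c" using qA by (simp add: Q.e_in)
    next
      fix a b f y assume *: "a \<in> Obj C" "b \<in> Obj C" "f \<in> Hom C b a" "y \<in> FOb Y a"
      have "act a b f (\<lambda>j\<in>Obj J. q j a y) = (\<lambda>j\<in>Obj J. q j b (FHom Y a b f y))"
        using psh_hom_nat[OF Y Kob q *] by (auto simp: act_def)
      then show "FHom Q a b f (e a (\<lambda>j\<in>Obj J. q j a y)) = e b (\<lambda>j\<in>Obj J. q j b (FHom Y a b f y))"
        using * qA by (simp add: Q.act_e)
    qed
    show "\<exists>!h. h \<in> Hom ?P Y Q \<and> (\<forall>j\<in>Obj J. Cmp ?P Y Q (FOb K j) (p j) h = q j)"
    proof (rule ex1I[of _ h], intro conjI h ballI)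
      fix j assume j: "j \<in> Obj J"
      show "Cmp ?P Y Q (FOb K j) (p j) h = q j"
      proof (rule psh_hom_eqI[OF Y Kob[OF j] _ q[OF j]])
        show "Cmp ?P Y Q (FOb K j) (p j) h \<in> Hom ?P Y (FOb K j)"
          using j by (intro cat_cmp category_psh C Q Y Kob h p)
        fix c y assume "c \<in> Obj C" "y \<in> FOb Y c"
        then show "Cmp ?P Y Q (FOb K j) (p j) h c y = q j c y"
          using j qA Q.e_in by (simp add: pv h_def Q.d_e)
      qed
    next
      fix g assume g: "g \<in> Hom ?P Y Q \<and> (\<forall>j\<in>Obj J. Cmp ?P Y Q (FOb K j) (p j) g = q j)"
      show "g = h"
      proof (rule psh_hom_eqI[OF Y Q])
        fix c y assume *: "c \<in> Obj C" "y \<in> FOb Y c"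
        have gQ: "g c y \<in> FOb Q c" using psh_hom_in[OF Y Q _ *] g by blast
        have "d c (g c y) = (\<lambda>j\<in>Obj J. q j c y)"
        proof (rule extensionalityI[of _ "Obj J"])
          show "d c (g c y) \<in> extensional (Obj J)" using Q.d_in[OF *(1) gQ] by (simp add: A_def PiE_iff)
          fix j assume j: "j \<in> Obj J"
          have "Cmp ?P Y Q (FOb K j) (p j) g c y = q j c y" using g j by simp
          then show "d c (g c y) j = (\<lambda>j\<in>Obj J. q j c y) j" using * gQ j by (simp add: pv)
        qed simp
        then show "g c y = h c y" using Q.e_d[OF *(1) gQ] * by (simp add: h_def)
      qed (use g h in auto)
    qed
  qed
  then show "\<exists>x p. is_limit J ?P K x p" by blast
qed


section \<open>Constructions in presheaf categories\<close>

text \<open>Here the values are the hom-sets themselves. For a category whose morphisms already have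
  type \<open>'u\<close> this avoids the \<open>Inl\<close> copy of
  \<open>representable\<close>.\<close>

definition rep :: "('o, 'm) cat \<Rightarrow> 'o \<Rightarrow> ('o, 'm, 'm) presheaf" where
  "rep C c = restrict_funct (op_cat C)
     \<lparr>FOb = (\<lambda>a. Hom C a c), FHom = (\<lambda>a b f. \<lambda>x\<in>Hom C a c. Cmp C b a c x f)\<rparr>"

text \<open>The transformation from \<open>rep C c\<close> to \<open>Q\<close> that the Yoneda lemma
  attaches to the element \<open>x\<close> of \<open>Q c\<close>.\<close>

definition yon :: "('o, 'm) cat \<Rightarrow> ('o, 'm, 's) presheaf \<Rightarrow> 'o \<Rightarrow> 's \<Rightarrow> 'o \<Rightarrow> 'm \<Rightarrow> 's" where
  "yon C Q c x = (\<lambda>a\<in>Obj C. \<lambda>f\<in>Hom C a c. FHom Q c a f x)"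

lemma rep_simps [simp]:
  "a \<in> Obj C \<Longrightarrow> FOb (rep C c) a = Hom C a c"
  "a \<in> Obj C \<Longrightarrow> b \<in> Obj C \<Longrightarrow> f \<in> Hom C b a \<Longrightarrow> x \<in> Hom C a c \<Longrightarrow> FHom (rep C c) a b f x = Cmp C b a c x f"
  by (simp_all add: rep_def restrict_funct_def)

lemma rep_obj:
  assumes C: "category C" and ls: "locally_small U C" and c: "c \<in> Obj C"
  shows "rep C c \<in> Obj (presheaf_cat U C)"
proof -
  have "FHom (rep C c) a b f \<in> extensional (FOb (rep C c) a)" if "a \<in> Obj C" "b \<in> Obj C" "f \<in> Hom C b a" for a b f
    using that by (auto simp: rep_def restrict_funct_def)
  moreover have "psh_data C (FOb (rep C c)) (FHom (rep C c))"
    unfolding psh_data_def using C c by (simp add: cat_cmp cat_ide cat_idr cat_assoc)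
  moreover have "extensional_funct (op_cat C) (rep C c)"
    by (auto simp: extensional_funct_def rep_def restrict_funct_def)
  ultimately show ?thesis
    unfolding psh_obj_iff using C ls c by (simp add: locally_small_def)
qed

text \<open>The exponential of base \<open>B\<close> and exponent \<open>A\<close>, known only
  through its evaluation \<open>\<gamma>\<close>. An element over \<open>c\<close> amounts to a
  transformation from \<open>rep C c \<times> A\<close> to \<open>B\<close>: by
  \<open>ev_ext\<close> it is determined by its values, and by \<open>ev_ex\<close> every natural
  family \<open>t\<close> arises.\<close>

locale presheaf_exponential =
  fixes C :: "('o, 'm) cat" and A B Q :: "('o, 'm, 's) presheaf" and \<gamma> :: "'o \<Rightarrow> 's \<Rightarrow> 's \<Rightarrow> 's"
  assumes ev_in: "c \<in> Obj C \<Longrightarrow> y \<in> FOb Q c \<Longrightarrow> s \<in> FOb A c \<Longrightarrow> \<gamma> c y s \<in> FOb B c"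
    and ev_nat: "c \<in> Obj C \<Longrightarrow> c' \<in> Obj C \<Longrightarrow> f \<in> Hom C c' c \<Longrightarrow> y \<in> FOb Q c \<Longrightarrow> s \<in> FOb A c \<Longrightarrow>
      FHom B c c' f (\<gamma> c y s) = \<gamma> c' (FHom Q c c' f y) (FHom A c c' f s)"
    and ev_ext: "c \<in> Obj C \<Longrightarrow> y \<in> FOb Q c \<Longrightarrow> y' \<in> FOb Q c \<Longrightarrow>
      (\<And>c' f s. c' \<in> Obj C \<Longrightarrow> f \<in> Hom C c' c \<Longrightarrow> s \<in> FOb A c' \<Longrightarrow>
        \<gamma> c' (FHom Q c c' f y) s = \<gamma> c' (FHom Q c c' f y') s) \<Longrightarrow> y = y'"
    and ev_ex: "c \<in> Obj C \<Longrightarrow>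
      (\<And>c' f s. c' \<in> Obj C \<Longrightarrow> f \<in> Hom C c' c \<Longrightarrow> s \<in> FOb A c' \<Longrightarrow> t c' f s \<in> FOb B c') \<Longrightarrow>
      (\<And>c' c'' f g s. c' \<in> Obj C \<Longrightarrow> c'' \<in> Obj C \<Longrightarrow> f \<in> Hom C c' c \<Longrightarrow> g \<in> Hom C c'' c' \<Longrightarrow> s \<in> FOb A c' \<Longrightarrow>
        FHom B c' c'' g (t c' f s) = t c'' (Cmp C c'' c' c f g) (FHom A c' c'' g s)) \<Longrightarrow>
      \<exists>y\<in>FOb Q c. \<forall>c'\<in>Obj C. \<forall>f\<in>Hom C c' c. \<forall>s\<in>FOb A c'. \<gamma> c' (FHom Q c c' f y) s = t c' f s"

text \<open>A sieve \<open>S\<close> is closed when it contains every \<open>f\<close> with \<open>f \<circ> d \<in> S\<close> for all \<open>d \<in> D c' c''\<close>, so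
  that \<open>D c'\<close> plays the role of the smallest covering sieve on \<open>c'\<close>. An element \<open>y\<close> of \<open>\<Omega> c\<close> stands for
  the sieve of all \<open>f\<close> for which the restriction of \<open>y\<close> along \<open>f\<close> is the maximal sieve \<open>tr\<close>.\<close>

locale closed_sieves =
  fixes C :: "('o, 'm) cat" and D :: "'o \<Rightarrow> 'o \<Rightarrow> 'm set" and \<Omega> :: "('o, 'm, 's) presheaf" and tr :: "'o \<Rightarrow> 's"
  assumes tr_in: "c \<in> Obj C \<Longrightarrow> tr c \<in> FOb \<Omega> c"
    and tr_nat: "c \<in> Obj C \<Longrightarrow> c' \<in> Obj C \<Longrightarrow> f \<in> Hom C c' c \<Longrightarrow> FHom \<Omega> c c' f (tr c) = tr c'"
    and closed: "c \<in> Obj C \<Longrightarrow> y \<in> FOb \<Omega> c \<Longrightarrow> c' \<in> Obj C \<Longrightarrow> f \<in> Hom C c' c \<Longrightarrow>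
      (\<And>c'' d. c'' \<in> Obj C \<Longrightarrow> d \<in> D c' c'' \<Longrightarrow> FHom \<Omega> c c'' (Cmp C c'' c' c f d) y = tr c'') \<Longrightarrow>
      FHom \<Omega> c c' f y = tr c'"
    and sieve_ext: "c \<in> Obj C \<Longrightarrow> y \<in> FOb \<Omega> c \<Longrightarrow> y' \<in> FOb \<Omega> c \<Longrightarrow>
      (\<And>c' f. c' \<in> Obj C \<Longrightarrow> f \<in> Hom C c' c \<Longrightarrow> FHom \<Omega> c c' f y = tr c' \<longleftrightarrow> FHom \<Omega> c c' f y' = tr c') \<Longrightarrow> y = y'"
    and sieve_ex: "c \<in> Obj C \<Longrightarrow>
      (\<And>c' c'' f g. c' \<in> Obj C \<Longrightarrow> c'' \<in> Obj C \<Longrightarrow> f \<in> Hom C c' c \<Longrightarrow> g \<in> Hom C c'' c' \<Longrightarrow> S c' f \<Longrightarrow>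
        S c'' (Cmp C c'' c' c f g)) \<Longrightarrow>
      (\<And>c' f. c' \<in> Obj C \<Longrightarrow> f \<in> Hom C c' c \<Longrightarrow>
        (\<And>c'' d. c'' \<in> Obj C \<Longrightarrow> d \<in> D c' c'' \<Longrightarrow> S c'' (Cmp C c'' c' c f d)) \<Longrightarrow> S c' f) \<Longrightarrow>
      \<exists>y\<in>FOb \<Omega> c. \<forall>c'\<in>Obj C. \<forall>f\<in>Hom C c' c. FHom \<Omega> c c' f y = tr c' \<longleftrightarrow> S c' f"

locale small_presheaves =
  fixes U :: "'u itself" and C :: "('c, 'u) cat"
  assumes inacc: "inaccessible U" and small: "small_category U C"
begin

abbreviation (input) PC :: "(('c, 'u, 'u) presheaf, 'c \<Rightarrow> 'u \<Rightarrow> 'u) cat" where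
  "PC \<equiv> presheaf_cat U C"

lemma cC: "category C"
  using small by (simp add: small_category_def)

lemma rep_ob: "c \<in> Obj C \<Longrightarrow> rep C c \<in> Obj PC"
  using small by (simp add: small_category_def rep_obj)

text \<open>Smallness of the set of objects of \<open>C\<close> enters here. It will make right Kan
  extensions small at each object, and \<open>E\<close> locally small.\<close>

lemma presheaf_hom_small:
  assumes P: "P \<in> Obj PC" and Q: "Q \<in> Obj PC"
  shows "small U (Hom PC P Q)"
proof (rule small_subset)
  show "small U (PiE (Obj C) (\<lambda>c. FOb P c \<rightarrow>\<^sub>E FOb Q c))"
    using small by (intro small_PiE[OF inacc]) (auto simp: small_category_def intro: psh_small[OF P] psh_small[OF Q])
  show "Hom PC P Q \<subseteq> PiE (Obj C) (\<lambda>c. FOb P c \<rightarrow>\<^sub>E FOb Q c)"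
    using psh_hom_iff[OF P Q] by (blast intro: PiE_I extensional_arb)
qed

lemma yon_app [simp]: "a \<in> Obj C \<Longrightarrow> f \<in> Hom C a c \<Longrightarrow> yon C Q c x a f = FHom Q c a f x"
  by (simp add: yon_def)

lemma yon_hom:
  assumes Q: "Q \<in> Obj PC" and c: "c \<in> Obj C" and x: "x \<in> FOb Q c"
  shows "yon C Q c x \<in> Hom PC (rep C c) Q"
proof -
  have eq: "yon C Q c x = (\<lambda>a\<in>Obj C. \<lambda>f\<in>FOb (rep C c) a. FHom Q c a f x)"
    by (auto simp: yon_def fun_eq_iff restrict_def)
  show ?thesis
    unfolding eq by (rule psh_homI[OF rep_ob[OF c] Q]) (use psh_act[OF Q] psh_cmp[OF Q] c x in auto)
qed

text \<open>The uniqueness half of the Yoneda lemma: the value at \<open>f\<close> is the action of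
  \<open>f\<close> on the value at the identity.\<close>

lemma rep_hom_eqI:
  assumes Q: "Q \<in> Obj PC" and c: "c \<in> Obj C"
    and \<alpha>: "\<alpha> \<in> Hom PC (rep C c) Q" and \<beta>: "\<beta> \<in> Hom PC (rep C c) Q"
    and eq: "\<alpha> c (Ide C c) = \<beta> c (Ide C c)"
  shows "\<alpha> = \<beta>"
proof (rule psh_hom_eqI[OF rep_ob[OF c] Q \<alpha> \<beta>])
  fix a f assume *: "a \<in> Obj C" "f \<in> FOb (rep C c) a"
  then have "\<alpha> a f = FHom Q c a f (\<alpha> c (Ide C c))" "\<beta> a f = FHom Q c a f (\<beta> c (Ide C c))"
    using psh_hom_nat[OF rep_ob[OF c] Q \<alpha> c, of a f "Ide C c"] psh_hom_nat[OF rep_ob[OF c] Q \<beta> c, of a f "Ide C c"] c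
    by (simp_all add: cC cat_ide cat_idl)
  then show "\<alpha> a f = \<beta> a f" using eq by simp
qed

text \<open>The product is arbitrary, known by its universal property alone; mapping
  \<open>rep C c\<close> into it shows that every pair of elements comes from one of its
  elements.\<close>

lemma presheaf_product_elements:
  assumes A: "A \<in> Obj PC" and B: "B \<in> Obj PC" and prod: "is_product PC A B X p1 p2"
    and c: "c \<in> Obj C" and x: "x \<in> FOb A c" and y: "y \<in> FOb B c"
  shows "\<exists>w\<in>FOb X c. p1 c w = x \<and> p2 c w = y"
proof -
  have "X \<in> Obj PC" using prod by (simp add: is_product_def)
  obtain h where h: "h \<in> Hom PC (rep C c) X" and
    "Cmp PC (rep C c) X A p1 h = yon C A c x" "Cmp PC (rep C c) X B p2 h = yon C B c y"
    using prod rep_ob[OF c] yon_hom[OF A c x] yon_hom[OF B c y] unfolding is_product_def by metis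
  then have "p1 c (h c (Ide C c)) = yon C A c x c (Ide C c)" "p2 c (h c (Ide C c)) = yon C B c y c (Ide C c)"
    using c cat_ide[OF cC c] psh_cmp_app[of c C "Ide C c" "rep C c"] rep_simps(1)[OF c] by metis+
  moreover have "h c (Ide C c) \<in> FOb X c"
    using psh_hom_in[OF rep_ob[OF c] \<open>X \<in> Obj PC\<close> h c] cat_ide[OF cC c] c by simp
  ultimately show ?thesis
    using c x y cat_ide[OF cC c] psh_ide[OF A c x] psh_ide[OF B c y] by auto
qed

text \<open>\<open>R c\<close> consists of the transformations from
  \<open>rep C c \<times> A\<close> to \<open>B\<close>, flattened to functions on triples
  \<open>(c', f, s)\<close> so that no product presheaf has to be chosen. Evaluation takes the
  component at the identity of \<open>c\<close>.\<close>

lemma exponential_presheaf: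
  assumes A: "A \<in> Obj PC" and B: "B \<in> Obj PC"
  shows "\<exists>Q\<in>Obj PC. \<exists>\<gamma>. presheaf_exponential C A B Q \<gamma>"
proof -
  define I where "I = (\<lambda>c. Sigma (Obj C) (\<lambda>c'. Hom C c' c \<times> FOb A c'))"
  define R where "R = (\<lambda>c. {t \<in> PiE (I c) (\<lambda>(c', f, s). FOb B c').
     \<forall>c'\<in>Obj C. \<forall>c''\<in>Obj C. \<forall>f\<in>Hom C c' c. \<forall>g\<in>Hom C c'' c'. \<forall>s\<in>FOb A c'.
       FHom B c' c'' g (t (c', f, s)) = t (c'', Cmp C c'' c' c f g, FHom A c' c'' g s)})"
  define act where "act = (\<lambda>c d h (t :: _ \<Rightarrow> 'u). \<lambda>(c', f, s)\<in>I d. t (c', Cmp C c' d c h f, s))"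
  have [simp]: "(c', f, s) \<in> I c \<longleftrightarrow> c' \<in> Obj C \<and> f \<in> Hom C c' c \<and> s \<in> FOb A c'" for c c' f s
    by (auto simp: I_def)
  have sI: "small U (I c)" if "c \<in> Obj C" for c
    unfolding I_def using small that psh_small[OF A]
    by (intro small_Sigma[OF inacc] small_Times[OF inacc]) (auto simp: small_category_def locally_small_def)
  have sR: "small U (R c)" if "c \<in> Obj C" for c
  proof (rule small_subset)
    show "small U (PiE (I c) (\<lambda>(c', f, s). FOb B c'))"
      by (rule small_PiE[OF inacc sI[OF that]]) (auto intro: psh_small[OF B])
  qed (auto simp: R_def)
  have Rin: "t (c', f, s) \<in> FOb B c'" if "t \<in> R c" "c' \<in> Obj C" "f \<in> Hom C c' c" "s \<in> FOb A c'" for t c c' f s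
  proof -
    have "t (c', f, s) \<in> (case (c', f, s) of (c', f, s) \<Rightarrow> FOb B c')"
      by (rule PiE_mem[of t "I c"]) (use that in \<open>auto simp: R_def\<close>)
    then show ?thesis by simp
  qed
  have Rnat: "FHom B c' c'' g (t (c', f, s)) = t (c'', Cmp C c'' c' c f g, FHom A c' c'' g s)"
    if "t \<in> R c" "c' \<in> Obj C" "c'' \<in> Obj C" "f \<in> Hom C c' c" "g \<in> Hom C c'' c'" "s \<in> FOb A c'" for t c c' c'' f g s
    using that by (simp add: R_def)
  have RI: "t \<in> R c" if "t \<in> extensional (I c)"
    "\<And>c' f s. c' \<in> Obj C \<Longrightarrow> f \<in> Hom C c' c \<Longrightarrow> s \<in> FOb A c' \<Longrightarrow> t (c', f, s) \<in> FOb B c'"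
    "\<And>c' c'' f g s. c' \<in> Obj C \<Longrightarrow> c'' \<in> Obj C \<Longrightarrow> f \<in> Hom C c' c \<Longrightarrow> g \<in> Hom C c'' c' \<Longrightarrow> s \<in> FOb A c' \<Longrightarrow>
        FHom B c' c'' g (t (c', f, s)) = t (c'', Cmp C c'' c' c f g, FHom A c' c'' g s)" for t c
    using that by (auto simp: R_def PiE_iff)
  have Req: "t = t'" if "t \<in> R c" "t' \<in> R c"
    "\<And>c' f s. c' \<in> Obj C \<Longrightarrow> f \<in> Hom C c' c \<Longrightarrow> s \<in> FOb A c' \<Longrightarrow> t (c', f, s) = t' (c', f, s)" for t t' c
    by (rule extensionalityI[of _ "I c"]) (use that in \<open>auto simp: R_def PiE_iff I_def\<close>)
  have acta: "act c d h t (c', f, s) = t (c', Cmp C c' d c h f, s)"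
    if "c' \<in> Obj C" "f \<in> Hom C c' d" "s \<in> FOb A c'" for c d h t c' f s
    using that by (simp add: act_def)
  have actR: "act c d h t \<in> R d" if "c \<in> Obj C" "d \<in> Obj C" "h \<in> Hom C d c" "t \<in> R c" for c d h t
  proof (rule RI)
    show "act c d h t \<in> extensional (I d)" by (simp add: act_def)
  next
    fix c' f s assume "c' \<in> Obj C" "f \<in> Hom C c' d" "s \<in> FOb A c'"
    then show "act c d h t (c', f, s) \<in> FOb B c'"
      using that by (simp add: acta) (intro Rin[OF that(4)] cat_cmp[OF cC])
  next
    fix c' c'' f g s assume "c' \<in> Obj C" "c'' \<in> Obj C" "f \<in> Hom C c' d" "g \<in> Hom C c'' c'" "s \<in> FOb A c'"
    then show "FHom B c' c'' g (act c d h t (c', f, s)) = act c d h t (c'', Cmp C c'' c' d f g, FHom A c' c'' g s)"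
      using that by (simp add: acta cat_cmp[OF cC] psh_act[OF A] Rnat[OF that(4)] cat_assoc[OF cC])
  qed
  have data: "psh_data C R act"
    unfolding psh_data_def
  proof (intro conjI ballI actR)
    fix a t assume *: "a \<in> Obj C" "t \<in> R a"
    show "act a a (Ide C a) t = t"
      by (rule Req[OF actR]) (use * in \<open>simp_all add: acta cat_ide[OF cC] cat_idl[OF cC]\<close>)
  next
    fix a b c f g t assume *: "a \<in> Obj C" "b \<in> Obj C" "c \<in> Obj C" "f \<in> Hom C b a" "g \<in> Hom C c b" "t \<in> R a"
    show "act a c (Cmp C c b a f g) t = act b c g (act a b f t)"
      by (rule Req[OF actR actR]) (use * in \<open>simp_all add: acta cat_cmp[OF cC] actR cat_assoc[OF cC]\<close>)
  qed
  obtain Q e d where Q: "Q \<in> Obj PC" and "coding C R act Q e d"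
    using coded_presheaf[OF cC inj_on_id sR data] .
  then interpret Q: coding C R act Q e d by simp
  define \<gamma> where "\<gamma> = (\<lambda>c y s. d c y (c, Ide C c, s))"
  have \<gamma>Q: "\<gamma> c' (FHom Q c c' f y) s = d c y (c', f, s)"
    if "c \<in> Obj C" "c' \<in> Obj C" "f \<in> Hom C c' c" "y \<in> FOb Q c" "s \<in> FOb A c'" for c c' f y s
    using that by (simp add: \<gamma>_def Q.act_d acta cat_ide[OF cC] cat_idr[OF cC])
  have "presheaf_exponential C A B Q \<gamma>"
  proof
    fix c assume c: "c \<in> Obj C"
    note i = cat_ide[OF cC c]
    show "\<gamma> c y s \<in> FOb B c" if "y \<in> FOb Q c" "s \<in> FOb A c" for y s
      unfolding \<gamma>_def by (rule Rin[OF Q.d_in]) (use c i that in auto)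
    show "FHom B c c' f (\<gamma> c y s) = \<gamma> c' (FHom Q c c' f y) (FHom A c c' f s)"
      if *: "c' \<in> Obj C" "f \<in> Hom C c' c" "y \<in> FOb Q c" "s \<in> FOb A c" for c' f y s
      using \<gamma>Q[OF c *(1,2,3) psh_act[OF A c *(1,2,4)]] Rnat[OF Q.d_in[OF c *(3)] c *(1) i *(2,4)] *
      by (simp add: \<gamma>_def cat_idl[OF cC] c)
    show "y = y'" if *: "y \<in> FOb Q c" "y' \<in> FOb Q c" and eq: "\<And>c' f s. c' \<in> Obj C \<Longrightarrow> f \<in> Hom C c' c \<Longrightarrow> s \<in> FOb A c' \<Longrightarrow>
        \<gamma> c' (FHom Q c c' f y) s = \<gamma> c' (FHom Q c c' f y') s" for y y'
    proof -
      have "d c y = d c y'"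
        by (rule Req[OF Q.d_in Q.d_in]) (use c * eq in \<open>auto simp: \<gamma>Q[symmetric]\<close>)
      then show "y = y'" using Q.e_d[OF c] * by metis
    qed
    show "\<exists>y\<in>FOb Q c. \<forall>c'\<in>Obj C. \<forall>f\<in>Hom C c' c. \<forall>s\<in>FOb A c'. \<gamma> c' (FHom Q c c' f y) s = t c' f s"
      if t1: "\<And>c' f s. c' \<in> Obj C \<Longrightarrow> f \<in> Hom C c' c \<Longrightarrow> s \<in> FOb A c' \<Longrightarrow> t c' f s \<in> FOb B c'"
        and t2: "\<And>c' c'' f g s. c' \<in> Obj C \<Longrightarrow> c'' \<in> Obj C \<Longrightarrow> f \<in> Hom C c' c \<Longrightarrow> g \<in> Hom C c'' c' \<Longrightarrow> s \<in> FOb A c' \<Longrightarrow>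
        FHom B c' c'' g (t c' f s) = t c'' (Cmp C c'' c' c f g) (FHom A c' c'' g s)" for t
    proof -
      define t' where "t' = (\<lambda>(c', f, s)\<in>I c. t c' f s)"
      have "t' \<in> R c"
        by (rule RI) (use c t1 t2 cat_cmp[OF cC] psh_act[OF A] in \<open>auto simp: t'_def\<close>)
      then show ?thesis
        using c by (intro bexI[of _ "e c t'"]) (auto simp: \<gamma>Q Q.e_in Q.d_e, simp add: t'_def)
    qed
  qed
  then show ?thesis using Q by blast
qed

text \<open>A sieve is a set of pairs of a domain and a morphism, acted upon by pullback. The fact
  \<open>mem\<close> ties this to the locale: \<open>f\<close> lies in a sieve exactly when the
  pullback along \<open>f\<close> is maximal, because a sieve containing the identity contains
  everything.\<close>

lemma closed_sieve_presheaf: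
  fixes D :: "'c \<Rightarrow> 'c \<Rightarrow> 'u set"
  assumes D: "\<And>c c'. D c c' \<subseteq> Hom C c' c"
  shows "\<exists>\<Omega>\<in>Obj PC. \<exists>tr. closed_sieves C D \<Omega> tr"
proof -
  define M where "M = (\<lambda>c. Sigma (Obj C) (\<lambda>c'. Hom C c' c))"
  define R where "R = (\<lambda>c. {r. r \<subseteq> M c \<and>
      (\<forall>c'\<in>Obj C. \<forall>c''\<in>Obj C. \<forall>f\<in>Hom C c' c. \<forall>g\<in>Hom C c'' c'. (c', f) \<in> r \<longrightarrow> (c'', Cmp C c'' c' c f g) \<in> r) \<and>
      (\<forall>c'\<in>Obj C. \<forall>f\<in>Hom C c' c. (\<forall>c''\<in>Obj C. \<forall>d\<in>D c' c''. (c'', Cmp C c'' c' c f d) \<in> r) \<longrightarrow> (c', f) \<in> r)})"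
  define act where "act = (\<lambda>c b (h::'u) (r::('c \<times> 'u) set). {(c', f). c' \<in> Obj C \<and> f \<in> Hom C c' b \<and> (c', Cmp C c' b c h f) \<in> r})"
  have Mm [simp]: "(c', f) \<in> M c \<longleftrightarrow> c' \<in> Obj C \<and> f \<in> Hom C c' c" for c c' f by (auto simp: M_def)
  have sR: "small U (R c)" if "c \<in> Obj C" for c
  proof (rule small_subset)
    show "small U (Pow (M c))"
      unfolding M_def using small that
      by (intro small_Pow[OF inacc] small_Sigma[OF inacc]) (auto simp: small_category_def locally_small_def)
  qed (auto simp: R_def)
  have actm: "(c', f) \<in> act c b h r \<longleftrightarrow> c' \<in> Obj C \<and> f \<in> Hom C c' b \<and> (c', Cmp C c' b c h f) \<in> r" for c' f c b h r
    by (simp add: act_def)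
  have actR: "act a b h r \<in> R b" if *: "a \<in> Obj C" "b \<in> Obj C" "h \<in> Hom C b a" "r \<in> R a" for a b h r
    unfolding R_def mem_Collect_eq
  proof (intro conjI ballI impI)
    show "act a b h r \<subseteq> M b" by (auto simp: actm)
  next
    fix c' c'' f g assume "c' \<in> Obj C" "c'' \<in> Obj C" "f \<in> Hom C c' b" "g \<in> Hom C c'' c'" "(c', f) \<in> act a b h r"
    then show "(c'', Cmp C c'' c' b f g) \<in> act a b h r"
      using * by (simp add: actm cat_cmp[OF cC] cat_assoc[OF cC, symmetric]) (simp add: R_def cat_cmp[OF cC])
  next
    fix c' f assume f: "c' \<in> Obj C" "f \<in> Hom C c' b" and all: "\<forall>c''\<in>Obj C. \<forall>d\<in>D c' c''. (c'', Cmp C c'' c' b f d) \<in> act a b h r"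
    have "(c'', Cmp C c'' c' a (Cmp C c' b a h f) d) \<in> r" if "c'' \<in> Obj C" "d \<in> D c' c''" for c'' d
    proof -
      have "d \<in> Hom C c'' c'" using D that by blast
      then show ?thesis using all that * f by (simp add: actm cat_assoc[OF cC])
    qed
    moreover have "Cmp C c' b a h f \<in> Hom C c' a" using * f by (intro cat_cmp[OF cC])
    ultimately have "(c', Cmp C c' b a h f) \<in> r" using *(4) f unfolding R_def by blast
    then show "(c', f) \<in> act a b h r" using f by (simp add: actm)
  qed
  have data: "psh_data C R act"
    unfolding psh_data_def
  proof (intro conjI ballI actR)
    fix a r assume *: "a \<in> Obj C" "r \<in> R a"
    then show "act a a (Ide C a) r = r"
      by (auto simp: actm R_def cat_idl[OF cC] act_def)
  next
    fix a b c f g r assume *: "a \<in> Obj C" "b \<in> Obj C" "c \<in> Obj C" "f \<in> Hom C b a" "g \<in> Hom C c b" "r \<in> R a"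
    then show "act a c (Cmp C c b a f g) r = act b c g (act a b f r)"
      by (auto simp: act_def cat_cmp[OF cC] cat_assoc[OF cC])
  qed
  obtain Q e d where Q: "Q \<in> Obj PC" and "coding C R act Q e d"
    using coded_presheaf[OF cC inj_on_id sR data] .
  then interpret Q: coding C R act Q e d by simp
  define tr where "tr = (\<lambda>c. e c (M c))"
  have MR: "M c \<in> R c" if "c \<in> Obj C" for c using that by (auto simp: R_def cat_cmp[OF cC])
  have full: "r = M c" if "c \<in> Obj C" "r \<in> R c" "(c, Ide C c) \<in> r" for r c
  proof
    show "r \<subseteq> M c" using that by (simp add: R_def)
    show "M c \<subseteq> r"
    proof (clarsimp)
      fix c' f assume "c' \<in> Obj C" "f \<in> Hom C c' c"
      then have "(c', Cmp C c' c c (Ide C c) f) \<in> r"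
        using that cat_ide[OF cC] unfolding R_def by blast
      then show "(c', f) \<in> r" using \<open>c' \<in> Obj C\<close> \<open>f \<in> Hom C c' c\<close> that by (simp add: cat_idl[OF cC])
    qed
  qed
  have mem: "FHom Q c c' f y = tr c' \<longleftrightarrow> (c', f) \<in> d c y"
    if "c \<in> Obj C" "y \<in> FOb Q c" "c' \<in> Obj C" "f \<in> Hom C c' c" for c c' f y
  proof -
    have 1: "d c y \<in> R c" using that by (simp add: Q.d_in)
    have 2: "act c c' f (d c y) \<in> R c'" using that 1 by (simp add: actR)
    have 3: "FHom Q c c' f y = e c' (act c c' f (d c y))"
      using Q.act_e[OF that(1,3,4) 1] Q.e_d[OF that(1,2)] by simp
    have "FHom Q c c' f y = tr c' \<longleftrightarrow> act c c' f (d c y) = M c'"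
      unfolding 3 tr_def using Q.d_e[OF that(3) 2] Q.d_e[OF that(3) MR[OF that(3)]] by metis
    also have "\<dots> \<longleftrightarrow> (c', Ide C c') \<in> act c c' f (d c y)"
    proof
      assume "act c c' f (d c y) = M c'"
      then show "(c', Ide C c') \<in> act c c' f (d c y)" using cat_ide[OF cC that(3)] that(3) by simp
    qed (rule full[OF that(3) 2])
    finally show ?thesis using that by (simp add: actm cat_ide[OF cC] cat_idr[OF cC])
  qed
  have "closed_sieves C D Q tr"
  proof
    show trQ: "tr c \<in> FOb Q c" if "c \<in> Obj C" for c using that by (simp add: tr_def Q.e_in MR)
    show "FHom Q c c' f (tr c) = tr c'" if "c \<in> Obj C" "c' \<in> Obj C" "f \<in> Hom C c' c" for c c' f
      using that by (simp add: mem trQ) (simp add: tr_def Q.d_e MR)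
    show "FHom Q c c' f y = tr c'" if *: "c \<in> Obj C" "y \<in> FOb Q c" "c' \<in> Obj C" "f \<in> Hom C c' c"
      and "\<And>c'' k. c'' \<in> Obj C \<Longrightarrow> k \<in> D c' c'' \<Longrightarrow> FHom Q c c'' (Cmp C c'' c' c f k) y = tr c''" for c c' f y
    proof -
      have "(c'', Cmp C c'' c' c f k) \<in> d c y" if "c'' \<in> Obj C" "k \<in> D c' c''" for c'' k
      proof -
        have "k \<in> Hom C c'' c'" using D that by blast
        then show ?thesis using * that \<open>\<And>c'' k. c'' \<in> Obj C \<Longrightarrow> k \<in> D c' c'' \<Longrightarrow> FHom Q c c'' (Cmp C c'' c' c f k) y = tr c''\<close>[OF that]
          by (simp add: mem cat_cmp[OF cC])
      qed
      then have "(c', f) \<in> d c y" using Q.d_in[OF *(1,2)] * unfolding R_def by blast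
      then show ?thesis using * by (simp add: mem)
    qed
    show "y = y'" if *: "c \<in> Obj C" "y \<in> FOb Q c" "y' \<in> FOb Q c" and
      eq: "\<And>c' f. c' \<in> Obj C \<Longrightarrow> f \<in> Hom C c' c \<Longrightarrow> FHom Q c c' f y = tr c' \<longleftrightarrow> FHom Q c c' f y' = tr c'" for c y y'
    proof -
      have "d c y \<subseteq> M c" "d c y' \<subseteq> M c" using Q.d_in[OF *(1)] * by (auto simp: R_def)
      moreover have "p \<in> d c y \<longleftrightarrow> p \<in> d c y'" if "p \<in> M c" for p
        using that eq * by (cases p) (simp add: mem)
      ultimately have "d c y = d c y'" by blast
      then show ?thesis using Q.e_d[OF *(1)] * by metis
    qed
    show "\<exists>y\<in>FOb Q c. \<forall>c'\<in>Obj C. \<forall>f\<in>Hom C c' c. FHom Q c c' f y = tr c' \<longleftrightarrow> S c' f"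
      if c: "c \<in> Obj C" and S1: "\<And>c' c'' f g. c' \<in> Obj C \<Longrightarrow> c'' \<in> Obj C \<Longrightarrow> f \<in> Hom C c' c \<Longrightarrow> g \<in> Hom C c'' c' \<Longrightarrow> S c' f \<Longrightarrow>
        S c'' (Cmp C c'' c' c f g)"
      and S2: "\<And>c' f. c' \<in> Obj C \<Longrightarrow> f \<in> Hom C c' c \<Longrightarrow>
        (\<And>c'' d. c'' \<in> Obj C \<Longrightarrow> d \<in> D c' c'' \<Longrightarrow> S c'' (Cmp C c'' c' c f d)) \<Longrightarrow> S c' f" for c S
    proof -
      define r where "r = {(c', f). c' \<in> Obj C \<and> f \<in> Hom C c' c \<and> S c' f}"
      have rm [simp]: "(c', f) \<in> r \<longleftrightarrow> c' \<in> Obj C \<and> f \<in> Hom C c' c \<and> S c' f" for c' f by (simp add: r_def)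
      have "r \<in> R c"
        unfolding R_def mem_Collect_eq
      proof (intro conjI ballI impI)
        show "r \<subseteq> M c" by (auto simp: r_def)
      next
        fix c' c'' f g assume "c' \<in> Obj C" "c'' \<in> Obj C" "f \<in> Hom C c' c" "g \<in> Hom C c'' c'" "(c', f) \<in> r"
        then show "(c'', Cmp C c'' c' c f g) \<in> r" using S1 c by (simp add: cat_cmp[OF cC])
      next
        fix c' f assume "c' \<in> Obj C" "f \<in> Hom C c' c" "\<forall>c''\<in>Obj C. \<forall>d\<in>D c' c''. (c'', Cmp C c'' c' c f d) \<in> r"
        then show "(c', f) \<in> r" using S2[of c' f] by auto
      qed
      then show ?thesis
        using c by (intro bexI[of _ "e c r"]) (auto simp: mem Q.e_in Q.d_e)
    qed
  qed
  then show ?thesis using Q by blast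
qed

end


section \<open>Essential localizations of presheaf toposes are toposes\<close>

text \<open>\<open>L\<close> turns the product \<open>Q \<times> N a\<close> into one of
  \<open>L Q\<close> and \<open>L (N a)\<close>; the counit then replaces the second factor by
  \<open>a\<close>.\<close>

lemma product_transport:
  assumes C: "category C" and prod: "is_product C a b p p1 p2" and iso: "iso_in C b b' \<theta> \<theta>'"
    and ob: "a \<in> Obj C" "b \<in> Obj C" "b' \<in> Obj C"
  shows "is_product C a b' p p1 (Cmp C p b b' \<theta> p2)"
proof -
  have p [simp]: "p \<in> Obj C" "p1 \<in> Hom C p a" "p2 \<in> Hom C p b"
    and pu: "\<And>y q1 q2. y \<in> Obj C \<Longrightarrow> q1 \<in> Hom C y a \<Longrightarrow> q2 \<in> Hom C y b \<Longrightarrow>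
       \<exists>!h. h \<in> Hom C y p \<and> Cmp C y p a p1 h = q1 \<and> Cmp C y p b p2 h = q2"
    using prod by (auto simp: is_product_def)
  have th [simp]: "\<theta> \<in> Hom C b b'" "\<theta>' \<in> Hom C b' b" "Cmp C b b' b \<theta>' \<theta> = Ide C b" "Cmp C b' b b' \<theta> \<theta>' = Ide C b'"
    using iso by (auto simp: iso_in_def)
  note [simp] = C ob cat_idl
  show ?thesis
    unfolding is_product_def
  proof (intro conjI ballI)
    show "Cmp C p b b' \<theta> p2 \<in> Hom C p b'" by (rule cat_cmp) auto
    fix y q1 q2 assume [simp]: "y \<in> Obj C" "q1 \<in> Hom C y a" "q2 \<in> Hom C y b'"
    have [simp]: "Cmp C y b' b \<theta>' q2 \<in> Hom C y b" by (rule cat_cmp) auto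
    have "Cmp C y p b' (Cmp C p b b' \<theta> p2) h = q2 \<longleftrightarrow> Cmp C y p b p2 h = Cmp C y b' b \<theta>' q2" if [simp]: "h \<in> Hom C y p" for h
    proof -
      have [simp]: "Cmp C y p b p2 h \<in> Hom C y b" by (rule cat_cmp) auto
      have "Cmp C y b' b \<theta>' (Cmp C y b b' \<theta> (Cmp C y p b p2 h)) = Cmp C y p b p2 h"
        by (simp add: cat_assoc[symmetric, where g=\<theta>])
      moreover have "Cmp C y b b' \<theta> (Cmp C y b' b \<theta>' q2) = q2"
        by (simp add: cat_assoc[symmetric])
      ultimately show ?thesis by (metis cat_assoc C ob p th(1) that \<open>y \<in> Obj C\<close>)
    qed
    then show "\<exists>!h. h \<in> Hom C y p \<and> Cmp C y p a p1 h = q1 \<and> Cmp C y p b' (Cmp C p b b' \<theta> p2) h = q2"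
      using pu[of y q1 "Cmp C y b' b \<theta>' q2"] by (metis (no_types, lifting) \<open>y \<in> Obj C\<close> \<open>q1 \<in> Hom C y a\<close> \<open>Cmp C y b' b \<theta>' q2 \<in> Hom C y b\<close>)
  qed auto
qed

text \<open>Through the fully faithful \<open>N\<close>, an object of \<open>E\<close> is handled as
  a presheaf and a morphism of \<open>E\<close> as a natural family of functions.
  \<open>\<eta>\<close> and \<open>\<epsilon>\<close> belong to \<open>L\<close> and
  \<open>N\<close>, \<open>\<theta>\<close> and \<open>\<zeta>\<close> to \<open>l\<close> and
  \<open>L\<close>.\<close>

locale essential_localization =
  small_presheaves U C + LN: adj "presheaf_cat U C" E L N \<eta> \<epsilon> + lL: adj E "presheaf_cat U C" l L \<theta> \<zeta>
  for U :: "'u itself" and C :: "('c, 'u) cat" and E :: "('o, 'm) cat" and L N l \<eta> \<epsilon> \<theta> \<zeta> +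
  assumes ff: "fully_faithful E PC N"
begin

abbreviation (input) nob :: "'o \<Rightarrow> 'c \<Rightarrow> 'u set" where "nob v \<equiv> FOb (FOb N v)"
abbreviation (input) nact where "nact v \<equiv> FHom (FOb N v)"
abbreviation (input) nmap where "nmap \<equiv> FHom N"

lemmas N_ob = fun_ob[OF LN.G] and L_ob = fun_ob[OF LN.F] and l_ob = fun_ob[OF lL.F]
lemmas N_hom = fun_hom[OF LN.G] and L_hom = fun_hom[OF LN.F] and l_hom = fun_hom[OF lL.F]
lemmas cE = LN.D
lemmas nact_in = psh_act[OF N_ob] and nact_ide = psh_ide[OF N_ob] and nact_cmp = psh_cmp[OF N_ob]

section \<open>Morphisms of \<open>E\<close> as natural families, and the unit on elements\<close>

lemma nmap_in: "v \<in> Obj E \<Longrightarrow> w \<in> Obj E \<Longrightarrow> h \<in> Hom E v w \<Longrightarrow> c \<in> Obj C \<Longrightarrow> x \<in> nob v c \<Longrightarrow> nmap v w h c x \<in> nob w c"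
  by (rule psh_hom_in[OF N_ob N_ob N_hom])

lemma nmap_nat:
  "v \<in> Obj E \<Longrightarrow> w \<in> Obj E \<Longrightarrow> h \<in> Hom E v w \<Longrightarrow> c \<in> Obj C \<Longrightarrow> c' \<in> Obj C \<Longrightarrow> f \<in> Hom C c' c \<Longrightarrow> x \<in> nob v c
    \<Longrightarrow> nact w c c' f (nmap v w h c x) = nmap v w h c' (nact v c c' f x)"
  by (rule psh_hom_nat[OF N_ob N_ob N_hom])

lemma nmap_cmp:
  "u \<in> Obj E \<Longrightarrow> v \<in> Obj E \<Longrightarrow> w \<in> Obj E \<Longrightarrow> h \<in> Hom E u v \<Longrightarrow> g \<in> Hom E v w \<Longrightarrow> c \<in> Obj C \<Longrightarrow> x \<in> nob u c
    \<Longrightarrow> nmap u w (Cmp E u v w g h) c x = nmap v w g c (nmap u v h c x)"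
  by (simp add: fun_cmp[OF LN.G])

lemma nmap_ide: "v \<in> Obj E \<Longrightarrow> c \<in> Obj C \<Longrightarrow> x \<in> nob v c \<Longrightarrow> nmap v v (Ide E v) c x = x"
  by (simp add: fun_ide[OF LN.G])

lemma nmap_eqI:
  assumes "v \<in> Obj E" "w \<in> Obj E" "h \<in> Hom E v w" "h' \<in> Hom E v w"
    and eq: "\<And>c x. c \<in> Obj C \<Longrightarrow> x \<in> nob v c \<Longrightarrow> nmap v w h c x = nmap v w h' c x"
  shows "h = h'"
proof -
  have "nmap v w h = nmap v w h'"
    by (rule psh_hom_eqI[OF N_ob[OF assms(1)] N_ob[OF assms(2)]]) (use assms N_hom in auto)
  moreover have "inj_on (nmap v w) (Hom E v w)"
    using ff assms(1,2) by (auto simp: fully_faithful_def bij_betw_def)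
  ultimately show ?thesis using assms by (auto dest: inj_onD)
qed

lemma nmap_ex:
  assumes v: "v \<in> Obj E" and w: "w \<in> Obj E" and "\<And>c x. c \<in> Obj C \<Longrightarrow> x \<in> nob v c \<Longrightarrow> \<alpha> c x \<in> nob w c"
    and "\<And>c c' f x. c \<in> Obj C \<Longrightarrow> c' \<in> Obj C \<Longrightarrow> f \<in> Hom C c' c \<Longrightarrow> x \<in> nob v c \<Longrightarrow>
      nact w c c' f (\<alpha> c x) = \<alpha> c' (nact v c c' f x)"
  shows "\<exists>h\<in>Hom E v w. \<forall>c\<in>Obj C. \<forall>x\<in>nob v c. nmap v w h c x = \<alpha> c x"
proof -
  have "(\<lambda>c\<in>Obj C. \<lambda>x\<in>nob v c. \<alpha> c x) \<in> Hom PC (FOb N v) (FOb N w)"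
    by (rule psh_homI[OF N_ob[OF v] N_ob[OF w]]) (use assms in auto)
  moreover have "nmap v w ` Hom E v w = Hom PC (FOb N v) (FOb N w)"
    using ff v w by (auto simp: fully_faithful_def bij_betw_def)
  ultimately obtain h where h: "h \<in> Hom E v w" "(\<lambda>c\<in>Obj C. \<lambda>x\<in>nob v c. \<alpha> c x) = nmap v w h" by blast
  show ?thesis by (rule bexI[OF _ h(1)]) (simp add: h(2)[symmetric])
qed

lemma eta_in: "Q \<in> Obj PC \<Longrightarrow> c \<in> Obj C \<Longrightarrow> x \<in> FOb Q c \<Longrightarrow> \<eta> Q c x \<in> nob (FOb L Q) c"
  by (rule psh_hom_in[OF _ N_ob[OF L_ob] LN.unit_hom])

lemma eta_nat:
  "Q \<in> Obj PC \<Longrightarrow> c \<in> Obj C \<Longrightarrow> c' \<in> Obj C \<Longrightarrow> f \<in> Hom C c' c \<Longrightarrow> x \<in> FOb Q c \<Longrightarrow>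
    nact (FOb L Q) c c' f (\<eta> Q c x) = \<eta> Q c' (FHom Q c c' f x)"
  by (rule psh_hom_nat[OF _ N_ob[OF L_ob] LN.unit_hom])

lemma eta_map:
  assumes P: "P \<in> Obj PC" and Q: "Q \<in> Obj PC" and \<alpha>: "\<alpha> \<in> Hom PC P Q" and c: "c \<in> Obj C" and x: "x \<in> FOb P c"
  shows "nmap (FOb L P) (FOb L Q) (FHom L P Q \<alpha>) c (\<eta> P c x) = \<eta> Q c (\<alpha> c x)"
  using fun_cong[OF fun_cong[OF LN.unit_nat[OF P Q \<alpha>]], of c x] c x by simp

lemma eta_counit:
  assumes v: "v \<in> Obj E" and c: "c \<in> Obj C" and x: "x \<in> nob v c"
  shows "nmap (FOb L (FOb N v)) v (\<epsilon> v) c (\<eta> (FOb N v) c x) = x"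
  using fun_cong[OF fun_cong[OF LN.triangle_G[OF v]], of c x] c x by simp

text \<open>By the adjunction, a morphism out of \<open>L Q\<close> is determined on the image of
  \<open>\<eta> Q\<close>, even though that image may be smaller than \<open>L Q\<close>.\<close>

lemma eta_eqI:
  assumes Q: "Q \<in> Obj PC" and v: "v \<in> Obj E" and h: "h \<in> Hom E (FOb L Q) v" "h' \<in> Hom E (FOb L Q) v"
    and eq: "\<And>c x. c \<in> Obj C \<Longrightarrow> x \<in> FOb Q c \<Longrightarrow> nmap (FOb L Q) v h c (\<eta> Q c x) = nmap (FOb L Q) v h' c (\<eta> Q c x)"
  shows "h = h'"
proof (rule LN.left_eqI[OF Q v h], rule psh_hom_eqI[OF Q N_ob[OF v]])
  show "Cmp PC Q (FOb N (FOb L Q)) (FOb N v) (nmap (FOb L Q) v h) (\<eta> Q) \<in> Hom PC Q (FOb N v)"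
    "Cmp PC Q (FOb N (FOb L Q)) (FOb N v) (nmap (FOb L Q) v h') (\<eta> Q) \<in> Hom PC Q (FOb N v)"
    using LN.transpose_right(1)[OF Q v] h by auto
qed (use eq in auto)

lemma eta_univ:
  assumes Q: "Q \<in> Obj PC" and v: "v \<in> Obj E" and \<alpha>: "\<alpha> \<in> Hom PC Q (FOb N v)"
  shows "\<exists>h\<in>Hom E (FOb L Q) v. \<forall>c\<in>Obj C. \<forall>x\<in>FOb Q c. nmap (FOb L Q) v h c (\<eta> Q c x) = \<alpha> c x"
proof (rule bexI[OF _ LN.transpose_left(1)[OF Q v \<alpha>]], intro ballI)
  fix c x assume "c \<in> Obj C" "x \<in> FOb Q c"
  then show "nmap (FOb L Q) v (Cmp E (FOb L Q) (FOb L (FOb N v)) v (\<epsilon> v) (FHom L Q (FOb N v) \<alpha>)) c (\<eta> Q c x) = \<alpha> c x"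
    using fun_cong[OF fun_cong[OF LN.transpose_left(2)[OF Q v \<alpha>]], of c x] by simp
qed

text \<open>\<open>r\<close> followed by \<open>\<eta> Q\<close> is an endomorphism of
  \<open>L Q\<close> that fixes the image of \<open>\<eta> Q\<close>, hence the identity. So a
  presheaf whose unit has a retraction is isomorphic to one coming from \<open>E\<close>;
  exponentials and the subobject classifier are recognized in this way.\<close>

lemma retract_iso:
  assumes Q: "Q \<in> Obj PC"
    and r: "\<And>c z. c \<in> Obj C \<Longrightarrow> z \<in> nob (FOb L Q) c \<Longrightarrow> r c z \<in> FOb Q c"
    and nat: "\<And>c c' f z. c \<in> Obj C \<Longrightarrow> c' \<in> Obj C \<Longrightarrow> f \<in> Hom C c' c \<Longrightarrow> z \<in> nob (FOb L Q) c \<Longrightarrow>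
      FHom Q c c' f (r c z) = r c' (nact (FOb L Q) c c' f z)"
    and r\<eta>: "\<And>c x. c \<in> Obj C \<Longrightarrow> x \<in> FOb Q c \<Longrightarrow> r c (\<eta> Q c x) = x"
    and c: "c \<in> Obj C" and z: "z \<in> nob (FOb L Q) c"
  shows "\<eta> Q c (r c z) = z"
proof -
  note LQ = L_ob[OF Q]
  have "\<exists>h\<in>Hom E (FOb L Q) (FOb L Q). \<forall>c\<in>Obj C. \<forall>x\<in>nob (FOb L Q) c. nmap (FOb L Q) (FOb L Q) h c x = \<eta> Q c (r c x)"
    by (rule nmap_ex[OF LQ LQ]) (use Q in \<open>simp_all add: r eta_in eta_nat nat\<close>)
  then obtain h where h: "h \<in> Hom E (FOb L Q) (FOb L Q)"
    and hx: "\<And>c x. c \<in> Obj C \<Longrightarrow> x \<in> nob (FOb L Q) c \<Longrightarrow> nmap (FOb L Q) (FOb L Q) h c x = \<eta> Q c (r c x)" by blast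
  have "h = Ide E (FOb L Q)"
    by (rule eta_eqI[OF Q LQ h cat_ide[OF cE LQ]]) (simp add: hx eta_in Q r\<eta> nmap_ide LQ)
  then show ?thesis using hx[OF c z] nmap_ide[OF LQ c z] by simp
qed

subsection \<open>Elements as morphisms\<close>

text \<open>\<open>\<kappa> c\<close> represents \<open>v \<mapsto> N v c\<close>, with universal element \<open>gen c\<close>.\<close>

definition \<kappa> :: "'c \<Rightarrow> 'o" where "\<kappa> c = FOb L (rep C c)"
definition gen :: "'c \<Rightarrow> 'u" where "gen c = \<eta> (rep C c) c (Ide C c)"

lemma kappa_ob: "c \<in> Obj C \<Longrightarrow> \<kappa> c \<in> Obj E"
  by (simp add: \<kappa>_def L_ob rep_ob)

lemma gen_in: "c \<in> Obj C \<Longrightarrow> gen c \<in> nob (\<kappa> c) c"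
  by (simp add: gen_def \<kappa>_def eta_in rep_ob cat_ide[OF cC])

text \<open>Adjunction and Yoneda: E(L (rep C c), v) is Hom(rep C c, N v), that is,
  \<open>N v c\<close>.\<close>

lemma elt_ex:
  assumes v: "v \<in> Obj E" and c: "c \<in> Obj C" and x: "x \<in> nob v c"
  shows "\<exists>h\<in>Hom E (\<kappa> c) v. nmap (\<kappa> c) v h c (gen c) = x"
  using eta_univ[OF rep_ob[OF c] v yon_hom[OF N_ob[OF v] c x]] c cat_ide[OF cC c] nact_ide[OF v c x]
  by (force simp: \<kappa>_def gen_def)

lemma elt_eqI:
  assumes v: "v \<in> Obj E" and c: "c \<in> Obj C" and h: "h \<in> Hom E (\<kappa> c) v" "h' \<in> Hom E (\<kappa> c) v"
    and eq: "nmap (\<kappa> c) v h c (gen c) = nmap (\<kappa> c) v h' c (gen c)"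
  shows "h = h'"
proof (rule eta_eqI[OF rep_ob[OF c] v])
  fix c' f assume *: "c' \<in> Obj C" "f \<in> FOb (rep C c) c'"
  then have "\<eta> (rep C c) c' f = nact (\<kappa> c) c c' f (gen c)"
    using c by (simp add: gen_def \<kappa>_def eta_nat rep_ob cat_ide[OF cC] cat_idl[OF cC])
  then show "nmap (FOb L (rep C c)) v h c' (\<eta> (rep C c) c' f) = nmap (FOb L (rep C c)) v h' c' (\<eta> (rep C c) c' f)"
    using nmap_nat[OF kappa_ob[OF c] v h(1) c *(1), of f "gen c"] nmap_nat[OF kappa_ob[OF c] v h(2) c *(1), of f "gen c"]
      eq * gen_in[OF c] c by (simp add: \<kappa>_def)
qed (use h in \<open>simp_all add: \<kappa>_def\<close>)

text \<open>This is preservation of products by \<open>N\<close>, read on elements: an element over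
  \<open>c\<close> is a morphism out of \<open>\<kappa> c\<close>, and morphisms into a product are
  pairs.\<close>

lemma product_elements:
  assumes prod: "is_product E a b p p1 p2" and ab: "a \<in> Obj E" "b \<in> Obj E"
    and c: "c \<in> Obj C" and x: "x \<in> nob a c" and y: "y \<in> nob b c"
  shows "\<exists>!w. w \<in> nob p c \<and> nmap p a p1 c w = x \<and> nmap p b p2 c w = y"
proof -
  have p: "p \<in> Obj E" "p1 \<in> Hom E p a" "p2 \<in> Hom E p b" using prod by (auto simp: is_product_def)
  note K = kappa_ob[OF c] and g = gen_in[OF c]
  obtain hx hy where hx: "hx \<in> Hom E (\<kappa> c) a" "nmap (\<kappa> c) a hx c (gen c) = x"
    and hy: "hy \<in> Hom E (\<kappa> c) b" "nmap (\<kappa> c) b hy c (gen c) = y"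
    using elt_ex ab c x y by meson
  have u: "\<exists>!h. h \<in> Hom E (\<kappa> c) p \<and> Cmp E (\<kappa> c) p a p1 h = hx \<and> Cmp E (\<kappa> c) p b p2 h = hy"
    using prod hx hy K by (auto simp: is_product_def)
  have iff: "nmap p a p1 c (nmap (\<kappa> c) p h c (gen c)) = x \<longleftrightarrow> Cmp E (\<kappa> c) p a p1 h = hx"
    "nmap p b p2 c (nmap (\<kappa> c) p h c (gen c)) = y \<longleftrightarrow> Cmp E (\<kappa> c) p b p2 h = hy" if h: "h \<in> Hom E (\<kappa> c) p" for h
  proof -
    have 1: "Cmp E (\<kappa> c) p a p1 h \<in> Hom E (\<kappa> c) a" "Cmp E (\<kappa> c) p b p2 h \<in> Hom E (\<kappa> c) b"
      using p h K ab by (auto intro: cat_cmp[OF cE])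
    show "nmap p a p1 c (nmap (\<kappa> c) p h c (gen c)) = x \<longleftrightarrow> Cmp E (\<kappa> c) p a p1 h = hx"
      using elt_eqI[OF ab(1) c 1(1) hx(1)] hx(2) nmap_cmp[OF K p(1) ab(1) h p(2) c g] by metis
    show "nmap p b p2 c (nmap (\<kappa> c) p h c (gen c)) = y \<longleftrightarrow> Cmp E (\<kappa> c) p b p2 h = hy"
      using elt_eqI[OF ab(2) c 1(2) hy(1)] hy(2) nmap_cmp[OF K p(1) ab(2) h p(3) c g] by metis
  qed
  from u obtain h where h: "h \<in> Hom E (\<kappa> c) p" "Cmp E (\<kappa> c) p a p1 h = hx" "Cmp E (\<kappa> c) p b p2 h = hy" by blast
  show ?thesis
  proof (rule ex1I[of _ "nmap (\<kappa> c) p h c (gen c)"])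
    show "nmap (\<kappa> c) p h c (gen c) \<in> nob p c \<and> nmap p a p1 c (nmap (\<kappa> c) p h c (gen c)) = x \<and>
      nmap p b p2 c (nmap (\<kappa> c) p h c (gen c)) = y"
      using iff[OF h(1)] h nmap_in[OF K p(1) h(1) c g] by simp
    fix w assume w: "w \<in> nob p c \<and> nmap p a p1 c w = x \<and> nmap p b p2 c w = y"
    obtain k where k: "k \<in> Hom E (\<kappa> c) p" "nmap (\<kappa> c) p k c (gen c) = w" using elt_ex[OF p(1) c] w by blast
    then have "k = h" using u h iff[OF k(1)] w by blast
    then show "w = nmap (\<kappa> c) p h c (gen c)" using k by simp
  qed
qed

definition pairing where
  "pairing a b p p1 p2 c x y = (THE w. w \<in> nob p c \<and> nmap p a p1 c w = x \<and> nmap p b p2 c w = y)"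

context
  fixes a b p p1 p2
  assumes prod: "is_product E a b p p1 p2" and ab: "a \<in> Obj E" "b \<in> Obj E"
begin

lemma pairing:
  assumes "c \<in> Obj C" "x \<in> nob a c" "y \<in> nob b c"
  shows "pairing a b p p1 p2 c x y \<in> nob p c" "nmap p a p1 c (pairing a b p p1 p2 c x y) = x"
    "nmap p b p2 c (pairing a b p p1 p2 c x y) = y"
  using theI'[OF product_elements[OF prod ab assms]] unfolding pairing_def by auto

lemma pairing_eq:
  assumes "c \<in> Obj C" "x \<in> nob a c" "y \<in> nob b c"
    and "w \<in> nob p c" "nmap p a p1 c w = x" "nmap p b p2 c w = y"
  shows "w = pairing a b p p1 p2 c x y"
  using product_elements[OF prod ab assms(1-3)] pairing[OF assms(1-3)] assms(4-6) by blast

lemma pairing_nat: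
  assumes *: "c \<in> Obj C" "c' \<in> Obj C" "f \<in> Hom C c' c" "x \<in> nob a c" "y \<in> nob b c"
  shows "nact p c c' f (pairing a b p p1 p2 c x y) = pairing a b p p1 p2 c' (nact a c c' f x) (nact b c c' f y)"
proof -
  note v = pairing[OF *(1,4,5)]
  have p: "p \<in> Obj E" "p1 \<in> Hom E p a" "p2 \<in> Hom E p b" using prod by (auto simp: is_product_def)
  show ?thesis
    by (rule pairing_eq)
       (use * v nmap_nat[OF p(1) ab(1) p(2) *(1-3) v(1)] nmap_nat[OF p(1) ab(2) p(3) *(1-3) v(1)] ab p
         in \<open>auto intro: nact_in nmap_in[OF p(1) ab(1) p(2)] nmap_in[OF p(1) ab(2) p(3)]\<close>)
qed

end

lemma mono_elements:
  assumes m: "is_mono E u v m" and uv: "u \<in> Obj E" "v \<in> Obj E" and c: "c \<in> Obj C"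
    and x: "x \<in> nob u c" and x': "x' \<in> nob u c" and eq: "nmap u v m c x = nmap u v m c x'"
  shows "x = x'"
proof -
  have mh: "m \<in> Hom E u v" using m by (simp add: is_mono_def)
  note K = kappa_ob[OF c] and g = gen_in[OF c]
  obtain h h' where h: "h \<in> Hom E (\<kappa> c) u" "nmap (\<kappa> c) u h c (gen c) = x"
    and h': "h' \<in> Hom E (\<kappa> c) u" "nmap (\<kappa> c) u h' c (gen c) = x'"
    using elt_ex uv c x x' by meson
  have "Cmp E (\<kappa> c) u v m h = Cmp E (\<kappa> c) u v m h'"
    by (rule elt_eqI[OF uv(2) c])
       (use h h' K uv mh eq in \<open>auto simp: nmap_cmp[OF K uv(1,2) _ mh c g] intro: cat_cmp[OF cE]\<close>)
  then have "h = h'" using m h h' K unfolding is_mono_def by blast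
  then show ?thesis using h h' by simp
qed

lemma pullback_elements:
  assumes pb: "is_pullback E a b d f g p p1 p2" and ob: "a \<in> Obj E" "b \<in> Obj E" "d \<in> Obj E"
    and fg: "f \<in> Hom E a d" "g \<in> Hom E b d"
    and c: "c \<in> Obj C" and x: "x \<in> nob a c" and y: "y \<in> nob b c" and eq: "nmap a d f c x = nmap b d g c y"
  shows "\<exists>w\<in>nob p c. nmap p a p1 c w = x"
proof -
  note K = kappa_ob[OF c] and gen = gen_in[OF c]
  have p: "p \<in> Obj E" "p1 \<in> Hom E p a" using pb by (auto simp: is_pullback_def)
  obtain hx hy where hx: "hx \<in> Hom E (\<kappa> c) a" "nmap (\<kappa> c) a hx c (gen c) = x"
    and hy: "hy \<in> Hom E (\<kappa> c) b" "nmap (\<kappa> c) b hy c (gen c) = y"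
    using elt_ex ob c x y by meson
  have "Cmp E (\<kappa> c) a d f hx = Cmp E (\<kappa> c) b d g hy"
    by (rule elt_eqI[OF ob(3) c])
       (use hx hy K ob fg eq in \<open>auto simp: nmap_cmp[OF K _ _ _ _ c gen] intro: cat_cmp[OF cE]\<close>)
  then obtain h where h: "h \<in> Hom E (\<kappa> c) p" "Cmp E (\<kappa> c) p a p1 h = hx"
    using pb hx hy K unfolding is_pullback_def by metis
  have "nmap p a p1 c (nmap (\<kappa> c) p h c (gen c)) = x"
    using nmap_cmp[OF K p(1) ob(1) h(1) p(2) c gen] h hx by simp
  then show ?thesis using nmap_in[OF K p(1) h(1) c gen] by blast
qed

subsection \<open>Finite limits and exponentials\<close>

lemma E_finite_limits: "has_finite_limits E"
  by (rule has_finite_limits_reflective[OF LN.adjunction ff lL.adjunction presheaf_has_finite_limits[OF inacc cC]])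

text \<open>The exponential is \<open>L Q\<close>, where \<open>Q\<close> is the exponential of
  \<open>N b\<close> by \<open>N a\<close> in presheaves. Since \<open>L\<close> preserves the
  product \<open>Q \<times> N a\<close>, evaluation extends from \<open>Q\<close> to
  \<open>L Q\<close>, and currying the extension gives a retraction of \<open>\<eta> Q\<close>. So
  \<open>Q\<close> and \<open>L Q\<close> are isomorphic, and transposes can be formed in
  \<open>Q\<close>.\<close>

lemma exponential_exists:
  assumes a: "a \<in> Obj E" and b: "b \<in> Obj E"
  shows "\<exists>x p p1 p2 ev. is_exponential E a b x p p1 p2 ev"
proof -
  let ?A = "FOb N a" and ?B = "FOb N b"
  obtain Q \<gamma> where Q: "Q \<in> Obj PC" and "presheaf_exponential C ?A ?B Q \<gamma>"
    using exponential_presheaf[OF N_ob[OF a] N_ob[OF b]] by blast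
  then interpret \<gamma>: presheaf_exponential C ?A ?B Q \<gamma> by simp
  note LQ = L_ob[OF Q]
  obtain X \<pi>1 \<pi>2 where X: "is_product PC Q ?A X \<pi>1 \<pi>2"
    using has_product[OF presheaf_has_finite_limits[OF inacc cC] category_psh[OF cC] Q N_ob[OF a]] by blast
  then have Xo: "X \<in> Obj PC" and \<pi>: "\<pi>1 \<in> Hom PC X Q" "\<pi>2 \<in> Hom PC X ?A" by (auto simp: is_product_def)
  note \<pi>1_in = psh_hom_in[OF Xo Q \<pi>(1)] and \<pi>1_nat = psh_hom_nat[OF Xo Q \<pi>(1)]
    and \<pi>2_in = psh_hom_in[OF Xo N_ob[OF a] \<pi>(2)] and \<pi>2_nat = psh_hom_nat[OF Xo N_ob[OF a] \<pi>(2)]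
  define p where "p = FOb L X"
  define p1 where "p1 = FHom L X Q \<pi>1"
  define p2 where "p2 = Cmp E p (FOb L ?A) a (\<epsilon> a) (FHom L X ?A \<pi>2)"
  obtain \<delta> where "iso_in E a (FOb L ?A) \<delta> (\<epsilon> a)" using LN.counit_iso[OF ff a] by blast
  then have iso: "iso_in E (FOb L ?A) a (\<epsilon> a) \<delta>" by (auto simp: iso_in_def)
  have p: "is_product E (FOb L Q) a p p1 p2"
    unfolding p_def p1_def p2_def
    by (rule product_transport[OF cE right_adjoint_preserves_product[OF lL.adjunction X Q N_ob[OF a]] iso])
       (use a LQ L_ob[OF N_ob[OF a]] in auto)
  have po: "p \<in> Obj E" and p1: "p1 \<in> Hom E p (FOb L Q)" and p2: "p2 \<in> Hom E p a"
    using p by (auto simp: is_product_def)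
  have "(\<lambda>c\<in>Obj C. \<lambda>w\<in>FOb X c. \<gamma> c (\<pi>1 c w) (\<pi>2 c w)) \<in> Hom PC X ?B"
    by (rule psh_homI[OF Xo N_ob[OF b]]) (simp_all add: \<gamma>.ev_in \<gamma>.ev_nat \<pi>1_in \<pi>2_in \<pi>1_nat \<pi>2_nat)
  from eta_univ[OF Xo b this] obtain ev where ev: "ev \<in> Hom E p b"
    and ev_eta: "\<And>c w. c \<in> Obj C \<Longrightarrow> w \<in> FOb X c \<Longrightarrow> nmap p b ev c (\<eta> X c w) = \<gamma> c (\<pi>1 c w) (\<pi>2 c w)"
    by (auto simp: p_def)
  define pr where "pr = pairing (FOb L Q) a p p1 p2"
  note pr = pairing[OF p LQ a, folded pr_def] and pr_eq = pairing_eq[OF p LQ a, folded pr_def]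
    and pr_nat = pairing_nat[OF p LQ a, folded pr_def]
  \<comment> \<open>\<open>pr\<close> pairs elements of \<open>L Q\<close> and \<open>a\<close> in
    \<open>p = L X\<close>, so \<open>r0\<close> extends the evaluation \<open>\<gamma>\<close> from
    \<open>Q\<close> to all of \<open>L Q\<close>.\<close>
  define r0 where "r0 = (\<lambda>c z s. nmap p b ev c (pr c z s))"
  have r0_in: "r0 c z s \<in> nob b c" if "c \<in> Obj C" "z \<in> nob (FOb L Q) c" "s \<in> nob a c" for c z s
    unfolding r0_def by (rule nmap_in[OF po b ev that(1) pr(1)[OF that]])
  have r0_nat: "nact b c c' f (r0 c z s) = r0 c' (nact (FOb L Q) c c' f z) (nact a c c' f s)"
    if *: "c \<in> Obj C" "c' \<in> Obj C" "f \<in> Hom C c' c" "z \<in> nob (FOb L Q) c" "s \<in> nob a c" for c c' f z s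
    unfolding r0_def using nmap_nat[OF po b ev *(1-3) pr(1)[OF *(1,4,5)]] pr_nat[OF *] by simp
  have r0_eta: "r0 c (\<eta> Q c y) s = \<gamma> c y s" if *: "c \<in> Obj C" "y \<in> FOb Q c" "s \<in> nob a c" for c y s
  proof -
    obtain w where w: "w \<in> FOb X c" "\<pi>1 c w = y" "\<pi>2 c w = s"
      using presheaf_product_elements[OF Q N_ob[OF a] X *] by blast
    have "nmap p (FOb L Q) p1 c (\<eta> X c w) = \<eta> Q c y"
      unfolding p_def p1_def using eta_map[OF Xo Q \<pi>(1) *(1) w(1)] w(2) by simp
    moreover have "nmap p a p2 c (\<eta> X c w) = s"
      unfolding p_def p2_def
      using nmap_cmp[OF L_ob[OF Xo] L_ob[OF N_ob[OF a]] a L_hom[OF Xo N_ob[OF a] \<pi>(2)] LN.counit_hom[OF a] *(1) eta_in[OF Xo *(1) w(1)]]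
        eta_map[OF Xo N_ob[OF a] \<pi>(2) *(1) w(1)] eta_counit[OF a *(1,3)] w(3) by simp
    ultimately have "\<eta> X c w = pr c (\<eta> Q c y) s"
      using * by (intro pr_eq) (auto simp: eta_in Q Xo w(1) p_def)
    then show ?thesis unfolding r0_def using ev_eta[OF *(1) w(1)] w by simp
  qed
  \<comment> \<open>Currying \<open>r0\<close> sends \<open>z\<close> to an element of
    \<open>Q\<close>; the resulting function \<open>r\<close> is the retraction of
    \<open>\<eta> Q\<close>.\<close>
  have "\<exists>y\<in>FOb Q c. \<forall>c'\<in>Obj C. \<forall>f\<in>Hom C c' c. \<forall>s\<in>FOb ?A c'. \<gamma> c' (FHom Q c c' f y) s = r0 c' (nact (FOb L Q) c c' f z) s"
    if *: "c \<in> Obj C" "z \<in> nob (FOb L Q) c" for c z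
    by (rule \<gamma>.ev_ex) (use * LQ in \<open>simp_all add: r0_in r0_nat nact_in nact_cmp\<close>)
  then obtain r where r: "\<And>c z. c \<in> Obj C \<Longrightarrow> z \<in> nob (FOb L Q) c \<Longrightarrow> r c z \<in> FOb Q c"
    and rg: "\<And>c z c' f s. c \<in> Obj C \<Longrightarrow> z \<in> nob (FOb L Q) c \<Longrightarrow> c' \<in> Obj C \<Longrightarrow> f \<in> Hom C c' c \<Longrightarrow> s \<in> nob a c' \<Longrightarrow>
      \<gamma> c' (FHom Q c c' f (r c z)) s = r0 c' (nact (FOb L Q) c c' f z) s"
    by metis
  have eta_r: "\<eta> Q c (r c z) = z" if *: "c \<in> Obj C" "z \<in> nob (FOb L Q) c" for c z
  proof (rule retract_iso[OF Q r _ _ *])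
    fix c c' f z assume *: "c \<in> Obj C" "c' \<in> Obj C" "f \<in> Hom C c' c" "z \<in> nob (FOb L Q) c"
    show "FHom Q c c' f (r c z) = r c' (nact (FOb L Q) c c' f z)"
    proof (rule \<gamma>.ev_ext[OF *(2)])
      fix c'' g s assume **: "c'' \<in> Obj C" "g \<in> Hom C c'' c'" "s \<in> nob a c''"
      have "\<gamma> c'' (FHom Q c c'' (Cmp C c'' c' c f g) (r c z)) s = r0 c'' (nact (FOb L Q) c c'' (Cmp C c'' c' c f g) z) s"
        by (rule rg) (use * ** in \<open>auto intro: cat_cmp[OF cC]\<close>)
      then show "\<gamma> c'' (FHom Q c' c'' g (FHom Q c c' f (r c z))) s = \<gamma> c'' (FHom Q c' c'' g (r c' (nact (FOb L Q) c c' f z))) s"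
        using * ** by (simp add: psh_cmp[OF Q] r nact_cmp LQ rg nact_in)
    qed (use * in \<open>simp_all add: psh_act[OF Q] r nact_in LQ\<close>)
  next
    fix c y assume *: "c \<in> Obj C" "y \<in> FOb Q c"
    show "r c (\<eta> Q c y) = y"
      by (rule \<gamma>.ev_ext[OF *(1)]) (use * in \<open>simp_all add: r eta_in Q rg eta_nat r0_eta psh_act[OF Q]\<close>)
  qed
  have "is_exponential E a b (FOb L Q) p p1 p2 ev"
    unfolding is_exponential_def
  proof (intro conjI LQ p ev ballI allI impI)
    fix y q q1 q2 g assume y: "y \<in> Obj E" and q: "is_product E y a q q1 q2" and g: "g \<in> Hom E q b"
    have qo: "q \<in> Obj E" and q1: "q1 \<in> Hom E q y" and q2: "q2 \<in> Hom E q a" using q by (auto simp: is_product_def)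
    define qr where "qr = pairing y a q q1 q2"
    note qr = pairing[OF q y a, folded qr_def] and qr_eq = pairing_eq[OF q y a, folded qr_def]
      and qr_nat = pairing_nat[OF q y a, folded qr_def]
    \<comment> \<open>The transpose of \<open>g\<close>, computed in presheaves: \<open>w\<close>
      becomes the element of \<open>Q\<close> whose evaluation at \<open>s\<close> is
      \<open>g\<close> of the pair of \<open>w\<close> and \<open>s\<close>. Afterwards
      \<open>\<eta> Q\<close> carries it into \<open>L Q\<close>.\<close>
    have "\<exists>x\<in>FOb Q c. \<forall>c'\<in>Obj C. \<forall>f\<in>Hom C c' c. \<forall>s\<in>FOb ?A c'. \<gamma> c' (FHom Q c c' f x) s =
        nmap q b g c' (qr c' (nact y c c' f w) s)" if *: "c \<in> Obj C" "w \<in> nob y c" for c w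
    proof (rule \<gamma>.ev_ex[OF *(1)])
      fix c' f s assume "c' \<in> Obj C" "f \<in> Hom C c' c" "s \<in> nob a c'"
      then show "nmap q b g c' (qr c' (nact y c c' f w) s) \<in> nob b c'"
        using * by (intro nmap_in[OF qo b g] qr nact_in[OF y])
    next
      fix c' c'' f h s assume "c' \<in> Obj C" "c'' \<in> Obj C" "f \<in> Hom C c' c" "h \<in> Hom C c'' c'" "s \<in> nob a c'"
      then show "nact b c' c'' h (nmap q b g c' (qr c' (nact y c c' f w) s)) =
         nmap q b g c'' (qr c'' (nact y c c'' (Cmp C c'' c' c f h) w) (nact a c' c'' h s))"
        using * by (simp add: nmap_nat[OF qo b g] qr nact_in[OF y] qr_nat nact_cmp[OF y])
    qed
    then obtain \<alpha> where \<alpha>: "\<And>c w. c \<in> Obj C \<Longrightarrow> w \<in> nob y c \<Longrightarrow> \<alpha> c w \<in> FOb Q c"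
      and \<alpha>g: "\<And>c w c' f s. c \<in> Obj C \<Longrightarrow> w \<in> nob y c \<Longrightarrow> c' \<in> Obj C \<Longrightarrow> f \<in> Hom C c' c \<Longrightarrow> s \<in> nob a c' \<Longrightarrow>
        \<gamma> c' (FHom Q c c' f (\<alpha> c w)) s = nmap q b g c' (qr c' (nact y c c' f w) s)"
      by metis
    have \<alpha>_nat: "FHom Q c c' f (\<alpha> c w) = \<alpha> c' (nact y c c' f w)"
      if *: "c \<in> Obj C" "c' \<in> Obj C" "f \<in> Hom C c' c" "w \<in> nob y c" for c c' f w
    proof (rule \<gamma>.ev_ext[OF *(2)])
      fix c'' h s assume **: "c'' \<in> Obj C" "h \<in> Hom C c'' c'" "s \<in> nob a c''"
      have "\<gamma> c'' (FHom Q c c'' (Cmp C c'' c' c f h) (\<alpha> c w)) s = nmap q b g c'' (qr c'' (nact y c c'' (Cmp C c'' c' c f h) w) s)"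
        by (rule \<alpha>g) (use * ** in \<open>auto intro: cat_cmp[OF cC]\<close>)
      then show "\<gamma> c'' (FHom Q c' c'' h (FHom Q c c' f (\<alpha> c w))) s = \<gamma> c'' (FHom Q c' c'' h (\<alpha> c' (nact y c c' f w))) s"
        using * ** by (simp add: psh_cmp[OF Q] \<alpha> nact_cmp y \<alpha>g nact_in)
    qed (use * in \<open>simp_all add: psh_act[OF Q] \<alpha> nact_in y\<close>)
    have "\<exists>h\<in>Hom E y (FOb L Q). \<forall>c\<in>Obj C. \<forall>w\<in>nob y c. nmap y (FOb L Q) h c w = \<eta> Q c (\<alpha> c w)"
      by (rule nmap_ex[OF y LQ]) (simp_all add: eta_in Q \<alpha> eta_nat \<alpha>_nat)
    then obtain h where h: "h \<in> Hom E y (FOb L Q)"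
      and h\<alpha>: "\<And>c w. c \<in> Obj C \<Longrightarrow> w \<in> nob y c \<Longrightarrow> nmap y (FOb L Q) h c w = \<eta> Q c (\<alpha> c w)" by blast
    have hq1: "Cmp E q y (FOb L Q) h q1 \<in> Hom E q (FOb L Q)" by (rule cat_cmp[OF cE qo y LQ q1 h])
    obtain k where k: "k \<in> Hom E q p" "Cmp E q p (FOb L Q) p1 k = Cmp E q y (FOb L Q) h q1" "Cmp E q p a p2 k = q2"
      using p qo hq1 q2 unfolding is_product_def by metis
    \<comment> \<open>Any candidate \<open>h'\<close> for the transpose recovers \<open>g\<close>
      through the extended evaluation \<open>r0\<close>; uniqueness rests on this.\<close>
    have key: "nmap q b g c x = r0 c (nmap y (FOb L Q) h' c (nmap q y q1 c x)) (nmap q a q2 c x)"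
      if h': "h' \<in> Hom E y (FOb L Q)" and k': "k' \<in> Hom E q p"
        "Cmp E q p (FOb L Q) p1 k' = Cmp E q y (FOb L Q) h' q1" "Cmp E q p a p2 k' = q2" "Cmp E q p b ev k' = g"
        and c: "c \<in> Obj C" and x: "x \<in> nob q c" for h' k' c x
    proof -
      have "nmap q p k' c x = pr c (nmap y (FOb L Q) h' c (nmap q y q1 c x)) (nmap q a q2 c x)"
      proof (rule pr_eq[OF c])
        show "nmap p (FOb L Q) p1 c (nmap q p k' c x) = nmap y (FOb L Q) h' c (nmap q y q1 c x)"
          using nmap_cmp[OF qo po LQ k'(1) p1 c x] nmap_cmp[OF qo y LQ q1 h' c x] k'(2) by simp
        show "nmap p a p2 c (nmap q p k' c x) = nmap q a q2 c x"
          using nmap_cmp[OF qo po a k'(1) p2 c x] k'(3) by simp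
      qed (use c x h' k' q1 q2 y LQ qo po a in \<open>auto intro: nmap_in\<close>)
      then show ?thesis using nmap_cmp[OF qo po b k'(1) ev c x] k'(4) by (simp add: r0_def)
    qed
    show "\<exists>!h. h \<in> Hom E y (FOb L Q) \<and> (\<exists>k\<in>Hom E q p. Cmp E q p (FOb L Q) p1 k = Cmp E q y (FOb L Q) h q1 \<and>
        Cmp E q p a p2 k = q2 \<and> Cmp E q p b ev k = g)"
    proof (rule ex1I[of _ h], intro conjI h bexI[OF _ k(1)] k(2,3))
      show "Cmp E q p b ev k = g"
      proof (rule nmap_eqI[OF qo b cat_cmp[OF cE qo po b k(1) ev] g])
        fix c x assume c: "c \<in> Obj C" and x: "x \<in> nob q c"
        let ?w = "nmap q y q1 c x" and ?s = "nmap q a q2 c x"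
        have w: "?w \<in> nob y c" and s: "?s \<in> nob a c" using c x q1 q2 y qo a by (auto intro: nmap_in)
        have "nmap q p k c x = pr c (nmap y (FOb L Q) h c ?w) ?s"
        proof (rule pr_eq[OF c])
          show "nmap p (FOb L Q) p1 c (nmap q p k c x) = nmap y (FOb L Q) h c ?w"
            using nmap_cmp[OF qo po LQ k(1) p1 c x] nmap_cmp[OF qo y LQ q1 h c x] k(2) by simp
          show "nmap p a p2 c (nmap q p k c x) = ?s"
            using nmap_cmp[OF qo po a k(1) p2 c x] k(3) by simp
        qed (use c x h k q1 q2 y LQ qo po a in \<open>auto intro: nmap_in\<close>)
        then have "nmap q b (Cmp E q p b ev k) c x = r0 c (\<eta> Q c (\<alpha> c ?w)) ?s"
          using nmap_cmp[OF qo po b k(1) ev c x] h\<alpha>[OF c w] by (simp add: r0_def)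
        also have "\<dots> = \<gamma> c (FHom Q c c (Ide C c) (\<alpha> c ?w)) ?s"
          using c w s by (simp add: r0_eta \<alpha> psh_ide[OF Q])
        also have "\<dots> = nmap q b g c (qr c ?w ?s)"
          using \<alpha>g[OF c w c cat_ide[OF cC c] s] nact_ide[OF y c w] by simp
        also have "qr c ?w ?s = x" using qr_eq[OF c w s x] by simp
        finally show "nmap q b (Cmp E q p b ev k) c x = nmap q b g c x" .
      qed
    next
      fix h' assume "h' \<in> Hom E y (FOb L Q) \<and> (\<exists>k\<in>Hom E q p. Cmp E q p (FOb L Q) p1 k = Cmp E q y (FOb L Q) h' q1 \<and>
        Cmp E q p a p2 k = q2 \<and> Cmp E q p b ev k = g)"
      then obtain k' where h': "h' \<in> Hom E y (FOb L Q)" and k': "k' \<in> Hom E q p"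
        "Cmp E q p (FOb L Q) p1 k' = Cmp E q y (FOb L Q) h' q1" "Cmp E q p a p2 k' = q2" "Cmp E q p b ev k' = g" by blast
      show "h' = h"
      proof (rule nmap_eqI[OF y LQ h' h])
        fix c w assume c: "c \<in> Obj C" and w: "w \<in> nob y c"
        let ?z = "nmap y (FOb L Q) h' c w"
        have z: "?z \<in> nob (FOb L Q) c" by (rule nmap_in[OF y LQ h' c w])
        have "r c ?z = \<alpha> c w"
        proof (rule \<gamma>.ev_ext[OF c r[OF c z] \<alpha>[OF c w]])
          fix c' f s assume *: "c' \<in> Obj C" "f \<in> Hom C c' c" "s \<in> nob a c'"
          have w': "nact y c c' f w \<in> nob y c'" using * c w by (simp add: nact_in y)
          note v = qr[OF *(1) w' *(3)]
          have "r0 c' (nact (FOb L Q) c c' f ?z) s = nmap q b g c' (qr c' (nact y c c' f w) s)"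
            using key[OF h' k' *(1) v(1)] v nmap_nat[OF y LQ h' c *(1,2) w] by simp
          then show "\<gamma> c' (FHom Q c c' f (r c ?z)) s = \<gamma> c' (FHom Q c c' f (\<alpha> c w)) s"
            using * c w z by (simp add: rg \<alpha>g)
        qed
        then show "?z = nmap y (FOb L Q) h c w" using eta_r[OF c z] h\<alpha>[OF c w] by simp
      qed
    qed
  qed
  then show ?thesis by blast
qed

subsection \<open>The subobject classifier\<close>

text \<open>\<open>D c\<close> generates the smallest sieve on \<open>c\<close> whose inclusion into \<open>rep C c\<close> is inverted by \<open>L\<close>.\<close>

definition D :: "'c \<Rightarrow> 'c \<Rightarrow> 'u set" where
  "D c c' = (if c \<in> Obj C \<and> c' \<in> Obj C then \<zeta> (rep C c) c' ` FOb (FOb l (\<kappa> c)) c' else {})"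

lemma zeta_hom: "c \<in> Obj C \<Longrightarrow> \<zeta> (rep C c) \<in> Hom PC (FOb l (\<kappa> c)) (rep C c)"
  unfolding \<kappa>_def by (rule lL.counit_hom[OF rep_ob])

lemma D_hom: "D c c' \<subseteq> Hom C c' c"
  using psh_hom_in[OF l_ob[OF kappa_ob] rep_ob zeta_hom] by (auto simp: D_def)

text \<open>View \<open>x\<close> and \<open>x'\<close> as maps from \<open>rep C c\<close> to
  \<open>P\<close>. Agreement on \<open>D c\<close> says that their composites with
  \<open>\<zeta>\<close> agree. By naturality of \<open>\<zeta>\<close> these composites are the
  transposes, under \<open>l\<close> and \<open>L\<close>, of the images of the two maps under
  \<open>L\<close>, and those are determined by the elements \<open>\<eta> P c x\<close> and
  \<open>\<eta> P c x'\<close>.\<close>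

lemma yon_zeta_iff:
  assumes P: "P \<in> Obj PC" and c: "c \<in> Obj C" and x: "x \<in> FOb P c" and x': "x' \<in> FOb P c"
  shows "(\<forall>c'\<in>Obj C. \<forall>d\<in>D c c'. FHom P c c' d x = FHom P c c' d x') \<longleftrightarrow> \<eta> P c x = \<eta> P c x'" (is "?l \<longleftrightarrow> ?r")
proof -
  let ?R = "rep C c"
  note R = rep_ob[OF c] and K = kappa_ob[OF c] and LP = L_ob[OF P] and lK = l_ob[OF kappa_ob[OF c]]
  define \<alpha> where "\<alpha> = (\<lambda>x. yon C P c x)"
  have \<alpha>: "\<alpha> x \<in> Hom PC ?R P" if "x \<in> FOb P c" for x unfolding \<alpha>_def by (rule yon_hom[OF P c that])
  have L\<alpha>: "FHom L ?R P (\<alpha> x) \<in> Hom E (\<kappa> c) (FOb L P)" if "x \<in> FOb P c" for x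
    unfolding \<kappa>_def by (rule L_hom[OF R P \<alpha>[OF that]])
  have cmp: "Cmp PC (FOb l (\<kappa> c)) ?R P (\<alpha> x) (\<zeta> ?R) =
     Cmp PC (FOb l (\<kappa> c)) (FOb l (FOb L P)) P (\<zeta> P) (FHom l (\<kappa> c) (FOb L P) (FHom L ?R P (\<alpha> x)))"
    if "x \<in> FOb P c" for x
    using lL.counit_nat[OF R P \<alpha>[OF that]] by (simp add: \<kappa>_def)
  have "?l \<longleftrightarrow> Cmp PC (FOb l (\<kappa> c)) ?R P (\<alpha> x) (\<zeta> ?R) = Cmp PC (FOb l (\<kappa> c)) ?R P (\<alpha> x') (\<zeta> ?R)"
  proof
    assume l: ?l
    show "Cmp PC (FOb l (\<kappa> c)) ?R P (\<alpha> x) (\<zeta> ?R) = Cmp PC (FOb l (\<kappa> c)) ?R P (\<alpha> x') (\<zeta> ?R)"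
    proof (rule psh_hom_eqI[OF lK P])
      show "Cmp PC (FOb l (\<kappa> c)) ?R P (\<alpha> x) (\<zeta> ?R) \<in> Hom PC (FOb l (\<kappa> c)) P"
        "Cmp PC (FOb l (\<kappa> c)) ?R P (\<alpha> x') (\<zeta> ?R) \<in> Hom PC (FOb l (\<kappa> c)) P"
        using \<alpha> x x' by (auto intro: cat_cmp[OF category_psh[OF cC] lK R P zeta_hom[OF c]])
      fix c' w assume *: "c' \<in> Obj C" "w \<in> FOb (FOb l (\<kappa> c)) c'"
      have d: "\<zeta> ?R c' w \<in> D c c'" using * c by (simp add: D_def)
      then have "\<zeta> ?R c' w \<in> Hom C c' c" using D_hom by blast
      then show "Cmp PC (FOb l (\<kappa> c)) ?R P (\<alpha> x) (\<zeta> ?R) c' w = Cmp PC (FOb l (\<kappa> c)) ?R P (\<alpha> x') (\<zeta> ?R) c' w"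
        using l * d by (simp add: \<alpha>_def)
    qed
  next
    assume r: "Cmp PC (FOb l (\<kappa> c)) ?R P (\<alpha> x) (\<zeta> ?R) = Cmp PC (FOb l (\<kappa> c)) ?R P (\<alpha> x') (\<zeta> ?R)"
    show ?l
    proof (intro ballI)
      fix c' d assume *: "c' \<in> Obj C" "d \<in> D c c'"
      then obtain w where w: "w \<in> FOb (FOb l (\<kappa> c)) c'" "d = \<zeta> ?R c' w" using c by (auto simp: D_def)
      have "d \<in> Hom C c' c" using * D_hom by blast
      then show "FHom P c c' d x = FHom P c c' d x'"
        using fun_cong[OF fun_cong[OF r], of c' w] w * by (simp add: \<alpha>_def)
    qed
  qed
  also have "\<dots> \<longleftrightarrow> FHom L ?R P (\<alpha> x) = FHom L ?R P (\<alpha> x')"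
    unfolding cmp[OF x] cmp[OF x'] using lL.right_eqI[OF K P L\<alpha>[OF x] L\<alpha>[OF x']] by auto
  also have "\<dots> \<longleftrightarrow> ?r"
  proof
    have ev: "nmap (\<kappa> c) (FOb L P) (FHom L ?R P (\<alpha> x)) c (gen c) = \<eta> P c x" if "x \<in> FOb P c" for x
      using eta_map[OF R P \<alpha>[OF that] c] c cat_ide[OF cC c] psh_ide[OF P c that]
      by (simp add: \<kappa>_def gen_def) (simp add: \<alpha>_def)
    show "FHom L ?R P (\<alpha> x) = FHom L ?R P (\<alpha> x') \<Longrightarrow> \<eta> P c x = \<eta> P c x'" using ev x x' by metis
    show "\<eta> P c x = \<eta> P c x' \<Longrightarrow> FHom L ?R P (\<alpha> x) = FHom L ?R P (\<alpha> x')"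
      by (rule elt_eqI[OF LP c L\<alpha>[OF x] L\<alpha>[OF x']]) (simp add: ev x x')
  qed
  finally show ?thesis .
qed

text \<open>At \<open>N v\<close> the unit is injective, being split by the counit.\<close>

lemma D_separated:
  assumes v: "v \<in> Obj E" and c: "c \<in> Obj C" and x: "x \<in> nob v c" "x' \<in> nob v c"
    and eq: "\<And>c' d. c' \<in> Obj C \<Longrightarrow> d \<in> D c c' \<Longrightarrow> nact v c c' d x = nact v c c' d x'"
  shows "x = x'"
proof -
  have "\<eta> (FOb N v) c x = \<eta> (FOb N v) c x'" using yon_zeta_iff[OF N_ob[OF v] c x] eq by blast
  then show ?thesis using eta_counit[OF v c] x by metis
qed

text \<open>Naturality of \<open>\<zeta>\<close> along \<open>f\<close>: the element of
  \<open>l (\<kappa> c')\<close> lying over \<open>d\<close> is carried to an element of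
  \<open>l (\<kappa> c)\<close> lying over the composite.\<close>

lemma D_ideal:
  assumes c: "c \<in> Obj C" "c' \<in> Obj C" "c'' \<in> Obj C" and f: "f \<in> Hom C c' c" and d: "d \<in> D c' c''"
  shows "Cmp C c'' c' c f d \<in> D c c''"
proof -
  note R = rep_ob[OF c(1)] rep_ob[OF c(2)]
  define \<alpha> where "\<alpha> = yon C (rep C c) c' f"
  have \<alpha>: "\<alpha> \<in> Hom PC (rep C c') (rep C c)" unfolding \<alpha>_def by (rule yon_hom[OF R(1) c(2)]) (use c f in simp)
  define \<beta> where "\<beta> = FHom l (\<kappa> c') (\<kappa> c) (FHom L (rep C c') (rep C c) \<alpha>)"
  have \<beta>: "\<beta> \<in> Hom PC (FOb l (\<kappa> c')) (FOb l (\<kappa> c))"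
    unfolding \<beta>_def \<kappa>_def by (intro l_hom L_hom L_ob R \<alpha>)
  obtain w where w: "w \<in> FOb (FOb l (\<kappa> c')) c''" "d = \<zeta> (rep C c') c'' w" using d c by (auto simp: D_def)
  have dh: "d \<in> Hom C c'' c'" using d D_hom by blast
  have "Cmp PC (FOb l (\<kappa> c')) (FOb l (\<kappa> c)) (rep C c) (\<zeta> (rep C c)) \<beta> =
    Cmp PC (FOb l (\<kappa> c')) (rep C c') (rep C c) \<alpha> (\<zeta> (rep C c'))"
    unfolding \<beta>_def \<kappa>_def by (rule lL.counit_nat[OF R(2,1) \<alpha>])
  from fun_cong[OF fun_cong[OF this], of c'' w] have "\<zeta> (rep C c) c'' (\<beta> c'' w) = \<alpha> c'' d"
    using w c by simp
  also have "\<dots> = Cmp C c'' c' c f d" using c f dh by (simp add: \<alpha>_def)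
  finally have "Cmp C c'' c' c f d = \<zeta> (rep C c) c'' (\<beta> c'' w)" by simp
  moreover have "\<beta> c'' w \<in> FOb (FOb l (\<kappa> c)) c''"
    using psh_hom_in[OF l_ob[OF kappa_ob] l_ob[OF kappa_ob] \<beta>] c w by blast
  ultimately show ?thesis using c by (simp add: D_def)
qed

text \<open>Subobjects in \<open>E\<close> are closed. Lifting \<open>x\<close> over the smallest
  covering sieve gives a transformation from \<open>l (\<kappa> c)\<close> to \<open>N u\<close>. It
  is the transpose of a morphism from \<open>\<kappa> c\<close> to \<open>L (N u)\<close>, and the
  counit turns the element represented by that morphism into a preimage of \<open>x\<close>.\<close>

lemma mono_closed:
  assumes m: "is_mono E u v m" and uv: "u \<in> Obj E" "v \<in> Obj E" and c: "c \<in> Obj C" and x: "x \<in> nob v c"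
    and D: "\<And>c' d. c' \<in> Obj C \<Longrightarrow> d \<in> D c c' \<Longrightarrow> nact v c c' d x \<in> nmap u v m c' ` nob u c'"
  shows "x \<in> nmap u v m c ` nob u c"
proof -
  let ?R = "rep C c" and ?Nu = "FOb N u" and ?Nv = "FOb N v"
  have mh: "m \<in> Hom E u v" using m by (simp add: is_mono_def)
  note R = rep_ob[OF c] and K = kappa_ob[OF c] and lK = l_ob[OF kappa_ob[OF c]] and Nu = N_ob[OF uv(1)] and Nv = N_ob[OF uv(2)]
  note z_in = psh_hom_in[OF lK R zeta_hom[OF c]] and z_nat = psh_hom_nat[OF lK R zeta_hom[OF c]]
  define \<psi> where "\<psi> = (\<lambda>c' w. inv_into (nob u c') (nmap u v m c') (nact v c c' (\<zeta> ?R c' w) x))"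
  have zD: "\<zeta> ?R c' w \<in> D c c'" "\<zeta> ?R c' w \<in> Hom C c' c" if "c' \<in> Obj C" "w \<in> FOb (FOb l (\<kappa> c)) c'" for c' w
    using that c z_in[of c' w] by (auto simp: D_def)
  have \<psi>: "\<psi> c' w \<in> nob u c'" "nmap u v m c' (\<psi> c' w) = nact v c c' (\<zeta> ?R c' w) x"
    if "c' \<in> Obj C" "w \<in> FOb (FOb l (\<kappa> c)) c'" for c' w
    using D[OF that(1) zD(1)[OF that]] unfolding \<psi>_def by (auto intro: inv_into_into f_inv_into_f)
  define \<Psi> where "\<Psi> = (\<lambda>c'\<in>Obj C. \<lambda>w\<in>FOb (FOb l (\<kappa> c)) c'. \<psi> c' w)"
  \<comment> \<open>The choices made by \<open>inv_into\<close> are natural because \<open>m\<close>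
    is injective on elements.\<close>
  have \<Psi>: "\<Psi> \<in> Hom PC (FOb l (\<kappa> c)) ?Nu"
    unfolding \<Psi>_def
  proof (rule psh_homI[OF lK Nu \<psi>(1)])
    fix a b f w assume *: "a \<in> Obj C" "b \<in> Obj C" "f \<in> Hom C b a" "w \<in> FOb (FOb l (\<kappa> c)) a"
    have w': "FHom (FOb l (\<kappa> c)) a b f w \<in> FOb (FOb l (\<kappa> c)) b" by (rule psh_act[OF lK *])
    show "nact u a b f (\<psi> a w) = \<psi> b (FHom (FOb l (\<kappa> c)) a b f w)"
    proof (rule mono_elements[OF m uv *(2) nact_in[OF uv(1) *(1-3) \<psi>(1)[OF *(1,4)]] \<psi>(1)[OF *(2) w']])
      have "nmap u v m b (nact u a b f (\<psi> a w)) = nact v a b f (nact v c a (\<zeta> ?R a w) x)"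
        using nmap_nat[OF uv mh *(1-3) \<psi>(1)[OF *(1,4)]] \<psi>(2)[OF *(1,4)] by simp
      also have "\<dots> = nact v c b (Cmp C b a c (\<zeta> ?R a w) f) x"
        using nact_cmp[OF uv(2) c *(1,2) zD(2)[OF *(1,4)] *(3) x] by simp
      also have "Cmp C b a c (\<zeta> ?R a w) f = \<zeta> ?R b (FHom (FOb l (\<kappa> c)) a b f w)"
        using z_nat[OF *] zD(2)[OF *(1,4)] * by simp
      finally show "nmap u v m b (nact u a b f (\<psi> a w)) = nmap u v m b (\<psi> b (FHom (FOb l (\<kappa> c)) a b f w))"
        using \<psi>(2)[OF *(2) w'] by simp
    qed
  qed
  let ?LNu = "FOb L ?Nu" and ?LNv = "FOb L ?Nv"
  note LNu = L_ob[OF Nu] and LNv = L_ob[OF Nv]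
  obtain k where k: "k \<in> Hom E (\<kappa> c) ?LNu"
    and k\<Psi>: "Cmp PC (FOb l (\<kappa> c)) (FOb l ?LNu) ?Nu (\<zeta> ?Nu) (FHom l (\<kappa> c) ?LNu k) = \<Psi>"
    using lL.transpose_right[OF K Nu \<Psi>] by blast
  define \<alpha> where "\<alpha> = yon C ?Nv c x"
  have \<alpha>: "\<alpha> \<in> Hom PC ?R ?Nv" unfolding \<alpha>_def by (rule yon_hom[OF Nv c x])
  define Nm where "Nm = nmap u v m"
  have Nm: "Nm \<in> Hom PC ?Nu ?Nv" unfolding Nm_def by (rule N_hom[OF uv mh])
  define LNm where "LNm = FHom L ?Nu ?Nv Nm"
  have LNm: "LNm \<in> Hom E ?LNu ?LNv" unfolding LNm_def by (rule L_hom[OF Nu Nv Nm])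
  have L\<alpha>: "FHom L ?R ?Nv \<alpha> \<in> Hom E (\<kappa> c) ?LNv" unfolding \<kappa>_def by (rule L_hom[OF R Nv \<alpha>])
  note cP = category_psh[OF cC]
  \<comment> \<open>Both sides are compared after transposition along \<open>l\<close> and
    \<open>L\<close>: there the claim becomes that \<open>\<Psi>\<close>, followed by
    \<open>m\<close>, is \<open>x\<close> restricted along \<open>\<zeta>\<close>.\<close>
  have "Cmp E (\<kappa> c) ?LNu ?LNv LNm k = FHom L ?R ?Nv \<alpha>"
  proof (rule lL.right_eqI[OF K Nv cat_cmp[OF cE K LNu LNv k LNm] L\<alpha>])
    have "Cmp PC (FOb l (\<kappa> c)) (FOb l ?LNv) ?Nv (\<zeta> ?Nv) (FHom l (\<kappa> c) ?LNv (Cmp E (\<kappa> c) ?LNu ?LNv LNm k)) =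
      Cmp PC (FOb l (\<kappa> c)) (FOb l ?LNu) ?Nv (Cmp PC (FOb l ?LNu) (FOb l ?LNv) ?Nv (\<zeta> ?Nv) (FHom l ?LNu ?LNv LNm)) (FHom l (\<kappa> c) ?LNu k)"
      using K LNu LNv Nv k LNm by (simp add: lL.adj_simps cat_assoc)
    also have "\<dots> = Cmp PC (FOb l (\<kappa> c)) ?Nu ?Nv Nm \<Psi>"
      unfolding LNm_def lL.counit_nat[OF Nu Nv Nm] k\<Psi>[symmetric]
      by (rule cat_assoc[OF cP lK l_ob[OF LNu] Nu Nv l_hom[OF K LNu k] lL.counit_hom[OF Nu] Nm])
    also have "\<dots> = Cmp PC (FOb l (\<kappa> c)) ?R ?Nv \<alpha> (\<zeta> ?R)"
    proof (rule psh_hom_eqI[OF lK Nv cat_cmp[OF cP lK Nu Nv \<Psi> Nm] cat_cmp[OF cP lK R Nv zeta_hom[OF c] \<alpha>]])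
      fix c' w assume *: "c' \<in> Obj C" "w \<in> FOb (FOb l (\<kappa> c)) c'"
      then show "Cmp PC (FOb l (\<kappa> c)) ?Nu ?Nv Nm \<Psi> c' w = Cmp PC (FOb l (\<kappa> c)) ?R ?Nv \<alpha> (\<zeta> ?R) c' w"
        using \<psi>(2)[OF *] zD(2)[OF *] by (simp add: \<Psi>_def Nm_def \<alpha>_def)
    qed
    also have "\<dots> = Cmp PC (FOb l (\<kappa> c)) (FOb l ?LNv) ?Nv (\<zeta> ?Nv) (FHom l (\<kappa> c) ?LNv (FHom L ?R ?Nv \<alpha>))"
      using lL.counit_nat[OF R Nv \<alpha>] by (simp add: \<kappa>_def)
    finally show "Cmp PC (FOb l (\<kappa> c)) (FOb l ?LNv) ?Nv (\<zeta> ?Nv) (FHom l (\<kappa> c) ?LNv (Cmp E (\<kappa> c) ?LNu ?LNv LNm k)) =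
      Cmp PC (FOb l (\<kappa> c)) (FOb l ?LNv) ?Nv (\<zeta> ?Nv) (FHom l (\<kappa> c) ?LNv (FHom L ?R ?Nv \<alpha>))" .
  qed
  moreover define z where "z = nmap (\<kappa> c) ?LNu k c (gen c)"
  ultimately have z1: "nmap ?LNu ?LNv LNm c z = \<eta> ?Nv c x"
    using nmap_cmp[OF K LNu LNv k LNm c gen_in[OF c]] eta_map[OF R Nv \<alpha> c] c cat_ide[OF cC c] nact_ide[OF uv(2) c x]
    by (simp add: gen_def \<kappa>_def \<alpha>_def)
  have z: "z \<in> nob ?LNu c" unfolding z_def by (rule nmap_in[OF K LNu k c gen_in[OF c]])
  define y where "y = nmap ?LNu u (\<epsilon> u) c z"
  have y: "y \<in> nob u c" unfolding y_def by (rule nmap_in[OF LNu uv(1) LN.counit_hom[OF uv(1)] c z])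
  have "nmap u v m c y = nmap ?LNu v (Cmp E ?LNu u v m (\<epsilon> u)) c z"
    unfolding y_def by (rule nmap_cmp[OF LNu uv LN.counit_hom[OF uv(1)] mh c z, symmetric])
  also have "\<dots> = nmap ?LNv v (\<epsilon> v) c (nmap ?LNu ?LNv LNm c z)"
    unfolding LNm_def Nm_def LN.counit_nat[OF uv mh, symmetric]
    by (rule nmap_cmp[OF LNu LNv uv(2) _ LN.counit_hom[OF uv(2)] c z]) (use LNm in \<open>simp add: LNm_def Nm_def\<close>)
  also have "\<dots> = x" unfolding z1 by (rule eta_counit[OF uv(2) c x])
  finally show ?thesis using y by blast
qed

text \<open>The classifier is \<open>L \<Omega>\<close> for the presheaf \<open>\<Omega>\<close> of
  closed sieves, and \<open>\<eta> \<Omega>\<close> is invertible: its retraction sends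
  \<open>z\<close> to the sieve of all \<open>f\<close> along which \<open>z\<close> becomes true,
  and this sieve is closed because elements of objects of \<open>E\<close> are determined by their
  restrictions along \<open>D\<close>.\<close>

lemma subobject_classifier_exists: "\<exists>one \<omega> t. is_subobject_classifier E one \<omega> t"
proof -
  obtain \<Omega> tr where \<Omega>: "\<Omega> \<in> Obj PC" and "closed_sieves C D \<Omega> tr"
    using closed_sieve_presheaf[of D, OF D_hom] by blast
  then interpret \<Omega>: closed_sieves C D \<Omega> tr by simp
  define \<omega> where "\<omega> = FOb L \<Omega>"
  have \<omega>: "\<omega> \<in> Obj E" unfolding \<omega>_def by (rule L_ob[OF \<Omega>])
  have eta [simp]: "\<eta> \<Omega> c y \<in> nob \<omega> c" if "c \<in> Obj C" "y \<in> FOb \<Omega> c" for c y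
    unfolding \<omega>_def by (rule eta_in[OF \<Omega> that])
  have eta_nat: "nact \<omega> c c' f (\<eta> \<Omega> c y) = \<eta> \<Omega> c' (FHom \<Omega> c c' f y)"
    if "c \<in> Obj C" "c' \<in> Obj C" "f \<in> Hom C c' c" "y \<in> FOb \<Omega> c" for c c' f y
    unfolding \<omega>_def by (rule eta_nat[OF \<Omega> that])
  \<comment> \<open>Half of the injectivity of \<open>\<eta>\<close> on \<open>\<Omega>\<close>:
    sieves with the same image agree on the composites of \<open>f\<close> with members of
    \<open>D\<close>, and closedness carries membership over to \<open>f\<close> itself.\<close>
  have eta_le: "FHom \<Omega> c c' f y' = tr c'"
    if *: "c \<in> Obj C" "y \<in> FOb \<Omega> c" "y' \<in> FOb \<Omega> c" "\<eta> \<Omega> c y = \<eta> \<Omega> c y'"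
      and f: "c' \<in> Obj C" "f \<in> Hom C c' c" "FHom \<Omega> c c' f y = tr c'" for c y y' c' f
  proof (rule \<Omega>.closed[OF *(1,3) f(1,2)])
    fix c'' d assume d: "c'' \<in> Obj C" "d \<in> D c' c''"
    then have dh: "d \<in> Hom C c'' c'" using D_hom by blast
    have "FHom \<Omega> c c'' (Cmp C c'' c' c f d) y' = FHom \<Omega> c c'' (Cmp C c'' c' c f d) y"
      using yon_zeta_iff[OF \<Omega> *(1-3)] *(4) D_ideal[OF *(1) f(1) d(1) f(2) d(2)] d(1) by simp
    also have "\<dots> = tr c''"
      using psh_cmp[OF \<Omega> *(1) f(1) d(1) f(2) dh *(2)] f(3) \<Omega>.tr_nat[OF f(1) d(1) dh] by simp
    finally show "FHom \<Omega> c c'' (Cmp C c'' c' c f d) y' = tr c''" .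
  qed
  have eta_inj: "y = y'" if "c \<in> Obj C" "y \<in> FOb \<Omega> c" "y' \<in> FOb \<Omega> c" "\<eta> \<Omega> c y = \<eta> \<Omega> c y'" for c y y'
    by (rule \<Omega>.sieve_ext[OF that(1-3)]) (use eta_le that in metis)
  define tt where "tt = (\<lambda>c. \<eta> \<Omega> c (tr c))"
  have tt: "tt c \<in> nob \<omega> c" if "c \<in> Obj C" for c using that by (simp add: tt_def \<Omega>.tr_in)
  have tt_nat: "nact \<omega> c c' f (tt c) = tt c'" if "c \<in> Obj C" "c' \<in> Obj C" "f \<in> Hom C c' c" for c c' f
    using that by (simp add: tt_def eta_nat \<Omega>.tr_in \<Omega>.tr_nat)
  have "\<exists>y\<in>FOb \<Omega> c. \<forall>c'\<in>Obj C. \<forall>f\<in>Hom C c' c. FHom \<Omega> c c' f y = tr c' \<longleftrightarrow> nact \<omega> c c' f z = tt c'"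
    if *: "c \<in> Obj C" "z \<in> nob \<omega> c" for c z
  proof (rule \<Omega>.sieve_ex[OF *(1)])
    fix c' c'' f g assume "c' \<in> Obj C" "c'' \<in> Obj C" "f \<in> Hom C c' c" "g \<in> Hom C c'' c'" "nact \<omega> c c' f z = tt c'"
    then show "nact \<omega> c c'' (Cmp C c'' c' c f g) z = tt c''" using * by (simp add: nact_cmp \<omega> tt_nat)
  next
    fix c' f assume f: "c' \<in> Obj C" "f \<in> Hom C c' c"
      and all: "\<And>c'' d. c'' \<in> Obj C \<Longrightarrow> d \<in> D c' c'' \<Longrightarrow> nact \<omega> c c'' (Cmp C c'' c' c f d) z = tt c''"
    show "nact \<omega> c c' f z = tt c'"
    proof (rule D_separated[OF \<omega> f(1) nact_in[OF \<omega> *(1) f *(2)] tt[OF f(1)]])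
      fix c'' d assume d: "c'' \<in> Obj C" "d \<in> D c' c''"
      then have "d \<in> Hom C c'' c'" using D_hom by blast
      then show "nact \<omega> c' c'' d (nact \<omega> c c' f z) = nact \<omega> c' c'' d (tt c')"
        using all[OF d] d f * nact_cmp[OF \<omega> *(1) f(1) d(1) f(2) _ *(2)] by (simp add: tt_nat)
    qed
  qed
  then obtain r where r: "\<And>c z. c \<in> Obj C \<Longrightarrow> z \<in> nob \<omega> c \<Longrightarrow> r c z \<in> FOb \<Omega> c"
    and rt: "\<And>c z c' f. c \<in> Obj C \<Longrightarrow> z \<in> nob \<omega> c \<Longrightarrow> c' \<in> Obj C \<Longrightarrow> f \<in> Hom C c' c \<Longrightarrow>
      FHom \<Omega> c c' f (r c z) = tr c' \<longleftrightarrow> nact \<omega> c c' f z = tt c'"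
    by metis
  have eta_tt: "\<eta> \<Omega> c y = tt c \<longleftrightarrow> y = tr c" if "c \<in> Obj C" "y \<in> FOb \<Omega> c" for c y
    using eta_inj[OF that \<Omega>.tr_in[OF that(1)]] by (auto simp: tt_def)
  have eta_r: "\<eta> \<Omega> c (r c z) = z" if *: "c \<in> Obj C" "z \<in> nob \<omega> c" for c z
  proof (rule retract_iso[OF \<Omega> r[unfolded \<omega>_def] _ _ *[unfolded \<omega>_def]])
    fix c c' f z assume *: "c \<in> Obj C" "c' \<in> Obj C" "f \<in> Hom C c' c" "z \<in> nob (FOb L \<Omega>) c"
    show "FHom \<Omega> c c' f (r c z) = r c' (nact (FOb L \<Omega>) c c' f z)"
    proof (rule \<Omega>.sieve_ext[OF *(2)])
      fix c'' g assume **: "c'' \<in> Obj C" "g \<in> Hom C c'' c'"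
      have fg: "Cmp C c'' c' c f g \<in> Hom C c'' c" using * ** by (intro cat_cmp[OF cC])
      show "FHom \<Omega> c' c'' g (FHom \<Omega> c c' f (r c z)) = tr c'' \<longleftrightarrow> FHom \<Omega> c' c'' g (r c' (nact (FOb L \<Omega>) c c' f z)) = tr c''"
        using * ** rt[OF *(1) _ **(1) fg, of z] by (simp add: \<omega>_def[symmetric] psh_cmp[OF \<Omega>] r rt nact_in \<omega> nact_cmp)
    qed (use * in \<open>simp_all add: \<omega>_def[symmetric] psh_act[OF \<Omega>] r nact_in \<omega>\<close>)
  next
    fix c y assume *: "c \<in> Obj C" "y \<in> FOb \<Omega> c"
    show "r c (\<eta> \<Omega> c y) = y"
      by (rule \<Omega>.sieve_ext[OF *(1)]) (use * in \<open>simp_all add: r rt eta_nat eta_tt psh_act[OF \<Omega>]\<close>)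
  qed
  obtain one where one: "is_terminal E one" using has_terminal[OF E_finite_limits cE] ..
  then have oneo: "one \<in> Obj E" by (simp add: is_terminal_def)
  \<comment> \<open>An element of the terminal object over \<open>c\<close> is needed below, where
    \<open>pullback_elements\<close> asks for an element mapped to the value true.\<close>
  have one_ex: "\<exists>x. x \<in> nob one c" if c: "c \<in> Obj C" for c
  proof -
    obtain h where "h \<in> Hom E (\<kappa> c) one" using one kappa_ob[OF c] by (auto simp: is_terminal_def)
    then show ?thesis using nmap_in[OF kappa_ob[OF c] oneo _ c gen_in[OF c]] by blast
  qed
  have "\<exists>t\<in>Hom E one \<omega>. \<forall>c\<in>Obj C. \<forall>x\<in>nob one c. nmap one \<omega> t c x = tt c"
    by (rule nmap_ex[OF oneo \<omega>]) (simp_all add: tt tt_nat)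
  then obtain t where t: "t \<in> Hom E one \<omega>"
    and t_app: "\<And>c x. c \<in> Obj C \<Longrightarrow> x \<in> nob one c \<Longrightarrow> nmap one \<omega> t c x = tt c" by blast
  have "is_subobject_classifier E one \<omega> t"
    unfolding is_subobject_classifier_def
  proof (intro conjI one \<omega> t ballI allI impI)
    fix u v m assume u: "u \<in> Obj E" and v: "v \<in> Obj E" and m: "is_mono E u v m"
    have mh: "m \<in> Hom E u v" using m by (simp add: is_mono_def)
    define im where "im = (\<lambda>c. nmap u v m c ` nob u c)"
    have im_act: "nact v c c' f x \<in> im c'" if "c \<in> Obj C" "c' \<in> Obj C" "f \<in> Hom C c' c" "x \<in> im c" for c c' f x
      using that by (auto simp: im_def nmap_nat[OF u v mh] nact_in[OF u])
    \<comment> \<open>The characteristic sieve of \<open>x\<close>: all \<open>f\<close> along which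
      \<open>x\<close> enters the image of \<open>m\<close>. It is closed by
      \<open>mono_closed\<close>.\<close>
    have "\<exists>y\<in>FOb \<Omega> c. \<forall>c'\<in>Obj C. \<forall>f\<in>Hom C c' c. FHom \<Omega> c c' f y = tr c' \<longleftrightarrow> nact v c c' f x \<in> im c'"
      if *: "c \<in> Obj C" "x \<in> nob v c" for c x
    proof (rule \<Omega>.sieve_ex[OF *(1)])
      fix c' c'' f g assume "c' \<in> Obj C" "c'' \<in> Obj C" "f \<in> Hom C c' c" "g \<in> Hom C c'' c'" "nact v c c' f x \<in> im c'"
      then show "nact v c c'' (Cmp C c'' c' c f g) x \<in> im c''" using * by (simp add: nact_cmp v im_act)
    next
      fix c' f assume f: "c' \<in> Obj C" "f \<in> Hom C c' c"
        and all: "\<And>c'' d. c'' \<in> Obj C \<Longrightarrow> d \<in> D c' c'' \<Longrightarrow> nact v c c'' (Cmp C c'' c' c f d) x \<in> im c''"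
      show "nact v c c' f x \<in> im c'"
        unfolding im_def
      proof (rule mono_closed[OF m u v f(1) nact_in[OF v *(1) f *(2)]])
        fix c'' d assume d: "c'' \<in> Obj C" "d \<in> D c' c''"
        then have "d \<in> Hom C c'' c'" using D_hom by blast
        then show "nact v c' c'' d (nact v c c' f x) \<in> nmap u v m c'' ` nob u c''"
          using all[OF d] nact_cmp[OF v *(1) f(1) d(1) f(2) _ *(2)] by (simp add: im_def)
      qed
    qed
    then obtain \<alpha> where \<alpha>: "\<And>c x. c \<in> Obj C \<Longrightarrow> x \<in> nob v c \<Longrightarrow> \<alpha> c x \<in> FOb \<Omega> c"
      and \<alpha>t: "\<And>c x c' f. c \<in> Obj C \<Longrightarrow> x \<in> nob v c \<Longrightarrow> c' \<in> Obj C \<Longrightarrow> f \<in> Hom C c' c \<Longrightarrow>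
        FHom \<Omega> c c' f (\<alpha> c x) = tr c' \<longleftrightarrow> nact v c c' f x \<in> im c'"
      by metis
    have \<alpha>_nat: "FHom \<Omega> c c' f (\<alpha> c x) = \<alpha> c' (nact v c c' f x)"
      if *: "c \<in> Obj C" "c' \<in> Obj C" "f \<in> Hom C c' c" "x \<in> nob v c" for c c' f x
    proof (rule \<Omega>.sieve_ext[OF *(2)])
      fix c'' g assume **: "c'' \<in> Obj C" "g \<in> Hom C c'' c'"
      have fg: "Cmp C c'' c' c f g \<in> Hom C c'' c" using * ** by (intro cat_cmp[OF cC])
      show "FHom \<Omega> c' c'' g (FHom \<Omega> c c' f (\<alpha> c x)) = tr c'' \<longleftrightarrow> FHom \<Omega> c' c'' g (\<alpha> c' (nact v c c' f x)) = tr c''"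
        using * ** \<alpha>t[OF *(1,4) **(1) fg] by (simp add: psh_cmp[OF \<Omega>] \<alpha> \<alpha>t nact_in v nact_cmp)
    qed (use * in \<open>simp_all add: psh_act[OF \<Omega>] \<alpha> nact_in v\<close>)
    have "\<exists>\<chi>\<in>Hom E v \<omega>. \<forall>c\<in>Obj C. \<forall>x\<in>nob v c. nmap v \<omega> \<chi> c x = \<eta> \<Omega> c (\<alpha> c x)"
      by (rule nmap_ex[OF v \<omega>]) (simp_all add: \<alpha> eta_nat \<alpha>_nat)
    then obtain \<chi> where \<chi>: "\<chi> \<in> Hom E v \<omega>"
      and \<chi>_app: "\<And>c x. c \<in> Obj C \<Longrightarrow> x \<in> nob v c \<Longrightarrow> nmap v \<omega> \<chi> c x = \<eta> \<Omega> c (\<alpha> c x)" by blast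
    have \<chi>_tt: "nmap v \<omega> \<chi> c x = tt c \<longleftrightarrow> x \<in> im c" if *: "c \<in> Obj C" "x \<in> nob v c" for c x
      using \<alpha>t[OF * *(1) cat_ide[OF cC *(1)]] * by (simp add: \<chi>_app eta_tt \<alpha> psh_ide[OF \<Omega>] nact_ide[OF v])
    obtain k where k: "k \<in> Hom E u one" using one u by (auto simp: is_terminal_def)
    have pb: "is_pullback E v one \<omega> \<chi> t u m k"
      unfolding is_pullback_def
    proof (intro conjI u mh k ballI impI)
      show "Cmp E u v \<omega> \<chi> m = Cmp E u one \<omega> t k"
        by (rule nmap_eqI[OF u \<omega> cat_cmp[OF cE u v \<omega> mh \<chi>] cat_cmp[OF cE u oneo \<omega> k t]])
           (simp add: nmap_cmp u v \<omega> mh \<chi> oneo k t t_app nmap_in \<chi>_tt im_def)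
      fix y q1 q2 assume y: "y \<in> Obj E" and q1: "q1 \<in> Hom E y v" and q2: "q2 \<in> Hom E y one"
        and eq: "Cmp E y v \<omega> \<chi> q1 = Cmp E y one \<omega> t q2"
      have "\<exists>z\<in>nob u c. nmap u v m c z = nmap y v q1 c w" if *: "c \<in> Obj C" "w \<in> nob y c" for c w
      proof -
        have "nmap v \<omega> \<chi> c (nmap y v q1 c w) = nmap one \<omega> t c (nmap y one q2 c w)"
          using nmap_cmp[OF y v \<omega> q1 \<chi> *] nmap_cmp[OF y oneo \<omega> q2 t *] eq by simp
        then have "nmap y v q1 c w \<in> im c"
          using \<chi>_tt[OF *(1) nmap_in[OF y v q1 *]] t_app[OF *(1) nmap_in[OF y oneo q2 *]] by simp
        then show ?thesis by (auto simp: im_def)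
      qed
      then obtain \<beta> where \<beta>: "\<And>c w. c \<in> Obj C \<Longrightarrow> w \<in> nob y c \<Longrightarrow> \<beta> c w \<in> nob u c"
        and m\<beta>: "\<And>c w. c \<in> Obj C \<Longrightarrow> w \<in> nob y c \<Longrightarrow> nmap u v m c (\<beta> c w) = nmap y v q1 c w" by metis
      have "\<exists>h\<in>Hom E y u. \<forall>c\<in>Obj C. \<forall>w\<in>nob y c. nmap y u h c w = \<beta> c w"
      proof (rule nmap_ex[OF y u \<beta>])
        fix c c' f w assume *: "c \<in> Obj C" "c' \<in> Obj C" "f \<in> Hom C c' c" "w \<in> nob y c"
        show "nact u c c' f (\<beta> c w) = \<beta> c' (nact y c c' f w)"
          by (rule mono_elements[OF m u v *(2)])
             (use * in \<open>simp_all add: nact_in u y \<beta> m\<beta> nmap_nat[OF u v mh, symmetric] nmap_nat[OF y v q1]\<close>)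
      qed
      then obtain h where h: "h \<in> Hom E y u" and h\<beta>: "\<And>c w. c \<in> Obj C \<Longrightarrow> w \<in> nob y c \<Longrightarrow> nmap y u h c w = \<beta> c w" by blast
      show "\<exists>!h. h \<in> Hom E y u \<and> Cmp E y u v m h = q1 \<and> Cmp E y u one k h = q2"
      proof (rule ex1I[of _ h], intro conjI h)
        show mh1: "Cmp E y u v m h = q1"
          by (rule nmap_eqI[OF y v cat_cmp[OF cE y u v h mh] q1]) (simp add: nmap_cmp y u v h mh h\<beta> m\<beta>)
        show "Cmp E y u one k h = q2"
          using one y q2 cat_cmp[OF cE y u oneo h k] by (auto simp: is_terminal_def)
        fix h' assume "h' \<in> Hom E y u \<and> Cmp E y u v m h' = q1 \<and> Cmp E y u one k h' = q2"
        then show "h' = h" using m y h mh1 unfolding is_mono_def by metis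
      qed
    qed
    show "\<exists>!\<chi>. \<chi> \<in> Hom E v \<omega> \<and> (\<exists>k\<in>Hom E u one. is_pullback E v one \<omega> \<chi> t u m k)"
    proof (rule ex1I[of _ \<chi>], intro conjI \<chi> bexI[OF _ k] pb)
      fix \<chi>' assume "\<chi>' \<in> Hom E v \<omega> \<and> (\<exists>k\<in>Hom E u one. is_pullback E v one \<omega> \<chi>' t u m k)"
      then obtain k' where \<chi>': "\<chi>' \<in> Hom E v \<omega>" and k': "k' \<in> Hom E u one" and pb': "is_pullback E v one \<omega> \<chi>' t u m k'" by blast
      \<comment> \<open>A competitor is true on exactly the elements of the image. Applied to all
        restrictions of \<open>x\<close>, this makes the sieves of the two truth values
        equal.\<close>
      have \<chi>'_tt: "nmap v \<omega> \<chi>' c x = tt c \<longleftrightarrow> x \<in> im c" if *: "c \<in> Obj C" "x \<in> nob v c" for c x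
      proof
        assume "nmap v \<omega> \<chi>' c x = tt c"
        moreover obtain s where "s \<in> nob one c" using one_ex[OF *(1)] ..
        ultimately show "x \<in> im c"
          using pullback_elements[OF pb' v oneo \<omega> \<chi>' t *] t_app[OF *(1)] by (force simp: im_def)
      next
        assume "x \<in> im c"
        then obtain z where z: "z \<in> nob u c" "x = nmap u v m c z" by (auto simp: im_def)
        have "Cmp E u v \<omega> \<chi>' m = Cmp E u one \<omega> t k'" using pb' by (simp add: is_pullback_def)
        then show "nmap v \<omega> \<chi>' c x = tt c"
          using nmap_cmp[OF u v \<omega> mh \<chi>' *(1) z(1)] nmap_cmp[OF u oneo \<omega> k' t *(1) z(1)]
            t_app[OF *(1) nmap_in[OF u oneo k' *(1) z(1)]] z(2) by simp
      qed
      show "\<chi>' = \<chi>"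
      proof (rule nmap_eqI[OF v \<omega> \<chi>' \<chi>])
        fix c x assume *: "c \<in> Obj C" "x \<in> nob v c"
        have n: "nmap v \<omega> \<chi>' c x \<in> nob \<omega> c" "nmap v \<omega> \<chi> c x \<in> nob \<omega> c"
          using * by (auto intro: nmap_in v \<omega> \<chi> \<chi>')
        have "r c (nmap v \<omega> \<chi>' c x) = r c (nmap v \<omega> \<chi> c x)"
          by (rule \<Omega>.sieve_ext[OF *(1)])
             (use * n in \<open>simp_all add: r rt nmap_nat[OF v \<omega> \<chi>] nmap_nat[OF v \<omega> \<chi>'] \<chi>_tt \<chi>'_tt nact_in v\<close>)
        then show "nmap v \<omega> \<chi>' c x = nmap v \<omega> \<chi> c x" using eta_r[OF *(1)] n by metis
      qed
    qed
  qed
  then show ?thesis by blast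
qed

theorem elementary_topos: "elementary_topos E"
  unfolding elementary_topos_def cartesian_closed_def
  using cE E_finite_limits has_terminal[OF E_finite_limits cE] has_product[OF E_finite_limits cE]
    exponential_exists subobject_classifier_exists by blast

end


section \<open>Presheaves on a large category\<close>

lemma yoneda_simps:
  "a \<in> Obj E \<Longrightarrow> FOb (FOb (yoneda U E) v) a = Inl ` Hom E a v"
  "a \<in> Obj E \<Longrightarrow> b \<in> Obj E \<Longrightarrow> f \<in> Hom E b a \<Longrightarrow> g \<in> Hom E a v \<Longrightarrow>
    FHom (FOb (yoneda U E) v) a b f (Inl g) = Inl (Cmp E b a v g f)"
  "a \<in> Obj E \<Longrightarrow> g \<in> Hom E a v \<Longrightarrow> FHom (yoneda U E) v w h a (Inl g) = Inl (Cmp E a v w h g)"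
  by (simp_all add: yoneda_def representable_def restrict_funct_def)

lemma yoneda_obj:
  assumes C: "category E" and ls: "locally_small U E" and v: "v \<in> Obj E"
  shows "FOb (yoneda U E) v \<in> Obj (presheaf_cat U E)"
proof -
  have "FHom (FOb (yoneda U E) v) a b f \<in> extensional (FOb (FOb (yoneda U E) v) a)"
    if "a \<in> Obj E" "b \<in> Obj E" "f \<in> Hom E b a" for a b f
    using that by (auto simp: yoneda_def representable_def restrict_funct_def)
  moreover have "psh_data E (FOb (FOb (yoneda U E) v)) (FHom (FOb (yoneda U E) v))"
    unfolding psh_data_def using C v by (auto simp: yoneda_simps cat_cmp cat_ide cat_idr cat_assoc)
  moreover have "extensional_funct (op_cat E) (FOb (yoneda U E) v)"
    by (auto simp: extensional_funct_def yoneda_def representable_def restrict_funct_def)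
  ultimately show ?thesis
    unfolding psh_obj_iff using C ls v by (auto simp: locally_small_def yoneda_simps intro!: small_image)
qed

lemma yoneda_functor:
  assumes C: "category E" and ls: "locally_small U E"
  shows "is_functor E (presheaf_cat U E) (yoneda U E)"
proof -
  note ob = yoneda_obj[OF C ls]
  have hom: "FHom (yoneda U E) v w h \<in> Hom (presheaf_cat U E) (FOb (yoneda U E) v) (FOb (yoneda U E) w)"
    if "v \<in> Obj E" "w \<in> Obj E" "h \<in> Hom E v w" for v w h
  proof -
    have eq: "FHom (yoneda U E) v w h = (\<lambda>a\<in>Obj E. \<lambda>x\<in>FOb (FOb (yoneda U E) v) a. map_sum (\<lambda>g. Cmp E a v w h g) id x)"
      by (auto simp: yoneda_def representable_def restrict_funct_def fun_eq_iff restrict_def)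
    show ?thesis
      unfolding eq by (rule psh_homI[OF ob[OF that(1)] ob[OF that(2)]])
        (use that C in \<open>auto simp: yoneda_simps cat_cmp cat_assoc\<close>)
  qed
  show ?thesis
    unfolding is_functor_def
  proof (intro conjI ballI C category_psh[OF C] ob hom)
    fix a assume a: "a \<in> Obj E"
    show "FHom (yoneda U E) a a (Ide E a) = Ide (presheaf_cat U E) (FOb (yoneda U E) a)"
      by (rule psh_hom_eqI[OF ob[OF a] ob[OF a] hom[OF a a cat_ide[OF C a]] cat_ide[OF category_psh[OF C] ob[OF a]]])
         (use a C in \<open>auto simp: yoneda_simps cat_idl\<close>)
  next
    fix a b c f g assume *: "a \<in> Obj E" "b \<in> Obj E" "c \<in> Obj E" "f \<in> Hom E a b" "g \<in> Hom E b c"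
    show "FHom (yoneda U E) a c (Cmp E a b c g f) = Cmp (presheaf_cat U E) (FOb (yoneda U E) a) (FOb (yoneda U E) b)
      (FOb (yoneda U E) c) (FHom (yoneda U E) b c g) (FHom (yoneda U E) a b f)"
      by (rule psh_hom_eqI[OF ob[OF *(1)] ob[OF *(3)] hom[OF *(1,3)] cat_cmp[OF category_psh[OF C] ob[OF *(1)] ob[OF *(2)] ob[OF *(3)] hom[OF *(1,2,4)] hom[OF *(2,3,5)]]])
         (use * C in \<open>auto simp: yoneda_simps cat_assoc cat_cmp\<close>)
  qed
qed

lemma yoneda_fully_faithful:
  assumes C: "category E" and ls: "locally_small U E"
  shows "fully_faithful E (presheaf_cat U E) (yoneda U E)"
  unfolding fully_faithful_def
proof (intro conjI ballI yoneda_functor[OF assms] bij_betw_imageI inj_onI equalityI subsetI)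
  let ?y = "yoneda U E" and ?P = "presheaf_cat U E"
  note ob = yoneda_obj[OF C ls] and hom = fun_hom[OF yoneda_functor[OF assms]]
  fix v w assume vw: "v \<in> Obj E" "w \<in> Obj E"
  note i = cat_ide[OF C vw(1)]
  { fix h h' assume *: "h \<in> Hom E v w" "h' \<in> Hom E v w" "FHom ?y v w h = FHom ?y v w h'"
    have "FHom ?y v w h v (Inl (Ide E v)) = FHom ?y v w h' v (Inl (Ide E v))" using * by simp
    then show "h = h'" unfolding yoneda_simps(3)[OF vw(1) i] using * vw C by (simp add: cat_idr) }
  { fix \<alpha> assume "\<alpha> \<in> FHom ?y v w ` Hom E v w"
    then show "\<alpha> \<in> Hom ?P (FOb ?y v) (FOb ?y w)" using hom vw by blast }
  fix \<alpha> assume \<alpha>: "\<alpha> \<in> Hom ?P (FOb ?y v) (FOb ?y w)"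
  have "\<alpha> v (Inl (Ide E v)) \<in> FOb (FOb ?y w) v"
    by (rule psh_hom_in[OF ob[OF vw(1)] ob[OF vw(2)] \<alpha> vw(1)]) (use vw i in \<open>simp add: yoneda_simps\<close>)
  then obtain h where h: "h \<in> Hom E v w" "\<alpha> v (Inl (Ide E v)) = Inl h" using vw by (auto simp: yoneda_simps)
  have "\<alpha> = FHom ?y v w h"
  proof (rule psh_hom_eqI[OF ob[OF vw(1)] ob[OF vw(2)] \<alpha> hom[OF vw h(1)]])
    fix a x assume a: "a \<in> Obj E" and "x \<in> FOb (FOb ?y v) a"
    then obtain g where g: "g \<in> Hom E a v" "x = Inl g" by (auto simp: yoneda_simps)
    have "FHom (FOb ?y w) v a g (\<alpha> v (Inl (Ide E v))) = \<alpha> a (FHom (FOb ?y v) v a g (Inl (Ide E v)))"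
      by (rule psh_hom_nat[OF ob[OF vw(1)] ob[OF vw(2)] \<alpha> vw(1) a g(1)]) (use vw i in \<open>simp add: yoneda_simps\<close>)
    then show "\<alpha> a x = FHom ?y v w h a x" using g h a vw i C by (simp add: yoneda_simps cat_idl)
  qed
  then show "\<alpha> \<in> FHom ?y v w ` Hom E v w" using h by blast
qed


section \<open>Restriction along a functor from a small category\<close>

text \<open>Full faithfulness of the nerve of \<open>k\<close>, spelled out for families
  \<open>\<beta>\<close> of functions between hom-sets. No coded presheaves occur, so density can be
  moved between different categories \<open>C\<close>.\<close>

definition dense_functor :: "('o1, 'm1) cat \<Rightarrow> ('o2, 'm2) cat \<Rightarrow> ('o1, 'm1, 'o2, 'm2) funct \<Rightarrow> bool" where
  "dense_functor C E k \<longleftrightarrow> is_functor C E k \<and>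
     (\<forall>v\<in>Obj E. \<forall>w\<in>Obj E. \<forall>\<beta>.
        (\<forall>c\<in>Obj C. \<forall>f\<in>Hom E (FOb k c) v. \<beta> c f \<in> Hom E (FOb k c) w) \<and>
        (\<forall>c\<in>Obj C. \<forall>c'\<in>Obj C. \<forall>g\<in>Hom C c' c. \<forall>f\<in>Hom E (FOb k c) v.
           \<beta> c' (Cmp E (FOb k c') (FOb k c) v f (FHom k c' c g)) = Cmp E (FOb k c') (FOb k c) w (\<beta> c f) (FHom k c' c g)) \<longrightarrow>
        (\<exists>!h. h \<in> Hom E v w \<and> (\<forall>c\<in>Obj C. \<forall>f\<in>Hom E (FOb k c) v. \<beta> c f = Cmp E (FOb k c) v w h f)))"

text \<open>Let \<open>i\<close> be the transpose of \<open>u\<close>. Then the counit after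
  \<open>F (i f)\<close> equals \<open>u\<close> after \<open>F f\<close>, hence the counit itself,
  and this forces \<open>i f\<close> to be the identity; so \<open>F i\<close> after
  \<open>u'\<close> inverts the counit.\<close>

lemma (in adj) counit_iso_if_iso:
  assumes d: "d \<in> Obj D" and x: "x \<in> Obj C" and u: "iso_in D (FOb F x) d u u'"
    and f: "f \<in> Hom C (FOb G d) x" and uf: "Cmp D (FOb F (FOb G d)) (FOb F x) d u (FHom F (FOb G d) x f) = \<epsilon> d"
  shows "\<exists>\<delta>. iso_in D (FOb F (FOb G d)) d (\<epsilon> d) \<delta>"
proof -
  have u1 [simp]: "u \<in> Hom D (FOb F x) d" "u' \<in> Hom D d (FOb F x)" "Cmp D (FOb F x) d (FOb F x) u' u = Ide D (FOb F x)"
    "Cmp D d (FOb F x) d u u' = Ide D d" using u by (auto simp: iso_in_def)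
  note [simp] = d x f adj_simps
  let ?GF = "FOb G (FOb F x)"
  define i where "i = Cmp C x ?GF (FOb G d) (FHom G (FOb F x) d u) (\<eta> x)"
  have i [simp]: "i \<in> Hom C x (FOb G d)" and \<epsilon>i: "Cmp D (FOb F x) (FOb F (FOb G d)) d (\<epsilon> d) (FHom F x (FOb G d) i) = u"
    using transpose_right[OF x d u1(1)] unfolding i_def by blast+
  define \<delta> where "\<delta> = Cmp D d (FOb F x) (FOb F (FOb G d)) (FHom F x (FOb G d) i) u'"
  have \<delta> [simp]: "\<delta> \<in> Hom D d (FOb F (FOb G d))" unfolding \<delta>_def by (rule cat_cmp) auto
  have 1: "Cmp D d (FOb F (FOb G d)) d (\<epsilon> d) \<delta> = Ide D d"
    unfolding \<delta>_def by (simp add: cat_assoc[symmetric] \<epsilon>i)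
  have "Cmp C (FOb G d) x (FOb G d) i f = Ide C (FOb G d)"
  proof (rule right_eqI[of "FOb G d" d])
    show "Cmp D (FOb F (FOb G d)) (FOb F (FOb G d)) d (\<epsilon> d) (FHom F (FOb G d) (FOb G d) (Cmp C (FOb G d) x (FOb G d) i f)) =
      Cmp D (FOb F (FOb G d)) (FOb F (FOb G d)) d (\<epsilon> d) (FHom F (FOb G d) (FOb G d) (Ide C (FOb G d)))"
      by (simp add: cat_assoc[symmetric] \<epsilon>i uf cat_idr)
  qed (auto intro: cat_cmp cat_ide)
  then have if1: "FHom F (FOb G d) (FOb G d) (Cmp C (FOb G d) x (FOb G d) i f) = Ide D (FOb F (FOb G d))" by simp
  have "Cmp D (FOb F (FOb G d)) d (FOb F (FOb G d)) \<delta> (\<epsilon> d) =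
    Cmp D (FOb F (FOb G d)) (FOb F x) (FOb F (FOb G d)) (FHom F x (FOb G d) i)
      (Cmp D (FOb F (FOb G d)) (FOb F x) (FOb F x) (Cmp D (FOb F x) d (FOb F x) u' u) (FHom F (FOb G d) x f))"
    unfolding \<delta>_def uf[symmetric] by (simp add: cat_assoc cat_cmp[where b="FOb F x"] del: u1(3,4))
  also have "\<dots> = Ide D (FOb F (FOb G d))" using if1 by (simp add: cat_idl)
  finally show ?thesis using 1 unfolding iso_in_def by (intro exI[of _ \<delta>]) simp
qed

locale base_change = small_presheaves U C
  for U :: "'u itself" and C :: "('c, 'u) cat" +
  fixes E :: "('o, 'm) cat" and k :: "('c, 'u, 'o, 'm) funct"
  assumes ls: "locally_small U E" and k: "is_functor C E k"
begin

abbreviation (input) PE :: "(('o, 'm, 'm + 'u) presheaf, 'o \<Rightarrow> 'm + 'u \<Rightarrow> 'm + 'u) cat" where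
  "PE \<equiv> presheaf_cat U E"
abbreviation (input) ko where "ko \<equiv> FOb k"
abbreviation (input) km where "km \<equiv> FHom k"
abbreviation (input) y where "y \<equiv> yoneda U E"

lemma cE: "category E"
  using fun_cat[OF k] by auto

lemmas k_ob = fun_ob[OF k] and k_hom = fun_hom[OF k]
lemmas y_ob = yoneda_obj[OF cE ls] and y_hom = fun_hom[OF yoneda_functor[OF cE ls]]

definition pull_ob :: "('o, 'm, 'm + 'u) presheaf \<Rightarrow> ('c, 'u, 'u) presheaf" where
  "pull_ob P = psh_of (id :: 'u \<Rightarrow> 'u) C (\<lambda>c. FOb P (ko c)) (\<lambda>a b f. FHom P (ko a) (ko b) (km b a f))"

text \<open>\<open>pe P c\<close> and \<open>pd P c\<close> translate between \<open>P (k c)\<close> and its coded copy \<open>pull_ob P c\<close>. Below, \<open>en v c\<close> and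
  \<open>dn v c\<close> do the same for \<open>E(k c, v)\<close> and \<open>N v c\<close>.\<close>

definition pe :: "('o, 'm, 'm + 'u) presheaf \<Rightarrow> 'c \<Rightarrow> 'm + 'u \<Rightarrow> 'u" where
  "pe P c = cod (id :: 'u \<Rightarrow> 'u) (FOb P (ko c))"

definition pd :: "('o, 'm, 'm + 'u) presheaf \<Rightarrow> 'c \<Rightarrow> 'u \<Rightarrow> 'm + 'u" where
  "pd P c = dec (id :: 'u \<Rightarrow> 'u) (FOb P (ko c))"

definition pull :: "(('o, 'm, 'm + 'u) presheaf, 'o \<Rightarrow> 'm + 'u \<Rightarrow> 'm + 'u, ('c, 'u, 'u) presheaf, 'c \<Rightarrow> 'u \<Rightarrow> 'u) funct" where
  "pull = \<lparr>FOb = pull_ob, FHom = (\<lambda>P Q \<alpha>. \<lambda>c\<in>Obj C. \<lambda>z\<in>FOb (pull_ob P) c. pe Q c (\<alpha> (ko c) (pd P c z)))\<rparr>"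

section \<open>Restriction of presheaves along \<open>k\<close>\<close>

lemma pull_data:
  assumes P: "P \<in> Obj PE"
  shows "psh_data C (\<lambda>c. FOb P (ko c)) (\<lambda>a b f. FHom P (ko a) (ko b) (km b a f))"
  unfolding psh_data_def
  using k_ob k_hom psh_act[OF P] psh_ide[OF P] psh_cmp[OF P] by (simp add: fun_ide[OF k] fun_cmp[OF k])

lemma pull_obj: "P \<in> Obj PE \<Longrightarrow> FOb pull P \<in> Obj PC"
  unfolding pull_def pull_ob_def
  by (simp, rule psh_of_obj[OF cC]) (auto intro: psh_small pull_data k_ob)

lemma pull_coding:
  assumes P: "P \<in> Obj PE"
  shows "coding C (\<lambda>c. FOb P (ko c)) (\<lambda>a b f. FHom P (ko a) (ko b) (km b a f)) (FOb pull P) (pe P) (pd P)"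
  unfolding pull_def pull_ob_def pe_def[abs_def] pd_def[abs_def] funct.simps
  by (rule coding_psh_of[OF _ _ pull_data[OF P]]) (auto intro: psh_small[OF P] k_ob)

lemmas pe_in = coding.e_in[OF pull_coding] and pd_pe = coding.d_e[OF pull_coding]
  and pd_in = coding.d_in[OF pull_coding] and pe_pd = coding.e_d[OF pull_coding]
  and pe_act = coding.act_e[OF pull_coding] and pd_act = coding.act_d[OF pull_coding]

lemma pull_app:
  assumes "P \<in> Obj PE" "c \<in> Obj C" "x \<in> FOb P (ko c)"
  shows "FHom pull P Q \<alpha> c (pe P c x) = pe Q c (\<alpha> (ko c) x)"
  using assms pe_in[OF assms] by (simp add: pull_def pd_pe)

lemma pull_elem:
  assumes "P \<in> Obj PE" "c \<in> Obj C" "z \<in> FOb (FOb pull P) c"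
  obtains x where "x \<in> FOb P (ko c)" "z = pe P c x"
  using that[OF pd_in[OF assms]] pe_pd[OF assms] by simp

lemma pull_hom:
  assumes P: "P \<in> Obj PE" and Q: "Q \<in> Obj PE" and \<alpha>: "\<alpha> \<in> Hom PE P Q"
  shows "FHom pull P Q \<alpha> \<in> Hom PC (FOb pull P) (FOb pull Q)"
proof -
  have eq: "FHom pull P Q \<alpha> = (\<lambda>c\<in>Obj C. \<lambda>z\<in>FOb (FOb pull P) c. pe Q c (\<alpha> (ko c) (pd P c z)))"
    by (simp add: pull_def)
  show ?thesis
    unfolding eq
  proof (rule psh_homI[OF pull_obj[OF P] pull_obj[OF Q]])
    fix c z assume "c \<in> Obj C" "z \<in> FOb (FOb pull P) c"
    then show "pe Q c (\<alpha> (ko c) (pd P c z)) \<in> FOb (FOb pull Q) c"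
      by (intro pe_in[OF Q] psh_hom_in[OF P Q \<alpha>] k_ob pd_in[OF P])
  next
    fix a b f z assume *: "a \<in> Obj C" "b \<in> Obj C" "f \<in> Hom C b a" "z \<in> FOb (FOb pull P) a"
    note x = pd_in[OF P *(1,4)]
    show "FHom (FOb pull Q) a b f (pe Q a (\<alpha> (ko a) (pd P a z))) = pe Q b (\<alpha> (ko b) (pd P b (FHom (FOb pull P) a b f z)))"
      using * x psh_hom_in[OF P Q \<alpha> k_ob[OF *(1)] x]
        psh_hom_nat[OF P Q \<alpha> k_ob[OF *(1)] k_ob[OF *(2)] k_hom[OF *(2,1,3)] x]
      by (simp add: pe_act[OF Q] pd_act[OF P])
  qed
qed

lemma pull_functor: "is_functor PE PC pull"
  unfolding is_functor_def
proof (intro conjI ballI category_psh cE cC pull_obj pull_hom)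
  fix P assume P: "P \<in> Obj PE"
  show "FHom pull P P (Ide PE P) = Ide PC (FOb pull P)"
  proof (rule psh_hom_eqI[OF pull_obj[OF P] pull_obj[OF P] pull_hom[OF P P cat_ide[OF category_psh[OF cE] P]] cat_ide[OF category_psh[OF cC] pull_obj[OF P]]])
    fix c z assume *: "c \<in> Obj C" "z \<in> FOb (FOb pull P) c"
    then obtain x where "x \<in> FOb P (ko c)" "z = pe P c x" using pull_elem[OF P] by blast
    then show "FHom pull P P (Ide PE P) c z = Ide PC (FOb pull P) c z"
      using * by (simp add: pull_app P k_ob)
  qed
next
  fix P Q R \<alpha> \<beta> assume *: "P \<in> Obj PE" "Q \<in> Obj PE" "R \<in> Obj PE" "\<alpha> \<in> Hom PE P Q" "\<beta> \<in> Hom PE Q R"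
  note c = cat_cmp[OF category_psh[OF cE] *]
  show "FHom pull P R (Cmp PE P Q R \<beta> \<alpha>) = Cmp PC (FOb pull P) (FOb pull Q) (FOb pull R) (FHom pull Q R \<beta>) (FHom pull P Q \<alpha>)"
  proof (rule psh_hom_eqI[OF pull_obj[OF *(1)] pull_obj[OF *(3)] pull_hom[OF *(1,3) c]
      cat_cmp[OF category_psh[OF cC] pull_obj[OF *(1)] pull_obj[OF *(2)] pull_obj[OF *(3)] pull_hom[OF *(1,2,4)] pull_hom[OF *(2,3,5)]]])
    fix c z assume **: "c \<in> Obj C" "z \<in> FOb (FOb pull P) c"
    then obtain x where x: "x \<in> FOb P (ko c)" "z = pe P c x" using pull_elem[OF *(1)] by blast
    then show "FHom pull P R (Cmp PE P Q R \<beta> \<alpha>) c z =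
        Cmp PC (FOb pull P) (FOb pull Q) (FOb pull R) (FHom pull Q R \<beta>) (FHom pull P Q \<alpha>) c z"
      using ** psh_hom_in[OF *(1,2,4) k_ob[OF **(1)] x(1)] by (simp add: pull_app * k_ob pe_in)
  qed
qed

text \<open>The nerve of \<open>k\<close>. As a composite with \<open>pull\<close> it has
  restrictions of representables as values, the form in which density compares maps into
  representables before and after restriction.\<close>

definition N :: "('o, 'm, ('c, 'u, 'u) presheaf, 'c \<Rightarrow> 'u \<Rightarrow> 'u) funct" where
  "N = comp_funct pull y"

definition en :: "'o \<Rightarrow> 'c \<Rightarrow> 'm \<Rightarrow> 'u" where
  "en v c f = pe (FOb y v) c (Inl f)"

lemma N_functor: "is_functor E PC N"
  unfolding N_def by (rule is_functor_comp[OF yoneda_functor[OF cE ls] pull_functor])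

lemmas N_ob = fun_ob[OF N_functor] and N_hom = fun_hom[OF N_functor]

lemma N_simps: "FOb N v = FOb pull (FOb y v)" "FHom N v w h = FHom pull (FOb y v) (FOb y w) (FHom y v w h)"
  by (simp_all add: N_def)

lemma en_in: "v \<in> Obj E \<Longrightarrow> c \<in> Obj C \<Longrightarrow> f \<in> Hom E (ko c) v \<Longrightarrow> en v c f \<in> FOb (FOb N v) c"
  unfolding en_def N_simps by (rule pe_in[OF y_ob]) (simp_all add: yoneda_simps k_ob)

lemma N_elem:
  assumes "v \<in> Obj E" "c \<in> Obj C" "z \<in> FOb (FOb N v) c"
  obtains f where "f \<in> Hom E (ko c) v" "z = en v c f"
proof -
  obtain x where "x \<in> FOb (FOb y v) (ko c)" "z = pe (FOb y v) c x"
    using pull_elem[OF y_ob[OF assms(1)] assms(2)] assms(3) by (auto simp: N_simps)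
  then show thesis using that assms(2) by (auto simp: yoneda_simps k_ob en_def)
qed

lemma en_inj:
  assumes "v \<in> Obj E" "c \<in> Obj C" "f \<in> Hom E (ko c) v" "f' \<in> Hom E (ko c) v" "en v c f = en v c f'"
  shows "f = f'"
proof -
  have "Inl f = (Inl f' :: 'm + 'u)"
    using assms pd_pe[OF y_ob[OF assms(1)] assms(2)] unfolding en_def
    by (metis yoneda_simps(1) k_ob imageI)
  then show ?thesis by simp
qed

lemma en_act:
  assumes "v \<in> Obj E" "c \<in> Obj C" "c' \<in> Obj C" "g \<in> Hom C c' c" "f \<in> Hom E (ko c) v"
  shows "FHom (FOb N v) c c' g (en v c f) = en v c' (Cmp E (ko c') (ko c) v f (km c' c g))"
  using assms k_ob k_hom by (simp add: en_def N_simps pe_act[OF y_ob] yoneda_simps)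

lemma en_map:
  assumes "v \<in> Obj E" "w \<in> Obj E" "h \<in> Hom E v w" "c \<in> Obj C" "f \<in> Hom E (ko c) v"
  shows "FHom N v w h c (en v c f) = en w c (Cmp E (ko c) v w h f)"
  using assms k_ob by (simp add: en_def N_simps pull_app[OF y_ob] yoneda_simps)

definition dn :: "'o \<Rightarrow> 'c \<Rightarrow> 'u \<Rightarrow> 'm" where
  "dn v c = inv_into (Hom E (ko c) v) (en v c)"

lemma dn_en: "v \<in> Obj E \<Longrightarrow> c \<in> Obj C \<Longrightarrow> f \<in> Hom E (ko c) v \<Longrightarrow> dn v c (en v c f) = f"
  unfolding dn_def by (rule inv_into_f_f) (auto intro: inj_onI en_inj)

lemma dn_in: "v \<in> Obj E \<Longrightarrow> c \<in> Obj C \<Longrightarrow> z \<in> FOb (FOb N v) c \<Longrightarrow> dn v c z \<in> Hom E (ko c) v"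
  using N_elem dn_en by metis

subsection \<open>Right Kan extension\<close>

text \<open>By Yoneda the value at \<open>v\<close> has to be Hom(y v, X) = Hom(N v, Q), which is
  small because \<open>C\<close> is; the counit \<open>u\<close> evaluates at an identity. If
  \<open>k\<close> is fully faithful, \<open>N (k c)\<close> is a copy of the representable presheaf
  of \<open>c\<close>, and this evaluation is bijective, again by Yoneda. Both facts are stated
  together because the description of \<open>X\<close> is hidden by the existential
  quantifier.\<close>

lemma ran_exists:
  assumes Q: "Q \<in> Obj PC"
  shows "\<exists>X\<in>Obj PE. \<exists>u\<in>Hom PC (FOb pull X) Q.
    (\<forall>P\<in>Obj PE. \<forall>\<beta>\<in>Hom PC (FOb pull P) Q.
       \<exists>!\<gamma>. \<gamma> \<in> Hom PE P X \<and> Cmp PC (FOb pull P) (FOb pull X) Q u (FHom pull P X \<gamma>) = \<beta>) \<and>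
    (fully_faithful C E k \<longrightarrow> (\<forall>c\<in>Obj C. bij_betw (u c) (FOb (FOb pull X) c) (FOb Q c)))"
proof -
  define A where "A = (\<lambda>v. Hom PC (FOb N v) Q)"
  define act where "act = (\<lambda>a b f \<alpha>. Cmp PC (FOb N b) (FOb N a) Q \<alpha> (FHom N b a f))"
  note cP = category_psh[OF cC] and [simp] = cE Q
  have small_A: "small U (A v)" if v: "v \<in> Obj E" for v
    unfolding A_def by (rule presheaf_hom_small[OF N_ob[OF v] Q])
  have act_in: "act a b f \<alpha> \<in> A b" if "a \<in> Obj E" "b \<in> Obj E" "f \<in> Hom E b a" "\<alpha> \<in> A a" for a b f \<alpha>
    unfolding act_def A_def by (rule cat_cmp[OF cP N_ob N_ob Q N_hom]) (use that in \<open>auto simp: A_def\<close>)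
  have data: "psh_data E A act"
    unfolding psh_data_def
  proof (intro conjI ballI act_in)
    fix a \<alpha> assume "a \<in> Obj E" "\<alpha> \<in> A a"
    then show "act a a (Ide E a) \<alpha> = \<alpha>"
      by (simp add: act_def A_def fun_ide[OF N_functor] cat_idr[OF cP] N_ob)
  next
    fix a b c f g \<alpha> assume "a \<in> Obj E" "b \<in> Obj E" "c \<in> Obj E" "f \<in> Hom E b a" "g \<in> Hom E c b" "\<alpha> \<in> A a"
    then show "act a c (Cmp E c b a f g) \<alpha> = act b c g (act a b f \<alpha>)"
      by (simp add: act_def A_def fun_cmp[OF N_functor] cat_assoc[OF cP] N_ob N_hom)
  qed
  have "inj (Inr :: 'u \<Rightarrow> 'm + 'u)" by simp
  from coded_presheaf[OF cE this small_A data] obtain X e d where X: "X \<in> Obj PE" and "coding E A act X e d" .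
  then interpret X: coding E A act X e d by simp
  have i: "Ide E (ko c) \<in> Hom E (ko c) (ko c)" if "c \<in> Obj C" for c using that by (simp add: cat_ide k_ob)
  have A_in: "\<alpha> c (en v c f) \<in> FOb Q c" if "\<alpha> \<in> A v" "v \<in> Obj E" "c \<in> Obj C" "f \<in> Hom E (ko c) v" for \<alpha> v c f
    using that psh_hom_in[OF N_ob Q _ _ en_in] by (auto simp: A_def)
  have A_nat: "FHom Q c c' g (\<alpha> c (en v c f)) = \<alpha> c' (en v c' (Cmp E (ko c') (ko c) v f (km c' c g)))"
    if "\<alpha> \<in> A v" "v \<in> Obj E" "c \<in> Obj C" "c' \<in> Obj C" "g \<in> Hom C c' c" "f \<in> Hom E (ko c) v" for \<alpha> v c c' g f
    using that psh_hom_nat[OF N_ob Q _ _ _ _ en_in, of v \<alpha> c c' g f] by (simp add: A_def en_act)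
  have A_eqI: "\<alpha> = \<alpha>'" if "\<alpha> \<in> A v" "\<alpha>' \<in> A v" "v \<in> Obj E"
    "\<And>c f. c \<in> Obj C \<Longrightarrow> f \<in> Hom E (ko c) v \<Longrightarrow> \<alpha> c (en v c f) = \<alpha>' c (en v c f)" for \<alpha> \<alpha>' v
    by (rule psh_hom_eqI[OF N_ob Q]) (use that in \<open>auto simp: A_def elim: N_elem[OF that(3)]\<close>)
  have A_I: "(\<lambda>c\<in>Obj C. \<lambda>z\<in>FOb (FOb N v) c. t c (dn v c z)) \<in> A v" if v: "v \<in> Obj E"
    and t1: "\<And>c f. c \<in> Obj C \<Longrightarrow> f \<in> Hom E (ko c) v \<Longrightarrow> t c f \<in> FOb Q c"
    and t2: "\<And>c c' g f. c \<in> Obj C \<Longrightarrow> c' \<in> Obj C \<Longrightarrow> g \<in> Hom C c' c \<Longrightarrow> f \<in> Hom E (ko c) v \<Longrightarrow>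
      FHom Q c c' g (t c f) = t c' (Cmp E (ko c') (ko c) v f (km c' c g))" for v t
    unfolding A_def
  proof (rule psh_homI[OF N_ob[OF v] Q])
    fix c z assume "c \<in> Obj C" "z \<in> FOb (FOb N v) c"
    then show "t c (dn v c z) \<in> FOb Q c" using t1 dn_in[OF v] by blast
  next
    fix c c' g z assume *: "c \<in> Obj C" "c' \<in> Obj C" "g \<in> Hom C c' c" "z \<in> FOb (FOb N v) c"
    obtain f where f: "f \<in> Hom E (ko c) v" "z = en v c f" using N_elem[OF v *(1,4)] .
    then have "Cmp E (ko c') (ko c) v f (km c' c g) \<in> Hom E (ko c') v"
      using * v by (intro cat_cmp k_ob k_hom) auto
    then show "FHom Q c c' g (t c (dn v c z)) = t c' (dn v c' (FHom (FOb N v) c c' g z))"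
      using * f v by (simp add: dn_en en_act t2)
  qed
  have act_app: "act a b f \<alpha> c (en b c g) = \<alpha> c (en a c (Cmp E (ko c) b a f g))"
    if "a \<in> Obj E" "b \<in> Obj E" "f \<in> Hom E b a" "\<alpha> \<in> A a" "c \<in> Obj C" "g \<in> Hom E (ko c) b" for a b f \<alpha> c g
    using that by (simp add: act_def en_in en_map)
  define u where "u = (\<lambda>c\<in>Obj C. \<lambda>z\<in>FOb (FOb pull X) c. d (ko c) (pd X c z) c (en (ko c) c (Ide E (ko c))))"
  have u_app: "u c (pe X c (e (ko c) \<alpha>)) = \<alpha> c (en (ko c) c (Ide E (ko c)))" if "c \<in> Obj C" "\<alpha> \<in> A (ko c)" for c \<alpha>
    using that by (simp add: u_def pe_in[OF X] X.e_in k_ob pd_pe[OF X] X.d_e)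
  have u: "u \<in> Hom PC (FOb pull X) Q"
    unfolding u_def
  proof (rule psh_homI[OF pull_obj[OF X] Q])
    fix c z assume *: "c \<in> Obj C" "z \<in> FOb (FOb pull X) c"
    then show "d (ko c) (pd X c z) c (en (ko c) c (Ide E (ko c))) \<in> FOb Q c"
      by (intro A_in X.d_in pd_in[OF X] k_ob i)
  next
    fix c c' f z assume *: "c \<in> Obj C" "c' \<in> Obj C" "f \<in> Hom C c' c" "z \<in> FOb (FOb pull X) c"
    define \<alpha> where "\<alpha> = d (ko c) (pd X c z)"
    have \<alpha>: "\<alpha> \<in> A (ko c)" unfolding \<alpha>_def by (intro X.d_in pd_in[OF X] k_ob *)
    have "d (ko c') (pd X c' (FHom (FOb pull X) c c' f z)) = act (ko c) (ko c') (km c' c f) \<alpha>"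
      unfolding \<alpha>_def using * by (simp add: pd_act[OF X] X.act_d k_ob k_hom pd_in[OF X])
    then show "FHom Q c c' f (d (ko c) (pd X c z) c (en (ko c) c (Ide E (ko c)))) =
      d (ko c') (pd X c' (FHom (FOb pull X) c c' f z)) c' (en (ko c') c' (Ide E (ko c')))"
      using * \<alpha> k_ob k_hom i
      by (simp add: \<alpha>_def[symmetric] A_nat act_app cat_idl[OF cE] cat_idr[OF cE])
  qed
  have "\<exists>!\<gamma>. \<gamma> \<in> Hom PE P X \<and> Cmp PC (FOb pull P) (FOb pull X) Q u (FHom pull P X \<gamma>) = \<beta>"
    if P: "P \<in> Obj PE" and \<beta>: "\<beta> \<in> Hom PC (FOb pull P) Q" for P \<beta>
  proof -
    note \<beta>_in = psh_hom_in[OF pull_obj[OF P] Q \<beta>] and \<beta>_nat = psh_hom_nat[OF pull_obj[OF P] Q \<beta>]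
    \<comment> \<open>The transpose of \<open>\<beta>\<close> at \<open>x\<close>: a morphism
      \<open>f\<close> from \<open>k c\<close> to \<open>v\<close> goes to the value of
      \<open>\<beta>\<close> at the restriction of \<open>x\<close> along \<open>f\<close>.\<close>
    define g where "g = (\<lambda>v x. \<lambda>c\<in>Obj C. \<lambda>z\<in>FOb (FOb N v) c. \<beta> c (pe P c (FHom P v (ko c) (dn v c z) x)))"
    have g_in: "g v x \<in> A v" if v: "v \<in> Obj E" and x: "x \<in> FOb P v" for v x
      unfolding g_def
    proof (rule A_I[OF v, where t = "\<lambda>c f. \<beta> c (pe P c (FHom P v (ko c) f x))"])
      fix c f assume "c \<in> Obj C" "f \<in> Hom E (ko c) v"
      then show "\<beta> c (pe P c (FHom P v (ko c) f x)) \<in> FOb Q c"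
        by (intro \<beta>_in pe_in[OF P] psh_act[OF P] v x k_ob)
    next
      fix c c' h f assume *: "c \<in> Obj C" "c' \<in> Obj C" "h \<in> Hom C c' c" "f \<in> Hom E (ko c) v"
      have x': "FHom P v (ko c) f x \<in> FOb P (ko c)" by (intro psh_act[OF P] v x k_ob *)
      show "FHom Q c c' h (\<beta> c (pe P c (FHom P v (ko c) f x))) =
        \<beta> c' (pe P c' (FHom P v (ko c') (Cmp E (ko c') (ko c) v f (km c' c h)) x))"
        using * v x x' by (simp add: \<beta>_nat pe_in[OF P] pe_act[OF P] psh_cmp[OF P] k_ob k_hom)
    qed
    have g_app: "g v x c (en v c f) = \<beta> c (pe P c (FHom P v (ko c) f x))"
      if "v \<in> Obj E" "c \<in> Obj C" "f \<in> Hom E (ko c) v" for v x c f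
      using that by (simp add: g_def en_in dn_en)
    define \<gamma> where "\<gamma> = (\<lambda>v\<in>Obj E. \<lambda>x\<in>FOb P v. e v (g v x))"
    have \<gamma>: "\<gamma> \<in> Hom PE P X"
      unfolding \<gamma>_def
    proof (rule psh_homI[OF P X])
      fix v x assume "v \<in> Obj E" "x \<in> FOb P v"
      then show "e v (g v x) \<in> FOb X v" by (intro X.e_in g_in)
    next
      fix a b f x assume *: "a \<in> Obj E" "b \<in> Obj E" "f \<in> Hom E b a" "x \<in> FOb P a"
      have "act a b f (g a x) = g b (FHom P a b f x)"
      proof (rule A_eqI[OF act_in[OF *(1-3) g_in[OF *(1,4)]] g_in[OF *(2) psh_act[OF P *]] *(2)])
        fix c h assume "c \<in> Obj C" "h \<in> Hom E (ko c) b"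
        then show "act a b f (g a x) c (en b c h) = g b (FHom P a b f x) c (en b c h)"
          using * by (simp add: act_app g_in g_app cat_cmp[where b=b] k_ob psh_cmp[OF P])
      qed
      then show "FHom X a b f (e a (g a x)) = e b (g b (FHom P a b f x))"
        using * by (simp add: X.act_e g_in)
    qed
    show ?thesis
    proof (rule ex1I[of _ \<gamma>], intro conjI \<gamma>)
      show "Cmp PC (FOb pull P) (FOb pull X) Q u (FHom pull P X \<gamma>) = \<beta>"
      proof (rule psh_hom_eqI[OF pull_obj[OF P] Q cat_cmp[OF cP pull_obj[OF P] pull_obj[OF X] Q pull_hom[OF P X \<gamma>] u] \<beta>])
        fix c z assume c: "c \<in> Obj C" and z: "z \<in> FOb (FOb pull P) c"
        obtain x where x: "x \<in> FOb P (ko c)" "z = pe P c x" using pull_elem[OF P c z] .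
        have "\<gamma> (ko c) x = e (ko c) (g (ko c) x)" using c x k_ob by (simp add: \<gamma>_def)
        then show "Cmp PC (FOb pull P) (FOb pull X) Q u (FHom pull P X \<gamma>) c z = \<beta> c z"
          using c z x k_ob i by (simp add: pull_app[OF P] u_app g_in g_app psh_ide[OF P])
      qed
      fix \<gamma>' assume \<gamma>': "\<gamma>' \<in> Hom PE P X \<and> Cmp PC (FOb pull P) (FOb pull X) Q u (FHom pull P X \<gamma>') = \<beta>"
      then have \<gamma>'h: "\<gamma>' \<in> Hom PE P X" by simp
      show "\<gamma>' = \<gamma>"
      proof (rule psh_hom_eqI[OF P X \<gamma>'h \<gamma>])
        fix v x assume v: "v \<in> Obj E" and x: "x \<in> FOb P v"
        have \<gamma>'x: "\<gamma>' v x \<in> FOb X v" by (rule psh_hom_in[OF P X \<gamma>'h v x])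
        \<comment> \<open>Naturality of \<open>\<gamma>'\<close> along \<open>f\<close> reduces the
          component at \<open>f\<close> to one at an identity, where \<open>u\<close> computes it
          and \<open>\<beta>\<close> prescribes it.\<close>
        have "d v (\<gamma>' v x) = g v x"
        proof (rule A_eqI[OF X.d_in[OF v \<gamma>'x] g_in[OF v x] v])
          fix c f assume c: "c \<in> Obj C" and f: "f \<in> Hom E (ko c) v"
          let ?x = "FHom P v (ko c) f x"
          have x': "?x \<in> FOb P (ko c)" by (rule psh_act[OF P v k_ob[OF c] f x])
          have \<gamma>'x': "\<gamma>' (ko c) ?x \<in> FOb X (ko c)" by (rule psh_hom_in[OF P X \<gamma>'h k_ob[OF c] x'])
          have "d v (\<gamma>' v x) c (en v c f) = act v (ko c) f (d v (\<gamma>' v x)) c (en (ko c) c (Ide E (ko c)))"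
            using v c f i by (simp add: act_app k_ob X.d_in[OF v \<gamma>'x] cat_idr)
          also have "act v (ko c) f (d v (\<gamma>' v x)) = d (ko c) (\<gamma>' (ko c) ?x)"
            using X.act_d[OF v k_ob[OF c] f \<gamma>'x] psh_hom_nat[OF P X \<gamma>'h v k_ob[OF c] f x] by simp
          also have "d (ko c) (\<gamma>' (ko c) ?x) c (en (ko c) c (Ide E (ko c))) = u c (pe X c (\<gamma>' (ko c) ?x))"
            using u_app[OF c X.d_in[OF k_ob[OF c] \<gamma>'x']] X.e_d[OF k_ob[OF c] \<gamma>'x'] by simp
          also have "\<dots> = Cmp PC (FOb pull P) (FOb pull X) Q u (FHom pull P X \<gamma>') c (pe P c ?x)"
            using c x' by (simp add: pe_in[OF P] pull_app[OF P])
          also have "\<dots> = \<beta> c (pe P c ?x)" using \<gamma>' by simp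
          finally show "d v (\<gamma>' v x) c (en v c f) = g v x c (en v c f)" using v c f by (simp add: g_app)
        qed
        then show "\<gamma>' v x = \<gamma> v x" using X.e_d[OF v \<gamma>'x] v x by (simp add: \<gamma>_def)
      qed
    qed
  qed
  moreover have "bij_betw (u c) (FOb (FOb pull X) c) (FOb Q c)" if ff: "fully_faithful C E k" and c: "c \<in> Obj C" for c
  proof -
    have bij: "bij_betw (km c' c) (Hom C c' c) (Hom E (ko c') (ko c))" if "c' \<in> Obj C" for c'
      using ff c that by (simp add: fully_faithful_def)
    define kinv where "kinv = (\<lambda>c'. inv_into (Hom C c' c) (km c' c))"
    have kk: "kinv c' (km c' c g) = g" if "c' \<in> Obj C" "g \<in> Hom C c' c" for c' g
      unfolding kinv_def by (rule bij_betw_inv_into_left[OF bij[OF that(1)] that(2)])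
    have kf: "\<exists>g\<in>Hom C c' c. f = km c' c g" if "c' \<in> Obj C" "f \<in> Hom E (ko c') (ko c)" for c' f
      using bij[OF that(1)] that(2) by (auto simp: bij_betw_def)
    have elem: "\<exists>\<alpha>\<in>A (ko c). z = pe X c (e (ko c) \<alpha>)" if "z \<in> FOb (FOb pull X) c" for z
      using that pd_in[OF X c that] pe_pd[OF X c that] X.d_in[OF k_ob[OF c]] X.e_d[OF k_ob[OF c]] by metis
    have at: "\<alpha> c' (en (ko c) c' (km c' c g)) = FHom Q c c' g (\<alpha> c (en (ko c) c (Ide E (ko c))))"
      if "\<alpha> \<in> A (ko c)" "c' \<in> Obj C" "g \<in> Hom C c' c" for \<alpha> c' g
      using that c i by (simp add: A_nat k_ob k_hom cat_idl)
    show ?thesis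
    proof (rule bij_betw_imageI)
      show "inj_on (u c) (FOb (FOb pull X) c)"
      proof (rule inj_onI)
        fix z z' assume "z \<in> FOb (FOb pull X) c" "z' \<in> FOb (FOb pull X) c" and eq: "u c z = u c z'"
        then obtain \<alpha> \<alpha>' where \<alpha>: "\<alpha> \<in> A (ko c)" "z = pe X c (e (ko c) \<alpha>)" and \<alpha>': "\<alpha>' \<in> A (ko c)" "z' = pe X c (e (ko c) \<alpha>')"
          using elem by metis
        have "\<alpha> = \<alpha>'"
        proof (rule A_eqI[OF \<alpha>(1) \<alpha>'(1) k_ob[OF c]])
          fix c' f assume *: "c' \<in> Obj C" "f \<in> Hom E (ko c') (ko c)"
          then obtain g where "g \<in> Hom C c' c" "f = km c' c g" using kf by blast
          then show "\<alpha> c' (en (ko c) c' f) = \<alpha>' c' (en (ko c) c' f)"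
            using at[OF \<alpha>(1) *(1)] at[OF \<alpha>'(1) *(1)] eq \<alpha> \<alpha>' c by (simp add: u_app)
        qed
        then show "z = z'" using \<alpha> \<alpha>' by simp
      qed
      have "q \<in> u c ` FOb (FOb pull X) c" if q: "q \<in> FOb Q c" for q
      proof -
        \<comment> \<open>The preimage of \<open>q\<close> is its Yoneda transformation, transported
          along the bijection of E(k c', k c) with C(c', c).\<close>
        let ?\<alpha> = "\<lambda>c'\<in>Obj C. \<lambda>z\<in>FOb (FOb N (ko c)) c'. FHom Q c c' (kinv c' (dn (ko c) c' z)) q"
        have \<alpha>: "?\<alpha> \<in> A (ko c)"
        proof (rule A_I[OF k_ob[OF c], where t = "\<lambda>c' f. FHom Q c c' (kinv c' f) q"])
          fix c' f assume *: "c' \<in> Obj C" "f \<in> Hom E (ko c') (ko c)"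
          then obtain g where "g \<in> Hom C c' c" "f = km c' c g" using kf by blast
          then show "FHom Q c c' (kinv c' f) q \<in> FOb Q c'" using * c q by (simp add: kk psh_act[OF Q])
        next
          fix c' c'' h f assume *: "c' \<in> Obj C" "c'' \<in> Obj C" "h \<in> Hom C c'' c'" "f \<in> Hom E (ko c') (ko c)"
          then obtain g where g: "g \<in> Hom C c' c" "f = km c' c g" using kf by blast
          have "Cmp E (ko c'') (ko c') (ko c) f (km c'' c' h) = km c'' c (Cmp C c'' c' c g h)"
            using * g c by (simp add: fun_cmp[OF k])
          moreover have "Cmp C c'' c' c g h \<in> Hom C c'' c" using * g c by (intro cat_cmp[OF cC])
          ultimately show "FHom Q c' c'' h (FHom Q c c' (kinv c' f) q) =
            FHom Q c c'' (kinv c'' (Cmp E (ko c'') (ko c') (ko c) f (km c'' c' h))) q"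
            using * g c q by (simp add: kk psh_cmp[OF Q])
        qed
        have "kinv c (Ide E (ko c)) = Ide C c" using kk[OF c cat_ide[OF cC c]] c by (simp add: fun_ide[OF k])
        then have "u c (pe X c (e (ko c) ?\<alpha>)) = q"
          using u_app[OF c \<alpha>] c i q by (simp add: en_in k_ob dn_en psh_ide[OF Q])
        from this[symmetric] pe_in[OF X c X.e_in[OF k_ob[OF c] \<alpha>]] show ?thesis by (rule image_eqI)
      qed
      then show "u c ` FOb (FOb pull X) c = FOb Q c"
        using psh_hom_in[OF pull_obj[OF X] Q u c] by blast
    qed
  qed
  ultimately show ?thesis using X u by blast
qed

lemma pull_right_adjoint: "\<exists>G. adjunction PE PC pull G"
  by (rule right_adjoint_exists[OF pull_functor]) (use ran_exists in blast)

text \<open>The right adjoint \<open>G\<close> is arbitrary; comparison with the universal arrow of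
  \<open>ran_exists\<close>, which is invertible at \<open>Q\<close>, carries the invertibility over
  to the counit.\<close>

lemma pull_counit_iso:
  assumes adj: "adj PE PC pull G \<eta> \<epsilon>" and ff: "fully_faithful C E k" and Q: "Q \<in> Obj PC"
  shows "\<exists>\<delta>. iso_in PC (FOb pull (FOb G Q)) Q (\<epsilon> Q) \<delta>"
proof -
  interpret adj PE PC pull G \<eta> \<epsilon> by (rule adj)
  note GQ = fun_ob[OF G Q]
  obtain X u where X: "X \<in> Obj PE" and u: "u \<in> Hom PC (FOb pull X) Q"
    and univ: "\<forall>P\<in>Obj PE. \<forall>\<beta>\<in>Hom PC (FOb pull P) Q.
       \<exists>!\<gamma>. \<gamma> \<in> Hom PE P X \<and> Cmp PC (FOb pull P) (FOb pull X) Q u (FHom pull P X \<gamma>) = \<beta>"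
    and bij: "\<And>c. c \<in> Obj C \<Longrightarrow> bij_betw (u c) (FOb (FOb pull X) c) (FOb Q c)"
    using ran_exists[OF Q] ff by blast
  obtain u' where u': "iso_in PC (FOb pull X) Q u u'"
    using psh_iso_in[OF pull_obj[OF X] Q u bij] by blast
  obtain f where "f \<in> Hom PE (FOb G Q) X" "Cmp PC (FOb pull (FOb G Q)) (FOb pull X) Q u (FHom pull (FOb G Q) X f) = \<epsilon> Q"
    using univ GQ counit_hom[OF Q] by blast
  then show ?thesis by (rule counit_iso_if_iso[OF Q X u'])
qed

subsection \<open>Left Kan extension\<close>

text \<open>The elements of the left Kan extension at \<open>a\<close> are classes of triples \<open>(c, f, q)\<close> with \<open>f : a \<rightarrow> k c\<close> and
  \<open>q \<in> Q c\<close>. Two triples are identified when every \<open>\<beta> : Q \<rightarrow> k\<^sup>*P\<close> sends them to the same element of \<open>P a\<close>,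
  so a class is represented by the function taking \<open>(P, \<beta>)\<close> to that element, and no quotient is needed.\<close>

lemma pull_left_adjoint: "\<exists>F. adjunction PC PE F pull"
proof (rule left_adjoint_exists[OF pull_functor])
  fix Q assume Q: "Q \<in> Obj PC"
  define Y where "Y = {(P, \<beta>). P \<in> Obj PE \<and> \<beta> \<in> Hom PC Q (FOb pull P)}"
  define T where "T = (\<lambda>a. Sigma (Obj C) (\<lambda>c. Hom E a (ko c) \<times> FOb Q c))"
  define val where "val = (\<lambda>a (c, f, q). \<lambda>(P, \<beta>)\<in>Y. FHom P (ko c) a f (pd P c (\<beta> c q)))"
  define A where "A = (\<lambda>a. val a ` T a)"
  define act where "act = (\<lambda>a b g F. \<lambda>(P, \<beta>)\<in>Y. FHom P a b g (F (P, \<beta>) :: 'm + 'u))"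
  have Ti [simp]: "(c, f, q) \<in> T a \<longleftrightarrow> c \<in> Obj C \<and> f \<in> Hom E a (ko c) \<and> q \<in> FOb Q c" for a c f q
    by (auto simp: T_def)
  have \<beta>_in: "pd P c (\<beta> c q) \<in> FOb P (ko c)" if "(P, \<beta>) \<in> Y" "c \<in> Obj C" "q \<in> FOb Q c" for P \<beta> c q
    using that psh_hom_in[OF Q pull_obj] by (auto simp: Y_def intro!: pd_in)
  have val_app: "val a (c, f, q) (P, \<beta>) = FHom P (ko c) a f (pd P c (\<beta> c q))" if "(P, \<beta>) \<in> Y" for a c f q P \<beta>
    using that by (simp add: val_def)
  \<comment> \<open>The functions \<open>val a (c, f, q)\<close> are defined on the possibly large
    set \<open>Y\<close>, but there are no more of them than elements of \<open>T a\<close>.\<close>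
  have small_A: "small U (A a)" if a: "a \<in> Obj E" for a
    unfolding A_def T_def using small ls a k_ob
    by (intro small_image small_Sigma[OF inacc] small_Times[OF inacc])
       (auto simp: small_category_def locally_small_def intro: psh_small[OF Q])
  have act_val: "act a b g (val a (c, f, q)) = val b (c, Cmp E b a (ko c) f g, q)"
    if "a \<in> Obj E" "b \<in> Obj E" "g \<in> Hom E b a" "(c, f, q) \<in> T a" for a b g c f q
  proof (rule extensionalityI[of _ Y])
    fix p assume p: "p \<in> Y"
    obtain P \<beta> where p': "p = (P, \<beta>)" by (cases p)
    then have "P \<in> Obj PE" using p by (simp add: Y_def)
    then show "act a b g (val a (c, f, q)) p = val b (c, Cmp E b a (ko c) f g, q) p"
      using that p p' \<beta>_in[of P \<beta> c q] k_ob by (simp add: act_def val_app psh_cmp)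
  qed (auto simp: act_def val_def)
  have A_cases: "\<exists>c f q. (c, f, q) \<in> T a \<and> F = val a (c, f, q)" if "F \<in> A a" for F a
    using that by (force simp: A_def T_def)
  have T_cmp: "(c, Cmp E b a (ko c) f g, q) \<in> T b" if "(c, f, q) \<in> T a" "a \<in> Obj E" "b \<in> Obj E" "g \<in> Hom E b a" for a b c f q g
    using that k_ob by (simp add: cat_cmp[OF cE])
  have data: "psh_data E A act"
    unfolding psh_data_def
  proof (intro conjI ballI)
    fix a b g F assume *: "a \<in> Obj E" "b \<in> Obj E" "g \<in> Hom E b a" "F \<in> A a"
    obtain c f q where "(c, f, q) \<in> T a" "F = val a (c, f, q)" using A_cases[OF *(4)] by blast
    then show "act a b g F \<in> A b"
      unfolding A_def using act_val[OF *(1-3)] T_cmp[OF _ *(1-3)] by (metis imageI)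
  next
    fix a F assume *: "a \<in> Obj E" "F \<in> A a"
    obtain c f q where "(c, f, q) \<in> T a" "F = val a (c, f, q)" using A_cases[OF *(2)] by blast
    then show "act a a (Ide E a) F = F" using * k_ob by (simp add: act_val cat_ide[OF cE] cat_idr[OF cE])
  next
    fix a b d g h F assume *: "a \<in> Obj E" "b \<in> Obj E" "d \<in> Obj E" "g \<in> Hom E b a" "h \<in> Hom E d b" "F \<in> A a"
    obtain c f q where cfq: "(c, f, q) \<in> T a" "F = val a (c, f, q)" using A_cases[OF *(6)] by blast
    then show "act a d (Cmp E d b a g h) F = act b d h (act a b g F)"
      using * k_ob T_cmp[OF cfq(1) *(1,2,4)]
      by (simp add: act_val cat_cmp[OF cE] cat_assoc[OF cE])
  qed
  have "inj (Inr :: 'u \<Rightarrow> 'm + 'u)" by simp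
  from coded_presheaf[OF cE this small_A data] obtain X e d where X: "X \<in> Obj PE" and "coding E A act X e d" .
  then interpret X: coding E A act X e d by simp
  have i: "Ide E (ko c) \<in> Hom E (ko c) (ko c)" if "c \<in> Obj C" for c using that by (simp add: cat_ide cE k_ob)
  define g where "g = (\<lambda>c q. e (ko c) (val (ko c) (c, Ide E (ko c), q)))"
  have gA: "val (ko c) (c, Ide E (ko c), q) \<in> A (ko c)" if "c \<in> Obj C" "q \<in> FOb Q c" for c q
    using that i by (auto simp: A_def)
  have g_in: "g c q \<in> FOb X (ko c)" if "c \<in> Obj C" "q \<in> FOb Q c" for c q
    unfolding g_def by (rule X.e_in[OF k_ob[OF that(1)] gA[OF that]])
  have g_act: "FHom X (ko c) a f (g c q) = e a (val a (c, f, q))" if "a \<in> Obj E" "(c, f, q) \<in> T a" for a c f q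
    unfolding g_def using that i k_ob
    by (subst X.act_e) (simp_all add: gA act_val cat_idl[OF cE])
  define u where "u = (\<lambda>c\<in>Obj C. \<lambda>q\<in>FOb Q c. pe X c (g c q))"
  have u: "u \<in> Hom PC Q (FOb pull X)"
    unfolding u_def
  proof (rule psh_homI[OF Q pull_obj[OF X]])
    fix c q assume "c \<in> Obj C" "q \<in> FOb Q c"
    then show "pe X c (g c q) \<in> FOb (FOb pull X) c" by (intro pe_in[OF X] g_in)
  next
    fix c c' f q assume *: "c \<in> Obj C" "c' \<in> Obj C" "f \<in> Hom C c' c" "q \<in> FOb Q c"
    have f: "km c' c f \<in> Hom E (ko c') (ko c)" using * by (intro k_hom)
    \<comment> \<open>The relation by which the left Kan extension is usually formed as a quotient;
      here it holds because every \<open>\<beta>\<close> is natural.\<close>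
    have "val (ko c') (c, km c' c f, q) = val (ko c') (c', Ide E (ko c'), FHom Q c c' f q)"
    proof (rule extensionalityI[of _ Y])
      fix p assume p: "p \<in> Y"
      obtain P \<beta> where p': "p = (P, \<beta>)" by (cases p)
      then have P: "P \<in> Obj PE" and \<beta>: "\<beta> \<in> Hom PC Q (FOb pull P)" using p by (simp_all add: Y_def)
      have "pd P c' (\<beta> c' (FHom Q c c' f q)) = FHom P (ko c) (ko c') (km c' c f) (pd P c (\<beta> c q))"
        using psh_hom_nat[OF Q pull_obj[OF P] \<beta> *] pd_act[OF P *(1-3) psh_hom_in[OF Q pull_obj[OF P] \<beta> *(1,4)]] by simp
      moreover have "FHom P (ko c) (ko c') (km c' c f) (pd P c (\<beta> c q)) \<in> FOb P (ko c')"
        using \<beta>_in[of P \<beta> c q] p p' * f by (intro psh_act[OF P]) (auto intro: k_ob)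
      ultimately show "val (ko c') (c, km c' c f, q) p = val (ko c') (c', Ide E (ko c'), FHom Q c c' f q) p"
        using p p' * k_ob by (simp add: val_app psh_ide[OF P])
    qed (auto simp: val_def)
    then show "FHom (FOb pull X) c c' f (pe X c (g c q)) = pe X c' (g c' (FHom Q c c' f q))"
      using * f k_ob by (simp add: pe_act[OF X] g_in g_act) (simp add: g_def)
  qed
  have u_app: "u c q = pe X c (g c q)" if "c \<in> Obj C" "q \<in> FOb Q c" for c q using that by (simp add: u_def)
  have univ: "\<exists>!h. h \<in> Hom PE X P \<and> Cmp PC Q (FOb pull X) (FOb pull P) (FHom pull X P h) u = \<beta>"
    if P: "P \<in> Obj PE" and \<beta>: "\<beta> \<in> Hom PC Q (FOb pull P)" for P \<beta>
  proof -
    have Y: "(P, \<beta>) \<in> Y" using P \<beta> by (simp add: Y_def)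
    have X_cases: "\<exists>c f q. (c, f, q) \<in> T a \<and> x = e a (val a (c, f, q))" if "a \<in> Obj E" "x \<in> FOb X a" for a x
      using A_cases[OF X.d_in[OF that]] X.e_d[OF that] by metis
    define h where "h = (\<lambda>a\<in>Obj E. \<lambda>x\<in>FOb X a. d a x (P, \<beta>))"
    have h: "h \<in> Hom PE X P"
      unfolding h_def
    proof (rule psh_homI[OF X P])
      fix a x assume a: "a \<in> Obj E" "x \<in> FOb X a"
      then obtain c f q where "(c, f, q) \<in> T a" "d a x = val a (c, f, q)" using A_cases[OF X.d_in] by blast
      then show "d a x (P, \<beta>) \<in> FOb P a"
        using Y a \<beta>_in[OF Y] by (simp add: val_app psh_act[OF P] k_ob)
    next
      fix a b f x assume "a \<in> Obj E" "b \<in> Obj E" "f \<in> Hom E b a" "x \<in> FOb X a"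
      then show "FHom P a b f (d a x (P, \<beta>)) = d b (FHom X a b f x) (P, \<beta>)"
        using Y by (simp add: X.act_d) (simp add: act_def)
    qed
    have uh: "Cmp PC Q (FOb pull X) (FOb pull P) (FHom pull X P h) u c q = pe P c (h (ko c) (g c q))"
      if "c \<in> Obj C" "q \<in> FOb Q c" for h c q
      using that by (simp add: u_app pull_app[OF X] g_in)
    show ?thesis
    proof (rule ex1I[of _ h], intro conjI h)
      show "Cmp PC Q (FOb pull X) (FOb pull P) (FHom pull X P h) u = \<beta>"
      proof (rule psh_hom_eqI[OF Q pull_obj[OF P] cat_cmp[OF category_psh[OF cC] Q pull_obj[OF X] pull_obj[OF P] u pull_hom[OF X P h]] \<beta>])
        fix c q assume *: "c \<in> Obj C" "q \<in> FOb Q c"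
        have "h (ko c) (g c q) = val (ko c) (c, Ide E (ko c), q) (P, \<beta>)"
          using * k_ob g_in[OF *] by (simp add: h_def) (simp add: g_def X.d_e gA)
        also have "\<dots> = pd P c (\<beta> c q)" using Y \<beta>_in[OF Y *] * k_ob by (simp add: val_app psh_ide[OF P])
        finally show "Cmp PC Q (FOb pull X) (FOb pull P) (FHom pull X P h) u c q = \<beta> c q"
          using uh[OF *] pe_pd[OF P *(1)] psh_hom_in[OF Q pull_obj[OF P] \<beta> *] by simp
      qed
      fix h' assume h': "h' \<in> Hom PE X P \<and> Cmp PC Q (FOb pull X) (FOb pull P) (FHom pull X P h') u = \<beta>"
      then have h'h: "h' \<in> Hom PE X P" by simp
      show "h' = h"
      proof (rule psh_hom_eqI[OF X P h'h h])
        fix a x assume a: "a \<in> Obj E" and x: "x \<in> FOb X a"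
        then obtain c f q where T: "(c, f, q) \<in> T a" and xe: "x = e a (val a (c, f, q))" using X_cases by blast
        then have c: "c \<in> Obj C" and f: "f \<in> Hom E a (ko c)" and q: "q \<in> FOb Q c" by auto
        note gq = g_in[OF c q] and kc = k_ob[OF c]
        \<comment> \<open>Every element of \<open>X\<close> is a restriction of some
          \<open>g c q\<close>, so naturality leaves only these to be compared.\<close>
        have "pe P c (h' (ko c) (g c q)) = pe P c (h (ko c) (g c q))"
          using h' \<open>Cmp PC Q (FOb pull X) (FOb pull P) (FHom pull X P h) u = \<beta>\<close> uh[OF c q] by metis
        then have "h' (ko c) (g c q) = h (ko c) (g c q)"
          using pd_pe[OF P c] psh_hom_in[OF X P h'h kc gq] psh_hom_in[OF X P h kc gq] by metis
        then show "h' a x = h a x"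
          using psh_hom_nat[OF X P h'h kc a f gq] psh_hom_nat[OF X P h kc a f gq] g_act[OF a T] xe by simp
      qed
    qed
  qed
  then show "\<exists>X\<in>Obj PE. \<exists>u\<in>Hom PC Q (FOb pull X). \<forall>P\<in>Obj PE. \<forall>\<beta>\<in>Hom PC Q (FOb pull P).
     \<exists>!h. h \<in> Hom PE X P \<and> Cmp PC Q (FOb pull X) (FOb pull P) (FHom pull X P h) u = \<beta>"
    using X u by blast
qed

subsection \<open>Restriction along a dense functor\<close>

text \<open>Given \<open>\<beta>\<close> and an element \<open>x\<close> of \<open>P a\<close>, the
  restrictions of \<open>x\<close> along all \<open>f\<close> from \<open>k c\<close> to
  \<open>a\<close> are sent by \<open>\<beta>\<close> to morphisms from \<open>k c\<close> to
  \<open>v\<close>. By density this natural family is composition with a unique morphism from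
  \<open>a\<close> to \<open>v\<close>, the value at \<open>x\<close> of the wanted
  transformation.\<close>

lemma pull_dense:
  assumes dense: "dense_functor C E k" and P: "P \<in> Obj PE" and v: "v \<in> Obj E"
  shows "bij_betw (FHom pull P (FOb y v)) (Hom PE P (FOb y v)) (Hom PC (FOb pull P) (FOb N v))"
proof -
  have du: "\<exists>!h. h \<in> Hom E a v \<and> (\<forall>c\<in>Obj C. \<forall>f\<in>Hom E (ko c) a. \<beta> c f = Cmp E (ko c) a v h f)"
    if "a \<in> Obj E" "\<And>c f. c \<in> Obj C \<Longrightarrow> f \<in> Hom E (ko c) a \<Longrightarrow> \<beta> c f \<in> Hom E (ko c) v"
      "\<And>c c' g f. c \<in> Obj C \<Longrightarrow> c' \<in> Obj C \<Longrightarrow> g \<in> Hom C c' c \<Longrightarrow> f \<in> Hom E (ko c) a \<Longrightarrow>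
           \<beta> c' (Cmp E (ko c') (ko c) a f (km c' c g)) = Cmp E (ko c') (ko c) v (\<beta> c f) (km c' c g)" for a \<beta>
    using dense v that unfolding dense_functor_def by blast
  note yv = y_ob[OF v]
  have y_el: "\<exists>g\<in>Hom E a v. x = Inl g" if "a \<in> Obj E" "x \<in> FOb (FOb y v) a" for a x
    using that by (auto simp: yoneda_simps)
  have y_in: "Inl g \<in> FOb (FOb y v) a" if "a \<in> Obj E" "g \<in> Hom E a v" for a g
    using that by (simp add: yoneda_simps)
  show ?thesis
  proof (rule bij_betw_imageI)
    show "inj_on (FHom pull P (FOb y v)) (Hom PE P (FOb y v))"
    proof (rule inj_onI)
      fix \<alpha> \<alpha>' assume \<alpha>: "\<alpha> \<in> Hom PE P (FOb y v)" and \<alpha>': "\<alpha>' \<in> Hom PE P (FOb y v)"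
        and eq: "FHom pull P (FOb y v) \<alpha> = FHom pull P (FOb y v) \<alpha>'"
      show "\<alpha> = \<alpha>'"
      proof (rule psh_hom_eqI[OF P yv \<alpha> \<alpha>'])
        fix a x assume a: "a \<in> Obj E" and x: "x \<in> FOb P a"
        obtain h h' where h: "h \<in> Hom E a v" "\<alpha> a x = Inl h" and h': "h' \<in> Hom E a v" "\<alpha>' a x = Inl h'"
          using y_el[OF a] psh_hom_in[OF P yv \<alpha> a x] psh_hom_in[OF P yv \<alpha>' a x] by metis
        have hf: "Cmp E (ko c) a v h f = Cmp E (ko c) a v h' f" if c: "c \<in> Obj C" and f: "f \<in> Hom E (ko c) a" for c f
        proof -
          note kc = k_ob[OF c]
          have px: "FHom P a (ko c) f x \<in> FOb P (ko c)" by (rule psh_act[OF P a kc f x])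
          have "pe (FOb y v) c (\<alpha> (ko c) (FHom P a (ko c) f x)) = pe (FOb y v) c (\<alpha>' (ko c) (FHom P a (ko c) f x))"
            using pull_app[OF P c px] eq by metis
          then have "\<alpha> (ko c) (FHom P a (ko c) f x) = \<alpha>' (ko c) (FHom P a (ko c) f x)"
            using pd_pe[OF yv c] psh_hom_in[OF P yv \<alpha> kc px] psh_hom_in[OF P yv \<alpha>' kc px] by metis
          then have "FHom (FOb y v) a (ko c) f (Inl h) = FHom (FOb y v) a (ko c) f (Inl h')"
            using psh_hom_nat[OF P yv \<alpha> a kc f x] psh_hom_nat[OF P yv \<alpha>' a kc f x] h h' by simp
          then show ?thesis using a kc f h h' by (simp add: yoneda_simps)
        qed
        have "\<exists>!k. k \<in> Hom E a v \<and> (\<forall>c\<in>Obj C. \<forall>f\<in>Hom E (ko c) a. Cmp E (ko c) a v h f = Cmp E (ko c) a v k f)"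
          by (rule du[OF a]) (use a v h cE k_ob k_hom in \<open>auto simp: cat_assoc intro: cat_cmp\<close>)
        then have "h = h'" using h h' hf by blast
        then show "\<alpha> a x = \<alpha>' a x" using h h' by simp
      qed
    qed
    have "\<beta> \<in> FHom pull P (FOb y v) ` Hom PE P (FOb y v)" if \<beta>: "\<beta> \<in> Hom PC (FOb pull P) (FOb N v)" for \<beta>
    proof -
      note \<beta>_in = psh_hom_in[OF pull_obj[OF P] N_ob[OF v] \<beta>] and \<beta>_nat = psh_hom_nat[OF pull_obj[OF P] N_ob[OF v] \<beta>]
      define b where "b = (\<lambda>c x. dn v c (\<beta> c (pe P c x)))"
      have b_in: "b c x \<in> Hom E (ko c) v" and b_en: "en v c (b c x) = \<beta> c (pe P c x)" if "c \<in> Obj C" "x \<in> FOb P (ko c)" for c x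
        using N_elem[OF v that(1) \<beta>_in[OF that(1) pe_in[OF P that]]] dn_en[OF v that(1)] unfolding b_def by metis+
      have b_nat: "b c' (FHom P (ko c) (ko c') (km c' c g) x) = Cmp E (ko c') (ko c) v (b c x) (km c' c g)"
        if *: "c \<in> Obj C" "c' \<in> Obj C" "g \<in> Hom C c' c" "x \<in> FOb P (ko c)" for c c' g x
      proof -
        have "\<beta> c' (pe P c' (FHom P (ko c) (ko c') (km c' c g) x)) = FHom (FOb N v) c c' g (en v c (b c x))"
          using \<beta>_nat[OF *(1-3) pe_in[OF P *(1,4)]] pe_act[OF P *] b_en[OF *(1,4)] by simp
        also have "\<dots> = en v c' (Cmp E (ko c') (ko c) v (b c x) (km c' c g))"
          by (rule en_act[OF v *(1-3) b_in[OF *(1,4)]])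
        finally show ?thesis unfolding b_def
          using dn_en[OF v *(2) cat_cmp[OF cE k_ob[OF *(2)] k_ob[OF *(1)] v k_hom[OF *(2,1,3)] b_in[OF *(1,4)]]] by (simp add: b_def)
      qed
      have "\<exists>h. h \<in> Hom E a v \<and> (\<forall>c\<in>Obj C. \<forall>f\<in>Hom E (ko c) a. b c (FHom P a (ko c) f x) = Cmp E (ko c) a v h f)"
        if a: "a \<in> Obj E" and x: "x \<in> FOb P a" for a x
      proof -
        have "\<exists>!h. h \<in> Hom E a v \<and> (\<forall>c\<in>Obj C. \<forall>f\<in>Hom E (ko c) a. b c (FHom P a (ko c) f x) = Cmp E (ko c) a v h f)"
        proof (rule du[OF a])
          fix c f assume "c \<in> Obj C" "f \<in> Hom E (ko c) a"
          then show "b c (FHom P a (ko c) f x) \<in> Hom E (ko c) v" using a x k_ob by (intro b_in psh_act[OF P]) auto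
        next
          fix c c' g f assume *: "c \<in> Obj C" "c' \<in> Obj C" "g \<in> Hom C c' c" "f \<in> Hom E (ko c) a"
          then show "b c' (FHom P a (ko c') (Cmp E (ko c') (ko c) a f (km c' c g)) x) =
             Cmp E (ko c') (ko c) v (b c (FHom P a (ko c) f x)) (km c' c g)"
            using a x k_ob k_hom psh_act[OF P a _ _ x] by (simp add: psh_cmp[OF P] b_nat)
        qed
        then show ?thesis by blast
      qed
      then obtain H where H: "\<And>a x. a \<in> Obj E \<Longrightarrow> x \<in> FOb P a \<Longrightarrow> H a x \<in> Hom E a v"
        and Hf: "\<And>a x c f. a \<in> Obj E \<Longrightarrow> x \<in> FOb P a \<Longrightarrow> c \<in> Obj C \<Longrightarrow> f \<in> Hom E (ko c) a \<Longrightarrow>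
          b c (FHom P a (ko c) f x) = Cmp E (ko c) a v (H a x) f" by metis
      define \<alpha> where "\<alpha> = (\<lambda>a\<in>Obj E. \<lambda>x\<in>FOb P a. Inl (H a x) :: 'm + 'u)"
      have \<alpha>: "\<alpha> \<in> Hom PE P (FOb y v)"
        unfolding \<alpha>_def
      proof (rule psh_homI[OF P yv])
        fix a x assume "a \<in> Obj E" "x \<in> FOb P a"
        then show "Inl (H a x) \<in> FOb (FOb y v) a" by (simp add: y_in H)
      next
        fix a a' g x assume *: "a \<in> Obj E" "a' \<in> Obj E" "g \<in> Hom E a' a" "x \<in> FOb P a"
        have x': "FHom P a a' g x \<in> FOb P a'" by (rule psh_act[OF P *])
        \<comment> \<open>Naturality of \<open>H\<close> by uniqueness: both sides represent the
          same family on the morphisms from some \<open>k c\<close> to \<open>a'\<close>.\<close>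
        have "\<exists>!h. h \<in> Hom E a' v \<and> (\<forall>c\<in>Obj C. \<forall>f\<in>Hom E (ko c) a'.
            Cmp E (ko c) a' v (H a' (FHom P a a' g x)) f = Cmp E (ko c) a' v h f)"
          by (rule du[OF *(2)]) (use * v H[OF *(2) x'] cE k_ob k_hom in \<open>auto simp: cat_assoc intro: cat_cmp\<close>)
        moreover have "Cmp E a' a v (H a x) g \<in> Hom E a' v" using * v H by (intro cat_cmp[OF cE]) auto
        moreover have "Cmp E (ko c) a' v (H a' (FHom P a a' g x)) f = Cmp E (ko c) a' v (Cmp E a' a v (H a x) g) f"
          if c: "c \<in> Obj C" and f: "f \<in> Hom E (ko c) a'" for c f
        proof -
          have "Cmp E (ko c) a' v (H a' (FHom P a a' g x)) f = b c (FHom P a (ko c) (Cmp E (ko c) a' a g f) x)"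
            using Hf[OF *(2) x' c f] psh_cmp[OF P *(1,2) k_ob[OF c] *(3) f *(4)] by simp
          also have "\<dots> = Cmp E (ko c) a v (H a x) (Cmp E (ko c) a' a g f)"
            using * c f k_ob by (intro Hf cat_cmp[OF cE]) auto
          finally show ?thesis using * c f k_ob v H cE by (simp add: cat_assoc)
        qed
        ultimately have "H a' (FHom P a a' g x) = Cmp E a' a v (H a x) g" using H[OF *(2) x'] by blast
        then show "FHom (FOb y v) a a' g (Inl (H a x)) = Inl (H a' (FHom P a a' g x))"
          using * H by (simp add: yoneda_simps)
      qed
      have "FHom pull P (FOb y v) \<alpha> = \<beta>"
      proof (rule psh_hom_eqI[OF pull_obj[OF P] N_ob[OF v] _ \<beta>])
        show "FHom pull P (FOb y v) \<alpha> \<in> Hom PC (FOb pull P) (FOb N v)" unfolding N_simps by (rule pull_hom[OF P yv \<alpha>])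
        fix c z assume c: "c \<in> Obj C" and z: "z \<in> FOb (FOb pull P) c"
        obtain x where x: "x \<in> FOb P (ko c)" "z = pe P c x" using pull_elem[OF P c z] .
        note kc = k_ob[OF c]
        have "b c (FHom P (ko c) (ko c) (Ide E (ko c)) x) = Cmp E (ko c) (ko c) v (H (ko c) x) (Ide E (ko c))"
          by (rule Hf[OF kc x(1) c cat_ide[OF cE kc]])
        then have "b c x = H (ko c) x" using x kc v H cE by (simp add: psh_ide[OF P] cat_idr)
        then show "FHom pull P (FOb y v) \<alpha> c z = \<beta> c z"
          using pull_app[OF P c x(1), of "FOb y v" \<alpha>] b_en[OF c x(1)] x kc by (simp add: \<alpha>_def en_def)
      qed
      then show ?thesis using \<alpha> by blast
    qed
    then show "FHom pull P (FOb y v) ` Hom PE P (FOb y v) = Hom PC (FOb pull P) (FOb N v)"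
      using pull_hom[OF P yv] by (auto simp: N_simps)
  qed
qed

text \<open>Yoneda, followed by \<open>pull_dense\<close> for representable
  \<open>P\<close>.\<close>

lemma N_fully_faithful:
  assumes dense: "dense_functor C E k"
  shows "fully_faithful E PC N"
  unfolding fully_faithful_def
proof (intro conjI ballI N_functor)
  fix v w assume vw: "v \<in> Obj E" "w \<in> Obj E"
  have "bij_betw (FHom y v w) (Hom E v w) (Hom PE (FOb y v) (FOb y w))"
    using yoneda_fully_faithful[OF cE ls] vw by (simp add: fully_faithful_def)
  from bij_betw_trans[OF this pull_dense[OF dense y_ob[OF vw(1)] vw(2)]]
  have "bij_betw (FHom pull (FOb y v) (FOb y w) \<circ> FHom y v w) (Hom E v w) (Hom PC (FOb N v) (FOb N w))"
    unfolding N_simps(1) .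
  moreover have "FHom pull (FOb y v) (FOb y w) \<circ> FHom y v w = FHom N v w" by (simp add: fun_eq_iff N_simps)
  ultimately show "bij_betw (FHom N v w) (Hom E v w) (Hom PC (FOb N v) (FOb N w))" by simp
qed

text \<open>E(A (pull P), v) = Hom(pull P, N v) = Hom(P, y v), the second equality by
  \<open>pull_dense\<close>.\<close>

lemma adjunction_yoneda:
  assumes dense: "dense_functor C E k" and adj: "adjunction PC E A N"
  shows "adjunction PE E (comp_funct A pull) y"
proof -
  note A = adjunction_functors(1)[OF adj]
  note [simp] = cE cC category_psh y_ob pull_obj fun_ob[OF A] fun_hom[OF A] y_hom
  obtain \<psi> where "hom_bijection PC E A N \<psi>"
    using adjunction_hom[OF adj] .
  then interpret \<psi>: hom_bijection PC E A N \<psi> .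
  note pd = pull_dense[OF dense]
  define \<rho> where "\<rho> = (\<lambda>P v. inv_into (Hom PE P (FOb y v)) (FHom pull P (FOb y v)))"
  have \<rho>: "bij_betw (\<rho> P v) (Hom PC (FOb pull P) (FOb N v)) (Hom PE P (FOb y v))" if "P \<in> Obj PE" "v \<in> Obj E" for P v
    unfolding \<rho>_def by (rule bij_betw_inv_into[OF pd[OF that]])
  have \<rho>_in: "\<rho> P v \<beta> \<in> Hom PE P (FOb y v)" and pull_\<rho>: "FHom pull P (FOb y v) (\<rho> P v \<beta>) = \<beta>"
    if "P \<in> Obj PE" "v \<in> Obj E" "\<beta> \<in> Hom PC (FOb pull P) (FOb N v)" for P v \<beta>
    using bij_betwE[OF \<rho>[OF that(1,2)]] bij_betw_inv_into_right[OF pd[OF that(1,2)] that(3)] that(3) by (auto simp: \<rho>_def)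
  have \<rho>_eq: "\<rho> P v \<beta> = \<alpha>" if "P \<in> Obj PE" "v \<in> Obj E" "\<alpha> \<in> Hom PE P (FOb y v)" "FHom pull P (FOb y v) \<alpha> = \<beta>" for P v \<beta> \<alpha>
    using bij_betw_inv_into_left[OF pd[OF that(1,2)] that(3)] that(4) by (simp add: \<rho>_def)
  show ?thesis
  proof (rule adjunctionI[where \<phi> = "\<lambda>P v g. \<rho> P v (\<psi> (FOb pull P) v g)"])
    show "is_functor PE E (comp_funct A pull)" by (rule is_functor_comp[OF pull_functor A])
    show "is_functor E PE y" by (rule yoneda_functor[OF cE ls])
    fix P v assume P: "P \<in> Obj PE" and v: "v \<in> Obj E"
    show "bij_betw (\<lambda>g. \<rho> P v (\<psi> (FOb pull P) v g)) (Hom E (FOb (comp_funct A pull) P) v) (Hom PE P (FOb y v))"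
      using bij_betw_trans[OF \<psi>.bij[OF pull_obj[OF P] v] \<rho>[OF P v]] by (simp add: comp_def)
  next
    fix P P' v f g assume *: "P \<in> Obj PE" "P' \<in> Obj PE" "v \<in> Obj E" "f \<in> Hom PE P' P" "g \<in> Hom E (FOb (comp_funct A pull) P) v"
    then have g: "\<psi> (FOb pull P) v g \<in> Hom PC (FOb pull P) (FOb N v)" by (intro \<psi>.hom) auto
    note r = \<rho>_in[OF *(1,3) g]
    show "\<rho> P' v (\<psi> (FOb pull P') v (Cmp E (FOb (comp_funct A pull) P') (FOb (comp_funct A pull) P) v g (FHom (comp_funct A pull) P' P f))) =
      Cmp PE P' P (FOb y v) (\<rho> P v (\<psi> (FOb pull P) v g)) f"
      by (rule \<rho>_eq[OF *(2,3)])
         (use * r g in \<open>auto intro!: cat_cmp simp: \<psi>.nat_left pull_hom fun_cmp[OF pull_functor] pull_\<rho> N_simps[symmetric]\<close>)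
  next
    fix P v v' g h assume *: "P \<in> Obj PE" "v \<in> Obj E" "v' \<in> Obj E" "g \<in> Hom E (FOb (comp_funct A pull) P) v" "h \<in> Hom E v v'"
    then have g: "\<psi> (FOb pull P) v g \<in> Hom PC (FOb pull P) (FOb N v)" by (intro \<psi>.hom) auto
    note r = \<rho>_in[OF *(1,2) g]
    show "\<rho> P v' (\<psi> (FOb pull P) v' (Cmp E (FOb (comp_funct A pull) P) v v' h g)) =
      Cmp PE P (FOb y v) (FOb y v') (FHom y v v' h) (\<rho> P v (\<psi> (FOb pull P) v g))"
      by (rule \<rho>_eq[OF *(1,3)])
         (use * r g in \<open>auto intro!: cat_cmp simp: \<psi>.nat_right pull_hom fun_cmp[OF pull_functor] pull_\<rho> N_simps[symmetric]\<close>)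
  qed
qed

text \<open>E(c (G Q), v) = Hom(G Q, y v) = Hom(pull (G Q), N v) = Hom(Q, N v), by the adjunction,
  by density, and by invertibility of the counit of \<open>pull\<close> and
  \<open>G\<close>.\<close>

lemma adjunction_N:
  assumes dense: "dense_functor C E k" and ff: "fully_faithful C E k"
    and cy: "adjunction PE E c y" and pG: "adjunction PE PC pull G"
  shows "adjunction PC E (comp_funct c G) N"
proof -
  obtain \<eta> \<epsilon> where adj: "adj PE PC pull G \<eta> \<epsilon>" using adjE[OF pG] .
  then interpret adj PE PC pull G \<eta> \<epsilon> .
  note GF = adjunction_functors(2)[OF pG] and cF = adjunction_functors(1)[OF cy]
  have "\<forall>Q\<in>Obj PC. \<exists>\<delta>. iso_in PC (FOb pull (FOb G Q)) Q (\<epsilon> Q) \<delta>" using pull_counit_iso[OF adj ff] by blast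
  then obtain \<delta> where \<delta>: "\<And>Q. Q \<in> Obj PC \<Longrightarrow> iso_in PC (FOb pull (FOb G Q)) Q (\<epsilon> Q) (\<delta> Q)" by metis
  have \<delta>h: "\<delta> Q \<in> Hom PC Q (FOb pull (FOb G Q))"
    and \<delta>\<epsilon>: "Cmp PC (FOb pull (FOb G Q)) Q (FOb pull (FOb G Q)) (\<delta> Q) (\<epsilon> Q) = Ide PC (FOb pull (FOb G Q))"
    and \<epsilon>\<delta>: "Cmp PC Q (FOb pull (FOb G Q)) Q (\<epsilon> Q) (\<delta> Q) = Ide PC Q" if "Q \<in> Obj PC" for Q
    using \<delta>[OF that] by (auto simp: iso_in_def)
  note [simp] = cE cC category_psh y_ob pull_obj fun_ob[OF GF] fun_hom[OF GF] fun_ob[OF cF] fun_hom[OF cF] y_hom \<delta>h N_ob N_hom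
    fun_hom[OF pull_functor] counit_hom
  obtain \<psi> where "hom_bijection PE E c y \<psi>"
    using adjunction_hom[OF cy] .
  then interpret \<psi>: hom_bijection PE E c y \<psi> .
  note [simp] = \<psi>.hom
  have pullh [simp]: "FHom pull P (FOb y d) \<alpha> \<in> Hom PC (FOb pull P) (FOb N d)" if "P \<in> Obj PE" "d \<in> Obj E" "\<alpha> \<in> Hom PE P (FOb y d)" for P d \<alpha>
    using pull_hom[OF that(1) y_ob[OF that(2)] that(3)] by (simp add: N_simps)
  \<comment> \<open>The inverses of a natural family of isomorphisms are natural; naturality of the
    hom bijection in \<open>Q\<close> depends on it.\<close>
  have \<delta>nat: "Cmp PC Q' (FOb pull (FOb G Q')) (FOb pull (FOb G Q)) (FHom pull (FOb G Q') (FOb G Q) (FHom G Q' Q f)) (\<delta> Q') =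
     Cmp PC Q' Q (FOb pull (FOb G Q)) (\<delta> Q) f" (is "?l = ?r")
    if *: "Q \<in> Obj PC" "Q' \<in> Obj PC" "f \<in> Hom PC Q' Q" for Q Q' f
  proof -
    let ?p = "FOb pull (FOb G Q)" and ?p' = "FOb pull (FOb G Q')"
    have l: "?l \<in> Hom PC Q' ?p" using * by (intro cat_cmp[where b="?p'"]) auto
    have "?l = Cmp PC Q' ?p ?p (Cmp PC ?p Q ?p (\<delta> Q) (\<epsilon> Q)) ?l" using * l by (simp add: \<delta>\<epsilon> cat_idl)
    also have "\<dots> = Cmp PC Q' Q ?p (\<delta> Q) (Cmp PC Q' ?p Q (\<epsilon> Q) ?l)" using * l by (intro cat_assoc) auto
    also have "Cmp PC Q' ?p Q (\<epsilon> Q) ?l = Cmp PC Q' ?p' Q (Cmp PC ?p' ?p Q (\<epsilon> Q) (FHom pull (FOb G Q') (FOb G Q) (FHom G Q' Q f))) (\<delta> Q')"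
      using * by (intro cat_assoc[symmetric]) auto
    also have "\<dots> = Cmp PC Q' Q' Q f (Cmp PC Q' ?p' Q' (\<epsilon> Q') (\<delta> Q'))"
      unfolding counit_nat[OF *(2,1,3)] using * by (intro cat_assoc) auto
    also have "\<dots> = f" using * by (simp add: \<epsilon>\<delta> cat_idr)
    finally show ?thesis .
  qed
  show ?thesis
  proof (rule adjunctionI[where \<phi> = "\<lambda>Q v g. Cmp PC Q (FOb pull (FOb G Q)) (FOb N v) (FHom pull (FOb G Q) (FOb y v) (\<psi> (FOb G Q) v g)) (\<delta> Q)"])
    show "is_functor PC E (comp_funct c G)" by (rule is_functor_comp[OF GF cF])
    show "is_functor E PC N" by (rule N_functor)
    fix Q v assume Q: "Q \<in> Obj PC" and v: "v \<in> Obj E"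
    let ?p = "FOb pull (FOb G Q)"
    have "bij_betw (\<lambda>\<alpha>. Cmp PC Q ?p (FOb N v) \<alpha> (\<delta> Q)) (Hom PC ?p (FOb N v)) (Hom PC Q (FOb N v))"
    proof (rule bij_betw_byWitness[where f' = "\<lambda>\<alpha>. Cmp PC ?p Q (FOb N v) \<alpha> (\<epsilon> Q)"])
      show "\<forall>\<alpha>\<in>Hom PC ?p (FOb N v). Cmp PC ?p Q (FOb N v) (Cmp PC Q ?p (FOb N v) \<alpha> (\<delta> Q)) (\<epsilon> Q) = \<alpha>"
        using Q v by (simp add: cat_assoc[where f="\<epsilon> Q"] \<delta>\<epsilon> cat_idr)
      show "\<forall>\<alpha>\<in>Hom PC Q (FOb N v). Cmp PC Q ?p (FOb N v) (Cmp PC ?p Q (FOb N v) \<alpha> (\<epsilon> Q)) (\<delta> Q) = \<alpha>"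
        using Q v by (simp add: cat_assoc[where f="\<delta> Q"] \<epsilon>\<delta> cat_idr)
    qed (use Q v in \<open>auto intro!: cat_cmp\<close>)
    from bij_betw_trans[OF bij_betw_trans[OF \<psi>.bij[OF fun_ob[OF GF Q] v] pull_dense[OF dense fun_ob[OF GF Q] v]] this]
    show "bij_betw (\<lambda>g. Cmp PC Q ?p (FOb N v) (FHom pull (FOb G Q) (FOb y v) (\<psi> (FOb G Q) v g)) (\<delta> Q))
      (Hom E (FOb (comp_funct c G) Q) v) (Hom PC Q (FOb N v))"
      by (simp add: comp_def)
  next
    fix Q Q' v f g assume *: "Q \<in> Obj PC" "Q' \<in> Obj PC" "v \<in> Obj E" "f \<in> Hom PC Q' Q" "g \<in> Hom E (FOb (comp_funct c G) Q) v"
    let ?p = "FOb pull (FOb G Q)" and ?p' = "FOb pull (FOb G Q')"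
    let ?f = "FHom pull (FOb G Q') (FOb G Q) (FHom G Q' Q f)" and ?h = "FHom pull (FOb G Q) (FOb y v) (\<psi> (FOb G Q) v g)"
    have [simp]: "?h \<in> Hom PC ?p (FOb N v)" "?f \<in> Hom PC ?p' ?p" using * by auto
    have "FHom pull (FOb G Q') (FOb y v) (\<psi> (FOb G Q') v (Cmp E (FOb c (FOb G Q')) (FOb c (FOb G Q)) v g (FHom c (FOb G Q') (FOb G Q) (FHom G Q' Q f)))) =
       Cmp PC ?p' ?p (FOb N v) ?h ?f"
      using * by (simp add: \<psi>.nat_left fun_cmp[OF pull_functor] N_simps[symmetric])
    moreover have "Cmp PC Q' ?p' (FOb N v) (Cmp PC ?p' ?p (FOb N v) ?h ?f) (\<delta> Q') = Cmp PC Q' ?p (FOb N v) ?h (Cmp PC Q' ?p' ?p ?f (\<delta> Q'))"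
      using * by (intro cat_assoc) auto
    moreover have "\<dots> = Cmp PC Q' Q (FOb N v) (Cmp PC Q ?p (FOb N v) ?h (\<delta> Q)) f"
      unfolding \<delta>nat[OF *(1,2,4)] using * by (intro cat_assoc[symmetric]) auto
    ultimately show "Cmp PC Q' ?p' (FOb N v) (FHom pull (FOb G Q') (FOb y v) (\<psi> (FOb G Q') v
        (Cmp E (FOb (comp_funct c G) Q') (FOb (comp_funct c G) Q) v g (FHom (comp_funct c G) Q' Q f)))) (\<delta> Q') =
       Cmp PC Q' Q (FOb N v) (Cmp PC Q ?p (FOb N v) ?h (\<delta> Q)) f" by simp
  next
    fix Q v v' g h assume *: "Q \<in> Obj PC" "v \<in> Obj E" "v' \<in> Obj E" "g \<in> Hom E (FOb (comp_funct c G) Q) v" "h \<in> Hom E v v'"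
    let ?p = "FOb pull (FOb G Q)" and ?h = "FHom pull (FOb G Q) (FOb y v) (\<psi> (FOb G Q) v g)"
    have "FHom pull (FOb G Q) (FOb y v') (\<psi> (FOb G Q) v' (Cmp E (FOb c (FOb G Q)) v v' h g)) = Cmp PC ?p (FOb N v) (FOb N v') (FHom N v v' h) ?h"
      using * by (simp add: \<psi>.nat_right fun_cmp[OF pull_functor] N_simps)
    then show "Cmp PC Q ?p (FOb N v') (FHom pull (FOb G Q) (FOb y v') (\<psi> (FOb G Q) v' (Cmp E (FOb (comp_funct c G) Q) v v' h g))) (\<delta> Q) =
      Cmp PC Q (FOb N v) (FOb N v') (FHom N v v' h) (Cmp PC Q ?p (FOb N v) ?h (\<delta> Q))"
      using * by (simp add: cat_assoc)
  qed
qed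

end


section \<open>Small dense generators\<close>

lemma restrict_funct_psh:
  assumes P: "P \<in> Obj (presheaf_cat U E)" and S: "S \<subseteq> Obj E"
  shows "restrict_funct (op_cat (full_subcat E S)) P \<in> Obj (presheaf_cat U (full_subcat E S))"
proof -
  let ?P = "restrict_funct (op_cat (full_subcat E S)) P"
  have E: "category E" by (rule psh_cat[OF P])
  have "FHom ?P a b f \<in> extensional (FOb ?P a)" if "a \<in> S" "b \<in> S" "f \<in> Hom E b a" for a b f
    using that P S by (auto simp: restrict_funct_def psh_obj_iff subset_iff)
  moreover have "psh_data (full_subcat E S) (FOb ?P) (FHom ?P)"
    using S cat_ide[OF E] cat_cmp[OF E]
    unfolding psh_data_def by (auto simp: restrict_funct_def psh_ide[OF P] psh_cmp[OF P] psh_act[OF P] subset_iff)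
  moreover have "extensional_funct (op_cat (full_subcat E S)) ?P"
    by (auto simp: extensional_funct_def restrict_funct_def)
  ultimately show ?thesis
    unfolding psh_obj_iff using category_full_subcat[OF E S] psh_small[OF P] S by (auto simp: restrict_funct_def)
qed

lemma restricted_yoneda_simps:
  "s \<in> S \<Longrightarrow> FOb (FOb (restricted_yoneda U E S) v) s = FOb (FOb (yoneda U E) v) s"
  "s \<in> S \<Longrightarrow> s' \<in> S \<Longrightarrow> f \<in> Hom E s' s \<Longrightarrow>
    FHom (FOb (restricted_yoneda U E S) v) s s' f = FHom (FOb (yoneda U E) v) s s' f"
  "s \<in> S \<Longrightarrow> FHom (restricted_yoneda U E S) v w h s = FHom (yoneda U E) v w h s"
  by (simp_all add: restricted_yoneda_def restrict_funct_def)

lemma restricted_yoneda_functor: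
  assumes E: "category E" and ls: "locally_small U E" and S: "S \<subseteq> Obj E"
  shows "is_functor E (presheaf_cat U (full_subcat E S)) (restricted_yoneda U E S)"
proof -
  let ?r = "restricted_yoneda U E S" and ?y = "yoneda U E" and ?P = "presheaf_cat U (full_subcat E S)"
  note y_ob = yoneda_obj[OF E ls] and y = yoneda_functor[OF E ls]
  have cP: "category ?P" by (rule category_psh[OF category_full_subcat[OF E S]])
  have ob: "FOb ?r v \<in> Obj ?P" if "v \<in> Obj E" for v
    unfolding restricted_yoneda_def using restrict_funct_psh[OF y_ob[OF that] S] by simp
  have hom: "FHom ?r v w h \<in> Hom ?P (FOb ?r v) (FOb ?r w)" if "v \<in> Obj E" "w \<in> Obj E" "h \<in> Hom E v w" for v w h
  proof -
    note \<alpha> = fun_hom[OF y that]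
    have ext: "FHom ?y v w h s \<in> FOb (FOb ?y v) s \<rightarrow>\<^sub>E FOb (FOb ?y w) s" if "s \<in> S" for s
      using \<alpha> psh_hom_iff[OF y_ob y_ob] \<open>v \<in> Obj E\<close> \<open>w \<in> Obj E\<close> S that by blast
    show ?thesis
      unfolding psh_hom_iff[OF ob[OF that(1)] ob[OF that(2)]] full_subcat_simps
    proof (intro conjI ballI)
      show "FHom ?r v w h \<in> extensional S" by (simp add: restricted_yoneda_def)
    qed (use S ext psh_hom_nat[OF y_ob[OF that(1)] y_ob[OF that(2)] \<alpha>] in \<open>auto simp: restricted_yoneda_simps subset_iff\<close>)
  qed
  show ?thesis
    unfolding is_functor_def
  proof (intro conjI ballI E cP ob hom)
    fix a assume a: "a \<in> Obj E"
    show "FHom ?r a a (Ide E a) = Ide ?P (FOb ?r a)"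
      by (rule psh_hom_eqI[OF ob[OF a] ob[OF a] hom[OF a a cat_ide[OF E a]] cat_ide[OF cP ob[OF a]]])
         (use a S in \<open>auto simp: restricted_yoneda_simps fun_ide[OF y]\<close>)
  next
    fix a b c f g assume *: "a \<in> Obj E" "b \<in> Obj E" "c \<in> Obj E" "f \<in> Hom E a b" "g \<in> Hom E b c"
    show "FHom ?r a c (Cmp E a b c g f) = Cmp ?P (FOb ?r a) (FOb ?r b) (FOb ?r c) (FHom ?r b c g) (FHom ?r a b f)"
      by (rule psh_hom_eqI[OF ob[OF *(1)] ob[OF *(3)] hom[OF *(1,3) cat_cmp[OF E *]]
           cat_cmp[OF cP ob[OF *(1)] ob[OF *(2)] ob[OF *(3)] hom[OF *(1,2,4)] hom[OF *(2,3,5)]]])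
         (use * S in \<open>auto simp: restricted_yoneda_simps fun_cmp[OF y] subset_iff\<close>)
  qed
qed

text \<open>Stripping the \<open>Inl\<close> copies with \<open>projl\<close> identifies
  transformations between restricted representables with natural families of functions between
  hom-sets, and composition with \<open>h\<close> on one side with composition with \<open>h\<close>
  on the other.\<close>

lemma restricted_yoneda_fully_faithful_iff:
  fixes E :: "('o, 'm) cat" and U :: "'u itself"
  assumes E: "category E" and ls: "locally_small U E" and S: "S \<subseteq> Obj E"
  shows "fully_faithful E (presheaf_cat U (full_subcat E S)) (restricted_yoneda U E S) \<longleftrightarrow>
    dense_functor (full_subcat E S) E id_funct"
proof -
  let ?r = "restricted_yoneda U E S" and ?P = "presheaf_cat U (full_subcat E S)"
  note r = restricted_yoneda_functor[OF assms]
  note ob = fun_ob[OF r] and hom = fun_hom[OF r]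
  have SE: "s \<in> Obj E" if "s \<in> S" for s using that S by blast
  note rs = restricted_yoneda_simps yoneda_simps
  define natural where "natural = (\<lambda>v w \<beta>. (\<forall>s\<in>S. \<forall>f\<in>Hom E s v. \<beta> s f \<in> Hom E s w) \<and>
    (\<forall>s\<in>S. \<forall>s'\<in>S. \<forall>g\<in>Hom E s' s. \<forall>f\<in>Hom E s v. \<beta> s' (Cmp E s' s v f g) = Cmp E s' s w (\<beta> s f) g))"
  define rep where "rep = (\<lambda>v w \<beta> h. \<forall>s\<in>S. \<forall>f\<in>Hom E s v. \<beta> s f = Cmp E s v w h f)"
  define trans_of :: "'o \<Rightarrow> ('o \<Rightarrow> 'm \<Rightarrow> 'm) \<Rightarrow> 'o \<Rightarrow> 'm + 'u \<Rightarrow> 'm + 'u"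
    where "trans_of = (\<lambda>v \<beta>. (\<lambda>s\<in>S. \<lambda>x\<in>FOb (FOb ?r v) s. Inl (\<beta> s (projl x))))"
  have trans_of: "trans_of v \<beta> \<in> Hom ?P (FOb ?r v) (FOb ?r w)" if vw: "v \<in> Obj E" "w \<in> Obj E" and n: "natural v w \<beta>" for v w \<beta>
  proof -
    have eq: "trans_of v \<beta> = (\<lambda>s\<in>Obj (full_subcat E S). \<lambda>x\<in>FOb (FOb ?r v) s. Inl (\<beta> s (projl x)))"
      by (simp add: trans_of_def)
    show ?thesis
      unfolding eq by (rule psh_homI[OF ob[OF vw(1)] ob[OF vw(2)]])
        (use n vw SE in \<open>auto simp: natural_def rs cat_cmp[OF E]\<close>)
  qed
  have trans_of_app: "trans_of v \<beta> s (Inl f) = Inl (\<beta> s f)" if "s \<in> S" "f \<in> Hom E s v" for v \<beta> s f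
    using that SE by (simp add: trans_of_def rs)
  have eq_iff: "trans_of v \<beta> = FHom ?r v w h \<longleftrightarrow> rep v w \<beta> h"
    if vw: "v \<in> Obj E" "w \<in> Obj E" and n: "natural v w \<beta>" and h: "h \<in> Hom E v w" for v w \<beta> h
  proof
    assume a: "trans_of v \<beta> = FHom ?r v w h"
    show "rep v w \<beta> h"
      unfolding rep_def
    proof (intro ballI)
      fix s f assume *: "s \<in> S" "f \<in> Hom E s v"
      then show "\<beta> s f = Cmp E s v w h f"
        using fun_cong[OF fun_cong[OF a, of s], of "Inl f"] SE[OF *(1)] by (simp add: trans_of_app rs)
    qed
  next
    assume "rep v w \<beta> h"
    then show "trans_of v \<beta> = FHom ?r v w h"
      by (intro psh_hom_eqI[OF ob[OF vw(1)] ob[OF vw(2)] trans_of[OF vw n] hom[OF vw h]])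
         (use SE in \<open>auto simp: rs trans_of_app rep_def\<close>)
  qed
  have ex: "\<exists>\<beta>. natural v w \<beta> \<and> \<alpha> = trans_of v \<beta>"
    if vw: "v \<in> Obj E" "w \<in> Obj E" and \<alpha>: "\<alpha> \<in> Hom ?P (FOb ?r v) (FOb ?r w)" for v w \<alpha>
  proof -
    define \<beta> where "\<beta> = (\<lambda>s f. projl (\<alpha> s (Inl f)))"
    have \<beta>: "\<alpha> s (Inl f) = Inl (\<beta> s f)" "\<beta> s f \<in> Hom E s w" if "s \<in> S" "f \<in> Hom E s v" for s f
      using psh_hom_in[OF ob[OF vw(1)] ob[OF vw(2)] \<alpha>, of s "Inl f"] that SE by (auto simp: \<beta>_def rs)
    have "natural v w \<beta>"
      unfolding natural_def
    proof (intro conjI ballI \<beta>(2))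
      fix s s' g f assume *: "s \<in> S" "s' \<in> S" "g \<in> Hom E s' s" "f \<in> Hom E s v"
      then have "Cmp E s' s v f g \<in> Hom E s' v" using vw SE by (intro cat_cmp[OF E]) auto
      then have "(Inl (\<beta> s' (Cmp E s' s v f g)) :: 'm + 'u) = Inl (Cmp E s' s w (\<beta> s f) g)"
        using psh_hom_nat[OF ob[OF vw(1)] ob[OF vw(2)] \<alpha>, of s s' g "Inl f"] * SE \<beta> by (simp add: rs)
      then show "\<beta> s' (Cmp E s' s v f g) = Cmp E s' s w (\<beta> s f) g" by simp
    qed
    moreover have "\<alpha> = trans_of v \<beta>"
      by (rule psh_hom_eqI[OF ob[OF vw(1)] ob[OF vw(2)] \<alpha> trans_of[OF vw \<open>natural v w \<beta>\<close>]])
         (use SE in \<open>auto simp: rs trans_of_app \<beta>\<close>)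
    ultimately show ?thesis by blast
  qed
  have bij: "bij_betw (FHom ?r v w) (Hom E v w) (Hom ?P (FOb ?r v) (FOb ?r w)) \<longleftrightarrow>
      (\<forall>\<beta>. natural v w \<beta> \<longrightarrow> (\<exists>!h. h \<in> Hom E v w \<and> rep v w \<beta> h))" (is "?l \<longleftrightarrow> ?u")
    if vw: "v \<in> Obj E" "w \<in> Obj E" for v w
  proof
    assume b: ?l
    show ?u
    proof (intro allI impI)
      fix \<beta> assume n: "natural v w \<beta>"
      have "trans_of v \<beta> \<in> FHom ?r v w ` Hom E v w"
        using bij_betw_imp_surj_on[OF b] trans_of[OF vw n] by simp
      then obtain h where h: "h \<in> Hom E v w" "trans_of v \<beta> = FHom ?r v w h" by blast
      show "\<exists>!h. h \<in> Hom E v w \<and> rep v w \<beta> h"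
      proof (rule ex1I[of _ h])
        show "h \<in> Hom E v w \<and> rep v w \<beta> h" using h eq_iff[OF vw n h(1)] by simp
        fix h' assume h': "h' \<in> Hom E v w \<and> rep v w \<beta> h'"
        then have "FHom ?r v w h' = FHom ?r v w h" using eq_iff[OF vw n, of h'] h(2) by simp
        then show "h' = h" using inj_onD[OF bij_betw_imp_inj_on[OF b]] h' h(1) by blast
      qed
    qed
  next
    assume u: ?u
    show ?l
    proof (rule bij_betw_imageI)
      show "inj_on (FHom ?r v w) (Hom E v w)"
      proof (rule inj_onI)
        fix h h' assume h: "h \<in> Hom E v w" "h' \<in> Hom E v w" "FHom ?r v w h = FHom ?r v w h'"
        obtain \<beta> where n: "natural v w \<beta>" "FHom ?r v w h = trans_of v \<beta>" using ex[OF vw hom[OF vw h(1)]] by blast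
        then have "rep v w \<beta> h" "rep v w \<beta> h'" using eq_iff[OF vw n(1) h(1)] eq_iff[OF vw n(1) h(2)] h(3) by simp_all
        then show "h = h'" using u n h by blast
      qed
      have "\<alpha> \<in> FHom ?r v w ` Hom E v w" if \<alpha>: "\<alpha> \<in> Hom ?P (FOb ?r v) (FOb ?r w)" for \<alpha>
      proof -
        obtain \<beta> where n: "natural v w \<beta>" "\<alpha> = trans_of v \<beta>" using ex[OF vw \<alpha>] by blast
        then obtain h where "h \<in> Hom E v w" "rep v w \<beta> h" using u by blast
        then show ?thesis using eq_iff[OF vw n(1)] n(2) by blast
      qed
      then show "FHom ?r v w ` Hom E v w = Hom ?P (FOb ?r v) (FOb ?r w)" using hom[OF vw] by blast
    qed
  qed
  have "is_functor (full_subcat E S) E id_funct"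
    unfolding is_functor_def using category_full_subcat[OF E S] E S by auto
  then have "dense_functor (full_subcat E S) E id_funct \<longleftrightarrow>
    (\<forall>v\<in>Obj E. \<forall>w\<in>Obj E. \<forall>\<beta>. natural v w \<beta> \<longrightarrow> (\<exists>!h. h \<in> Hom E v w \<and> rep v w \<beta> h))"
    by (simp add: dense_functor_def natural_def rep_def)
  then show ?thesis using bij r by (simp add: fully_faithful_def)
qed

text \<open>A family on the full image restricts along \<open>k\<close> to a natural family on
  \<open>C\<close>, and the morphism that represents the restriction represents the family, since
  every object of the image is some \<open>k c\<close>. This allows \<open>k\<close> to identify
  objects and to be neither full nor faithful.\<close>

lemma dense_functor_image:
  assumes dense: "dense_functor C E k"
  shows "dense_functor (full_subcat E (FOb k ` Obj C)) E id_funct"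
proof -
  have k: "is_functor C E k" using dense by (simp add: dense_functor_def)
  have S: "FOb k ` Obj C \<subseteq> Obj E" using fun_ob[OF k] by blast
  have E: "category E" using fun_cat[OF k] by simp
  show ?thesis
    unfolding dense_functor_def
  proof (intro conjI ballI allI impI)
    show "is_functor (full_subcat E (FOb k ` Obj C)) E id_funct"
      unfolding is_functor_def using category_full_subcat[OF E S] E S by auto
    fix v w \<beta> assume vw: "v \<in> Obj E" "w \<in> Obj E"
      and n: "(\<forall>c\<in>Obj (full_subcat E (FOb k ` Obj C)). \<forall>f\<in>Hom E (FOb id_funct c) v. \<beta> c f \<in> Hom E (FOb id_funct c) w) \<and>
        (\<forall>c\<in>Obj (full_subcat E (FOb k ` Obj C)). \<forall>c'\<in>Obj (full_subcat E (FOb k ` Obj C)).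
          \<forall>g\<in>Hom (full_subcat E (FOb k ` Obj C)) c' c. \<forall>f\<in>Hom E (FOb id_funct c) v.
           \<beta> c' (Cmp E (FOb id_funct c') (FOb id_funct c) v f (FHom id_funct c' c g)) =
           Cmp E (FOb id_funct c') (FOb id_funct c) w (\<beta> c f) (FHom id_funct c' c g))"
    have "\<exists>!h. h \<in> Hom E v w \<and> (\<forall>c\<in>Obj C. \<forall>f\<in>Hom E (FOb k c) v. \<beta> (FOb k c) f = Cmp E (FOb k c) v w h f)"
      using dense[unfolded dense_functor_def, THEN conjunct2, rule_format, OF vw, of "\<lambda>c. \<beta> (FOb k c)"] n fun_hom[OF k]
      by simp
    then show "\<exists>!h. h \<in> Hom E v w \<and> (\<forall>c\<in>Obj (full_subcat E (FOb k ` Obj C)). \<forall>f\<in>Hom E (FOb id_funct c) v.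
        \<beta> c f = Cmp E (FOb id_funct c) v w h f)" by simp
  qed
qed

text \<open>In this direction injectivity on objects lets \<open>\<beta>\<close> be reindexed by the
  image, and fullness makes a family natural along \<open>C\<close> natural for all morphisms of the
  image.\<close>

lemma dense_functor_from_image:
  assumes k: "fully_faithful C E k" and inj: "inj_on (FOb k) (Obj C)"
    and dense: "dense_functor (full_subcat E (FOb k ` Obj C)) E id_funct"
  shows "dense_functor C E k"
  unfolding dense_functor_def
proof (intro conjI ballI allI impI)
  show kf: "is_functor C E k" using k by (simp add: fully_faithful_def)
  fix v w \<beta> assume vw: "v \<in> Obj E" "w \<in> Obj E"
    and n: "(\<forall>c\<in>Obj C. \<forall>f\<in>Hom E (FOb k c) v. \<beta> c f \<in> Hom E (FOb k c) w) \<and>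
        (\<forall>c\<in>Obj C. \<forall>c'\<in>Obj C. \<forall>g\<in>Hom C c' c. \<forall>f\<in>Hom E (FOb k c) v.
           \<beta> c' (Cmp E (FOb k c') (FOb k c) v f (FHom k c' c g)) = Cmp E (FOb k c') (FOb k c) w (\<beta> c f) (FHom k c' c g))"
  have full: "\<exists>g'\<in>Hom C c' c. g = FHom k c' c g'" if "c \<in> Obj C" "c' \<in> Obj C" "g \<in> Hom E (FOb k c') (FOb k c)" for c c' g
    using k that unfolding fully_faithful_def bij_betw_def by (metis imageE)
  define \<beta>' where "\<beta>' = (\<lambda>s. \<beta> (inv_into (Obj C) (FOb k) s))"
  have \<beta>': "\<beta>' (FOb k c) = \<beta> c" if "c \<in> Obj C" for c using inj that by (simp add: \<beta>'_def)
  have "\<forall>c\<in>Obj C. \<forall>c'\<in>Obj C. \<forall>g\<in>Hom E (FOb k c') (FOb k c). \<forall>f\<in>Hom E (FOb k c) v.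
     \<beta>' (FOb k c') (Cmp E (FOb k c') (FOb k c) v f g) = Cmp E (FOb k c') (FOb k c) w (\<beta>' (FOb k c) f) g"
    using n full \<beta>' by metis
  then have "\<exists>!h. h \<in> Hom E v w \<and> (\<forall>c\<in>Obj C. \<forall>f\<in>Hom E (FOb k c) v. \<beta>' (FOb k c) f = Cmp E (FOb k c) v w h f)"
    using dense[unfolded dense_functor_def, THEN conjunct2, rule_format, OF vw, of \<beta>'] n by (simp add: \<beta>')
  then show "\<exists>!h. h \<in> Hom E v w \<and> (\<forall>c\<in>Obj C. \<forall>f\<in>Hom E (FOb k c) v. \<beta> c f = Cmp E (FOb k c) v w h f)"
    by (simp add: \<beta>')
qed

text \<open>A generator has its objects and morphisms in the types of \<open>E\<close>, while the
  presheaf topos is to be formed over a category with both in the universe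
  \<open>'u\<close>.\<close>

lemma small_category_copy:
  fixes U :: "'u itself"
  assumes D: "small_category U D"
  shows "\<exists>(C :: ('u, 'u) cat) k. small_category U C \<and> fully_faithful C D k \<and> inj_on (FOb k) (Obj C) \<and> FOb k ` Obj C = Obj D"
proof -
  have cD: "category D" and sD: "small U (Obj D)" and lD: "\<And>a b. a \<in> Obj D \<Longrightarrow> b \<in> Obj D \<Longrightarrow> small U (Hom D a b)"
    using D by (auto simp: small_category_def locally_small_def)
  let ?id = "id :: 'u \<Rightarrow> 'u"
  define X where "X = cod ?id (Obj D) ` Obj D"
  define o' where "o' = dec ?id (Obj D)"
  define H where "H = (\<lambda>x y. Hom D (o' x) (o' y))"
  define C :: "('u, 'u) cat" where "C = \<lparr>Obj = X, Hom = (\<lambda>x y. cod ?id (H x y) ` H x y),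
    Ide = (\<lambda>x. cod ?id (H x x) (Ide D (o' x))),
    Cmp = (\<lambda>x y z g f. cod ?id (H x z) (Cmp D (o' x) (o' y) (o' z) (dec ?id (H y z) g) (dec ?id (H x y) f)))\<rparr>"
  define k where "k = \<lparr>FOb = o', FHom = (\<lambda>x y. dec ?id (H x y))\<rparr>"
  have ob: "o' x \<in> Obj D" if "x \<in> X" for x using that dec_in by (simp add: o'_def X_def)
  have sH: "small U (H x y)" if "x \<in> X" "y \<in> X" for x y using that by (simp add: H_def lD ob)
  have dc: "dec ?id (H x y) (cod ?id (H x y) f) = f" if "x \<in> X" "y \<in> X" "f \<in> H x y" for x y f
    by (rule dec_cod[OF sH[OF that(1,2)] inj_on_id that(3)])
  have i: "Ide D (o' x) \<in> H x x" if "x \<in> X" for x using that by (simp add: H_def ob cat_ide[OF cD])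
  have m: "Cmp D (o' x) (o' y) (o' z) g f \<in> H x z" if "x \<in> X" "y \<in> X" "z \<in> X" "f \<in> H x y" "g \<in> H y z" for x y z f g
    using that by (simp add: H_def) (rule cat_cmp[OF cD ob ob ob])
  have Cs: "Obj C = X" "Hom C x y = cod ?id (H x y) ` H x y" "Ide C x = cod ?id (H x x) (Ide D (o' x))"
    "Cmp C x y z g f = cod ?id (H x z) (Cmp D (o' x) (o' y) (o' z) (dec ?id (H y z) g) (dec ?id (H x y) f))" for x y z f g
    by (simp_all add: C_def)
  have cC: "category C"
    unfolding category_def Cs
  proof (intro conjI ballI)
    fix a b f assume *: "a \<in> X" "b \<in> X" "f \<in> cod ?id (H a b) ` H a b"
    then obtain f' where f': "f' \<in> H a b" "f = cod ?id (H a b) f'" by blast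
    have "Cmp D (o' a) (o' a) (o' b) f' (Ide D (o' a)) = f'" "Cmp D (o' a) (o' b) (o' b) (Ide D (o' b)) f' = f'"
      using * f' ob by (auto simp: H_def cat_idl[OF cD] cat_idr[OF cD])
    then show "cod ?id (H a b) (Cmp D (o' a) (o' a) (o' b) (dec ?id (H a b) f) (dec ?id (H a a) (cod ?id (H a a) (Ide D (o' a))))) = f"
      "cod ?id (H a b) (Cmp D (o' a) (o' b) (o' b) (dec ?id (H b b) (cod ?id (H b b) (Ide D (o' b)))) (dec ?id (H a b) f)) = f"
      using * f' i by (simp_all add: dc)
  next
    fix a b c d f g h assume *: "a \<in> X" "b \<in> X" "c \<in> X" "d \<in> X" "f \<in> cod ?id (H a b) ` H a b" "g \<in> cod ?id (H b c) ` H b c" "h \<in> cod ?id (H c d) ` H c d"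
    then obtain f' g' h' where fgh: "f' \<in> H a b" "f = cod ?id (H a b) f'" "g' \<in> H b c" "g = cod ?id (H b c) g'" "h' \<in> H c d" "h = cod ?id (H c d) h'" by blast
    have "Cmp D (o' a) (o' b) (o' d) (Cmp D (o' b) (o' c) (o' d) h' g') f' = Cmp D (o' a) (o' c) (o' d) h' (Cmp D (o' a) (o' b) (o' c) g' f')"
      by (rule cat_assoc[OF cD]) (use * fgh ob in \<open>auto simp: H_def\<close>)
    then show "cod ?id (H a d) (Cmp D (o' a) (o' b) (o' d) (dec ?id (H b d) (cod ?id (H b d) (Cmp D (o' b) (o' c) (o' d) (dec ?id (H c d) h) (dec ?id (H b c) g)))) (dec ?id (H a b) f)) =
      cod ?id (H a d) (Cmp D (o' a) (o' c) (o' d) (dec ?id (H c d) h) (dec ?id (H a c) (cod ?id (H a c) (Cmp D (o' a) (o' b) (o' c) (dec ?id (H b c) g) (dec ?id (H a b) f)))))"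
      using * fgh by (simp add: dc m)
  qed (auto simp: i dc m)
  have "small_category U C"
    unfolding small_category_def locally_small_def Cs
    using cC sD sH by (auto simp: X_def[symmetric] intro: small_image) (auto simp: X_def intro: small_image)
  moreover have "fully_faithful C D k"
    unfolding fully_faithful_def is_functor_def
  proof (intro conjI ballI cC cD)
    fix a b assume "a \<in> Obj C" "b \<in> Obj C"
    then have ab: "a \<in> X" "b \<in> X" by (simp_all add: Cs)
    have "bij_betw (inv_into (H a b) (cod ?id (H a b))) (cod ?id (H a b) ` H a b) (H a b)"
      by (rule bij_betw_inv_into[OF bij_cod[OF sH[OF ab] inj_on_id]])
    then show "bij_betw (FHom k a b) (Hom C a b) (Hom D (FOb k a) (FOb k b))"
      by (simp add: k_def Cs dec_def) (simp add: H_def)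
  qed (auto simp: Cs k_def ob dc i m, auto simp: H_def)
  moreover have "inj_on (FOb k) (Obj C)"
    unfolding k_def Cs X_def o'_def funct.simps by (intro inj_onI) (metis cod_dec)
  moreover have "FOb k ` Obj C = Obj D"
    using dec_cod[OF sD inj_on_id] dec_in[of _ ?id "Obj D"] by (auto simp: k_def Cs X_def o'_def image_image)
  ultimately show ?thesis by blast
qed


section \<open>The characterization\<close>

context essential_localization
begin

lemma E_locally_small: "locally_small U E"
  unfolding locally_small_def
proof (intro ballI)
  fix a b assume "a \<in> Obj E" "b \<in> Obj E"
  then have "bij_betw (FHom N a b) (Hom E a b) (Hom PC (FOb N a) (FOb N b))" "small U (Hom PC (FOb N a) (FOb N b))"
    using ff by (auto simp: fully_faithful_def intro: presheaf_hom_small N_ob)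
  then show "small U (Hom E a b)" using small_bij by blast
qed

definition k :: "('c, 'u, 'o, 'm) funct" where
  "k = \<lparr>FOb = \<kappa>, FHom = (\<lambda>a b f. FHom L (rep C a) (rep C b) (yon C (rep C b) a f))\<rparr>"

lemma yon_rep: "a \<in> Obj C \<Longrightarrow> b \<in> Obj C \<Longrightarrow> f \<in> Hom C a b \<Longrightarrow> yon C (rep C b) a f \<in> Hom PC (rep C a) (rep C b)"
  by (rule yon_hom[OF rep_ob]) auto

lemma k_functor: "is_functor C E k"
proof -
  have "is_functor C PC \<lparr>FOb = rep C, FHom = (\<lambda>a b f. yon C (rep C b) a f)\<rparr>" (is "is_functor _ _ ?R")
    unfolding is_functor_def
  proof (intro conjI ballI cC category_psh)
    fix a assume a: "a \<in> Obj C"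
    show "FHom ?R a a (Ide C a) = Ide PC (FOb ?R a)"
      using a cat_ide[OF cC a] yon_rep[OF a a] cat_ide[OF category_psh[OF cC] rep_ob[OF a]]
      by (auto intro!: rep_hom_eqI[OF rep_ob[OF a] a] simp: cat_idl[OF cC])
  next
    fix a b c f g assume *: "a \<in> Obj C" "b \<in> Obj C" "c \<in> Obj C" "f \<in> Hom C a b" "g \<in> Hom C b c"
    have "yon C (rep C c) a (Cmp C a b c g f) = Cmp PC (rep C a) (rep C b) (rep C c) (yon C (rep C c) b g) (yon C (rep C b) a f)"
      by (rule rep_hom_eqI[OF rep_ob[OF *(3)] *(1) yon_rep[OF *(1,3) cat_cmp[OF cC *]]
            cat_cmp[OF category_psh[OF cC] rep_ob[OF *(1)] rep_ob[OF *(2)] rep_ob[OF *(3)] yon_rep[OF *(1,2,4)] yon_rep[OF *(2,3,5)]]])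
         (use * cC in \<open>simp add: cat_ide cat_cmp cat_idr\<close>)
    then show "FHom ?R a c (Cmp C a b c g f) = Cmp PC (FOb ?R a) (FOb ?R b) (FOb ?R c) (FHom ?R b c g) (FHom ?R a b f)" by simp
  qed (simp_all add: rep_ob yon_rep)
  from is_functor_comp[OF this LN.F] show ?thesis by (simp add: k_def comp_funct_def \<kappa>_def[abs_def])
qed

lemma k_simps: "FOb k = \<kappa>" by (simp add: k_def)

text \<open>Under the bijection of E(\<kappa> c, v) with \<open>N v c\<close>, composing with
  \<open>k g\<close> becomes the action of \<open>g\<close>; so \<open>N\<close> is, up to
  isomorphism, the nerve of \<open>k\<close>.\<close>

lemma nmap_k:
  assumes c: "c \<in> Obj C" "c' \<in> Obj C" and g: "g \<in> Hom C c' c" and v: "v \<in> Obj E" and f: "f \<in> Hom E (\<kappa> c) v"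
  shows "nmap (\<kappa> c') v (Cmp E (\<kappa> c') (\<kappa> c) v f (FHom k c' c g)) c' (gen c') = nact v c c' g (nmap (\<kappa> c) v f c (gen c))"
proof -
  note R = rep_ob[OF c(1)] rep_ob[OF c(2)] and K = kappa_ob[OF c(1)] kappa_ob[OF c(2)]
  have kg: "FHom k c' c g \<in> Hom E (\<kappa> c') (\<kappa> c)" using fun_hom[OF k_functor c(2,1) g] by (simp add: k_simps)
  have "nmap (\<kappa> c') (\<kappa> c) (FHom k c' c g) c' (gen c') = \<eta> (rep C c) c' g"
    using eta_map[OF R(2,1) yon_rep[OF c(2,1) g] c(2), of "Ide C c'"] c g cat_ide[OF cC c(2)]
    by (simp add: k_def \<kappa>_def gen_def cat_idr[OF cC])
  also have "\<dots> = nact (\<kappa> c) c c' g (gen c)"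
    using eta_nat[OF R(1) c g, of "Ide C c"] c g cat_ide[OF cC c(1)] by (simp add: \<kappa>_def gen_def cat_idl[OF cC])
  finally show ?thesis
    using nmap_cmp[OF K(2,1) v kg f c(2) gen_in[OF c(2)]] nmap_nat[OF K(1) v f c g gen_in[OF c(1)]] by simp
qed

definition elt :: "'o \<Rightarrow> 'c \<Rightarrow> 'u \<Rightarrow> 'm" where
  "elt v c x = (SOME h. h \<in> Hom E (\<kappa> c) v \<and> nmap (\<kappa> c) v h c (gen c) = x)"

lemma elt:
  assumes "v \<in> Obj E" "c \<in> Obj C" "x \<in> nob v c"
  shows "elt v c x \<in> Hom E (\<kappa> c) v" "nmap (\<kappa> c) v (elt v c x) c (gen c) = x"
  using someI_ex[of "\<lambda>h. h \<in> Hom E (\<kappa> c) v \<and> nmap (\<kappa> c) v h c (gen c) = x"] elt_ex[OF assms] unfolding elt_def by blast+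

lemma elt_nmap: "v \<in> Obj E \<Longrightarrow> c \<in> Obj C \<Longrightarrow> h \<in> Hom E (\<kappa> c) v \<Longrightarrow> elt v c (nmap (\<kappa> c) v h c (gen c)) = h"
  by (rule elt_eqI) (auto simp: elt nmap_in kappa_ob gen_in)

lemma elt_nact:
  assumes "v \<in> Obj E" "c \<in> Obj C" "c' \<in> Obj C" "g \<in> Hom C c' c" "x \<in> nob v c"
  shows "elt v c' (nact v c c' g x) = Cmp E (\<kappa> c') (\<kappa> c) v (elt v c x) (FHom k c' c g)"
proof -
  have "FHom k c' c g \<in> Hom E (\<kappa> c') (\<kappa> c)" using fun_hom[OF k_functor assms(3,2,4)] by (simp add: k_simps)
  then have "Cmp E (\<kappa> c') (\<kappa> c) v (elt v c x) (FHom k c' c g) \<in> Hom E (\<kappa> c') v"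
    using assms elt by (intro cat_cmp[OF cE] kappa_ob) auto
  from elt_nmap[OF assms(1,3) this] show ?thesis
    using nmap_k[OF assms(2,3,4,1) elt(1)[OF assms(1,2,5)]] elt(2)[OF assms(1,2,5)] by simp
qed

lemma elt_map:
  assumes "v \<in> Obj E" "w \<in> Obj E" "h \<in> Hom E v w" "c \<in> Obj C" "x \<in> nob v c"
  shows "elt w c (nmap v w h c x) = Cmp E (\<kappa> c) v w h (elt v c x)"
proof -
  note e = elt[OF assms(1,4,5)]
  have "Cmp E (\<kappa> c) v w h (elt v c x) \<in> Hom E (\<kappa> c) w" using assms e kappa_ob by (intro cat_cmp[OF cE]) auto
  from elt_nmap[OF assms(2,4) this] show ?thesis
    using nmap_cmp[OF kappa_ob[OF assms(4)] assms(1,2) e(1) assms(3,4) gen_in[OF assms(4)]] e(2) by simp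
qed

text \<open>By means of \<open>elt\<close>, families natural along \<open>k\<close> are the same as
  transformations from \<open>N v\<close> to \<open>N w\<close>, so density is full faithfulness of
  \<open>N\<close> in another guise.\<close>

lemma k_dense: "dense_functor C E k"
  unfolding dense_functor_def k_simps
proof (intro conjI k_functor ballI allI impI)
  fix v w \<beta> assume vw: "v \<in> Obj E" "w \<in> Obj E"
    and "(\<forall>c\<in>Obj C. \<forall>f\<in>Hom E (\<kappa> c) v. \<beta> c f \<in> Hom E (\<kappa> c) w) \<and>
        (\<forall>c\<in>Obj C. \<forall>c'\<in>Obj C. \<forall>g\<in>Hom C c' c. \<forall>f\<in>Hom E (\<kappa> c) v.
           \<beta> c' (Cmp E (\<kappa> c') (\<kappa> c) v f (FHom k c' c g)) = Cmp E (\<kappa> c') (\<kappa> c) w (\<beta> c f) (FHom k c' c g))"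
  then have \<beta>: "\<And>c f. c \<in> Obj C \<Longrightarrow> f \<in> Hom E (\<kappa> c) v \<Longrightarrow> \<beta> c f \<in> Hom E (\<kappa> c) w"
    and \<beta>n: "\<And>c c' g f. c \<in> Obj C \<Longrightarrow> c' \<in> Obj C \<Longrightarrow> g \<in> Hom C c' c \<Longrightarrow> f \<in> Hom E (\<kappa> c) v \<Longrightarrow>
      \<beta> c' (Cmp E (\<kappa> c') (\<kappa> c) v f (FHom k c' c g)) = Cmp E (\<kappa> c') (\<kappa> c) w (\<beta> c f) (FHom k c' c g)"
    by blast+
  have "\<exists>h\<in>Hom E v w. \<forall>c\<in>Obj C. \<forall>x\<in>nob v c. nmap v w h c x = nmap (\<kappa> c) w (\<beta> c (elt v c x)) c (gen c)"
    by (rule nmap_ex[OF vw])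
       (use vw in \<open>simp_all add: nmap_in kappa_ob gen_in \<beta> elt elt_nact \<beta>n nmap_k\<close>)
  then obtain h where h: "h \<in> Hom E v w"
    and hx: "\<And>c x. c \<in> Obj C \<Longrightarrow> x \<in> nob v c \<Longrightarrow> nmap v w h c x = nmap (\<kappa> c) w (\<beta> c (elt v c x)) c (gen c)" by blast
  have rep_iff: "(\<forall>c\<in>Obj C. \<forall>f\<in>Hom E (\<kappa> c) v. \<beta> c f = Cmp E (\<kappa> c) v w h' f) \<longleftrightarrow>
     (\<forall>c\<in>Obj C. \<forall>x\<in>nob v c. nmap v w h' c x = nmap (\<kappa> c) w (\<beta> c (elt v c x)) c (gen c))"
    if h': "h' \<in> Hom E v w" for h'
  proof (intro iffI ballI)
    fix c x assume "\<forall>c\<in>Obj C. \<forall>f\<in>Hom E (\<kappa> c) v. \<beta> c f = Cmp E (\<kappa> c) v w h' f" and *: "c \<in> Obj C" "x \<in> nob v c"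
    then show "nmap v w h' c x = nmap (\<kappa> c) w (\<beta> c (elt v c x)) c (gen c)"
      using elt[OF vw(1) *] nmap_cmp[OF kappa_ob[OF *(1)] vw _ h' *(1) gen_in[OF *(1)]] by simp
  next
    fix c f assume all: "\<forall>c\<in>Obj C. \<forall>x\<in>nob v c. nmap v w h' c x = nmap (\<kappa> c) w (\<beta> c (elt v c x)) c (gen c)"
      and *: "c \<in> Obj C" "f \<in> Hom E (\<kappa> c) v"
    note K = kappa_ob[OF *(1)] and g = gen_in[OF *(1)]
    have "nmap (\<kappa> c) w (Cmp E (\<kappa> c) v w h' f) c (gen c) = nmap (\<kappa> c) w (\<beta> c f) c (gen c)"
      using all * nmap_cmp[OF K vw *(2) h' *(1) g] nmap_in[OF K vw(1) *(2,1) g] elt_nmap[OF vw(1) *] by simp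
    then show "\<beta> c f = Cmp E (\<kappa> c) v w h' f"
      using elt_eqI[OF vw(2) *(1) \<beta>[OF *] cat_cmp[OF cE K vw *(2) h']] by simp
  qed
  show "\<exists>!h. h \<in> Hom E v w \<and> (\<forall>c\<in>Obj C. \<forall>f\<in>Hom E (\<kappa> c) v. \<beta> c f = Cmp E (\<kappa> c) v w h f)"
  proof (rule ex1I[of _ h], intro conjI h)
    show "\<forall>c\<in>Obj C. \<forall>f\<in>Hom E (\<kappa> c) v. \<beta> c f = Cmp E (\<kappa> c) v w h f" unfolding rep_iff[OF h] using hx by blast
    fix h' assume h': "h' \<in> Hom E v w \<and> (\<forall>c\<in>Obj C. \<forall>f\<in>Hom E (\<kappa> c) v. \<beta> c f = Cmp E (\<kappa> c) v w h' f)"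
    then show "h' = h" using rep_iff[of h'] hx by (intro nmap_eqI[OF vw _ h]) simp_all
  qed
qed

text \<open>\<open>N\<close> and the nerve \<open>B.N\<close> of \<open>k\<close> have isomorphic
  but differently coded values, so the adjunction of \<open>L\<close> and \<open>N\<close> is
  transported along \<open>elt\<close> before \<open>adjunction_yoneda\<close> applies.\<close>

lemma totally_distributive: "totally_distributive U E"
proof -
  interpret B: base_change U C E k
    by unfold_locales (rule E_locally_small, rule k_functor)
  define \<theta> where "\<theta> = (\<lambda>v. \<lambda>c\<in>Obj C. \<lambda>x\<in>nob v c. B.en v c (elt v c x))"
  have \<theta>: "\<theta> v \<in> Hom PC (FOb N v) (FOb B.N v)" if v: "v \<in> Obj E" for v
    unfolding \<theta>_def
    by (rule psh_homI[OF N_ob[OF v] B.N_ob[OF v]])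
       (use v elt in \<open>simp_all add: B.en_in B.en_act k_simps elt_nact\<close>)
  have "\<exists>\<theta>'. iso_in PC (FOb N v) (FOb B.N v) (\<theta> v) \<theta>'" if v: "v \<in> Obj E" for v
  proof (rule psh_iso_in[OF N_ob[OF v] B.N_ob[OF v] \<theta>[OF v]])
    fix c assume c: "c \<in> Obj C"
    show "bij_betw (\<theta> v c) (nob v c) (FOb (FOb B.N v) c)"
    proof (rule bij_betw_imageI)
      show "inj_on (\<theta> v c) (nob v c)"
      proof (rule inj_onI)
        fix x x' assume x: "x \<in> nob v c" "x' \<in> nob v c" "\<theta> v c x = \<theta> v c x'"
        then have "elt v c x = elt v c x'"
          using B.en_inj[OF v c] elt(1)[OF v c] c by (simp add: \<theta>_def k_simps)
        then show "x = x'" using elt(2)[OF v c] x by metis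
      qed
      have "z \<in> \<theta> v c ` nob v c" if z: "z \<in> FOb (FOb B.N v) c" for z
      proof -
        obtain f where f: "f \<in> Hom E (\<kappa> c) v" "z = B.en v c f" using B.N_elem[OF v c z] by (auto simp: k_simps)
        have "nmap (\<kappa> c) v f c (gen c) \<in> nob v c" by (rule nmap_in[OF kappa_ob[OF c] v f(1) c gen_in[OF c]])
        then show ?thesis
          using f c by (intro image_eqI[of _ _ "nmap (\<kappa> c) v f c (gen c)"]) (simp_all add: \<theta>_def elt_nmap v)
      qed
      then show "\<theta> v c ` nob v c = FOb (FOb B.N v) c"
        using psh_hom_in[OF N_ob[OF v] B.N_ob[OF v] \<theta>[OF v] c] by blast
    qed
  qed
  then obtain \<theta>' where \<theta>': "\<And>v. v \<in> Obj E \<Longrightarrow> iso_in PC (FOb N v) (FOb B.N v) (\<theta> v) (\<theta>' v)" by metis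
  have "adjunction PC E L B.N"
  proof (rule adjunction_transport_right[OF LN.adjunction B.N_functor \<theta>'])
    fix v w h assume *: "v \<in> Obj E" "w \<in> Obj E" "h \<in> Hom E v w"
    show "Cmp PC (FOb N v) (FOb N w) (FOb B.N w) (\<theta> w) (FHom N v w h) = Cmp PC (FOb N v) (FOb B.N v) (FOb B.N w) (FHom B.N v w h) (\<theta> v)"
    proof (rule psh_hom_eqI[OF N_ob[OF *(1)] B.N_ob[OF *(2)]
        cat_cmp[OF category_psh[OF cC] N_ob[OF *(1)] N_ob[OF *(2)] B.N_ob[OF *(2)] N_hom[OF *] \<theta>[OF *(2)]]
        cat_cmp[OF category_psh[OF cC] N_ob[OF *(1)] B.N_ob[OF *(1)] B.N_ob[OF *(2)] \<theta>[OF *(1)] B.N_hom[OF *]]])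
      fix c x assume c: "c \<in> Obj C" "x \<in> nob v c"
      then show "Cmp PC (FOb N v) (FOb N w) (FOb B.N w) (\<theta> w) (FHom N v w h) c x =
        Cmp PC (FOb N v) (FOb B.N v) (FOb B.N w) (FHom B.N v w h) (\<theta> v) c x"
        using * elt(1)[OF *(1) c] nmap_in[OF * c] by (simp add: \<theta>_def elt_map B.en_map k_simps)
    qed
  qed
  then have "adjunction B.PE E (comp_funct L B.pull) (yoneda U E)"
    by (rule B.adjunction_yoneda[OF k_dense])
  moreover obtain F where "adjunction PC B.PE F B.pull" using B.pull_left_adjoint by blast
  ultimately show ?thesis
    unfolding totally_distributive_def
    using cE E_locally_small adjunction_comp[OF lL.adjunction] by blast
qed

lemma small_dense_generator: "small_dense_generator U E (\<kappa> ` Obj C)"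
proof -
  have S: "\<kappa> ` Obj C \<subseteq> Obj E" using kappa_ob by blast
  have "small_category U (full_subcat E (\<kappa> ` Obj C))"
    unfolding small_category_def using category_full_subcat[OF cE S] small S E_locally_small
    by (auto simp: small_category_def locally_small_def kappa_ob intro: small_image)
  moreover have "dense_functor (full_subcat E (\<kappa> ` Obj C)) E id_funct"
    using dense_functor_image[OF k_dense] by (simp add: k_simps)
  ultimately show ?thesis
    unfolding small_dense_generator_def restricted_yoneda_fully_faithful_iff[OF cE E_locally_small S] using S by blast
qed

end

section \<open>Presheaf toposes and the two implications\<close>

lemma presheaf_topos:
  fixes U :: "'u itself" and C :: "('c, 'u) cat"
  assumes "inaccessible U" "small_category U C"
  shows "elementary_topos (presheaf_cat U C :: (('c, 'u, 'u) presheaf, 'c \<Rightarrow> 'u \<Rightarrow> 'u) cat)"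
proof -
  interpret small_presheaves U C using assms by unfold_locales
  have cP: "category PC" by (rule category_psh[OF cC])
  obtain \<eta> \<epsilon> where "adj PC PC id_funct id_funct \<eta> \<epsilon>" using adjE[OF adjunction_id[OF cP]] .
  then interpret essential_localization U C PC id_funct id_funct id_funct \<eta> \<epsilon> \<eta> \<epsilon>
    unfolding essential_localization_def essential_localization_axioms_def
    using fully_faithful_id[OF cP] small_presheaves_axioms by blast
  show ?thesis by (rule elementary_topos)
qed

lemma essential_subtopos_if_dense_generator:
  fixes E :: "('o, 'm) cat" and U :: "'u itself"
  assumes inacc: "inaccessible U" and td: "totally_distributive U E" and S: "small_dense_generator U E S"
  shows "\<exists>C :: ('u, 'u) cat. small_category U C \<and>
    essential_subtopos E (presheaf_cat U C :: (('u, 'u, 'u) presheaf, 'u \<Rightarrow> 'u \<Rightarrow> 'u) cat)"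
proof -
  obtain c t where E: "category E" and ls: "locally_small U E"
    and tc: "adjunction E (presheaf_cat U E) t c" and cy: "adjunction (presheaf_cat U E) E c (yoneda U E)"
    using td by (auto simp: totally_distributive_def)
  have SE: "S \<subseteq> Obj E" and sS: "small_category U (full_subcat E S)" and dS: "dense_functor (full_subcat E S) E id_funct"
    using S restricted_yoneda_fully_faithful_iff[OF E ls] by (auto simp: small_dense_generator_def)
  obtain C :: "('u, 'u) cat" and k where C: "small_category U C" and ffS: "fully_faithful C (full_subcat E S) k"
    and inj: "inj_on (FOb k) (Obj C)" and kS: "FOb k ` Obj C = S"
    using small_category_copy[OF sS] by auto
  have ffk: "fully_faithful C E k"
    using ffS E SE unfolding fully_faithful_def is_functor_def full_subcat_simps by blast
  have dense: "dense_functor C E k"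
    by (rule dense_functor_from_image[OF ffk inj]) (simp add: kS dS)
  interpret B: base_change U C E k
    using inacc C ls ffk by unfold_locales (auto simp: fully_faithful_def)
  obtain G where G: "adjunction B.PE B.PC B.pull G" using B.pull_right_adjoint by blast
  define L where "L = comp_funct c G"
  define l where "l = comp_funct B.pull t"
  have LN: "adjunction B.PC E L B.N" unfolding L_def by (rule B.adjunction_N[OF dense ffk cy G])
  have lL: "adjunction E B.PC l L" unfolding l_def L_def by (rule adjunction_comp[OF tc G])
  have ff: "fully_faithful E B.PC B.N" by (rule B.N_fully_faithful[OF dense])
  obtain \<eta> \<epsilon> where "adj B.PC E L B.N \<eta> \<epsilon>" using adjE[OF LN] .
  moreover obtain \<theta> \<zeta> where "adj E B.PC l L \<theta> \<zeta>" using adjE[OF lL] .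
  ultimately interpret essential_localization U C E L B.N l \<eta> \<epsilon> \<theta> \<zeta>
    unfolding essential_localization_def essential_localization_axioms_def
    using ff B.small_presheaves_axioms by blast
  \<comment> \<open>Left exactness of the inverse image comes for free, as \<open>L\<close> is a
    right adjoint of \<open>l\<close>.\<close>
  have "preserves_finite_limits B.PC E L"
    unfolding preserves_finite_limits_def using right_adjoint_preserves_limit[OF lL] by blast
  then have "geometric_morphism E B.PC L B.N"
    unfolding geometric_morphism_def using elementary_topos presheaf_topos[OF inacc C] LN by blast
  then show ?thesis unfolding essential_subtopos_def using C ff lL by blast
qed

theorem theorem1p5p5:
  fixes E :: "('o, 'm) cat"
  assumes "inaccessible TYPE('u)"
    and "category E"
  shows "(totally_distributive TYPE('u) E \<and> (\<exists>S. small_dense_generator TYPE('u) E S)) \<longleftrightarrow>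
         (\<exists>C :: ('u, 'u) cat. small_category TYPE('u) C \<and>
            essential_subtopos E
              (presheaf_cat TYPE('u) C :: (('u, 'u, 'u) presheaf, 'u \<Rightarrow> 'u \<Rightarrow> 'u) cat))"
    (is "?l \<longleftrightarrow> ?r")
proof
  show "?l \<Longrightarrow> ?r" using essential_subtopos_if_dense_generator[OF assms(1)] by blast
next
  let ?U = "TYPE('u)"
  assume ?r
  then obtain C :: "('u, 'u) cat" and L N l where C: "small_category ?U C"
    and LN: "adjunction (presheaf_cat ?U C :: (('u, 'u, 'u) presheaf, 'u \<Rightarrow> 'u \<Rightarrow> 'u) cat) E L N"
    and ff: "fully_faithful E (presheaf_cat ?U C) N" and lL: "adjunction E (presheaf_cat ?U C) l L"
    by (auto simp: essential_subtopos_def geometric_morphism_def)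
  obtain \<eta> \<epsilon> where "adj (presheaf_cat ?U C) E L N \<eta> \<epsilon>" using adjE[OF LN] .
  moreover obtain \<theta> \<zeta> where "adj E (presheaf_cat ?U C) l L \<theta> \<zeta>" using adjE[OF lL] .
  ultimately interpret essential_localization ?U C E L N l \<eta> \<epsilon> \<theta> \<zeta>
    using assms(1) C ff
    by (simp add: essential_localization_def essential_localization_axioms_def small_presheaves_def)
  show ?l using totally_distributive small_dense_generator by blast
qed

end
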